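(* Let $n\ge 2$, let $\Omega\subset\mathbb{R}^n$ be a bounded open domain, and let $L\ge 1$, $\mu\in[0,1]$, $0<\lambda_-<\lambda_+<+\infty$. Let $\omega:[0,\infty)\to[0,\infty)$ be nondecreasing and continuous with $\omega(0)=0$ and $\omega(R)\le L|\log R|^{-1}$ for all $0<R<1$. Let $p:\overline\Omega\to(1,+\infty)$ be continuous with $|p(x)-p(y)|\le\omega(|x-y|)$ for all $x,y\in\overline\Omega$ and $1<p_-:=\inf_\Omega p\le p_+:=\sup_\Omega p<+\infty$. Let $q:\Omega\to(1,+\infty)$ be continuous with a modulus of continuity of the same type (nondecreasing, continuous, vanishing at $0$, bounded by $L|\log R|^{-1}$ for $0<R<1$), and let $q_-$ be a constant such that $q(x)\ge q_-$ for all $x\in\Omega$. Assume $$\frac1{p_-}-\frac1{p_+}<\frac1n,\qquad q_->\begin{cases}\dfrac{1}{p_--1}\cdot\dfrac{1}{\frac1n-\frac1{p_-}+\frac1{p_+}} & \text{if } p_-<2,\\[2mm] \dfrac{1}{\frac1n-\frac1{p_-}+\frac1{p_+}} & \text{if } p_-\ge 2.\end{cases}$$ Let $f:\Omega\times\mathbb{R}^n\to\mathbb{R}$ be such that $f(x,z)$ is $C^2$ in $x$ and $z$, $z\mapsto f(x,z)$ is convex for every $x$, and for all $z\in\mathbb{R}^n$ and $x,x_0\in\Omega$ $$L^{-1}(\mu^2+|z|^2)^{p(x)/2}\le f(x,z)\le L(\mu^2+|z|^2)^{p(x)/2},$$ $$|f(x,z)-f(x_0,z)|\le L\,\omega(|x-x_0|)\big[(\mu^2+|z|^2)^{p(x)/2}+(\mu^2+|z|^2)^{p(x_0)/2}\big]\big[1+|\log(\mu^2+|z|^2)|\big].$$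 Let $\psi\in W^{1,p(\cdot)}(\Omega)\cap L^\infty(\Omega)$, $g\in L^{q(\cdot)}(\Omega)$, and $\mathcal{K}=\{u\in W^{1,p(\cdot)}(\Omega):u-\psi\in W^{1,p(\cdot)}_0(\Omega)\}$. Then for each $0\le\gamma\le1$ there exists a minimizer $u_\gamma\in\mathcal{K}$ of the functional $\mathcal{J}_\gamma(u)=\int_\Omega\big(f(x,\nabla u)+F_\gamma(u)+gu\big)\,dx$ over $\mathcal{K}$. Furthermore $u_\gamma$ is bounded; more precisely, $$\|u_\gamma\|_{L^\infty(\Omega)}\le C$$ with a constant $C$ depending only on $n,L,q_-,p_\pm,\lambda_\pm,\Omega,\|\psi\|_{L^\infty(\partial\Omega)},\|g\|_{L^{q(\cdot)}(\Omega)}$.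
   Context: For $0<\gamma\le1$, $F_\gamma(u)=\lambda_+(u^+)^\gamma+\lambda_-(u^-)^\gamma$ with $u^\pm=\max\{\pm u,0\}$; for $\gamma=0$, $F_0(u)=\lambda_+\chi_{\{u>0\}}+\lambda_-\chi_{\{u\le0\}}$. $L^{p(\cdot)}(\Omega)$ is the space of measurable $u$ with $\int_\Omega|u|^{p(x)}dx<\infty$, with the Luxemburg norm $\|u\|_{L^{p(\cdot)}(\Omega)}=\inf\{\lambda>0:\int_\Omega|u/\lambda|^{p(x)}dx\le1\}$; $W^{1,p(\cdot)}(\Omega)=\{u\in L^{p(\cdot)}(\Omega):|\nabla u|\in L^{p(\cdot)}(\Omega)\}$ with norm $\|u\|_{L^{p(\cdot)}}+\|\nabla u\|_{L^{p(\cdot)}}$; $W^{1,p(\cdot)}_0(\Omega)$ is the closure of $C_0^\infty(\Omega)$ in it. A minimizer of $\mathcal{J}_\gamma$ is $u\in\mathcal{K}$ with $\mathcal{J}_\gamma(u)\le\mathcal{J}_\gamma(v)$ for all $v\in\mathcal{K}$. Conventions: the right-hand side of the continuity condition is read as $0$ when $\mu=0,z=0$. $\|\psi\|_{L^\infty(\partial\Omega)}$ is the supremum of $|\psi|$ on $\partial\Omega$ in the Sobolev sense, i.e. the least $k\ge0$ with $(|\psi|-k)^+\in W_0^{1,p(\cdot)}(\Omega)$. *)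

theory Defs
  imports "HOL-Analysis.Analysis" "HOL-Probability.Essential_Supremum"
begin

(* Functions on \<Omega> are represented by total functions whose values outside \<Omega> are irrelevant. *)

(* Continuous differentiability of order k; intended for open S. *)
primrec Ck_on :: "nat \<Rightarrow> 'a::euclidean_space set \<Rightarrow> ('a \<Rightarrow> real) \<Rightarrow> bool" where
  "Ck_on 0 S f \<longleftrightarrow> continuous_on S f"
| "Ck_on (Suc k) S f \<longleftrightarrow>
     (\<forall>x\<in>S. f differentiable (at x)) \<and>
     (\<forall>v. Ck_on k S (\<lambda>x. frechet_derivative f (at x) v))"

definition test_functions :: "'a::euclidean_space set \<Rightarrow> ('a \<Rightarrow> real) set" where
  "test_functions \<Omega> = {\<phi>. (\<forall>k. Ck_on k UNIV \<phi>) \<and>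
      compact (closure {x. \<phi> x \<noteq> 0}) \<and> closure {x. \<phi> x \<noteq> 0} \<subseteq> \<Omega>}"

definition classical_grad :: "('a::euclidean_space \<Rightarrow> real) \<Rightarrow> 'a \<Rightarrow> 'a" where
  "classical_grad \<phi> x = (\<Sum>b\<in>Basis. frechet_derivative \<phi> (at x) b *\<^sub>R b)"

definition locally_integrable_on :: "('a::euclidean_space \<Rightarrow> 'b::euclidean_space) \<Rightarrow> 'a set \<Rightarrow> bool" where
  "locally_integrable_on h \<Omega> \<longleftrightarrow> (\<forall>K. compact K \<longrightarrow> K \<subseteq> \<Omega> \<longrightarrow> integrable (lebesgue_on K) h)"

definition has_weak_grad :: "'a::euclidean_space set \<Rightarrow> ('a \<Rightarrow> real) \<Rightarrow> ('a \<Rightarrow> 'a) \<Rightarrow> bool" where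
  "has_weak_grad \<Omega> u G \<longleftrightarrow> locally_integrable_on u \<Omega> \<and> locally_integrable_on G \<Omega> \<and>
     (\<forall>\<phi>\<in>test_functions \<Omega>.
        (LINT x|lebesgue_on \<Omega>. u x *\<^sub>R classical_grad \<phi> x) = - (LINT x|lebesgue_on \<Omega>. \<phi> x *\<^sub>R G x))"

(* The weak gradient is unique only up to null sets; every use below is insensitive to
   the choice of representative. *)
definition weak_grad :: "'a::euclidean_space set \<Rightarrow> ('a \<Rightarrow> real) \<Rightarrow> 'a \<Rightarrow> 'a" where
  "weak_grad \<Omega> u = (SOME G. has_weak_grad \<Omega> u G)"

definition var_modular :: "'a::euclidean_space set \<Rightarrow> ('a \<Rightarrow> real) \<Rightarrow> ('a \<Rightarrow> real) \<Rightarrow> ennreal" where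
  "var_modular \<Omega> p u = (\<integral>\<^sup>+x. ennreal (\<bar>u x\<bar> powr p x) \<partial>lebesgue_on \<Omega>)"

definition var_Lp :: "'a::euclidean_space set \<Rightarrow> ('a \<Rightarrow> real) \<Rightarrow> ('a \<Rightarrow> real) set" where
  "var_Lp \<Omega> p = {u. u \<in> borel_measurable (lebesgue_on \<Omega>) \<and> var_modular \<Omega> p u < \<infinity>}"

definition luxemburg_norm :: "'a::euclidean_space set \<Rightarrow> ('a \<Rightarrow> real) \<Rightarrow> ('a \<Rightarrow> real) \<Rightarrow> real" where
  "luxemburg_norm \<Omega> p u = Inf {l. 0 < l \<and> var_modular \<Omega> p (\<lambda>x. u x / l) \<le> 1}"

definition var_W1p :: "'a::euclidean_space set \<Rightarrow> ('a \<Rightarrow> real) \<Rightarrow> ('a \<Rightarrow> real) set" where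
  "var_W1p \<Omega> p = {u \<in> var_Lp \<Omega> p. \<exists>G. has_weak_grad \<Omega> u G \<and> (\<lambda>x. norm (G x)) \<in> var_Lp \<Omega> p}"

definition W1p_norm :: "'a::euclidean_space set \<Rightarrow> ('a \<Rightarrow> real) \<Rightarrow> ('a \<Rightarrow> real) \<Rightarrow> real" where
  "W1p_norm \<Omega> p u = luxemburg_norm \<Omega> p u + luxemburg_norm \<Omega> p (\<lambda>x. norm (weak_grad \<Omega> u x))"

definition var_W1p_0 :: "'a::euclidean_space set \<Rightarrow> ('a \<Rightarrow> real) \<Rightarrow> ('a \<Rightarrow> real) set" where
  "var_W1p_0 \<Omega> p = {u \<in> var_W1p \<Omega> p.
     \<forall>e>0. \<exists>\<phi>\<in>test_functions \<Omega>. W1p_norm \<Omega> p (\<lambda>x. u x - \<phi> x) < e}"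

definition Linf_norm :: "'a::euclidean_space set \<Rightarrow> ('a \<Rightarrow> real) \<Rightarrow> ereal" where
  "Linf_norm \<Omega> u = esssup (lebesgue_on \<Omega>) (\<lambda>x. ereal \<bar>u x\<bar>)"

definition Linf :: "'a::euclidean_space set \<Rightarrow> ('a \<Rightarrow> real) set" where
  "Linf \<Omega> = {u \<in> borel_measurable (lebesgue_on \<Omega>). Linf_norm \<Omega> u < \<infinity>}"

(* Supremum of |\<psi>| over the boundary in the Sobolev sense. For \<psi> in W^{1,p(.)} and L^\<infinity>
   the set is nonempty and the infimum is attained, so it is the least admissible k. *)
definition bdry_Linf_norm :: "'a::euclidean_space set \<Rightarrow> ('a \<Rightarrow> real) \<Rightarrow> ('a \<Rightarrow> real) \<Rightarrow> real" where
  "bdry_Linf_norm \<Omega> p \<psi> = Inf {k. 0 \<le> k \<and> (\<lambda>x. max (\<bar>\<psi> x\<bar> - k) 0) \<in> var_W1p_0 \<Omega> p}"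

definition log_modulus :: "real \<Rightarrow> (real \<Rightarrow> real) \<Rightarrow> bool" where
  "log_modulus L \<omega> \<longleftrightarrow> (\<forall>R\<ge>0. 0 \<le> \<omega> R) \<and> mono_on {0..} \<omega> \<and> continuous_on {0..} \<omega> \<and> \<omega> 0 = 0 \<and>
     (\<forall>R. 0 < R \<and> R < 1 \<longrightarrow> \<omega> R \<le> L * inverse \<bar>ln R\<bar>)"

definition exp_minus :: "'a set \<Rightarrow> ('a \<Rightarrow> real) \<Rightarrow> real" where
  "exp_minus \<Omega> p = (INF x\<in>\<Omega>. p x)"

definition exp_plus :: "'a set \<Rightarrow> ('a \<Rightarrow> real) \<Rightarrow> real" where
  "exp_plus \<Omega> p = (SUP x\<in>\<Omega>. p x)"

definition F_pot :: "real \<Rightarrow> real \<Rightarrow> real \<Rightarrow> real \<Rightarrow> real" where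
  "F_pot lam_p lam_m \<gamma> u =
     (if \<gamma> = 0 then lam_p * indicator {0<..} u + lam_m * indicator {..0} u
      else lam_p * (max u 0) powr \<gamma> + lam_m * (max (- u) 0) powr \<gamma>)"

(* Growth and continuity conditions on the integrand. Where \<mu> = 0 and z = 0 the right-hand
   side of the continuity condition is 0, since 0 powr a = 0. *)
definition structure_conditions ::
  "'a::euclidean_space set \<Rightarrow> real \<Rightarrow> real \<Rightarrow> (real \<Rightarrow> real) \<Rightarrow> ('a \<Rightarrow> real) \<Rightarrow> ('a \<Rightarrow> 'a \<Rightarrow> real) \<Rightarrow> bool" where
  "structure_conditions \<Omega> L \<mu> \<omega> p f \<longleftrightarrow>
     Ck_on 2 (\<Omega> \<times> UNIV) (\<lambda>(x, z). f x z) \<and>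
     (\<forall>x\<in>\<Omega>. convex_on UNIV (f x)) \<and>
     (\<forall>x\<in>\<Omega>. \<forall>z.
        inverse L * (\<mu>\<^sup>2 + (norm z)\<^sup>2) powr (p x / 2) \<le> f x z \<and>
        f x z \<le> L * (\<mu>\<^sup>2 + (norm z)\<^sup>2) powr (p x / 2)) \<and>
     (\<forall>x\<in>\<Omega>. \<forall>x0\<in>\<Omega>. \<forall>z.
        \<bar>f x z - f x0 z\<bar> \<le> L * \<omega> (norm (x - x0)) *
          ((\<mu>\<^sup>2 + (norm z)\<^sup>2) powr (p x / 2) + (\<mu>\<^sup>2 + (norm z)\<^sup>2) powr (p x0 / 2)) *
          (1 + \<bar>ln (\<mu>\<^sup>2 + (norm z)\<^sup>2)\<bar>))"

definition admissible :: "'a::euclidean_space set \<Rightarrow> ('a \<Rightarrow> real) \<Rightarrow> ('a \<Rightarrow> real) \<Rightarrow> ('a \<Rightarrow> real) set" where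
  "admissible \<Omega> p \<psi> = {u \<in> var_W1p \<Omega> p. (\<lambda>x. u x - \<psi> x) \<in> var_W1p_0 \<Omega> p}"

(* Under the hypotheses of the theorem the integrand is integrable for every admissible u:
   f(x, \<nabla>u) by the growth bound, F(u) because \<gamma> \<le> 1, and g u by Hoelder and Sobolev, since
   the lower bound on q exceeds n. So the value 0 of a divergent Bochner integral never occurs. *)
definition energy ::
  "'a::euclidean_space set \<Rightarrow> ('a \<Rightarrow> 'a \<Rightarrow> real) \<Rightarrow> real \<Rightarrow> real \<Rightarrow> ('a \<Rightarrow> real) \<Rightarrow> real \<Rightarrow> ('a \<Rightarrow> real) \<Rightarrow> real" where
  "energy \<Omega> f lam_p lam_m g \<gamma> u =
     (LINT x|lebesgue_on \<Omega>. f x (weak_grad \<Omega> u x) + F_pot lam_p lam_m \<gamma> (u x) + g x * u x)"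

definition is_minimizer :: "(('a \<Rightarrow> real) \<Rightarrow> real) \<Rightarrow> ('a \<Rightarrow> real) set \<Rightarrow> ('a \<Rightarrow> real) \<Rightarrow> bool" where
  "is_minimizer J K u \<longleftrightarrow> u \<in> K \<and> (\<forall>v\<in>K. J u \<le> J v)"

end

(* Functions are handled as pairs (u, G) with G the weak gradient of u, and everything is measured by the
   modular. Uniform convexity of |z|^s, uniformly for s in [p_-, p_+], replaces weak compactness: if pairs
   are bounded in the modular and their first components converge in L^1, then iterated midpoints of tails
   converge in the modular. As f is convex in the gradient, this and Rellich's theorem give a minimizer
   among the competitors bounded by a constant M.

   The hypotheses force q_- > n. Averaging the values of a test function phi over a ball where it vanishes
   then gives int |g phi| <= C |g|_q int |grad phi|, which controls the term g u and, applied to indicator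
   functions, starts the De Giorgi iteration on the level sets above the boundary supremum. The resulting
   bound does not depend on M, so truncating an arbitrary competitor shows that a minimizer for large M is
   a minimizer on all of K.

   The log-Hoelder condition on p enters once: it makes mollification bounded in the modular, so compactly
   supported functions lie in W_0; hence so do the truncations (u - k)^+, being limits of minima with
   compactly supported functions. *)
theory Submission
  imports Defs "HOL-Complex_Analysis.Great_Picard"
begin

text \<open>With a variable exponent the modular is not homogeneous. The estimates therefore use
  gradients only through their L1 norm: this is all that the inequality for |g phi| requires, and
  Young's inequality pays for it with the modular and the measure of the level set.

  Competitors are bounded by M at first because then |g u| \<le> M |g|: the energy is bounded below,
  and the term g u passes to the limit by dominated convergence.

  The obstacle in the direct method is F, which in general is not convex and for gamma = 0 not even
  continuous. Midpoints help only the convex gradient term, so the three terms are separated: f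
  follows the midpoints, while F and g u stay on the original minimizing sequence, where almost
  everywhere convergence is at hand.

  Truncation acts towards 0, at levels k \<ge> 0. F does not increase under it, also for gamma = 0,
  since its value on u \<le> 0 is the smaller constant lambda_-. So comparing a minimizer with its
  truncation leaves only the gradient and the term g u on the level set.\<close>

lemmas bochner_mono = Bochner_Integration.integral_mono
  and bochner_bound = Bochner_Integration.integrable_bound
  and bochner_add = Bochner_Integration.integrable_add
  and bochner_diff = Bochner_Integration.integrable_diff

section \<open>Smooth functions\<close>

definition smooth :: "('a::euclidean_space \<Rightarrow> real) \<Rightarrow> bool" where
  "smooth f \<longleftrightarrow> (\<forall>k. Ck_on k UNIV f)"

text \<open>The induction on k has to run over the whole family F at once, because
  \<open>Ck_on (Suc k)\<close> refers to the directional derivatives of f, which are other members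
  of F.\<close>

lemma smooth_coinduct:
  assumes "f \<in> F" "\<And>f x. f \<in> F \<Longrightarrow> f differentiable (at x)"
    "\<And>f v. f \<in> F \<Longrightarrow> (\<lambda>x. frechet_derivative f (at x) v) \<in> F"
  shows "smooth f"
proof -
  have "\<forall>f\<in>F. Ck_on k UNIV f" for k
  proof (induction k)
    case 0
    then show ?case using assms(2) by (auto intro!: differentiable_imp_continuous_on simp: differentiable_on_def)
  next
    case (Suc k)
    then show ?case using assms(2,3) by simp
  qed
  then show ?thesis using assms(1) unfolding smooth_def by blast
qed

lemma smooth_differentiable: "smooth f \<Longrightarrow> f differentiable (at x)"
proof -
  assume "smooth f"
  then have "Ck_on (Suc 0) UNIV f" unfolding smooth_def by blast
  then show ?thesis by simp
qed

lemma smooth_frechet_derivative: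
  assumes "smooth f" shows "smooth (\<lambda>x. frechet_derivative f (at x) v)"
  unfolding smooth_def
proof
  fix k
  have "Ck_on (Suc k) UNIV f" using assms unfolding smooth_def by blast
  then show "Ck_on k UNIV (\<lambda>x. frechet_derivative f (at x) v)" by simp
qed

lemma smooth_continuous: "smooth f \<Longrightarrow> continuous_on UNIV f"
  by (metis Ck_on.simps(1) smooth_def)

lemma smooth_affine: "smooth (\<lambda>x::'a::euclidean_space. x \<bullet> v + c)"
proof (rule smooth_coinduct[where F="range (\<lambda>(v,c) x. x \<bullet> v + c)"])
  have D: "((\<lambda>x::'a. x \<bullet> v + c) has_derivative (\<lambda>h. h \<bullet> v)) (at x)" for v c x
    by (auto intro!: derivative_eq_intros)
  show "f differentiable at x" if "f \<in> range (\<lambda>(v,c) x. x \<bullet> v + c)" for f and x :: 'a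
    using that D by (fastforce simp: differentiable_def)
  show "(\<lambda>x. frechet_derivative f (at x) w) \<in> range (\<lambda>(v,c) x. x \<bullet> v + c)"
    if "f \<in> range (\<lambda>(v,c) x. x \<bullet> v + c)" for f and w :: 'a
  proof -
    from that obtain v c where f: "f = (\<lambda>x. x \<bullet> v + c)" by auto
    have "frechet_derivative f (at x) = (\<lambda>h. h \<bullet> v)" for x
      unfolding f using frechet_derivative_at[OF D] by simp
    then have "(\<lambda>x. frechet_derivative f (at x) w) = (\<lambda>(v,c) x. x \<bullet> v + c) (0, w \<bullet> v)"
      by (auto simp: fun_eq_iff)
    then show ?thesis by blast
  qed
qed auto

section \<open>A smooth bump function\<close>

definition exp_recip :: "nat \<Rightarrow> real \<Rightarrow> real" where
  "exp_recip m t = (if t > 0 then inverse t ^ m * exp (- inverse t) else 0)"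

lemma power_div_fact_le_exp:
  fixes x :: real assumes "0 \<le> x" shows "x ^ m / fact m \<le> exp x"
proof -
  have "(\<Sum>n\<in>{m}. x ^ n /\<^sub>R fact n) \<le> (\<Sum>n. x ^ n /\<^sub>R fact n)"
    using assms exp_converges[of x] by (intro sum_le_suminf) (auto simp: sums_iff)
  then show ?thesis using exp_converges[of x] by (simp add: sums_iff divide_inverse mult.commute)
qed

lemma exp_recip_nonneg: "0 \<le> exp_recip m t"
  by (simp add: exp_recip_def)

text \<open>The term of order m + 2 in the series of \<open>exp (inverse t)\<close> leaves two spare
  powers of t, one more than the difference quotient at 0 consumes.\<close>

lemma exp_recip_le:
  assumes "0 < t" shows "exp_recip m t \<le> fact (m + 2) * t^2"
proof -
  have "inverse t ^ (m+2) / fact (m+2) \<le> exp (inverse t)"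
    using assms by (intro power_div_fact_le_exp) auto
  then have "inverse t ^ (m+2) \<le> exp (inverse t) * fact (m+2)"
    by (simp only: pos_divide_le_eq fact_gt_zero)
  then have "inverse t ^ (m+2) * exp (- inverse t) \<le> exp (inverse t) * fact (m+2) * exp (- inverse t)"
    by (rule mult_right_mono) simp
  also have "\<dots> = fact (m+2)"
    by (simp add: mult.commute mult.left_commute exp_minus_inverse del: fact_Suc add_2_eq_Suc')
  finally have "inverse t ^ (m+2) * exp (- inverse t) \<le> fact (m+2)" .
  then have "inverse t ^ (m+2) * exp (- inverse t) * t^2 \<le> fact (m+2) * t^2"
    by (rule mult_right_mono) simp
  moreover have "inverse t ^ (m+2) * exp (- inverse t) * t^2 = exp_recip m t"
    using assms by (simp add: exp_recip_def power_add field_simps power2_eq_square)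
  ultimately show ?thesis by simp
qed

text \<open>Differentiation maps each \<open>exp_recip m\<close> into the span of this family; that
  is why powers of \<open>inverse t\<close> are carried along. At 0 the quadratic bound
  \<open>exp_recip_le\<close> makes the difference quotient tend to 0.\<close>

lemma exp_recip_deriv:
  "(exp_recip m has_real_derivative (exp_recip (m+2) t - real m * exp_recip (m+1) t)) (at t)"
proof -
  consider "t > 0" | "t < 0" | "t = 0" by linarith
  then show ?thesis
  proof cases
    case 1
    have "((\<lambda>t. inverse t ^ m * exp (- inverse t)) has_real_derivative
        (real m * inverse t ^ (m - 1) * (- (inverse t ^ 2)) * exp (- inverse t)
          + inverse t ^ m * (exp (- inverse t) * (inverse t ^ 2)))) (at t)"
      by (auto intro!: derivative_eq_intros simp: 1[THEN less_imp_neq] power2_eq_square numeral_2_eq_2)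
        (use 1 in auto)
    moreover have "real m * inverse t ^ (m - 1) * (- (inverse t ^ 2)) * exp (- inverse t)
          + inverse t ^ m * (exp (- inverse t) * (inverse t ^ 2)) = exp_recip (m+2) t - real m * exp_recip (m+1) t"
      using 1 by (cases m) (auto simp: exp_recip_def power2_eq_square algebra_simps)
    ultimately have "((\<lambda>t. inverse t ^ m * exp (- inverse t)) has_real_derivative
        (exp_recip (m+2) t - real m * exp_recip (m+1) t)) (at t)"
      by simp
    then show ?thesis
      by (rule has_field_derivative_transform_within_open[where S="{0<..}"])
        (use 1 in \<open>auto simp: exp_recip_def\<close>)
  next
    case 2
    have "((\<lambda>t. 0) has_real_derivative 0) (at t)" by simp
    then have "(exp_recip m has_real_derivative 0) (at t)"
      by (rule has_field_derivative_transform_within_open[where S="{..<0}"])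
        (use 2 in \<open>auto simp: exp_recip_def\<close>)
    then show ?thesis using 2 by (simp add: exp_recip_def)
  next
    case 3
    have b: "norm (exp_recip m h / h) \<le> fact (m+2) * \<bar>h\<bar>" for h
    proof (cases "h > 0")
      case True
      then show ?thesis using exp_recip_le[OF True, of m] exp_recip_nonneg[of m h]
        by (simp add: divide_simps power2_eq_square mult.assoc del: fact_Suc)
    next
      case False
      moreover have "0 \<le> (fact (m+2) :: real) * \<bar>h\<bar>" by (intro mult_nonneg_nonneg) auto
      ultimately show ?thesis by (simp only: exp_recip_def if_False div_0 norm_zero)
    qed
    have "(\<lambda>h. fact (m+2) * \<bar>h\<bar>) \<midarrow>0\<rightarrow> (fact (m+2) * \<bar>0\<bar> :: real)"
      by (intro tendsto_intros)
    then have "(\<lambda>h. exp_recip m h / h) \<midarrow>0\<rightarrow> 0"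
      by (intro tendsto_0_le[where K=1 and g="\<lambda>h. exp_recip m h / h" and f="\<lambda>h. fact (m+2) * \<bar>h\<bar>"] always_eventually)
        (use b in \<open>auto simp del: fact_Suc\<close>)
    then show ?thesis
      unfolding 3 by (simp add: DERIV_def exp_recip_def[of _ 0])
  qed
qed

text \<open>An algebra that contains the smooth functions and the radial functions built from
  \<open>exp_recip\<close> and is closed under directional derivatives, since the product rule stays
  inside it. \<open>smooth_coinduct\<close> applied to the whole set gives the smoothness of the
  bump function and of sums and products at one stroke.\<close>

inductive_set smooth_alg :: "('a::euclidean_space \<Rightarrow> real) set" where
  base: "smooth f \<Longrightarrow> f \<in> smooth_alg"
| bump: "(\<lambda>x. exp_recip m (1 - x \<bullet> x)) \<in> smooth_alg"
| add: "f \<in> smooth_alg \<Longrightarrow> g \<in> smooth_alg \<Longrightarrow> (\<lambda>x. f x + g x) \<in> smooth_alg"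
| mult: "f \<in> smooth_alg \<Longrightarrow> g \<in> smooth_alg \<Longrightarrow> (\<lambda>x. f x * g x) \<in> smooth_alg"

lemma frechet_derivative_worksI: "f differentiable F \<Longrightarrow> (f has_derivative frechet_derivative f F) F"
  using frechet_derivative_works by blast

lemma smooth_const: "smooth (\<lambda>x. c)"
  using smooth_affine[of 0 c] by simp

lemma smooth_alg_differentiable: "f \<in> smooth_alg \<Longrightarrow> f differentiable (at x)"
proof (induction rule: smooth_alg.induct)
  case (bump m)
  have "((\<lambda>x::'a. 1 - x \<bullet> x) has_derivative (\<lambda>h. - (2 * (x \<bullet> h)))) (at x)"
    by (auto intro!: derivative_eq_intros simp: inner_commute)
  from has_derivative_compose[OF this exp_recip_deriv[THEN has_field_derivative_imp_has_derivative]]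
  show ?case by (auto simp: differentiable_def)
qed (auto simp: smooth_differentiable)

lemma smooth_alg_derivative: "f \<in> smooth_alg \<Longrightarrow> (\<lambda>x. frechet_derivative f (at x) v) \<in> smooth_alg"
proof (induction rule: smooth_alg.induct)
  case (bump m)
  have D: "((\<lambda>x::'a. 1 - x \<bullet> x) has_derivative (\<lambda>h. - (2 * (x \<bullet> h)))) (at x)" for x
    by (auto intro!: derivative_eq_intros simp: inner_commute)
  have "frechet_derivative (\<lambda>x::'a. exp_recip m (1 - x \<bullet> x)) (at x) v =
      exp_recip (m+2) (1 - x \<bullet> x) * (x \<bullet> (-2 *\<^sub>R v) + 0)
      + (- real m) * (exp_recip (m+1) (1 - x \<bullet> x) * (x \<bullet> (-2 *\<^sub>R v) + 0))" for x
  proof -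
    have "frechet_derivative (\<lambda>x::'a. exp_recip m (1 - x \<bullet> x)) (at x) =
       (\<lambda>h. (exp_recip (m+2) (1 - x \<bullet> x) - real m * exp_recip (m+1) (1 - x \<bullet> x)) * - (2 * (x \<bullet> h)))"
      by (rule frechet_derivative_at[symmetric])
        (rule has_derivative_compose[OF D exp_recip_deriv[THEN has_field_derivative_imp_has_derivative]])
    then have "frechet_derivative (\<lambda>x::'a. exp_recip m (1 - x \<bullet> x)) (at x) v =
       (exp_recip (m+2) (1 - x \<bullet> x) - real m * exp_recip (m+1) (1 - x \<bullet> x)) * - (2 * (x \<bullet> v))"
      by simp
    moreover have "x \<bullet> (-2 *\<^sub>R v) + 0 = - (2 * (x \<bullet> v))" by simp
    moreover have "(a - r * b) * y = a * y + (- r) * (b * y)" for a b r y :: real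
      by (simp add: left_diff_distrib)
    ultimately show ?thesis by metis
  qed
  then show ?case
    by (simp only:) (rule smooth_alg.add[OF smooth_alg.mult smooth_alg.mult[OF _ smooth_alg.mult]] smooth_alg.bump smooth_alg.base smooth_affine smooth_const)+
next
  case (add f g)
  have "frechet_derivative (\<lambda>x. f x + g x) (at x) v
     = frechet_derivative f (at x) v + frechet_derivative g (at x) v" for x
    using add smooth_alg_differentiable
    by (subst frechet_derivative_at[symmetric, OF has_derivative_add[OF frechet_derivative_worksI frechet_derivative_worksI]]) auto
  then show ?case using add by (simp add: smooth_alg.add)
next
  case (mult f g)
  have "frechet_derivative (\<lambda>x. f x * g x) (at x) v
     = f x * frechet_derivative g (at x) v + frechet_derivative f (at x) v * g x" for x
    using mult smooth_alg_differentiable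
    by (subst frechet_derivative_at[symmetric, OF has_derivative_mult[OF frechet_derivative_worksI frechet_derivative_worksI]]) auto
  then show ?case using mult by (simp add: smooth_alg.add smooth_alg.mult)
qed (auto intro: smooth_alg.base smooth_frechet_derivative)

lemma smooth_alg_smooth: "f \<in> smooth_alg \<Longrightarrow> smooth f"
  by (rule smooth_coinduct[where F=smooth_alg]) (auto intro: smooth_alg_differentiable smooth_alg_derivative)

lemma smooth_add: "smooth f \<Longrightarrow> smooth g \<Longrightarrow> smooth (\<lambda>x. f x + g x)"
  and smooth_mult: "smooth f \<Longrightarrow> smooth g \<Longrightarrow> smooth (\<lambda>x. f x * g x)"
  by (rule smooth_alg_smooth, rule smooth_alg.add smooth_alg.mult; erule smooth_alg.base)+

lemma smooth_affine_comp:
  fixes f :: "'a::euclidean_space \<Rightarrow> real"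
  assumes "smooth f" shows "smooth (\<lambda>x. f (t + c *\<^sub>R x))"
proof -
  \<comment> \<open>The scalar a is needed for closure under differentiation: by the chain rule each
    derivative brings a factor c.\<close>
  define F where "F = {(\<lambda>x. a * f (t + c *\<^sub>R x)) | a f. smooth f}"
  have D: "((\<lambda>x. a * f (t + c *\<^sub>R x)) has_derivative (\<lambda>h. a * frechet_derivative f (at (t + c *\<^sub>R x)) (c *\<^sub>R h))) (at x)"
    if "smooth f" for f :: "'a \<Rightarrow> real" and a t c x
  proof -
    have "(f has_derivative frechet_derivative f (at (t + c *\<^sub>R x))) (at (t + c *\<^sub>R x))"
      using smooth_differentiable[OF that] frechet_derivative_works by metis
    moreover have "((\<lambda>x. t + c *\<^sub>R x) has_derivative (\<lambda>h. c *\<^sub>R h)) (at x)"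
      by (auto intro!: derivative_eq_intros)
    ultimately have "((\<lambda>x. f (t + c *\<^sub>R x)) has_derivative (\<lambda>h. frechet_derivative f (at (t + c *\<^sub>R x)) (c *\<^sub>R h))) (at x)"
      using has_derivative_compose by blast
    then show ?thesis by (rule has_derivative_mult_right)
  qed
  have "(\<lambda>x. 1 * f (t + c *\<^sub>R x)) \<in> F" using assms unfolding F_def by blast
  then have "smooth (\<lambda>x. 1 * f (t + c *\<^sub>R x))"
  proof (rule smooth_coinduct)
    fix g x assume "g \<in> F"
    then show "g differentiable at x" using D unfolding F_def differentiable_def by blast
  next
    fix g v assume "g \<in> F"
    then obtain a f where g: "g = (\<lambda>x. a * f (t + c *\<^sub>R x))" "smooth f" unfolding F_def by auto
    have "frechet_derivative g (at x) v = (a * c) * frechet_derivative f (at (t + c *\<^sub>R x)) v" for x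
    proof -
      have "linear (frechet_derivative f (at (t + c *\<^sub>R x)))"
        using smooth_differentiable[OF g(2)] linear_frechet_derivative by blast
      then show ?thesis
        unfolding g(1) frechet_derivative_at[OF D[OF g(2)], symmetric] by (simp add: linear_scale)
    qed
    then have "(\<lambda>x. frechet_derivative g (at x) v) = (\<lambda>x. (a * c) * (\<lambda>y. frechet_derivative f (at y) v) (t + c *\<^sub>R x))"
      by auto
    then show "(\<lambda>x. frechet_derivative g (at x) v) \<in> F"
      unfolding F_def mem_Collect_eq using smooth_frechet_derivative[OF g(2)]
      by (intro exI[of _ "a * c"] exI[of _ "\<lambda>y. frechet_derivative f (at y) v"] conjI) auto
  qed
  then show ?thesis by simp
qed

definition bump_fun :: "'a::euclidean_space \<Rightarrow> real" where
  "bump_fun x = exp_recip 0 (1 - x \<bullet> x)"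

lemma smooth_bump_fun: "smooth bump_fun"
  unfolding bump_fun_def by (rule smooth_alg_smooth, rule smooth_alg.bump)

lemma bump_fun_bounds: "0 \<le> bump_fun x" "bump_fun x \<le> 1"
  by (auto simp: bump_fun_def exp_recip_def)

lemma bump_fun_eq_0: "norm x \<ge> 1 \<Longrightarrow> bump_fun x = 0"
  by (auto simp: bump_fun_def exp_recip_def dot_square_norm abs_square_less_1)

lemma bump_fun_pos: "norm x < 1 \<Longrightarrow> bump_fun x > 0"
  by (auto simp: bump_fun_def exp_recip_def dot_square_norm abs_square_less_1)

section \<open>Test functions and classical gradients\<close>

lemma test_functions_iff:
  "\<phi> \<in> test_functions \<Omega> \<longleftrightarrow> smooth \<phi> \<and> (\<exists>K. compact K \<and> K \<subseteq> \<Omega> \<and> (\<forall>x. x \<notin> K \<longrightarrow> \<phi> x = 0))"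
proof safe
  assume "\<phi> \<in> test_functions \<Omega>"
  then show "\<exists>K. compact K \<and> K \<subseteq> \<Omega> \<and> (\<forall>x. x \<notin> K \<longrightarrow> \<phi> x = 0)"
    using closure_subset[of "{x. \<phi> x \<noteq> 0}"] unfolding test_functions_def smooth_def by blast
next
  fix K assume *: "smooth \<phi>" "compact K" "K \<subseteq> \<Omega>" "\<forall>x. x \<notin> K \<longrightarrow> \<phi> x = 0"
  then have c: "closure {x. \<phi> x \<noteq> 0} \<subseteq> K" by (intro closure_minimal compact_imp_closed) auto
  then have "compact (closure {x. \<phi> x \<noteq> 0})"
    using *(2) by (metis Int_absorb1 closed_closure compact_Int_closed)
  then show "\<phi> \<in> test_functions \<Omega>"
    using * c by (auto simp: test_functions_def smooth_def)
qed (simp add: test_functions_def smooth_def)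

text \<open>A class between smooth and differentiable: composing a mollified function with a merely
  C1 function of one variable stays in it, and integration by parts against test functions is
  available.\<close>

definition C1_grad :: "('a::euclidean_space \<Rightarrow> real) \<Rightarrow> ('a \<Rightarrow> 'a) \<Rightarrow> bool" where
  "C1_grad \<phi> g \<longleftrightarrow> (\<forall>x. (\<phi> has_derivative (\<lambda>v. g x \<bullet> v)) (at x)) \<and> continuous_on UNIV g"

lemma frechet_eq_classical_grad:
  assumes "\<phi> differentiable (at x)"
  shows "frechet_derivative \<phi> (at x) v = classical_grad \<phi> x \<bullet> v"
proof -
  have l: "linear (frechet_derivative \<phi> (at x))" using assms linear_frechet_derivative by blast
  have "frechet_derivative \<phi> (at x) v = frechet_derivative \<phi> (at x) (\<Sum>b\<in>Basis. (v \<bullet> b) *\<^sub>R b)"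
    by (simp add: euclidean_representation)
  also have "\<dots> = (\<Sum>b\<in>Basis. (v \<bullet> b) * frechet_derivative \<phi> (at x) b)"
    using l by (simp add: linear_sum linear_scale)
  also have "\<dots> = classical_grad \<phi> x \<bullet> v"
    by (simp add: classical_grad_def inner_sum_left inner_commute[of v] mult.commute)
  finally show ?thesis .
qed

lemma smooth_C1_grad: "smooth \<phi> \<Longrightarrow> C1_grad \<phi> (classical_grad \<phi>)"
  unfolding C1_grad_def
proof safe
  fix x assume s: "smooth \<phi>"
  have "(\<lambda>v. classical_grad \<phi> x \<bullet> v) = frechet_derivative \<phi> (at x)"
    using frechet_eq_classical_grad[OF smooth_differentiable[OF s]] by auto
  then show "(\<phi> has_derivative (\<lambda>v. classical_grad \<phi> x \<bullet> v)) (at x)"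
    using smooth_differentiable[OF s] frechet_derivative_works by metis
next
  assume s: "smooth \<phi>"
  show "continuous_on UNIV (classical_grad \<phi>)"
    unfolding classical_grad_def
    by (intro continuous_intros smooth_continuous smooth_frechet_derivative s)
qed

lemma C1_grad_classical: "C1_grad \<phi> g \<Longrightarrow> classical_grad \<phi> = g"
proof
  fix x assume "C1_grad \<phi> g"
  then have "frechet_derivative \<phi> (at x) = (\<lambda>v. g x \<bullet> v)"
    by (metis C1_grad_def frechet_derivative_at)
  then show "classical_grad \<phi> x = g x"
    by (simp add: classical_grad_def euclidean_representation)
qed

section \<open>Mollification\<close>

lemma divide_succ_le_1: "0 \<le> (a::real) \<Longrightarrow> a / (a + 1) \<le> 1"
  by simp

lemma nn_integral_lborel_affine:
  fixes f :: "'a::euclidean_space \<Rightarrow> ennreal"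
  assumes [measurable]: "f \<in> borel_measurable borel" and c: "c \<noteq> 0"
  shows "(\<integral>\<^sup>+x. f x \<partial>lborel) = ennreal (\<bar>c\<bar> ^ DIM('a)) * (\<integral>\<^sup>+x. f (t + c *\<^sub>R x) \<partial>lborel)"
  by (subst lborel_affine[OF c, of t])
     (simp add: nn_integral_density nn_integral_distr nn_integral_cmult)

lemma nn_integral_lborel_shift:
  fixes f :: "'a::euclidean_space \<Rightarrow> ennreal"
  assumes "f \<in> borel_measurable borel"
  shows "(\<integral>\<^sup>+x. f (t + x) \<partial>lborel) = (\<integral>\<^sup>+x. f x \<partial>lborel)"
  using nn_integral_lborel_affine[OF assms, of 1 t] by simp

lemma lborel_integral_affine:
  fixes f :: "'a::euclidean_space \<Rightarrow> 'b::{banach, second_countable_topology}"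
  assumes c: "c \<noteq> 0"
  shows "integrable lborel f \<Longrightarrow> integrable lborel (\<lambda>x. f (t + c *\<^sub>R x))"
    "integrable lborel f \<Longrightarrow> (LINT x|lborel. f x) = (\<bar>c\<bar> ^ DIM('a)) *\<^sub>R (LINT x|lborel. f (t + c *\<^sub>R x))"
proof -
  assume f: "integrable lborel f"
  then have [measurable]: "f \<in> borel_measurable borel" by auto
  have "ennreal (\<bar>c\<bar> ^ DIM('a)) * (\<integral>\<^sup>+x. ennreal (norm (f (t + c *\<^sub>R x))) \<partial>lborel) < \<infinity>"
    using f nn_integral_lborel_affine[OF _ c, of "\<lambda>x. ennreal (norm (f x))" t] by (simp add: integrable_iff_bounded)
  then show i: "integrable lborel (\<lambda>x. f (t + c *\<^sub>R x))"
    using c by (auto simp: integrable_iff_bounded ennreal_mult_less_top)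
  show "(LINT x|lborel. f x) = (\<bar>c\<bar> ^ DIM('a)) *\<^sub>R (LINT x|lborel. f (t + c *\<^sub>R x))"
    by (subst lborel_affine[OF c, of t]) (simp add: integral_density integral_distr)
qed

lemma C1_grad_continuous: "C1_grad \<phi> g \<Longrightarrow> continuous_on UNIV \<phi>"
  unfolding C1_grad_def by (meson differentiable_def differentiable_imp_continuous_on differentiable_on_def)

lemma C1_grad_borel:
  assumes "C1_grad \<phi> g" shows "\<phi> \<in> borel_measurable borel" "g \<in> borel_measurable borel"
  using C1_grad_continuous[OF assms] assms by (auto simp: C1_grad_def intro: borel_measurable_continuous_onI)

text \<open>Fundamental theorem of calculus on the segment from x to x + h. The form with
  \<open>nn_integral\<close> can be integrated in x and reordered by Tonelli without integrability
  conditions.\<close>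

lemma C1_grad_segment:
  fixes \<phi> :: "'a::euclidean_space \<Rightarrow> real"
  assumes "C1_grad \<phi> g"
  shows "ennreal \<bar>\<phi> (x + h) - \<phi> x\<bar> \<le> ennreal (norm h) * (\<integral>\<^sup>+t. indicator {0..1} t * ennreal (norm (g (x + t *\<^sub>R h))) \<partial>lborel)"
proof -
  have g: "continuous_on UNIV g" and d: "\<And>x. (\<phi> has_derivative (\<lambda>v. g x \<bullet> v)) (at x)"
    using assms by (auto simp: C1_grad_def)
  have [measurable]: "g \<in> borel_measurable borel" using C1_grad_borel[OF assms] by simp
  have v: "((\<lambda>t. \<phi> (x + t *\<^sub>R h)) has_vector_derivative (g (x + t *\<^sub>R h) \<bullet> h)) (at t within {0..1})" for t
  proof -
    have "((\<lambda>t. x + t *\<^sub>R h) has_derivative (\<lambda>s. s *\<^sub>R h)) (at t within {0..1})"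
      by (auto intro!: derivative_eq_intros)
    from has_derivative_compose[OF this d] show ?thesis
      by (simp add: has_vector_derivative_def mult.commute)
  qed
  have "has_bochner_integral lborel (\<lambda>t. indicator {0..1} t *\<^sub>R (g (x + t *\<^sub>R h) \<bullet> h)) (\<phi> (x + 1 *\<^sub>R h) - \<phi> (x + 0 *\<^sub>R h))"
    by (rule has_bochner_integral_FTC_Icc[OF zero_le_one v])
      (auto intro!: continuous_intros continuous_on_compose2[OF g])
  then have i: "integrable lborel (\<lambda>t. indicator {0..1} t *\<^sub>R (g (x + t *\<^sub>R h) \<bullet> h))"
    and e: "\<phi> (x + h) - \<phi> x = (LINT t|lborel. indicator {0..1} t *\<^sub>R (g (x + t *\<^sub>R h) \<bullet> h))"
    by (auto simp: has_bochner_integral_iff)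
  have "ennreal \<bar>\<phi> (x + h) - \<phi> x\<bar> \<le> (\<integral>\<^sup>+t. ennreal (norm (indicator {0..1} t *\<^sub>R (g (x + t *\<^sub>R h) \<bullet> h))) \<partial>lborel)"
    unfolding e using integral_norm_bound_ennreal[OF i] by simp
  also have "\<dots> \<le> (\<integral>\<^sup>+t. ennreal (norm h) * (indicator {0..1} t * ennreal (norm (g (x + t *\<^sub>R h)))) \<partial>lborel)"
    by (intro nn_integral_mono)
      (auto simp: indicator_def ennreal_mult[symmetric] mult.commute[of "norm h"] intro!: ennreal_leI Cauchy_Schwarz_ineq2)
  also have "\<dots> = ennreal (norm h) * (\<integral>\<^sup>+t. indicator {0..1} t * ennreal (norm (g (x + t *\<^sub>R h))) \<partial>lborel)"
    by (rule nn_integral_cmult) measurable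
  finally show ?thesis .
qed

text \<open>Tonelli and translation invariance applied to \<open>C1_grad_segment\<close>. This
  quantitative modulus is what makes mollification uniform over families with bounded gradients in
  Rellich's theorem.\<close>

lemma C1_grad_translation_L1:
  fixes \<phi> :: "'a::euclidean_space \<Rightarrow> real"
  assumes "C1_grad \<phi> g"
  shows "(\<integral>\<^sup>+x. ennreal \<bar>\<phi> (x + h) - \<phi> x\<bar> \<partial>lborel) \<le> ennreal (norm h) * (\<integral>\<^sup>+x. ennreal (norm (g x)) \<partial>lborel)"
proof -
  have [measurable]: "\<phi> \<in> borel_measurable borel" "g \<in> borel_measurable borel" using C1_grad_borel[OF assms] by auto
  have "(\<integral>\<^sup>+x. ennreal \<bar>\<phi> (x + h) - \<phi> x\<bar> \<partial>lborel) \<le>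
     (\<integral>\<^sup>+x. ennreal (norm h) * (\<integral>\<^sup>+t. indicator {0..1} t * ennreal (norm (g (x + t *\<^sub>R h))) \<partial>lborel) \<partial>lborel)"
    by (intro nn_integral_mono C1_grad_segment assms)
  also have "\<dots> = ennreal (norm h) * (\<integral>\<^sup>+x. (\<integral>\<^sup>+t. indicator {0..1} t * ennreal (norm (g (x + t *\<^sub>R h))) \<partial>lborel) \<partial>lborel)"
    by (rule nn_integral_cmult) measurable
  also have "(\<integral>\<^sup>+x. (\<integral>\<^sup>+t. indicator {0..1} t * ennreal (norm (g (x + t *\<^sub>R h))) \<partial>(lborel :: real measure)) \<partial>lborel)
     = (\<integral>\<^sup>+t. (\<integral>\<^sup>+x. indicator {0..1} t * ennreal (norm (g (x + t *\<^sub>R h))) \<partial>lborel) \<partial>lborel)"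
    by (rule lborel_pair.Fubini'[symmetric]) measurable
  also have "\<dots> = (\<integral>\<^sup>+t. indicator {0..1::real} t * (\<integral>\<^sup>+x. ennreal (norm (g x)) \<partial>lborel) \<partial>lborel)"
  proof (intro nn_integral_cong)
    fix t :: real
    have "(\<integral>\<^sup>+x. ennreal (norm (g (x + t *\<^sub>R h))) \<partial>lborel) = (\<integral>\<^sup>+x. ennreal (norm (g x)) \<partial>lborel)"
      using nn_integral_lborel_shift[of "\<lambda>x. ennreal (norm (g x))" "t *\<^sub>R h"] by (simp add: add.commute)
    then show "(\<integral>\<^sup>+x. indicator {0..1} t * ennreal (norm (g (x + t *\<^sub>R h))) \<partial>lborel) = indicator {0..1} t * (\<integral>\<^sup>+x. ennreal (norm (g x)) \<partial>lborel)"
      by (subst nn_integral_cmult) auto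
  qed
  also have "\<dots> = (\<integral>\<^sup>+x. ennreal (norm (g x)) \<partial>lborel)"
    by (subst nn_integral_multc) auto
  finally show ?thesis .
qed

section \<open>Continuity of translations in L1\<close>

definition L1_modulus :: "('a::euclidean_space \<Rightarrow> 'b::real_normed_vector) \<Rightarrow> 'a \<Rightarrow> ennreal" where
  "L1_modulus f h = (\<integral>\<^sup>+x. ennreal (norm (f (x + h) - f x)) \<partial>lborel)"

text \<open>Squeeze A between a compact set K and an open set U. A shift shorter than the distance
  of K to the complement of U keeps K inside U, so the two indicators differ only on A - K, U - A
  and the translates of these two small sets.\<close>

lemma L1_modulus_indicator:
  fixes A :: "'a::euclidean_space set" and c :: "'b::real_normed_vector"
  assumes A: "A \<in> sets lborel" "emeasure lborel A < \<infinity>" and "e > 0"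
  shows "\<exists>d>0. \<forall>h. norm h < d \<longrightarrow> L1_modulus (\<lambda>x. indicator A x *\<^sub>R c) h \<le> ennreal e"
proof -
  \<comment> \<open>The divisor 6 counts the errors: 2 \<eta> for A - K and \<eta> for U - A, each
    occurring twice because of the translate.\<close>
  define \<eta> where "\<eta> = e / (norm c + 1) / 6"
  have \<eta>: "\<eta> > 0" using \<open>e > 0\<close> by (simp add: \<eta>_def add_nonneg_pos)
  have Al: "A \<in> sets lebesgue" using A by simp
  obtain U where U: "open U" "A \<subseteq> U" "emeasure lebesgue (U - A) < ennreal \<eta>"
    using sets_lebesgue_outer_open[OF Al \<eta>] by metis
  obtain T where T: "closed T" "T \<subseteq> A" "emeasure lebesgue (A - T) < ennreal \<eta>"
    using sets_lebesgue_inner_closed[OF Al \<eta>] by metis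
  have Tfin: "emeasure lborel T < \<infinity>"
    using A T by (meson emeasure_mono le_less_trans sets_lborel)
  have Tb: "T \<in> sets borel" using T by (simp add: borel_closed)
  \<comment> \<open>The closed inner set T need not be bounded, but a positive distance to the
    complement of U requires compactness; as A has finite measure, a large ball loses little of
    T.\<close>
  define K where "K n = T \<inter> cball 0 (real n)" for n
  have "\<exists>n. emeasure lborel (T - K n) < ennreal \<eta>"
  proof -
    have "(\<lambda>n. emeasure lborel (T - K n)) \<longlonglongrightarrow> emeasure lborel (\<Inter>n. T - K n)"
    proof (rule Lim_emeasure_decseq)
      show "decseq (\<lambda>n. T - K n)" by (auto simp: K_def decseq_def)
      show "emeasure lborel (T - K n) \<noteq> \<infinity>" for n
        using Tfin Tb by (metis Diff_subset emeasure_mono infinity_ennreal_def less_le_not_le top.extremum_unique top_greatest sets_lborel linorder_not_less)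
    qed (use Tb in \<open>auto simp: K_def\<close>)
    moreover have "(\<Inter>n. T - K n) = {}"
      by (auto simp: K_def) (meson real_arch_simple)
    ultimately have "(\<lambda>n. emeasure lborel (T - K n)) \<longlonglongrightarrow> 0" by (metis emeasure_empty)
    then have "\<forall>\<^sub>F n in sequentially. emeasure lborel (T - K n) < ennreal \<eta>"
      using \<eta> by (intro order_tendstoD(2)) (auto simp: ennreal_zero_less_top)
    then show ?thesis by (auto simp: eventually_sequentially)
  qed
  then obtain n where n: "emeasure lborel (T - K n) < ennreal \<eta>" by blast
  have Kb: "K n \<in> sets borel" using Tb by (simp add: K_def)
  have AK: "emeasure lborel (A - K n) \<le> ennreal (2 * \<eta>)"
  proof -
    have "emeasure lborel (A - K n) \<le> emeasure lborel ((A - T) \<union> (T - K n))"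
      using A Tb Kb by (intro emeasure_mono) auto
    also have "\<dots> \<le> emeasure lborel (A - T) + emeasure lborel (T - K n)"
      using A Tb Kb by (intro emeasure_subadditive) auto
    also have "emeasure lborel (A - T) = emeasure lebesgue (A - T)" using A Tb by simp
    also have "emeasure lebesgue (A - T) + emeasure lborel (T - K n) \<le> ennreal \<eta> + ennreal \<eta>"
      using n T(3) by (intro add_mono) auto
    finally show ?thesis using \<eta> by (simp flip: ennreal_plus)
  qed
  have UA: "emeasure lborel (U - A) \<le> ennreal \<eta>"
    using U A by (simp add: borel_open)
  have "compact (K n)" unfolding K_def using T(1) by (intro closed_Int_compact) auto
  moreover have "closed (- U)" "K n \<inter> - U = {}" using U T by (auto simp: K_def)
  ultimately have "\<exists>d>0. \<forall>x\<in>K n. \<forall>y\<in>- U. d \<le> dist x y"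
    by (rule separate_compact_closed)
  then obtain d where d: "d > 0" "\<And>x y. x \<in> K n \<Longrightarrow> y \<notin> U \<Longrightarrow> d \<le> dist x y"
    by blast
  have *: "norm (indicator A (x + h) *\<^sub>R c - indicator A x *\<^sub>R c)
      \<le> norm c * (indicator (A - K n) (x + h) + indicator (U - A) x + indicator (A - K n) x + indicator (U - A) (x + h))"
    if "norm h < d" for x h
  proof -
    have "x + h \<in> K n \<Longrightarrow> x \<in> U"
      using d(2)[of "x + h" x] that by (force simp: dist_norm)
    moreover have "x \<in> K n \<Longrightarrow> x + h \<in> U"
      using d(2)[of x "x+h"] that by (force simp: dist_norm)
    ultimately show ?thesis by (auto simp: indicator_def)
  qed
  have "L1_modulus (\<lambda>x. indicator A x *\<^sub>R c) h \<le> ennreal e" if "norm h < d" for h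
  proof -
    have [measurable]: "A - K n \<in> sets borel" "U - A \<in> sets borel" using A Kb U by auto
    have sh: "(\<integral>\<^sup>+x. indicator S (x + h) \<partial>lborel) = emeasure lborel S" if "S \<in> sets borel" for S
      using nn_integral_lborel_shift[of "indicator S" h] that by (simp add: add.commute)
    have "L1_modulus (\<lambda>x. indicator A x *\<^sub>R c) h \<le> (\<integral>\<^sup>+x. ennreal (norm c) * (indicator (A - K n) (x + h) + indicator (U - A) x + indicator (A - K n) x + indicator (U - A) (x + h)) \<partial>lborel)"
      unfolding L1_modulus_def
    proof (rule nn_integral_mono)
      fix x
      show "ennreal (norm (indicat_real A (x + h) *\<^sub>R c - indicat_real A x *\<^sub>R c))
         \<le> ennreal (norm c) * (indicator (A - K n) (x + h) + indicator (U - A) x + indicator (A - K n) x + indicator (U - A) (x + h))"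
        using ennreal_leI[OF *[OF that, of x]]
        by (simp add: ennreal_mult ennreal_indicator ennreal_plus)
    qed
    also have "\<dots> = ennreal (norm c) * (emeasure lborel (A - K n) + emeasure lborel (U - A) + emeasure lborel (A - K n) + emeasure lborel (U - A))"
      by (subst nn_integral_cmult, measurable, (subst nn_integral_add, measurable)+) (simp add: sh)
    also have "\<dots> \<le> ennreal (norm c) * (ennreal (2 * \<eta>) + ennreal \<eta> + ennreal (2 * \<eta>) + ennreal \<eta>)"
      by (intro mult_left_mono add_mono AK UA) auto
    also have "\<dots> = ennreal (norm c * (6 * \<eta>))"
      using \<eta> by (simp flip: ennreal_plus ennreal_mult)
    also have "\<dots> \<le> ennreal e"
    proof (intro ennreal_leI)
      have "norm c * (6 * \<eta>) = e * (norm c / (norm c + 1))" unfolding \<eta>_def by algebra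
      also have "\<dots> \<le> e * 1" using \<open>e > 0\<close> by (intro mult_left_mono divide_succ_le_1) auto
      finally show "norm c * (6 * \<eta>) \<le> e" by simp
    qed
    finally show ?thesis .
  qed
  then show ?thesis using d(1) by blast
qed

text \<open>Density argument from indicators. In the limit step the distance of f to its
  approximation is counted twice, once translated, because translation preserves the L1
  norm.\<close>

lemma L1_modulus_tendsto:
  fixes f :: "'a::euclidean_space \<Rightarrow> 'b::{banach, second_countable_topology}"
  assumes "integrable lborel f"
  shows "\<forall>e>0. \<exists>d>0. \<forall>h. norm h < d \<longrightarrow> L1_modulus f h \<le> ennreal e"
  using assms
proof (induction f rule: integrable_induct)
  case (base A c)
  then show ?case using L1_modulus_indicator by blast
next
  case (add f g)
  show ?case
  proof safe
    fix e :: real assume "e > 0"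
    then have "e/2 > 0" by simp
    then obtain d1 d2 where d: "d1 > 0" "d2 > 0" "\<And>h. norm h < d1 \<Longrightarrow> L1_modulus f h \<le> ennreal (e/2)"
      "\<And>h. norm h < d2 \<Longrightarrow> L1_modulus g h \<le> ennreal (e/2)"
      using add by metis
    have [measurable]: "f \<in> borel_measurable borel" "g \<in> borel_measurable borel" using add by auto
    have "L1_modulus (\<lambda>x. f x + g x) h \<le> L1_modulus f h + L1_modulus g h" for h
      unfolding L1_modulus_def
      by (subst nn_integral_add[symmetric])
        (auto intro!: nn_integral_mono simp: ennreal_plus[symmetric] simp del: ennreal_plus
          intro: order_trans[OF eq_refl norm_triangle_ineq] ennreal_leI,
          metis (no_types, lifting) add_diff_add ennreal_leI norm_triangle_ineq)
    then have "L1_modulus (\<lambda>x. f x + g x) h \<le> ennreal e" if "norm h < min d1 d2" for h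
      using d(3,4)[of h] that \<open>e>0\<close> order_trans[OF _ add_mono, of _ "L1_modulus f h" "L1_modulus g h" "ennreal (e/2)" "ennreal (e/2)"]
      by (auto simp flip: ennreal_plus)
    then show "\<exists>d>0. \<forall>h. norm h < d \<longrightarrow> L1_modulus (\<lambda>x. f x + g x) h \<le> ennreal e"
      using d by (intro exI[of _ "min d1 d2"]) auto
  qed
next
  case (lim f s)
  show ?case
  proof safe
    fix e :: real assume "e > 0"
    have [measurable]: "f \<in> borel_measurable borel" "\<And>i. s i \<in> borel_measurable borel" using lim by auto
    have "(\<lambda>i. \<integral>\<^sup>+x. norm (f x - s i x) \<partial>lborel) \<longlonglongrightarrow> 0"
    proof (rule nn_integral_dominated_convergence_norm[where w="\<lambda>x. 2 * norm (f x)"])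
      have "(\<integral>\<^sup>+x. ennreal (norm (f x)) \<partial>lborel) < \<infinity>"
        using lim.hyps(4) by (simp add: integrable_iff_bounded)
      then show "(\<integral>\<^sup>+x. ennreal (2 * norm (f x)) \<partial>lborel) < \<infinity>"
        by (auto simp: integrable_iff_bounded ennreal_mult nn_integral_cmult ennreal_mult_less_top)
    qed (use lim in auto)
    then have "\<forall>\<^sub>F i in sequentially. (\<integral>\<^sup>+x. norm (f x - s i x) \<partial>lborel) < ennreal (e/3)"
      using \<open>e > 0\<close> by (intro order_tendstoD(2)) auto
    then obtain i where i: "(\<integral>\<^sup>+x. norm (f x - s i x) \<partial>lborel) < ennreal (e/3)"
      by (auto simp: eventually_sequentially)
    obtain d where d: "d > 0" "\<And>h. norm h < d \<Longrightarrow> L1_modulus (s i) h \<le> ennreal (e/3)"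
      using lim.IH[of i] \<open>e > 0\<close> by (metis zero_less_divide_iff zero_less_numeral)
    have "L1_modulus f h \<le> ennreal e" if "norm h < d" for h
    proof -
      have "L1_modulus f h \<le> (\<integral>\<^sup>+x. norm (f (h + x) - s i (h + x)) + norm (f x - s i x) + norm (s i (x + h) - s i x) \<partial>lborel)"
        unfolding L1_modulus_def
      proof (intro nn_integral_mono ennreal_leI)
        fix x
        have e: "f (x + h) - f x = (f (h + x) - s i (h + x)) - (f x - s i x) + (s i (x + h) - s i x)"
          by (simp add: add.commute)
        show "norm (f (x + h) - f x) \<le> norm (f (h + x) - s i (h + x)) + norm (f x - s i x) + norm (s i (x + h) - s i x)"
          unfolding e using norm_triangle_ineq[of "(f (h + x) - s i (h + x)) - (f x - s i x)" "s i (x + h) - s i x"]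
            norm_triangle_ineq4[of "f (h + x) - s i (h + x)" "f x - s i x"] by linarith
      qed
      also have "\<dots> = (\<integral>\<^sup>+x. norm (f (h + x) - s i (h + x)) \<partial>lborel) + (\<integral>\<^sup>+x. norm (f x - s i x) \<partial>lborel) + L1_modulus (s i) h"
        unfolding L1_modulus_def by (simp add: nn_integral_add)
      also have "(\<integral>\<^sup>+x. norm (f (h + x) - s i (h + x)) \<partial>lborel) = (\<integral>\<^sup>+x. norm (f x - s i x) \<partial>lborel)"
        using nn_integral_lborel_shift[of "\<lambda>x. ennreal (norm (f x - s i x))" h] by simp
      also have "(\<integral>\<^sup>+x. norm (f x - s i x) \<partial>lborel) + (\<integral>\<^sup>+x. norm (f x - s i x) \<partial>lborel) + L1_modulus (s i) h \<le> ennreal (e/3) + ennreal (e/3) + ennreal (e/3)"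
        using i d that by (intro add_mono) (auto simp: less_imp_le)
      also have "\<dots> = ennreal (e/3 + e/3 + e/3)" using \<open>e > 0\<close> by (simp only: ennreal_plus[symmetric])
      finally show ?thesis by simp
    qed
    then show "\<exists>d>0. \<forall>h. norm h < d \<longrightarrow> L1_modulus f h \<le> ennreal e" using d by blast
  qed
qed

lemma C1_grad_uniform:
  fixes \<phi> :: "'a::euclidean_space \<Rightarrow> real"
  assumes C: "C1_grad \<phi> g" and R: "\<forall>x. norm x > R \<longrightarrow> \<phi> x = 0"
  shows "\<And>x. norm x > R \<Longrightarrow> g x = 0"
    and "e > 0 \<Longrightarrow> \<exists>d>0. \<forall>x h. norm h < d \<longrightarrow> \<bar>\<phi> (x + h) - \<phi> x - g x \<bullet> h\<bar> \<le> e * norm h"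
proof -
  have g: "continuous_on UNIV g" and d: "\<And>x. (\<phi> has_derivative (\<lambda>v. g x \<bullet> v)) (at x)"
    using C by (auto simp: C1_grad_def)
  show g0: "g x = 0" if "norm x > R" for x
  proof -
    have o: "open {x. norm x > R}" by (intro open_Collect_less continuous_intros)
    have "((\<lambda>x. 0) has_derivative (\<lambda>v. 0)) (at x)" by simp
    then have "(\<phi> has_derivative (\<lambda>v. 0)) (at x)"
      by (rule has_derivative_transform_within_open[OF _ o]) (use that R in auto)
    then have "(\<lambda>v. g x \<bullet> v) = (\<lambda>v. 0)" using d has_derivative_unique by blast
    then show ?thesis by (metis inner_eq_zero_iff)
  qed
  assume "e > 0"
  show "\<exists>d>0. \<forall>x h. norm h < d \<longrightarrow> \<bar>\<phi> (x + h) - \<phi> x - g x \<bullet> h\<bar> \<le> e * norm h"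
  proof -
    \<comment> \<open>The radius R + 1 leaves room: if two points are closer than 1/2 and one has
      norm at most R, both lie in this ball; if neither has, both gradients vanish.\<close>
    have "uniformly_continuous_on (cball 0 (R + 1)) g"
      by (intro compact_uniformly_continuous continuous_on_subset[OF g]) auto
    then obtain d where d0: "d > 0" "\<And>x y. x \<in> cball 0 (R+1) \<Longrightarrow> y \<in> cball 0 (R+1) \<Longrightarrow> dist y x < d \<Longrightarrow> dist (g y) (g x) < e"
      using \<open>e > 0\<close> unfolding uniformly_continuous_on_def by meson
    have gd: "norm (g y - g x) \<le> e" if "norm (y - x) < min d (1/2)" for x y
    proof (cases "norm x \<le> R \<or> norm y \<le> R")
      case True
      then have "x \<in> cball 0 (R+1)" "y \<in> cball 0 (R+1)"
        using that norm_triangle_ineq2[of y x] norm_triangle_ineq2[of x y] by (auto simp: norm_minus_commute)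
      then show ?thesis using d0(2)[of x y] that by (simp add: dist_norm less_imp_le)
    next
      case False
      then show ?thesis using g0[of x] g0[of y] \<open>e > 0\<close> by simp
    qed
    have "\<bar>\<phi> (x + h) - \<phi> x - g x \<bullet> h\<bar> \<le> e * norm h" if h: "norm h < min d (1/2)" for x h
    proof -
      have "norm (\<phi> (x + h) - \<phi> x - (\<lambda>y v. g y \<bullet> v) x ((x + h) - x)) \<le> norm ((x + h) - x) * e"
      proof (rule differentiable_bound_linearization[where S="ball x (min d (1/2))" and f'="\<lambda>y v. g y \<bullet> v" and ?x0.0=x])
        show "x + t *\<^sub>R (x + h - x) \<in> ball x (min d (1/2))" if "t \<in> {0..1}" for t
        proof -
          have "norm (t *\<^sub>R h) \<le> norm h" using that by (simp add: mult_left_le_one_le)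
          then show ?thesis using h by (simp add: dist_norm)
        qed
        show "(\<phi> has_derivative (\<lambda>v. g y \<bullet> v)) (at y within ball x (min d (1/2)))" for y
          using d has_derivative_at_withinI by blast
        show "onorm ((\<lambda>v. g y \<bullet> v) - (\<lambda>v. g x \<bullet> v)) \<le> e" if "y \<in> ball x (min d (1/2))" for y
        proof (rule onorm_le)
          fix v
          have "norm (((\<lambda>v. g y \<bullet> v) - (\<lambda>v. g x \<bullet> v)) v) = \<bar>(g y - g x) \<bullet> v\<bar>" by (simp add: inner_diff_left)
          also have "\<dots> \<le> norm (g y - g x) * norm v" by (rule Cauchy_Schwarz_ineq2)
          also have "\<dots> \<le> e * norm v" using that gd[of y x] by (intro mult_right_mono) (auto simp: dist_norm norm_minus_commute)
          finally show "norm (((\<lambda>v. g y \<bullet> v) - (\<lambda>v. g x \<bullet> v)) v) \<le> e * norm v" .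
        qed
        show "x \<in> ball x (min d (1/2))" using d0 by simp
      qed
      then show ?thesis by (simp add: mult.commute)
    qed
    then show ?thesis using d0(1) by (intro exI[of _ "min d (1/2)"]) auto
  qed
qed

text \<open>By translation invariance the integral of \<phi>(x + s v) - \<phi>(x) is 0. By
  \<open>C1_grad_uniform\<close> it differs from s times the integral of
  \<open>g x \<bullet> v\<close> by at most s e, with e arbitrary.\<close>

lemma C1_grad_integral_0:
  fixes \<phi> :: "'a::euclidean_space \<Rightarrow> real"
  assumes C: "C1_grad \<phi> g" and R: "\<forall>x. norm x > R \<longrightarrow> \<phi> x = 0"
  shows "integrable lborel \<phi>" "integrable lborel g" "(LINT x|lborel. g x) = 0"
proof -
  have g: "continuous_on UNIV g" using C by (auto simp: C1_grad_def)
  have int: "integrable lborel f" if "continuous_on UNIV f" "\<And>x. norm x > R \<Longrightarrow> f x = 0"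
    for f :: "'a \<Rightarrow> 'b::{banach, second_countable_topology}"
  proof -
    have "integrable lborel (\<lambda>x. indicator (cball 0 R) x *\<^sub>R f x)"
      by (intro borel_integrable_compact continuous_on_subset[OF that(1)]) auto
    also have "(\<lambda>x. indicator (cball 0 R) x *\<^sub>R f x) = f"
      using that(2) by (auto simp: fun_eq_iff indicator_def)
    finally show ?thesis .
  qed
  show i: "integrable lborel \<phi>" "integrable lborel g"
    using int[OF C1_grad_continuous[OF C]] int[OF g] C1_grad_uniform(1)[OF C R] R by auto
  have "\<bar>(LINT x|lborel. g x) \<bullet> v\<bar> \<le> e" if "e > 0" for e v
  proof -
    define m where "m = measure lborel (cball (0::'a) (R + 1))"
    define \<eta> where "\<eta> = e / ((norm v + 1) * (m + 1))"
    have m: "m \<ge> 0" by (simp add: m_def)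
    have \<eta>: "\<eta> > 0" using \<open>e > 0\<close> m by (simp add: \<eta>_def add_nonneg_pos)
    obtain d where d: "d > 0" "\<And>x h. norm h < d \<Longrightarrow> \<bar>\<phi> (x + h) - \<phi> x - g x \<bullet> h\<bar> \<le> \<eta> * norm h"
      using C1_grad_uniform(2)[OF C R \<eta>] by blast
    \<comment> \<open>Two requirements on s v: length below d for the linearization bound, and
      length at most 1 so that the integrand vanishes outside the ball of radius R + 1.\<close>
    define s where "s = min (d/2) 1 / (norm v + 1)"
    have s: "s > 0" using d(1) by (simp add: s_def add_nonneg_pos)
    have sv: "norm (s *\<^sub>R v) < d" "norm (s *\<^sub>R v) \<le> 1"
    proof -
      have "norm (s *\<^sub>R v) = min (d/2) 1 * (norm v / (norm v + 1))" using s d(1) by (simp add: s_def)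
      also have "\<dots> \<le> min (d/2) 1 * 1" using d(1) by (intro mult_left_mono divide_succ_le_1) auto
      finally show "norm (s *\<^sub>R v) < d" "norm (s *\<^sub>R v) \<le> 1" using d(1) by auto
    qed
    let ?D = "\<lambda>x. \<phi> (x + s *\<^sub>R v) - \<phi> x - g x \<bullet> (s *\<^sub>R v)"
    have sh: "integrable lborel (\<lambda>x. \<phi> (x + s *\<^sub>R v))" "(LINT x|lborel. \<phi> (x + s *\<^sub>R v)) = (LINT x|lborel. \<phi> x)"
      using lborel_integral_affine[of 1 \<phi> "s *\<^sub>R v"] i(1) by (auto simp: add.commute)
    have "(LINT x|lborel. ?D x) = - (s * ((LINT x|lborel. g x) \<bullet> v))"
      using i sh by simp
    then have "s * \<bar>(LINT x|lborel. g x) \<bullet> v\<bar> = \<bar>\<integral>x. ?D x \<partial>lborel\<bar>" using s by (simp add: abs_mult)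
    also have "\<dots> \<le> (LINT x|lborel. norm (?D x))" using integral_norm_bound[of lborel ?D] by simp
    also have "\<dots> \<le> (LINT x|lborel. (\<eta> * norm (s *\<^sub>R v)) * indicator (cball (0::'a) (R + 1)) x)"
    proof (rule bochner_mono)
      show "integrable lborel (\<lambda>x. norm (?D x))" using i sh by (intro integrable_norm) auto
      show "integrable lborel (\<lambda>x. (\<eta> * norm (s *\<^sub>R v)) * indicator (cball (0::'a) (R + 1)) x :: real)"
        by (intro integrable_mult_right integrable_real_indicator) (auto simp: emeasure_bounded_finite[OF bounded_cball, unfolded infinity_ennreal_def])
      show "norm (?D x) \<le> (\<eta> * norm (s *\<^sub>R v)) * indicator (cball 0 (R + 1)) x" for x
      proof (cases "norm x \<le> R + 1")
        case True then show ?thesis using d(2)[OF sv(1), of x] by simp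
      next
        case False
        then have "norm (x + s *\<^sub>R v) > R" using sv(2) norm_triangle_ineq4[of "x + s *\<^sub>R v" "s *\<^sub>R v"] by simp
        then show ?thesis using False R C1_grad_uniform(1)[OF C R] by simp
      qed
    qed
    also have "\<dots> = \<eta> * norm (s *\<^sub>R v) * m" by (simp add: m_def)
    also have "\<dots> = s * (e * (norm v / (norm v + 1)) * (m / (m + 1)))" using s by (simp add: \<eta>_def)
    also have "\<dots> \<le> s * (e * 1 * 1)"
      using s m \<open>e > 0\<close> by (intro mult_left_mono mult_mono divide_succ_le_1) auto
    finally show ?thesis using s by simp
  qed
  then have "(LINT x|lborel. g x) \<bullet> v = 0" for v
    by (metis abs_le_zero_iff field_le_epsilon add_0)
  then show "(LINT x|lborel. g x) = 0" by (metis inner_eq_zero_iff)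
qed

lemma C1_grad_mult:
  "C1_grad \<phi> g \<Longrightarrow> C1_grad \<psi> h \<Longrightarrow> C1_grad (\<lambda>x. \<phi> x * \<psi> x) (\<lambda>x. \<phi> x *\<^sub>R h x + \<psi> x *\<^sub>R g x)"
  using C1_grad_continuous[of \<phi> g] C1_grad_continuous[of \<psi> h] unfolding C1_grad_def
  by (auto intro!: continuous_intros derivative_eq_intros simp: inner_add_left algebra_simps)

lemma C1_grad_compose:
  assumes "C1_grad \<phi> g" "\<And>t. (T has_real_derivative T' t) (at t)" "continuous_on UNIV T'"
  shows "C1_grad (\<lambda>x. T (\<phi> x)) (\<lambda>x. T' (\<phi> x) *\<^sub>R g x)"
  unfolding C1_grad_def
proof safe
  fix x
  have "(\<phi> has_derivative (\<lambda>v. g x \<bullet> v)) (at x)" using assms(1) by (auto simp: C1_grad_def)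
  from has_derivative_compose[OF this assms(2)[THEN has_field_derivative_imp_has_derivative]]
  show "((\<lambda>x. T (\<phi> x)) has_derivative (\<lambda>v. (T' (\<phi> x) *\<^sub>R g x) \<bullet> v)) (at x)" by simp
next
  have "continuous_on UNIV g" using assms(1) by (simp add: C1_grad_def)
  moreover have "continuous_on UNIV (\<lambda>x. T' (\<phi> x))"
    by (rule continuous_on_compose2[OF assms(3) C1_grad_continuous[OF assms(1)]]) auto
  ultimately show "continuous_on UNIV (\<lambda>x. T' (\<phi> x) *\<^sub>R g x)" by (intro continuous_intros)
qed

section \<open>Convolution\<close>

definition conv :: "('a::euclidean_space \<Rightarrow> real) \<Rightarrow> ('a \<Rightarrow> 'b::{banach, second_countable_topology}) \<Rightarrow> 'a \<Rightarrow> 'b" where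
  "conv k u x = (LINT y|lborel. k (x - y) *\<^sub>R u y)"

lemma conv_integrable:
  fixes u :: "'a::euclidean_space \<Rightarrow> 'b::{banach, second_countable_topology}"
  assumes [measurable]: "k \<in> borel_measurable borel" and u: "integrable lborel u" and B: "\<And>x. \<bar>k x\<bar> \<le> B"
  shows "integrable lborel (\<lambda>y. k (x - y) *\<^sub>R u y)"
proof (rule bochner_bound[of _ "\<lambda>y. B *\<^sub>R u y"])
  have [measurable]: "u \<in> borel_measurable borel" using u by auto
  show "(\<lambda>y. k (x - y) *\<^sub>R u y) \<in> borel_measurable lborel" by measurable
  have "\<bar>k z\<bar> \<le> \<bar>B\<bar>" for z using B[of z] by linarith
  then show "AE y in lborel. norm (k (x - y) *\<^sub>R u y) \<le> norm (B *\<^sub>R u y)"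
    by (auto intro!: mult_right_mono)
qed (use u in auto)

lemma C1_grad_bounded:
  fixes \<phi> :: "'a::euclidean_space \<Rightarrow> real"
  assumes C: "C1_grad \<phi> g" and R: "\<forall>x. norm x > R \<longrightarrow> \<phi> x = 0"
  shows "\<exists>B. \<forall>x. \<bar>\<phi> x\<bar> \<le> B \<and> norm (g x) \<le> B"
proof -
  have "bounded (\<phi> ` cball 0 R)" "bounded (g ` cball 0 R)"
    using C C1_grad_continuous[OF C]
    by (auto intro!: compact_imp_bounded compact_continuous_image intro: continuous_on_subset simp: C1_grad_def)
  then obtain B1 B2 where B: "\<And>x. x \<in> cball 0 R \<Longrightarrow> norm (\<phi> x) \<le> B1" "\<And>x. x \<in> cball 0 R \<Longrightarrow> norm (g x) \<le> B2"
    unfolding bounded_iff by (metis imageI)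
  have "\<bar>\<phi> x\<bar> \<le> max 0 (max B1 B2) \<and> norm (g x) \<le> max 0 (max B1 B2)" for x
    using B[of x] R C1_grad_uniform(1)[OF C R, of x] by (cases "norm x \<le> R") auto
  then show ?thesis by blast
qed

text \<open>The linearization error of the kernel is uniform in the point by
  \<open>C1_grad_uniform\<close>, so integrating against u only multiplies it by the L1 norm of
  u.\<close>

lemma conv_has_derivative:
  fixes u :: "'a::euclidean_space \<Rightarrow> real"
  assumes C: "C1_grad k g" and R: "\<forall>x. norm x > R \<longrightarrow> k x = 0" and u: "integrable lborel u"
  shows "(conv k u has_derivative (\<lambda>h. conv (\<lambda>x. g x \<bullet> h) u x)) (at x)"
proof -
  obtain B where B: "\<And>x. \<bar>k x\<bar> \<le> B" "\<And>x. norm (g x) \<le> B" using C1_grad_bounded[OF C R] by auto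
  have [measurable]: "k \<in> borel_measurable borel" "g \<in> borel_measurable borel" using C1_grad_borel[OF C] by auto
  have Bh: "\<bar>g x \<bullet> h\<bar> \<le> B * norm h" for x h
    by (rule order_trans[OF Cauchy_Schwarz_ineq2]) (simp add: B mult_right_mono)
  have i: "integrable lborel (\<lambda>y. k (x - y) *\<^sub>R u y)" for x by (rule conv_integrable[OF _ u B(1)]) measurable
  have ih: "integrable lborel (\<lambda>y. (g (x - y) \<bullet> h) *\<^sub>R u y)" for x h
    by (rule conv_integrable[where k="\<lambda>x. g x \<bullet> h", OF _ u Bh]) measurable
  define U where "U = (LINT y|lborel. norm (u y))"
  have U: "U \<ge> 0" by (simp add: U_def)
  show ?thesis
    unfolding has_derivative_at_alt
  proof safe
    show "bounded_linear (\<lambda>h. conv (\<lambda>x. g x \<bullet> h) u x)"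
    proof (rule bounded_linear_intro[where K="B * U"])
      show "conv (\<lambda>x. g x \<bullet> (a + b)) u x = conv (\<lambda>x. g x \<bullet> a) u x + conv (\<lambda>x. g x \<bullet> b) u x" for a b
        unfolding conv_def using ih by (simp add: inner_add_right distrib_right)
      show "conv (\<lambda>x. g x \<bullet> (r *\<^sub>R a)) u x = r *\<^sub>R conv (\<lambda>x. g x \<bullet> a) u x" for a r
        unfolding conv_def by (simp add: mult.assoc)
      show "norm (conv (\<lambda>x. g x \<bullet> a) u x) \<le> norm a * (B * U)" for a
      proof -
        have "norm (conv (\<lambda>x. g x \<bullet> a) u x) \<le> (LINT y|lborel. norm ((g (x - y) \<bullet> a) *\<^sub>R u y))"
          unfolding conv_def by (rule integral_norm_bound)
        also have "\<dots> \<le> (LINT y|lborel. B * norm a * norm (u y))"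
        proof (rule bochner_mono)
          show "integrable lborel (\<lambda>y. norm ((g (x - y) \<bullet> a) *\<^sub>R u y))" by (rule integrable_norm[OF ih])
        qed (use u Bh in \<open>auto simp: abs_mult intro!: mult_right_mono\<close>)
        also have "\<dots> = norm a * (B * U)" by (simp add: U_def)
        finally show ?thesis .
      qed
    qed
  next
    fix e :: real assume "e > 0"
    then have "e / (U + 1) > 0" using U by simp
    then obtain d where d: "d > 0" "\<And>x h. norm h < d \<Longrightarrow> \<bar>k (x + h) - k x - g x \<bullet> h\<bar> \<le> e / (U+1) * norm h"
      using C1_grad_uniform(2)[OF C R] by blast
    have "norm (conv k u y - conv k u x - conv (\<lambda>z. g z \<bullet> (y - x)) u x) \<le> e * norm (y - x)" if "norm (y - x) < d" for y
    proof -
      let ?h = "y - x"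
      have "conv k u y - conv k u x - conv (\<lambda>z. g z \<bullet> (y - x)) u x =
         (LINT z|lborel. (k (y - z) - k (x - z) - g (x - z) \<bullet> ?h) *\<^sub>R u z)"
        unfolding conv_def using i ih by (simp add: left_diff_distrib)
      also have "norm \<dots> \<le> (LINT z|lborel. norm ((k (y - z) - k (x - z) - g (x - z) \<bullet> ?h) *\<^sub>R u z))"
        by (rule integral_norm_bound)
      also have "\<dots> \<le> (LINT z|lborel. e / (U+1) * norm ?h * norm (u z))"
      proof (rule bochner_mono)
        show "integrable lborel (\<lambda>z. norm ((k (y - z) - k (x - z) - g (x - z) \<bullet> ?h) *\<^sub>R u z))"
          using i[of x] i[of y] ih[of x ?h] by (intro integrable_norm) (simp add: left_diff_distrib)
        show "norm ((k (y - z) - k (x - z) - g (x - z) \<bullet> ?h) *\<^sub>R u z) \<le> e / (U+1) * norm ?h * norm (u z)" for z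
          using mult_right_mono[OF d(2)[OF that, of "x - z"], of "norm (u z)"] by (simp add: abs_mult)
      qed (use u in auto)
      also have "\<dots> = e * norm ?h * (U / (U + 1))" by (simp add: U_def)
      also have "\<dots> \<le> e * norm ?h * 1" using U \<open>e > 0\<close> by (intro mult_left_mono) auto
      finally show ?thesis by simp
    qed
    then show "\<exists>d>0. \<forall>y. norm (y - x) < d \<longrightarrow> norm (conv k u y - conv k u x - conv (\<lambda>z. g z \<bullet> (y - x)) u x) \<le> e * norm (y - x)"
      using d(1) by blast
  qed
qed

lemma frechet_derivative_support:
  fixes k :: "'a::euclidean_space \<Rightarrow> real"
  assumes "smooth k" "\<forall>x. norm x > R \<longrightarrow> k x = 0" "norm x > R"
  shows "frechet_derivative k (at x) v = 0"
  using frechet_eq_classical_grad[OF smooth_differentiable[OF assms(1)]] C1_grad_uniform(1)[OF smooth_C1_grad[OF assms(1)] assms(2) assms(3)]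
  by simp

text \<open>Coinduction over the convolutions of u with all smooth kernels supported in one fixed
  ball: differentiation replaces the kernel by its derivative, which has its support in the same
  ball.\<close>

lemma smooth_conv:
  fixes u :: "'a::euclidean_space \<Rightarrow> real"
  assumes "smooth k" "\<forall>x. norm x > R \<longrightarrow> k x = 0" and u: "integrable lborel u"
  shows "smooth (conv k u)"
    and "classical_grad (conv k u) x \<bullet> v = conv (\<lambda>x. classical_grad k x \<bullet> v) u x"
proof -
  have fd: "frechet_derivative (conv k u) (at x) = (\<lambda>v. conv (\<lambda>x. frechet_derivative k (at x) v) u x)"
     "conv k u differentiable (at x)"
    if k: "smooth k" "\<forall>x. norm x > R \<longrightarrow> k x = 0" for k x
  proof -
    note D = conv_has_derivative[OF smooth_C1_grad[OF k(1)] k(2) u, of x]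
    have "(\<lambda>v. conv (\<lambda>x. frechet_derivative k (at x) v) u x) = (\<lambda>v. conv (\<lambda>x. classical_grad k x \<bullet> v) u x)"
      using frechet_eq_classical_grad[OF smooth_differentiable[OF k(1)]] by simp
    then show "frechet_derivative (conv k u) (at x) = (\<lambda>v. conv (\<lambda>x. frechet_derivative k (at x) v) u x)"
      using frechet_derivative_at[OF D] by simp
    show "conv k u differentiable (at x)" using D by (auto simp: differentiable_def)
  qed
  show "smooth (conv k u)"
  proof (rule smooth_coinduct[where F="{conv k u | k. smooth k \<and> (\<forall>x. norm x > R \<longrightarrow> k x = 0)}"])
    fix f :: "'a \<Rightarrow> real" and v assume "f \<in> {conv k u | k. smooth k \<and> (\<forall>x. norm x > R \<longrightarrow> k x = 0)}"
    then obtain k where k: "f = conv k u" "smooth k" "\<forall>x. norm x > R \<longrightarrow> k x = 0" by auto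
    then show "(\<lambda>x. frechet_derivative f (at x) v) \<in> {conv k u | k. smooth k \<and> (\<forall>x. norm x > R \<longrightarrow> k x = 0)}"
      using fd(1)[OF k(2,3)] smooth_frechet_derivative[OF k(2)] frechet_derivative_support[OF k(2,3)]
      unfolding k(1) by (intro CollectI exI[of _ "\<lambda>x. frechet_derivative k (at x) v"]) auto
  qed (use assms fd in auto)
  then show "classical_grad (conv k u) x \<bullet> v = conv (\<lambda>x. classical_grad k x \<bullet> v) u x"
    using fd[OF assms(1,2), of x] frechet_eq_classical_grad[OF smooth_differentiable, of "conv k u" x v]
     frechet_eq_classical_grad[OF smooth_differentiable[OF assms(1)]] by simp
qed

section \<open>The standard mollifier\<close>

definition bump_mass :: "'a::euclidean_space itself \<Rightarrow> real" where
  "bump_mass _ = (LINT x|lborel. bump_fun (x::'a))"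

definition moll :: "real \<Rightarrow> 'a::euclidean_space \<Rightarrow> real" where
  "moll e x = bump_fun (inverse e *\<^sub>R x) / (e ^ DIM('a) * bump_mass TYPE('a))"

lemma bump_fun_integrable: "integrable lborel (bump_fun :: 'a::euclidean_space \<Rightarrow> real)"
  by (rule C1_grad_integral_0(1)[OF smooth_C1_grad[OF smooth_bump_fun], of 1]) (simp add: bump_fun_eq_0)

lemma bump_mass_pos: "bump_mass TYPE('a::euclidean_space) > 0"
proof (rule ccontr)
  assume "\<not> bump_mass TYPE('a) > 0"
  moreover have "bump_mass TYPE('a) \<ge> 0" unfolding bump_mass_def by (simp add: bump_fun_bounds)
  ultimately have "(LINT x|lborel. bump_fun (x::'a)) = 0" by (simp add: bump_mass_def)
  moreover have "(LINT x|lborel. bump_fun (x::'a)) = 0 \<longleftrightarrow> (AE x::'a in lborel. bump_fun x = 0)"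
    by (rule integral_nonneg_eq_0_iff_AE[OF bump_fun_integrable]) (simp add: bump_fun_bounds)
  ultimately have "AE x::'a in lborel. bump_fun x = 0" by simp
  then have "AE x::'a in lborel. x \<notin> ball 0 1"
    by eventually_elim (use bump_fun_pos in force)
  then have "emeasure lborel (ball (0::'a) 1) = 0"
    by (subst (asm) AE_iff_measurable[of "ball 0 1"]) auto
  then show False using content_ball_pos[of 1 "0::'a"] by (simp add: measure_def)
qed

lemma moll_nonneg: "e > 0 \<Longrightarrow> moll e x \<ge> 0"
  using bump_mass_pos[where 'a='a] by (simp add: moll_def bump_fun_bounds)

lemma moll_le: "e > 0 \<Longrightarrow> moll e (x::'a::euclidean_space) \<le> 1 / (e ^ DIM('a) * bump_mass TYPE('a))"
  using bump_mass_pos[where 'a='a] unfolding moll_def by (intro divide_right_mono) (auto simp: bump_fun_bounds)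

lemma moll_eq_0: "e > 0 \<Longrightarrow> norm x \<ge> e \<Longrightarrow> moll e x = 0"
  by (simp add: moll_def bump_fun_eq_0 field_simps)

lemma smooth_moll: "smooth (moll e)"
proof -
  have "smooth (\<lambda>x::'a. (1 / (e ^ DIM('a) * bump_mass TYPE('a))) * bump_fun (0 + inverse e *\<^sub>R x))"
    by (intro smooth_mult smooth_const smooth_affine_comp smooth_bump_fun)
  then show ?thesis by (simp add: moll_def[abs_def])
qed

lemma moll_minus: "moll e (- x) = moll e x"
  by (simp add: moll_def bump_fun_def)

lemma moll_borel[measurable]: "moll e \<in> borel_measurable borel"
  by (intro borel_measurable_continuous_onI smooth_continuous smooth_moll)

lemma moll_integral:
  assumes "e > 0" shows "integrable lborel (moll e :: 'a::euclidean_space \<Rightarrow> real)" "(LINT x|lborel. moll e (x::'a)) = 1"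
   "(\<integral>\<^sup>+x. ennreal (moll e (x::'a)) \<partial>lborel) = 1"
proof -
  note * = lborel_integral_affine[of "inverse e" "bump_fun :: 'a \<Rightarrow> real" 0, OF _ bump_fun_integrable]
  show i: "integrable lborel (moll e :: 'a \<Rightarrow> real)"
    using *(1) assms unfolding moll_def[abs_def] by simp
  show I: "(LINT x|lborel. moll e (x::'a)) = 1"
  proof -
    have "bump_mass TYPE('a) = inverse e ^ DIM('a) * (LINT x|lborel. bump_fun (inverse e *\<^sub>R (x::'a)))"
      using *(2) assms by (simp add: bump_mass_def)
    then have "(LINT x|lborel. bump_fun (inverse e *\<^sub>R (x::'a))) = e ^ DIM('a) * bump_mass TYPE('a)"
      using assms by (simp add: power_inverse)
    then show ?thesis using assms bump_mass_pos[where 'a='a] unfolding moll_def[abs_def] by simp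
  qed
  show "(\<integral>\<^sup>+x. ennreal (moll e (x::'a)) \<partial>lborel) = 1"
    by (subst nn_integral_eq_integral[OF i]) (auto simp: moll_nonneg[OF assms] I)
qed

lemma conv_moll_integrable:
  fixes u :: "'a::euclidean_space \<Rightarrow> 'b::{banach, second_countable_topology}"
  assumes "e > 0" "integrable lborel u"
  shows "integrable lborel (\<lambda>y. moll e (x - y) *\<^sub>R u y)"
  by (rule conv_integrable[OF _ assms(2), where B="1 / (e ^ DIM('a) * bump_mass TYPE('a))"])
    (auto simp: moll_nonneg[OF assms(1)] moll_le[OF assms(1)])

lemma conv_moll_reflect:
  fixes f :: "'a::euclidean_space \<Rightarrow> ennreal"
  assumes [measurable]: "f \<in> borel_measurable borel"
  shows "(\<integral>\<^sup>+y. ennreal (moll e (x - y)) * f y \<partial>lborel) = (\<integral>\<^sup>+h. ennreal (moll e h) * f (x + h) \<partial>lborel)"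
  by (subst nn_integral_lborel_shift[of _ x, symmetric]) (auto simp: moll_minus)

text \<open>As the kernel has mass 1, the error at x is an average of u (x + h) - u x over |h| < e;
  integrating in x first bounds it by the worst translation.\<close>

lemma conv_moll_L1:
  fixes u :: "'a::euclidean_space \<Rightarrow> 'b::{banach, second_countable_topology}"
  assumes e: "e > 0" and u: "integrable lborel u" and D: "\<And>h. norm h < e \<Longrightarrow> L1_modulus u h \<le> D"
  shows "(\<integral>\<^sup>+x. ennreal (norm (conv (moll e) u x - u x)) \<partial>lborel) \<le> D"
proof -
  have [measurable]: "u \<in> borel_measurable borel" using u by auto
  have pt: "ennreal (norm (conv (moll e) u x - u x)) \<le> (\<integral>\<^sup>+h. ennreal (moll e h) * ennreal (norm (u (x + h) - u x)) \<partial>lborel)" for x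
  proof -
    have i1: "integrable lborel (\<lambda>y. moll e (x - y) *\<^sub>R u y)" by (rule conv_moll_integrable[OF e u])
    have i0: "integrable lborel (\<lambda>y. moll e (x - y))" "(LINT y|lborel. moll e (x - y)) = 1"
      using lborel_integral_affine[of "-1" "moll e" x] moll_integral[OF e, where 'a='a] by auto
    have "conv (moll e) u x - u x = (LINT y|lborel. moll e (x - y) *\<^sub>R u y - moll e (x - y) *\<^sub>R u x)"
      unfolding conv_def using i0 i1 by simp
    also have "ennreal (norm \<dots>) \<le> (\<integral>\<^sup>+y. norm (moll e (x - y) *\<^sub>R u y - moll e (x - y) *\<^sub>R u x) \<partial>lborel)"
      by (rule integral_norm_bound_ennreal) (use i0 i1 in auto)
    also have "\<dots> = (\<integral>\<^sup>+y. ennreal (moll e (x - y)) * ennreal (norm (u y - u x)) \<partial>lborel)"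
      by (intro nn_integral_cong) (simp add: moll_nonneg[OF e] ennreal_mult[symmetric] flip: scaleR_diff_right)
    also have "\<dots> = (\<integral>\<^sup>+h. ennreal (moll e h) * ennreal (norm (u (x + h) - u x)) \<partial>lborel)"
      by (rule conv_moll_reflect) measurable
    finally show ?thesis .
  qed
  have "(\<integral>\<^sup>+x. ennreal (norm (conv (moll e) u x - u x)) \<partial>lborel) \<le> (\<integral>\<^sup>+x. (\<integral>\<^sup>+h. ennreal (moll e h) * ennreal (norm (u (x + h) - u x)) \<partial>lborel) \<partial>lborel)"
    by (intro nn_integral_mono pt)
  also have "\<dots> = (\<integral>\<^sup>+h. (\<integral>\<^sup>+x. ennreal (moll e h) * ennreal (norm (u (x + h) - u x)) \<partial>lborel) \<partial>lborel)"
    by (rule lborel_pair.Fubini'[symmetric]) measurable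
  also have "\<dots> = (\<integral>\<^sup>+h. ennreal (moll e h) * L1_modulus u h \<partial>lborel)"
    unfolding L1_modulus_def by (intro nn_integral_cong nn_integral_cmult) measurable
  also have "\<dots> \<le> (\<integral>\<^sup>+h. ennreal (moll e (h::'a)) * D \<partial>lborel)"
  proof (intro nn_integral_mono)
    fix h :: 'a
    show "ennreal (moll e h) * L1_modulus u h \<le> ennreal (moll e h) * D"
      using D[of h] moll_eq_0[OF e, of h] by (cases "norm h < e") (auto intro: mult_left_mono)
  qed
  also have "\<dots> = D" using moll_integral(3)[OF e, where 'a='a] by (subst nn_integral_multc) auto
  finally show ?thesis .
qed

lemma ennreal_pos_real_below:
  assumes "0 < (a::ennreal)" shows "\<exists>r>0. ennreal r < a"
proof -
  obtain b where b: "0 < b" "b < a" using assms dense by blast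
  then have "b \<noteq> top" by auto
  then show ?thesis using b by (intro exI[of _ "enn2real b"]) (auto simp: enn2real_positive_iff less_top)
qed

lemma conv_moll_tendsto:
  fixes u :: "'a::euclidean_space \<Rightarrow> 'b::{banach, second_countable_topology}"
  assumes u: "integrable lborel u" and e: "\<And>n. e n > 0" "e \<longlonglongrightarrow> 0"
  shows "(\<lambda>n. \<integral>\<^sup>+x. ennreal (norm (conv (moll (e n)) u x - u x)) \<partial>lborel) \<longlonglongrightarrow> 0"
proof (rule order_tendstoI)
  fix a :: ennreal assume "0 < a"
  then obtain r where r: "r > 0" "ennreal r < a"
    by (meson ennreal_pos_real_below)
  obtain d where d: "d > 0" "\<And>h. norm h < d \<Longrightarrow> L1_modulus u h \<le> ennreal r"
    using L1_modulus_tendsto[OF u] r(1) by blast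
  have "\<forall>\<^sub>F n in sequentially. e n < d" using e(2) d(1) by (rule order_tendstoD)
  then show "\<forall>\<^sub>F n in sequentially. (\<integral>\<^sup>+x. ennreal (norm (conv (moll (e n)) u x - u x)) \<partial>lborel) < a"
  proof eventually_elim
    case (elim n)
    have "(\<integral>\<^sup>+x. ennreal (norm (conv (moll (e n)) u x - u x)) \<partial>lborel) \<le> ennreal r"
      by (rule conv_moll_L1[OF e(1) u]) (use elim d(2) in auto)
    then show ?case using r(2) by simp
  qed
qed simp

section \<open>Weak gradients\<close>

text \<open>Translations and Fubini are used over \<open>lborel\<close>, weak gradients are
  integrated over \<open>lebesgue_on\<close>. Borel functions vanishing off S pass between the
  two.\<close>

lemma lebesgue_on_lborel:
  fixes f :: "'a::euclidean_space \<Rightarrow> 'b::{banach, second_countable_topology}"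
  assumes S: "S \<in> sets borel" and f: "f \<in> borel_measurable borel" "\<And>x. x \<notin> S \<Longrightarrow> f x = 0"
  shows "integrable (lebesgue_on S) f \<longleftrightarrow> integrable lborel f"
    and "(LINT x|lebesgue_on S. f x) = (LINT x|lborel. f x)"
proof -
  have *: "(\<lambda>x. indicator S x *\<^sub>R f x) = f" using f(2) by (auto simp: indicator_def)
  show "integrable (lebesgue_on S) f \<longleftrightarrow> integrable lborel f"
    using S f by (simp add: integrable_restrict_space * integrable_completion)
  show "(LINT x|lebesgue_on S. f x) = (LINT x|lborel. f x)"
    using S f by (simp add: integral_restrict_space * integral_completion)
qed

lemma nn_integral_lebesgue_on_lborel:
  assumes "S \<in> sets borel" "\<And>x. x \<notin> S \<Longrightarrow> f x = 0"
  shows "(\<integral>\<^sup>+x. f x \<partial>lebesgue_on S) = (\<integral>\<^sup>+x. f x \<partial>lborel)"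
proof -
  have *: "(\<lambda>x. f x * indicator S x) = f" using assms(2) by (auto simp: indicator_def)
  show ?thesis using assms(1) by (simp add: nn_integral_restrict_space * nn_integral_completion)
qed

lemma borel_measurable_lebesgue_on:
  "f \<in> borel_measurable borel \<Longrightarrow> f \<in> borel_measurable (lebesgue_on S)"
  by (simp add: measurable_completion measurable_restrict_space1)

lemma AE_lebesgue_on_iff:
  "S \<in> sets borel \<Longrightarrow> (AE x in lebesgue_on S. P x) \<longleftrightarrow> (AE x in lborel. x \<in> S \<longrightarrow> P x)"
  by (simp add: AE_restrict_space_iff AE_completion_iff)

text \<open>Convolutions need Borel functions on the whole space, while a function in the Sobolev
  space is only Lebesgue measurable on S. The representative is put together coordinate by
  coordinate.\<close>

lemma lebesgue_on_borel_rep: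
  fixes u :: "'a::euclidean_space \<Rightarrow> 'b::euclidean_space"
  assumes S: "S \<in> sets borel" and u: "u \<in> borel_measurable (lebesgue_on S)"
  obtains v where "v \<in> borel_measurable borel" "\<And>x. x \<notin> S \<Longrightarrow> v x = 0" "AE x in lebesgue_on S. u x = v x"
proof -
  have "(\<lambda>x. indicator S x *\<^sub>R u x) \<in> borel_measurable lebesgue"
    using u S by (subst (asm) borel_measurable_restrict_space_iff) auto
  then have m: "(\<lambda>x. (indicator S x *\<^sub>R u x) \<bullet> b) \<in> borel_measurable lebesgue" for b
    by measurable
  have "\<exists>g\<in>borel_measurable lborel. AE x in lborel. (indicator S x *\<^sub>R u x) \<bullet> b = g x" for b
    by (rule completion_ex_borel_measurable_real[OF m])
  then obtain g where g: "\<And>b. g b \<in> borel_measurable lborel" "\<And>b. AE x in lborel. (indicator S x *\<^sub>R u x) \<bullet> b = g b x"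
    by metis
  define v where "v x = indicator S x *\<^sub>R (\<Sum>b\<in>Basis. g b x *\<^sub>R b)" for x
  have [measurable]: "g b \<in> borel_measurable borel" for b using g(1)[of b] by simp
  have "AE x in lborel. \<forall>b\<in>Basis. (indicator S x *\<^sub>R u x) \<bullet> b = g b x"
    using g(2) by (simp add: AE_finite_all)
  then have "AE x in lborel. x \<in> S \<longrightarrow> u x = v x"
  proof eventually_elim
    case (elim x)
    have "u x = v x" if "x \<in> S"
    proof -
      have "(\<Sum>b\<in>Basis. g b x *\<^sub>R b) = (\<Sum>b\<in>Basis. (u x \<bullet> b) *\<^sub>R b)"
        by (rule sum.cong) (use elim that in auto)
      then show ?thesis using that by (simp add: v_def euclidean_representation)
    qed
    then show ?case by blast
  qed
  then have "AE x in lebesgue_on S. u x = v x" using S by (simp add: AE_lebesgue_on_iff)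
  moreover have "v \<in> borel_measurable borel" unfolding v_def using S by measurable
  moreover have "\<And>x. x \<notin> S \<Longrightarrow> v x = 0" by (simp add: v_def)
  ultimately show ?thesis using that by blast
qed

lemma lebesgue_on_integrable_rep:
  fixes u :: "'a::euclidean_space \<Rightarrow> 'b::euclidean_space"
  assumes S: "S \<in> sets borel" and u: "integrable (lebesgue_on S) u"
  obtains v where "v \<in> borel_measurable borel" "\<And>x. x \<notin> S \<Longrightarrow> v x = 0" "AE x in lebesgue_on S. u x = v x"
    "integrable lborel v"
proof -
  obtain v where v: "v \<in> borel_measurable borel" "\<And>x. x \<notin> S \<Longrightarrow> v x = 0" "AE x in lebesgue_on S. u x = v x"
    by (rule lebesgue_on_borel_rep[OF S borel_measurable_integrable[OF u]]) blast
  have "integrable (lebesgue_on S) v"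
    by (rule integrable_cong_AE_imp[OF u borel_measurable_lebesgue_on[OF v(1)] v(3)])
  then have "integrable lborel v" using lebesgue_on_lborel(1)[OF S v(1,2)] by simp
  with v show ?thesis by (rule that)
qed

lemma test_functionsD:
  fixes \<phi> :: "'a::euclidean_space \<Rightarrow> real"
  assumes "\<phi> \<in> test_functions \<Omega>"
  shows "smooth \<phi>" "C1_grad \<phi> (classical_grad \<phi>)" "\<phi> \<in> borel_measurable borel" "classical_grad \<phi> \<in> borel_measurable borel"
    "\<exists>K R B. compact K \<and> K \<subseteq> \<Omega> \<and> (\<forall>x. x \<notin> K \<longrightarrow> \<phi> x = 0 \<and> classical_grad \<phi> x = 0) \<and> K \<subseteq> cball 0 R
       \<and> (\<forall>x. \<bar>\<phi> x\<bar> \<le> B \<and> norm (classical_grad \<phi> x) \<le> B)"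
proof -
  show s: "smooth \<phi>" using assms by (simp add: test_functions_iff)
  show C: "C1_grad \<phi> (classical_grad \<phi>)" using smooth_C1_grad[OF s] .
  show "\<phi> \<in> borel_measurable borel" "classical_grad \<phi> \<in> borel_measurable borel" using C1_grad_borel[OF C] by auto
  obtain K where K: "compact K" "K \<subseteq> \<Omega>" "\<And>x. x \<notin> K \<Longrightarrow> \<phi> x = 0" using assms by (auto simp: test_functions_iff)
  obtain R where R: "K \<subseteq> cball 0 R" using compact_imp_bounded[OF K(1)] by (auto simp: bounded_iff subset_iff)
  have 0: "classical_grad \<phi> x = 0" if "x \<notin> K" for x
  proof -
    have "((\<lambda>x. 0) has_derivative (\<lambda>v. 0)) (at x)" by simp
    then have "(\<phi> has_derivative (\<lambda>v. 0)) (at x)"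
      by (rule has_derivative_transform_within_open[of _ _ _ _ "- K"]) (use that K in \<open>auto simp: compact_imp_closed\<close>)
    then have "frechet_derivative \<phi> (at x) = (\<lambda>v. 0)" using frechet_derivative_at by metis
    then show ?thesis by (simp add: classical_grad_def)
  qed
  have "\<forall>x. norm x > R \<longrightarrow> \<phi> x = 0"
  proof safe
    fix x :: 'a assume "norm x > R"
    then have "x \<notin> K" using R by auto
    then show "\<phi> x = 0" by (rule K(3))
  qed
  then obtain B where B: "\<forall>x. \<bar>\<phi> x\<bar> \<le> B \<and> norm (classical_grad \<phi> x) \<le> B" using C1_grad_bounded[OF C] by blast
  then show "\<exists>K R B. compact K \<and> K \<subseteq> \<Omega> \<and> (\<forall>x. x \<notin> K \<longrightarrow> \<phi> x = 0 \<and> classical_grad \<phi> x = 0) \<and> K \<subseteq> cball 0 R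
       \<and> (\<forall>x. \<bar>\<phi> x\<bar> \<le> B \<and> norm (classical_grad \<phi> x) \<le> B)"
    by (intro exI[of _ K] exI[of _ R] exI[of _ B] conjI) (use K R 0 B in simp_all)
qed

lemma moll_test:
  assumes "e > 0" "cball x e \<subseteq> \<Omega>"
  shows "(\<lambda>y. moll e (x - y)) \<in> test_functions \<Omega>"
    and "classical_grad (\<lambda>y. moll e (x - y)) y = - classical_grad (moll e) (x - y)"
proof -
  have "smooth (\<lambda>y. moll e (x + (-1) *\<^sub>R y))" by (intro smooth_affine_comp smooth_moll)
  then have s: "smooth (\<lambda>y. moll e (x - y))" by simp
  moreover have "moll e (x - y) = 0" if "y \<notin> cball x e" for y
    by (rule moll_eq_0[OF assms(1)]) (use that in \<open>auto simp: dist_norm\<close>)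
  ultimately show "(\<lambda>y. moll e (x - y)) \<in> test_functions \<Omega>"
    unfolding test_functions_iff using assms(2) by (intro conjI exI[of _ "cball x e"]) auto
  have D: "(moll e has_derivative (\<lambda>v. classical_grad (moll e) (x - y) \<bullet> v)) (at (x - y))"
    by (rule smooth_C1_grad[OF smooth_moll, unfolded C1_grad_def, THEN conjunct1, rule_format])
  have "((\<lambda>y. x - y) has_derivative (\<lambda>v. - v)) (at y)" by (auto intro!: derivative_eq_intros)
  from has_derivative_compose[OF this D]
  have "frechet_derivative (\<lambda>y. moll e (x - y)) (at y) = (\<lambda>v. classical_grad (moll e) (x - y) \<bullet> (- v))"
    using frechet_derivative_at by metis
  then show "classical_grad (\<lambda>y. moll e (x - y)) y = - classical_grad (moll e) (x - y)"
    by (simp add: classical_grad_def[of "(\<lambda>y. moll e (x - y))"] euclidean_representation sum_negf)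
qed

lemma conv_borel[measurable]:
  fixes u :: "'a::euclidean_space \<Rightarrow> 'b::{banach, second_countable_topology}"
  assumes [measurable]: "k \<in> borel_measurable borel" "u \<in> borel_measurable borel"
  shows "conv k u \<in> borel_measurable borel"
proof -
  have "(\<lambda>x. LINT y|lborel. k (x - y) *\<^sub>R u y) \<in> borel_measurable lborel"
    by (rule lborel.borel_measurable_lebesgue_integral) measurable
  then show ?thesis by (simp add: conv_def[abs_def])
qed

text \<open>Lindelof: countably many of the balls already cover \<Omega>, and countably many null
  sets have a null union.\<close>

lemma AE_lebesgue_locally:
  fixes \<Omega> :: "'a::euclidean_space set"
  assumes \<Omega>: "open \<Omega>" and loc: "\<And>x0. x0 \<in> \<Omega> \<Longrightarrow> \<exists>r>0. AE x in lebesgue. x \<in> ball x0 r \<longrightarrow> P x"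
  shows "AE x in lebesgue_on \<Omega>. P x"
proof -
  obtain r where r: "\<And>x0. x0 \<in> \<Omega> \<Longrightarrow> r x0 > 0" "\<And>x0. x0 \<in> \<Omega> \<Longrightarrow> AE x in lebesgue. x \<in> ball x0 (r x0) \<longrightarrow> P x"
    using loc by metis
  obtain F' where F': "F' \<subseteq> (\<lambda>x0. ball x0 (r x0)) ` \<Omega>" "countable F'" "\<Union>F' = (\<Union>x0\<in>\<Omega>. ball x0 (r x0))"
    using Lindelof[of "(\<lambda>x0. ball x0 (r x0)) ` \<Omega>"] by (metis imageE open_ball)
  have "AE x in lebesgue. \<forall>U\<in>F'. x \<in> U \<longrightarrow> P x"
    using F' r(2) by (subst AE_ball_countable) auto
  then have "AE x in lebesgue. x \<in> \<Omega> \<longrightarrow> P x"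
  proof eventually_elim
    case (elim x)
    then show ?case using F'(3) r(1) by (metis UN_I UnionE centre_in_ball)
  qed
  then show ?thesis using \<Omega> by (simp add: AE_restrict_space_iff)
qed

text \<open>Fundamental lemma of the calculus of variations. Near x0 a mollification of H is an
  integral of H against a test function, hence 0, and mollifications converge to H in L1.\<close>

lemma weak_zero_AE:
  fixes \<Omega> :: "'a::euclidean_space set" and H :: "'a \<Rightarrow> 'b::euclidean_space"
  assumes \<Omega>: "open \<Omega>" and H: "locally_integrable_on H \<Omega>"
    and 0: "\<And>\<phi>. \<phi> \<in> test_functions \<Omega> \<Longrightarrow> (LINT x|lebesgue_on \<Omega>. \<phi> x *\<^sub>R H x) = 0"
  shows "AE x in lebesgue_on \<Omega>. H x = 0"
proof (rule AE_lebesgue_locally[OF \<Omega>])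
  fix x0 assume "x0 \<in> \<Omega>"
  then obtain s where s: "s > 0" "cball x0 s \<subseteq> \<Omega>" using \<Omega> open_contains_cball by blast
  \<comment> \<open>Centres in the ball of radius r and kernels of radius below r keep all supports
    in the compact ball of radius 2 r, on which H is integrable.\<close>
  define r where "r = s / 2"
  have r: "r > 0" "cball x0 (2 * r) \<subseteq> \<Omega>" using s by (auto simp: r_def)
  define K where "K = cball x0 (2 * r)"
  have K: "compact K" "K \<subseteq> \<Omega>" "K \<in> sets borel" using r by (auto simp: K_def)
  have "integrable (lebesgue_on K) H" using H K by (simp add: locally_integrable_on_def)
  then obtain v where v: "v \<in> borel_measurable borel" "\<And>x. x \<notin> K \<Longrightarrow> v x = 0" "AE x in lebesgue_on K. H x = v x" "integrable lborel v"
    using lebesgue_on_integrable_rep[OF K(3)] by metis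
  note [measurable] = v(1)
  have [measurable]: "H \<in> borel_measurable (lebesgue_on K)" using \<open>integrable (lebesgue_on K) H\<close> by auto
  have [measurable]: "v \<in> borel_measurable (lebesgue_on K)" "(\<lambda>y. moll e (x - y)) \<in> borel_measurable (lebesgue_on K)" for e x
    by (intro borel_measurable_lebesgue_on; measurable)+
  have z: "conv (moll e) v x = 0" if e: "0 < e" "e < r" and x: "x \<in> ball x0 r" for e x
  proof -
    have sub: "cball x e \<subseteq> K"
    proof
      fix y assume "y \<in> cball x e"
      then have "dist x0 y \<le> dist x0 x + dist x y" "dist x y \<le> e" by (auto intro: dist_triangle)
      then show "y \<in> K" using e x by (auto simp: K_def)
    qed
    let ?\<phi> = "\<lambda>y. moll e (x - y)"
    have out: "?\<phi> y = 0" if "y \<notin> K" for y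
    proof -
      have "\<not> norm (x - y) \<le> e" using that sub by (auto simp: dist_norm)
      then show ?thesis by (intro moll_eq_0[OF e(1)]) simp
    qed
    have "conv (moll e) v x = (LINT y|lebesgue_on K. ?\<phi> y *\<^sub>R v y)"
      unfolding conv_def by (rule lebesgue_on_lborel(2)[symmetric, OF K(3)]) (use v(2) in auto)
    also have "\<dots> = (LINT y|lebesgue_on K. ?\<phi> y *\<^sub>R H y)"
      by (rule integral_cong_AE) (use v(3) in auto)
    also have "\<dots> = (LINT y|lebesgue_on \<Omega>. ?\<phi> y *\<^sub>R H y)"
    proof -
      have "(\<lambda>y. indicator K y *\<^sub>R (?\<phi> y *\<^sub>R H y)) = (\<lambda>y. ?\<phi> y *\<^sub>R H y)"
        using out by (auto simp: fun_eq_iff indicator_def)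
      moreover have "(\<lambda>y. indicator \<Omega> y *\<^sub>R (?\<phi> y *\<^sub>R H y)) = (\<lambda>y. ?\<phi> y *\<^sub>R H y)"
        using out K(2) by (auto simp: fun_eq_iff indicator_def)
      ultimately show ?thesis using K(3) \<Omega> by (simp add: integral_restrict_space)
    qed
    also have "\<dots> = 0" using moll_test(1)[OF e(1), of x \<Omega>] sub K(2) by (intro 0) auto
    finally show ?thesis .
  qed
  define e where "e n = r / real (n + 2)" for n
  have e: "e n > 0" "e n < r" for n using r(1) by (auto simp: e_def field_simps add_pos_nonneg)
  have "e \<longlonglongrightarrow> 0" unfolding e_def by (rule LIMSEQ_ignore_initial_segment[of "\<lambda>n. r / real n" 0 2]) (rule lim_const_over_n)
  from conv_moll_tendsto[OF v(4) e(1) this]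
  have t: "(\<lambda>n. \<integral>\<^sup>+x. ennreal (norm (conv (moll (e n)) v x - v x)) \<partial>lborel) \<longlonglongrightarrow> 0" .
  have "(\<integral>\<^sup>+x. indicator (ball x0 r) x * ennreal (norm (v x)) \<partial>lborel) \<le> (\<integral>\<^sup>+x. ennreal (norm (conv (moll (e n)) v x - v x)) \<partial>lborel)" for n
    using z[OF e] by (intro nn_integral_mono) (auto simp: indicator_def)
  then have "(\<integral>\<^sup>+x. indicator (ball x0 r) x * ennreal (norm (v x)) \<partial>lborel) = 0"
    using LIMSEQ_le_const[OF t] by (metis le_zero_eq)
  then have "AE x in lborel. x \<in> ball x0 r \<longrightarrow> v x = 0"
    by (subst (asm) nn_integral_0_iff_AE) (auto elim!: AE_mp simp: indicator_def)
  moreover have "AE x in lborel. x \<in> K \<longrightarrow> H x = v x" using v(3) K(3) by (simp add: AE_lebesgue_on_iff)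
  ultimately have "AE x in lborel. x \<in> ball x0 r \<longrightarrow> H x = 0"
  proof eventually_elim
    case (elim x)
    then show ?case using r by (auto simp: K_def)
  qed
  then show "\<exists>r>0. AE x in lebesgue. x \<in> ball x0 r \<longrightarrow> H x = 0"
    using r(1) by (auto simp: AE_completion_iff)
qed

lemma locally_integrable_test:
  fixes H :: "'a::euclidean_space \<Rightarrow> 'b::euclidean_space"
  assumes \<Omega>: "open \<Omega>" and H: "locally_integrable_on H \<Omega>"
    and k: "k \<in> borel_measurable borel" "compact K" "K \<subseteq> \<Omega>" "\<And>x. x \<notin> K \<Longrightarrow> k x = 0" "\<And>x. \<bar>k x\<bar> \<le> B"
  shows "integrable (lebesgue_on \<Omega>) (\<lambda>x. k x *\<^sub>R H x)"
proof -
  have i: "integrable (lebesgue_on K) H" using H k by (simp add: locally_integrable_on_def)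
  have [measurable]: "H \<in> borel_measurable (lebesgue_on K)" using i by auto
  have [measurable]: "k \<in> borel_measurable (lebesgue_on K)" using k(1) by (rule borel_measurable_lebesgue_on)
  have "integrable (lebesgue_on K) (\<lambda>x. k x *\<^sub>R H x)"
  proof (rule bochner_bound[of _ "\<lambda>x. B *\<^sub>R H x"])
    have "\<bar>k z\<bar> \<le> \<bar>B\<bar>" for z using k(5)[of z] by linarith
    then show "AE x in lebesgue_on K. norm (k x *\<^sub>R H x) \<le> norm (B *\<^sub>R H x)" by (auto intro!: mult_right_mono)
  qed (use i in auto)
  moreover have "(\<lambda>y. indicator K y *\<^sub>R (k y *\<^sub>R H y)) = (\<lambda>y. k y *\<^sub>R H y)" "(\<lambda>y. indicator \<Omega> y *\<^sub>R (k y *\<^sub>R H y)) = (\<lambda>y. k y *\<^sub>R H y)"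
    using k(3,4) by (auto simp: fun_eq_iff indicator_def)
  moreover have "K \<in> sets borel" using k(2) by (simp add: borel_compact)
  ultimately show ?thesis using \<Omega> by (simp add: integrable_restrict_space)
qed

lemma locally_integrable_test_vec:
  fixes H :: "'a::euclidean_space \<Rightarrow> real" and k :: "'a \<Rightarrow> 'a"
  assumes \<Omega>: "open \<Omega>" and H: "locally_integrable_on H \<Omega>"
    and k: "k \<in> borel_measurable borel" "compact K" "K \<subseteq> \<Omega>" "\<And>x. x \<notin> K \<Longrightarrow> k x = 0" "\<And>x. norm (k x) \<le> B"
  shows "integrable (lebesgue_on \<Omega>) (\<lambda>x. H x *\<^sub>R k x)"
proof -
  have "integrable (lebesgue_on \<Omega>) (\<lambda>x. (k x \<bullet> b) *\<^sub>R H x)" if "b \<in> Basis" for b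
    by (rule locally_integrable_test[OF \<Omega> H _ k(2,3), where B=B])
      (use k that in \<open>auto intro: order_trans[OF Basis_le_norm]\<close>)
  then have "integrable (lebesgue_on \<Omega>) (\<lambda>x. \<Sum>b\<in>Basis. ((k x \<bullet> b) *\<^sub>R H x) *\<^sub>R b)"
    by (intro Bochner_Integration.integrable_sum integrable_scaleR_left) auto
  moreover have "(\<Sum>b\<in>Basis. ((k x \<bullet> b) *\<^sub>R H x) *\<^sub>R b) = H x *\<^sub>R k x" for x
  proof -
    have "(\<Sum>b\<in>Basis. ((k x \<bullet> b) *\<^sub>R H x) *\<^sub>R b) = H x *\<^sub>R (\<Sum>b\<in>Basis. (k x \<bullet> b) *\<^sub>R b)"
      by (simp add: scaleR_sum_right mult.commute)
    then show ?thesis by (simp add: euclidean_representation)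
  qed
  ultimately show ?thesis by simp
qed

lemma weak_grad_test_integrable:
  assumes "open \<Omega>" "has_weak_grad \<Omega> u G" "\<phi> \<in> test_functions \<Omega>"
  shows "integrable (lebesgue_on \<Omega>) (\<lambda>x. u x *\<^sub>R classical_grad \<phi> x)" "integrable (lebesgue_on \<Omega>) (\<lambda>x. \<phi> x *\<^sub>R G x)"
proof -
  obtain K R B where K: "compact K" "K \<subseteq> \<Omega>" "\<forall>x. x \<notin> K \<longrightarrow> \<phi> x = 0 \<and> classical_grad \<phi> x = 0" "K \<subseteq> cball 0 R"
    "\<forall>x. \<bar>\<phi> x\<bar> \<le> B \<and> norm (classical_grad \<phi> x) \<le> B" using test_functionsD(5)[OF assms(3)] by blast
  show "integrable (lebesgue_on \<Omega>) (\<lambda>x. u x *\<^sub>R classical_grad \<phi> x)" "integrable (lebesgue_on \<Omega>) (\<lambda>x. \<phi> x *\<^sub>R G x)"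
    using assms(2) K test_functionsD(3,4)[OF assms(3)] unfolding has_weak_grad_def
    by (intro locally_integrable_test[OF assms(1), where K=K and B=B] locally_integrable_test_vec[OF assms(1), where K=K and B=B]; auto)+
qed

lemma has_weak_grad_unique:
  assumes \<Omega>: "open \<Omega>" and 1: "has_weak_grad \<Omega> u G" and 2: "has_weak_grad \<Omega> u G'"
  shows "AE x in lebesgue_on \<Omega>. G x = G' x"
proof -
  have "AE x in lebesgue_on \<Omega>. G x - G' x = 0"
  proof (rule weak_zero_AE[OF \<Omega>])
    show "locally_integrable_on (\<lambda>x. G x - G' x) \<Omega>"
      using 1 2 by (auto simp: has_weak_grad_def locally_integrable_on_def)
    fix \<phi> assume \<phi>: "\<phi> \<in> test_functions \<Omega>"
    then show "(LINT x|lebesgue_on \<Omega>. \<phi> x *\<^sub>R (G x - G' x)) = 0"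
      using 1 2 weak_grad_test_integrable(2)[OF \<Omega> 1 \<phi>] weak_grad_test_integrable(2)[OF \<Omega> 2 \<phi>]
      by (simp add: has_weak_grad_def scaleR_diff_right)
  qed
  then show ?thesis by simp
qed

lemma has_weak_grad_add:
  assumes \<Omega>: "open \<Omega>" and 1: "has_weak_grad \<Omega> u G" and 2: "has_weak_grad \<Omega> v H"
  shows "has_weak_grad \<Omega> (\<lambda>x. u x + v x) (\<lambda>x. G x + H x)"
  using 1 2 weak_grad_test_integrable[OF \<Omega> 1] weak_grad_test_integrable[OF \<Omega> 2]
  unfolding has_weak_grad_def locally_integrable_on_def
  by (auto simp: scaleR_add_right scaleR_add_left)

lemma has_weak_grad_scale:
  assumes 1: "has_weak_grad \<Omega> u G"
  shows "has_weak_grad \<Omega> (\<lambda>x. c * u x) (\<lambda>x. c *\<^sub>R G x)"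
proof -
  have "(LINT x|lebesgue_on \<Omega>. (c * u x) *\<^sub>R classical_grad \<phi> x) = - (LINT x|lebesgue_on \<Omega>. \<phi> x *\<^sub>R c *\<^sub>R G x)"
    if "\<phi> \<in> test_functions \<Omega>" for \<phi>
  proof -
    have "(LINT x|lebesgue_on \<Omega>. (c * u x) *\<^sub>R classical_grad \<phi> x) = c *\<^sub>R (LINT x|lebesgue_on \<Omega>. u x *\<^sub>R classical_grad \<phi> x)"
      by (simp flip: scaleR_scaleR)
    also have "\<dots> = - (c *\<^sub>R (LINT x|lebesgue_on \<Omega>. \<phi> x *\<^sub>R G x))"
      using 1 that by (simp add: has_weak_grad_def)
    also have "c *\<^sub>R (LINT x|lebesgue_on \<Omega>. \<phi> x *\<^sub>R G x) = (LINT x|lebesgue_on \<Omega>. \<phi> x *\<^sub>R c *\<^sub>R G x)"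
      by (subst integral_scaleR_right[symmetric]) (simp add: mult.commute)
    finally show ?thesis .
  qed
  then show ?thesis using 1 by (auto simp: has_weak_grad_def locally_integrable_on_def)
qed

lemma locally_integrable_on_integrable:
  assumes "open \<Omega>" "integrable (lebesgue_on \<Omega>) h" shows "locally_integrable_on h \<Omega>"
  unfolding locally_integrable_on_def
proof safe
  fix K assume K: "compact K" "K \<subseteq> \<Omega>"
  have "integrable lebesgue (\<lambda>x. indicator \<Omega> x *\<^sub>R h x)" using assms by (simp add: integrable_restrict_space)
  moreover have "K \<in> sets lebesgue" using K(1) by (simp add: borel_compact)
  ultimately have "integrable lebesgue (\<lambda>x. indicator K x *\<^sub>R (indicator \<Omega> x *\<^sub>R h x))"
    by (intro integrable_mult_indicator[of K lebesgue "\<lambda>x. indicator \<Omega> x *\<^sub>R h x"])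
  moreover have "(\<lambda>x. indicator K x *\<^sub>R (indicator \<Omega> x *\<^sub>R h x)) = (\<lambda>x. indicator K x *\<^sub>R h x)"
    using K(2) by (auto simp: fun_eq_iff indicator_def)
  ultimately show "integrable (lebesgue_on K) h" using K by (simp add: integrable_restrict_space borel_compact)
qed

text \<open>The product \<phi> u is C1 with compact support, so its gradient integrates to 0 by
  \<open>C1_grad_integral_0\<close>; the product rule turns this into the weak identity.\<close>

lemma C1_grad_has_weak_grad:
  fixes \<Omega> :: "'a::euclidean_space set"
  assumes \<Omega>: "open \<Omega>" and C: "C1_grad u g"
  shows "has_weak_grad \<Omega> u g"
  unfolding has_weak_grad_def
proof safe
  have loc: "locally_integrable_on h \<Omega>" if "continuous_on UNIV h" for h :: "'a \<Rightarrow> 'b::euclidean_space"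
    unfolding locally_integrable_on_def
  proof safe
    fix K :: "'a set" assume K: "compact K"
    have "integrable lborel (\<lambda>x. indicator K x *\<^sub>R h x)"
      by (rule borel_integrable_compact[OF K continuous_on_subset[OF that]]) simp
    then show "integrable (lebesgue_on K) h"
      using K borel_measurable_integrable[of lborel "\<lambda>x. indicator K x *\<^sub>R h x"]
      by (simp add: integrable_restrict_space integrable_completion borel_compact)
  qed
  show "locally_integrable_on u \<Omega>" "locally_integrable_on g \<Omega>"
    using C1_grad_continuous[OF C] C by (auto simp: C1_grad_def intro: loc)
  fix \<phi> assume \<phi>: "\<phi> \<in> test_functions \<Omega>"
  obtain K R B where K: "compact K" "K \<subseteq> \<Omega>" "\<forall>x. x \<notin> K \<longrightarrow> \<phi> x = 0 \<and> classical_grad \<phi> x = 0" "K \<subseteq> cball 0 R"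
    "\<forall>x. \<bar>\<phi> x\<bar> \<le> B \<and> norm (classical_grad \<phi> x) \<le> B" using test_functionsD(5)[OF \<phi>] by blast
  note [measurable] = test_functionsD(3,4)[OF \<phi>] C1_grad_borel[OF C]
  have lu: "locally_integrable_on u \<Omega>" "locally_integrable_on g \<Omega>" by fact+
  have z: "\<forall>x. norm x > R \<longrightarrow> \<phi> x * u x = 0"
  proof safe
    fix x :: 'a assume "norm x > R"
    then have "x \<notin> K" using K(4) by auto
    then show "\<phi> x * u x = 0" using K(3) by simp
  qed
  have "(LINT x|lborel. \<phi> x *\<^sub>R g x + u x *\<^sub>R classical_grad \<phi> x) = 0"
    by (rule C1_grad_integral_0(3)[OF C1_grad_mult[OF test_functionsD(2)[OF \<phi>] C] z])
  then have "(LINT x|lebesgue_on \<Omega>. \<phi> x *\<^sub>R g x + u x *\<^sub>R classical_grad \<phi> x) = 0"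
    by (subst lebesgue_on_lborel(2)) (use \<Omega> K in auto)
  moreover have "integrable (lebesgue_on \<Omega>) (\<lambda>x. \<phi> x *\<^sub>R g x)"
    by (rule locally_integrable_test[OF \<Omega> lu(2), where K=K and B=B]) (use K in auto)
  moreover have "integrable (lebesgue_on \<Omega>) (\<lambda>x. u x *\<^sub>R classical_grad \<phi> x)"
    by (rule locally_integrable_test_vec[OF \<Omega> lu(1), where K=K and B=B]) (use K in auto)
  ultimately show "(LINT x|lebesgue_on \<Omega>. u x *\<^sub>R classical_grad \<phi> x) = - (LINT x|lebesgue_on \<Omega>. \<phi> x *\<^sub>R g x)"
    by (simp add: add_eq_0_iff2)
qed

text \<open>A test function and its gradient are bounded, so L1 convergence of u and G is enough to
  pass to the limit in the defining identity. Applied to a constant sequence it also permits changes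
  on null sets, see \<open>has_weak_grad_cong_AE\<close>.\<close>

lemma weak_grad_test_limit:
  fixes \<Omega> :: "'a::euclidean_space set"
  assumes \<Omega>: "open \<Omega>" and u: "\<And>n. has_weak_grad \<Omega> (u n) (G n)"
    and i: "\<And>n. integrable (lebesgue_on \<Omega>) (u n)" "\<And>n. integrable (lebesgue_on \<Omega>) (G n)"
       "integrable (lebesgue_on \<Omega>) v" "integrable (lebesgue_on \<Omega>) H"
    and l: "(\<lambda>n. LINT x|lebesgue_on \<Omega>. \<bar>u n x - v x\<bar>) \<longlonglongrightarrow> 0" "(\<lambda>n. LINT x|lebesgue_on \<Omega>. norm (G n x - H x)) \<longlonglongrightarrow> 0"
  shows "has_weak_grad \<Omega> v H"
  unfolding has_weak_grad_def
proof safe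
  show "locally_integrable_on v \<Omega>" "locally_integrable_on H \<Omega>"
    using locally_integrable_on_integrable[OF \<Omega>] i by auto
  fix \<phi> assume \<phi>: "\<phi> \<in> test_functions \<Omega>"
  obtain B where B: "\<And>x. \<bar>\<phi> x\<bar> \<le> B" "\<And>x. norm (classical_grad \<phi> x) \<le> B" using test_functionsD(5)[OF \<phi>] by blast
  note [measurable] = test_functionsD(3,4)[OF \<phi>, THEN borel_measurable_lebesgue_on]
  have B0: "B \<ge> 0" using B(1)[of 0] by linarith
  have bd: "integrable (lebesgue_on \<Omega>) (\<lambda>x. \<phi> x *\<^sub>R h x)" if h: "integrable (lebesgue_on \<Omega>) h" for h :: "'a \<Rightarrow> 'a"
  proof (rule bochner_bound[OF integrable_scaleR_right[OF h, of B]])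
    have [measurable]: "h \<in> borel_measurable (lebesgue_on \<Omega>)" using h by auto
    show "(\<lambda>x. \<phi> x *\<^sub>R h x) \<in> borel_measurable (lebesgue_on \<Omega>)" by measurable
  qed (use B B0 in \<open>auto intro!: mult_right_mono\<close>)
  have bd2: "integrable (lebesgue_on \<Omega>) (\<lambda>x. h x *\<^sub>R classical_grad \<phi> x)" if h: "integrable (lebesgue_on \<Omega>) h" for h :: "'a \<Rightarrow> real"
  proof (rule bochner_bound[OF integrable_mult_left[OF h, of B]])
    have [measurable]: "h \<in> borel_measurable (lebesgue_on \<Omega>)" using h by auto
    show "(\<lambda>x. h x *\<^sub>R classical_grad \<phi> x) \<in> borel_measurable (lebesgue_on \<Omega>)" by measurable
  qed (use B B0 in \<open>auto simp: abs_mult intro!: mult_left_mono\<close>)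
  have 1: "(\<lambda>n. LINT x|lebesgue_on \<Omega>. u n x *\<^sub>R classical_grad \<phi> x) \<longlonglongrightarrow> (LINT x|lebesgue_on \<Omega>. v x *\<^sub>R classical_grad \<phi> x)"
  proof (rule LIM_zero_cancel, rule tendsto_0_le[OF l(1), of _ B], intro always_eventually allI)
    fix n
    have "norm ((LINT x|lebesgue_on \<Omega>. u n x *\<^sub>R classical_grad \<phi> x) - (LINT x|lebesgue_on \<Omega>. v x *\<^sub>R classical_grad \<phi> x))
      = norm (LINT x|lebesgue_on \<Omega>. (u n x - v x) *\<^sub>R classical_grad \<phi> x)"
      using bd2 i by (simp add: scaleR_diff_left)
    also have "\<dots> \<le> (LINT x|lebesgue_on \<Omega>. norm ((u n x - v x) *\<^sub>R classical_grad \<phi> x))" by (rule integral_norm_bound)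
    also have "\<dots> \<le> (LINT x|lebesgue_on \<Omega>. \<bar>u n x - v x\<bar> * B)"
      by (rule bochner_mono) (use bd2 i B in \<open>auto intro!: mult_left_mono integrable_norm[OF bd2, simplified norm_scaleR real_norm_def]\<close>)
    also have "\<dots> = norm (LINT x|lebesgue_on \<Omega>. \<bar>u n x - v x\<bar>) * B" by simp
    finally show "norm ((LINT x|lebesgue_on \<Omega>. u n x *\<^sub>R classical_grad \<phi> x) - (LINT x|lebesgue_on \<Omega>. v x *\<^sub>R classical_grad \<phi> x))
       \<le> norm (LINT x|lebesgue_on \<Omega>. \<bar>u n x - v x\<bar>) * B" .
  qed
  have 2: "(\<lambda>n. LINT x|lebesgue_on \<Omega>. \<phi> x *\<^sub>R G n x) \<longlonglongrightarrow> (LINT x|lebesgue_on \<Omega>. \<phi> x *\<^sub>R H x)"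
  proof (rule LIM_zero_cancel, rule tendsto_0_le[OF l(2), of _ B], intro always_eventually allI)
    fix n
    have "norm ((LINT x|lebesgue_on \<Omega>. \<phi> x *\<^sub>R G n x) - (LINT x|lebesgue_on \<Omega>. \<phi> x *\<^sub>R H x))
      = norm (LINT x|lebesgue_on \<Omega>. \<phi> x *\<^sub>R (G n x - H x))"
      using bd i by (simp add: scaleR_diff_right)
    also have "\<dots> \<le> (LINT x|lebesgue_on \<Omega>. norm (\<phi> x *\<^sub>R (G n x - H x)))" by (rule integral_norm_bound)
    also have "\<dots> \<le> (LINT x|lebesgue_on \<Omega>. norm (G n x - H x) * B)"
      by (rule bochner_mono)
        (use i B in \<open>auto simp: mult.commute[of _ B] intro!: mult_right_mono integrable_norm[OF bd, simplified norm_scaleR]\<close>)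
    also have "\<dots> = norm (LINT x|lebesgue_on \<Omega>. norm (G n x - H x)) * B" by simp
    finally show "norm ((LINT x|lebesgue_on \<Omega>. \<phi> x *\<^sub>R G n x) - (LINT x|lebesgue_on \<Omega>. \<phi> x *\<^sub>R H x))
       \<le> norm (LINT x|lebesgue_on \<Omega>. norm (G n x - H x)) * B" .
  qed
  have "(\<lambda>n. LINT x|lebesgue_on \<Omega>. u n x *\<^sub>R classical_grad \<phi> x) = (\<lambda>n. - (LINT x|lebesgue_on \<Omega>. \<phi> x *\<^sub>R G n x))"
    using u \<phi> by (auto simp: has_weak_grad_def)
  then show "(LINT x|lebesgue_on \<Omega>. v x *\<^sub>R classical_grad \<phi> x) = - (LINT x|lebesgue_on \<Omega>. \<phi> x *\<^sub>R H x)"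
    using LIMSEQ_unique[OF 1] tendsto_minus[OF 2] by metis
qed

lemma has_weak_grad_cong_AE:
  assumes \<Omega>: "open \<Omega>" and "has_weak_grad \<Omega> u G"
    and i: "integrable (lebesgue_on \<Omega>) u" "integrable (lebesgue_on \<Omega>) G"
    and m: "v \<in> borel_measurable (lebesgue_on \<Omega>)" "H \<in> borel_measurable (lebesgue_on \<Omega>)"
    and ae: "AE x in lebesgue_on \<Omega>. u x = v x" "AE x in lebesgue_on \<Omega>. G x = H x"
  shows "has_weak_grad \<Omega> v H"
proof (rule weak_grad_test_limit[of \<Omega> "\<lambda>_. u" "\<lambda>_. G"])
  show v: "integrable (lebesgue_on \<Omega>) v" "integrable (lebesgue_on \<Omega>) H"
    using integrable_cong_AE_imp[OF i(1) m(1)] integrable_cong_AE_imp[OF i(2) m(2)] ae by (auto elim: AE_mp)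
  have "(LINT x|lebesgue_on \<Omega>. \<bar>u x - v x\<bar>) = (LINT x|lebesgue_on \<Omega>. 0)"
    by (rule integral_cong_AE) (use i v ae(1) in auto)
  then show "(\<lambda>n. LINT x|lebesgue_on \<Omega>. \<bar>u x - v x\<bar>) \<longlonglongrightarrow> 0" by simp
  have "(LINT x|lebesgue_on \<Omega>. norm (G x - H x)) = (LINT x|lebesgue_on \<Omega>. 0)"
    by (rule integral_cong_AE) (use i v ae(2) in auto)
  then show "(\<lambda>n. LINT x|lebesgue_on \<Omega>. norm (G x - H x)) \<longlonglongrightarrow> 0" by simp
qed (use assms in auto)

section \<open>The chain rule for weak gradients\<close>

text \<open>The extension by 0 only serves to make convolutions over the whole space meaningful. It
  need not be weakly differentiable across the boundary, so \<open>has_weak_grad\<close> is asked on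
  \<Omega> alone.\<close>

definition sob_rep :: "'a::euclidean_space set \<Rightarrow> ('a \<Rightarrow> real) \<Rightarrow> ('a \<Rightarrow> 'a) \<Rightarrow> bool" where
  "sob_rep \<Omega> U V \<longleftrightarrow> open \<Omega> \<and> has_weak_grad \<Omega> U V \<and> U \<in> borel_measurable borel \<and> V \<in> borel_measurable borel \<and>
     integrable lborel U \<and> integrable lborel V \<and> (\<forall>x. x \<notin> \<Omega> \<longrightarrow> U x = 0 \<and> V x = 0)"

lemma sob_rep_exists:
  fixes \<Omega> :: "'a::euclidean_space set"
  assumes \<Omega>: "open \<Omega>" and w: "has_weak_grad \<Omega> u G" and i: "integrable (lebesgue_on \<Omega>) u" "integrable (lebesgue_on \<Omega>) G"
  obtains U V where "sob_rep \<Omega> U V" "AE x in lebesgue_on \<Omega>. u x = U x" "AE x in lebesgue_on \<Omega>. G x = V x"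
proof -
  have S: "\<Omega> \<in> sets borel" using \<Omega> by simp
  obtain U where U: "U \<in> borel_measurable borel" "\<And>x. x \<notin> \<Omega> \<Longrightarrow> U x = 0" "AE x in lebesgue_on \<Omega>. u x = U x" "integrable lborel U"
    by (rule lebesgue_on_integrable_rep[OF S i(1)]) blast
  obtain V where V: "V \<in> borel_measurable borel" "\<And>x. x \<notin> \<Omega> \<Longrightarrow> V x = 0" "AE x in lebesgue_on \<Omega>. G x = V x" "integrable lborel V"
    by (rule lebesgue_on_integrable_rep[OF S i(2)]) blast
  have "has_weak_grad \<Omega> U V"
    by (rule has_weak_grad_cong_AE[OF \<Omega> w i borel_measurable_lebesgue_on[OF U(1)] borel_measurable_lebesgue_on[OF V(1)] U(3) V(3)])
  then have "sob_rep \<Omega> U V" using U V \<Omega> unfolding sob_rep_def by simp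
  then show ?thesis using U(3) V(3) by (rule that)
qed

text \<open>Since the closed ball around x lies in \<Omega>, the reflected kernel
  \<open>\<lambda>y. moll e (x - y)\<close> is a test function; inserted into the definition of the
  weak gradient it moves the derivative from the kernel to U.\<close>

lemma conv_moll_weak_grad:
  fixes \<Omega> :: "'a::euclidean_space set"
  assumes s: "sob_rep \<Omega> U V" and e: "e > 0" "cball x e \<subseteq> \<Omega>"
  shows "classical_grad (conv (moll e) U) x = conv (moll e) V x"
proof -
  have \<Omega>: "\<Omega> \<in> sets borel" and U: "U \<in> borel_measurable borel" "integrable lborel U" "\<And>x. x \<notin> \<Omega> \<Longrightarrow> U x = 0"
    and V: "V \<in> borel_measurable borel" "integrable lborel V" "\<And>x. x \<notin> \<Omega> \<Longrightarrow> V x = 0" and w: "has_weak_grad \<Omega> U V"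
    using s by (auto simp: sob_rep_def)
  note [measurable] = U(1) V(1)
  have sup: "\<forall>x::'a. norm x > e \<longrightarrow> moll e x = 0" by (simp add: moll_eq_0[OF e(1)])
  let ?\<phi> = "\<lambda>y. moll e (x - y)"
  have \<phi>: "?\<phi> \<in> test_functions \<Omega>" by (rule moll_test(1)[OF e])
  note [measurable] = test_functionsD(3,4)[OF \<phi>]
  have eq: "(LINT y|lebesgue_on \<Omega>. U y *\<^sub>R classical_grad ?\<phi> y) = - (LINT y|lebesgue_on \<Omega>. ?\<phi> y *\<^sub>R V y)"
    using w \<phi> by (simp add: has_weak_grad_def)
  have "(LINT y|lebesgue_on \<Omega>. ?\<phi> y *\<^sub>R V y) = conv (moll e) V x"
    unfolding conv_def by (rule lebesgue_on_lborel(2)[OF \<Omega>]) (use V in auto)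
  moreover have "(LINT y|lebesgue_on \<Omega>. U y *\<^sub>R classical_grad ?\<phi> y) = (LINT y|lborel. U y *\<^sub>R classical_grad ?\<phi> y)"
    by (rule lebesgue_on_lborel(2)[OF \<Omega>]) (use U in auto)
  ultimately have eq2: "conv (moll e) V x = - (LINT y|lborel. U y *\<^sub>R classical_grad ?\<phi> y)" using eq by (metis minus_minus)
  have i: "integrable lborel (\<lambda>y. U y *\<^sub>R classical_grad ?\<phi> y)"
  proof -
    have "integrable (lebesgue_on \<Omega>) (\<lambda>y. U y *\<^sub>R classical_grad ?\<phi> y)"
      by (rule weak_grad_test_integrable(1)[OF _ w \<phi>]) (use s in \<open>simp add: sob_rep_def\<close>)
    then show ?thesis by (subst (asm) lebesgue_on_lborel(1)[OF \<Omega>]) (use U in auto)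
  qed
  have "classical_grad (conv (moll e) U) x \<bullet> v = conv (moll e) V x \<bullet> v" for v
  proof -
    have "classical_grad (conv (moll e) U) x \<bullet> v = conv (\<lambda>x. classical_grad (moll e) x \<bullet> v) U x"
      by (rule smooth_conv(2)[OF smooth_moll sup U(2)])
    also have "\<dots> = (LINT y|lborel. - (U y *\<^sub>R classical_grad ?\<phi> y) \<bullet> v)"
      unfolding conv_def by (simp add: moll_test(2)[OF e] mult.commute)
    also have "\<dots> = (- (LINT y|lborel. U y *\<^sub>R classical_grad ?\<phi> y)) \<bullet> v"
      using integral_inner_left[OF i, of v] by simp
    finally show ?thesis using eq2 by simp
  qed
  then show ?thesis by (metis vector_eq_rdot)
qed

text \<open>Split the difference into bn (fn - f) and (bn - b) f. The first part is controlled by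
  the common bound B, the second by dominated convergence with majorant a multiple of |f|.\<close>

lemma L1_mult_tendsto:
  fixes f :: "'a \<Rightarrow> 'b::{banach, second_countable_topology}" and b :: "'a \<Rightarrow> real"
  assumes bm: "\<And>n. bn n \<in> borel_measurable M" "b \<in> borel_measurable M" and B: "\<And>n x. \<bar>bn n x\<bar> \<le> B" "\<And>x. \<bar>b x\<bar> \<le> B"
    and bl: "AE x in M. (\<lambda>n. bn n x) \<longlonglongrightarrow> b x"
    and f: "\<And>n. integrable M (fn n)" "integrable M f"
    and l: "(\<lambda>n. \<integral>\<^sup>+x. ennreal (norm (fn n x - f x)) \<partial>M) \<longlonglongrightarrow> 0"
  shows "(\<lambda>n. LINT x|M. bn n x *\<^sub>R fn n x) \<longlonglongrightarrow> (LINT x|M. b x *\<^sub>R f x)"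
proof (rule tendsto_L1_int)
  note [measurable] = bm
  have [measurable]: "\<And>n. fn n \<in> borel_measurable M" "f \<in> borel_measurable M" using f by auto
  have B0: "B \<ge> 0" using B(2) abs_ge_zero order_trans by blast
  show "integrable M (\<lambda>x. bn n x *\<^sub>R fn n x)" for n
    by (rule bochner_bound[OF integrable_scaleR_right[OF f(1)[of n], of B]]) (use B B0 in \<open>auto intro!: mult_right_mono\<close>)
  show "integrable M (\<lambda>x. b x *\<^sub>R f x)"
    by (rule bochner_bound[OF integrable_scaleR_right[OF f(2), of B]]) (use B B0 in \<open>auto intro!: mult_right_mono\<close>)
  have 2: "(\<lambda>n. \<integral>\<^sup>+x. ennreal (norm (b x *\<^sub>R f x - bn n x *\<^sub>R f x)) \<partial>M) \<longlonglongrightarrow> 0"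
  proof (rule nn_integral_dominated_convergence_norm[where w="\<lambda>x. B * norm (f x)"])
    have "integrable M (\<lambda>x. B *\<^sub>R f x)" using f by simp
    then show "(\<integral>\<^sup>+x. ennreal (B * norm (f x)) \<partial>M) < \<infinity>" using B0 by (simp add: integrable_iff_bounded del: integrable_scaleR_right)
    show "AE x in M. (\<lambda>n. bn n x *\<^sub>R f x) \<longlonglongrightarrow> b x *\<^sub>R f x" using bl by eventually_elim (intro tendsto_intros)
  qed (use B in \<open>auto intro!: mult_right_mono\<close>)
  have "(\<lambda>n. ennreal B * (\<integral>\<^sup>+x. ennreal (norm (fn n x - f x)) \<partial>M) + (\<integral>\<^sup>+x. ennreal (norm (b x *\<^sub>R f x - bn n x *\<^sub>R f x)) \<partial>M)) \<longlonglongrightarrow> ennreal B * 0 + 0"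
    by (intro tendsto_add 2 ennreal_tendsto_cmult l) simp
  then have lim0: "(\<lambda>n. ennreal B * (\<integral>\<^sup>+x. ennreal (norm (fn n x - f x)) \<partial>M) + (\<integral>\<^sup>+x. ennreal (norm (b x *\<^sub>R f x - bn n x *\<^sub>R f x)) \<partial>M)) \<longlonglongrightarrow> 0"
    by simp
  show "(\<lambda>n. \<integral>\<^sup>+x. ennreal (norm (bn n x *\<^sub>R fn n x - b x *\<^sub>R f x)) \<partial>M) \<longlonglongrightarrow> 0"
  proof (rule tendsto_sandwich[OF _ _ tendsto_const lim0])
    show "\<forall>\<^sub>F n in sequentially. (\<integral>\<^sup>+x. ennreal (norm (bn n x *\<^sub>R fn n x - b x *\<^sub>R f x)) \<partial>M) \<le>
      ennreal B * (\<integral>\<^sup>+x. ennreal (norm (fn n x - f x)) \<partial>M) + (\<integral>\<^sup>+x. ennreal (norm (b x *\<^sub>R f x - bn n x *\<^sub>R f x)) \<partial>M)"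
    proof (intro always_eventually allI)
      fix n
      have pt: "norm (bn n x *\<^sub>R fn n x - b x *\<^sub>R f x) \<le> B * norm (fn n x - f x) + norm (b x *\<^sub>R f x - bn n x *\<^sub>R f x)" for x
      proof -
        have "bn n x *\<^sub>R fn n x - b x *\<^sub>R f x = bn n x *\<^sub>R (fn n x - f x) - (b x *\<^sub>R f x - bn n x *\<^sub>R f x)"
          by (simp add: scaleR_diff_right)
        then have "norm (bn n x *\<^sub>R fn n x - b x *\<^sub>R f x) \<le> norm (bn n x *\<^sub>R (fn n x - f x)) + norm (b x *\<^sub>R f x - bn n x *\<^sub>R f x)"
          using norm_triangle_ineq4 by metis
        also have "norm (bn n x *\<^sub>R (fn n x - f x)) \<le> B * norm (fn n x - f x)" using B(1)[of n x] by (simp add: mult_right_mono)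
        finally show ?thesis by simp
      qed
      have "(\<integral>\<^sup>+x. ennreal (norm (bn n x *\<^sub>R fn n x - b x *\<^sub>R f x)) \<partial>M) \<le> (\<integral>\<^sup>+x. ennreal B * ennreal (norm (fn n x - f x)) + ennreal (norm (b x *\<^sub>R f x - bn n x *\<^sub>R f x)) \<partial>M)"
        using B0 pt by (intro nn_integral_mono) (simp add: ennreal_mult[symmetric] ennreal_plus[symmetric] del: ennreal_plus)
      also have "\<dots> = ennreal B * (\<integral>\<^sup>+x. ennreal (norm (fn n x - f x)) \<partial>M) + (\<integral>\<^sup>+x. ennreal (norm (b x *\<^sub>R f x - bn n x *\<^sub>R f x)) \<partial>M)"
        by (simp add: nn_integral_add nn_integral_cmult)
      finally show "(\<integral>\<^sup>+x. ennreal (norm (bn n x *\<^sub>R fn n x - b x *\<^sub>R f x)) \<partial>M) \<le>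
        ennreal B * (\<integral>\<^sup>+x. ennreal (norm (fn n x - f x)) \<partial>M) + (\<integral>\<^sup>+x. ennreal (norm (b x *\<^sub>R f x - bn n x *\<^sub>R f x)) \<partial>M)" .
    qed
  qed auto
qed

lemma lipschitz_from_deriv:
  fixes T :: "real \<Rightarrow> real"
  assumes "\<And>t. (T has_real_derivative T' t) (at t)" "\<And>t. \<bar>T' t\<bar> \<le> 1"
  shows "\<bar>T a - T b\<bar> \<le> \<bar>a - b\<bar>"
  using field_differentiable_bound[of UNIV T T' 1 a b] assms by (auto simp: has_field_derivative_at_within)

lemma DERIV_borel_measurable:
  fixes T :: "real \<Rightarrow> real"
  assumes "\<And>t. (T has_real_derivative T' t) (at t)"
  shows "T \<in> borel_measurable borel"
  by (rule borel_measurable_continuous_onI, rule continuous_at_imp_continuous_on) (use DERIV_isCont[OF assms] in blast)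

lemma conv_moll_tendsto_AE:
  fixes u :: "'a::euclidean_space \<Rightarrow> real"
  assumes e: "\<And>n. e n > 0" "e \<longlonglongrightarrow> 0" and u: "integrable lborel u"
    and i: "\<And>n. integrable lborel (conv (moll (e n)) u)"
  shows "\<exists>r::nat\<Rightarrow>nat. strict_mono r \<and> (AE x in lborel. (\<lambda>n. conv (moll (e (r n))) u x) \<longlonglongrightarrow> u x)"
proof -
  have "(\<lambda>n. LINT x|lborel. norm (conv (moll (e n)) u x - u x)) \<longlonglongrightarrow> 0"
  proof -
    have "ennreal (LINT x|lborel. norm (conv (moll (e n)) u x - u x)) = (\<integral>\<^sup>+x. ennreal (norm (conv (moll (e n)) u x - u x)) \<partial>lborel)" for n
      by (subst nn_integral_eq_integral) (use i u in auto)
    then have "(\<lambda>n. ennreal (LINT x|lborel. norm (conv (moll (e n)) u x - u x))) \<longlonglongrightarrow> ennreal 0"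
      using conv_moll_tendsto[OF u e] by simp
    then show ?thesis by (subst (asm) tendsto_ennreal_iff) auto
  qed
  then obtain r :: "nat \<Rightarrow> nat" where "strict_mono r" "AE x in lborel. (\<lambda>n. conv (moll (e (r n))) u x - u x) \<longlonglongrightarrow> 0"
    using tendsto_L1_AE_subseq[of lborel "\<lambda>n x. conv (moll (e n)) u x - u x"] i u by auto
  then show ?thesis by (auto simp: LIM_zero_iff)
qed

lemma conv_moll_integrable_whole:
  fixes u :: "'a::euclidean_space \<Rightarrow> 'b::{banach, second_countable_topology}"
  assumes e: "e > 0" and u: "integrable lborel u"
  shows "integrable lborel (conv (moll e) u)"
    and "(\<integral>\<^sup>+x. ennreal (norm (conv (moll e) u x)) \<partial>lborel) \<le> (\<integral>\<^sup>+x. ennreal (norm (u x)) \<partial>lborel)"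
proof -
  have [measurable]: "u \<in> borel_measurable borel" using u by auto
  have "(\<integral>\<^sup>+x. ennreal (norm (conv (moll e) u x)) \<partial>lborel) \<le> (\<integral>\<^sup>+x. (\<integral>\<^sup>+h. ennreal (moll e h) * ennreal (norm (u (x + h))) \<partial>lborel) \<partial>lborel)"
  proof (rule nn_integral_mono)
    fix x
    have "ennreal (norm (conv (moll e) u x)) \<le> (\<integral>\<^sup>+y. norm (moll e (x - y) *\<^sub>R u y) \<partial>lborel)"
      unfolding conv_def by (rule integral_norm_bound_ennreal[OF conv_moll_integrable[OF e u]])
    also have "\<dots> = (\<integral>\<^sup>+y. ennreal (moll e (x - y)) * ennreal (norm (u y)) \<partial>lborel)"
      by (intro nn_integral_cong) (simp add: moll_nonneg[OF e] ennreal_mult)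
    also have "\<dots> = (\<integral>\<^sup>+h. ennreal (moll e h) * ennreal (norm (u (x + h))) \<partial>lborel)"
      by (rule conv_moll_reflect) measurable
    finally show "ennreal (norm (conv (moll e) u x)) \<le> (\<integral>\<^sup>+h. ennreal (moll e h) * ennreal (norm (u (x + h))) \<partial>lborel)" .
  qed
  also have "\<dots> = (\<integral>\<^sup>+h. (\<integral>\<^sup>+x. ennreal (moll e h) * ennreal (norm (u (x + h))) \<partial>lborel) \<partial>lborel)"
    by (rule lborel_pair.Fubini'[symmetric]) measurable
  also have "\<dots> = (\<integral>\<^sup>+h. ennreal (moll e (h::'a)) * (\<integral>\<^sup>+x. ennreal (norm (u x)) \<partial>lborel) \<partial>lborel)"
  proof (intro nn_integral_cong)
    fix h :: 'a
    have "(\<integral>\<^sup>+x. ennreal (norm (u (x + h))) \<partial>lborel) = (\<integral>\<^sup>+x. ennreal (norm (u x)) \<partial>lborel)"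
      using nn_integral_lborel_shift[of "\<lambda>x. ennreal (norm (u x))" h] by (simp add: add.commute)
    then show "(\<integral>\<^sup>+x. ennreal (moll e h) * ennreal (norm (u (x + h))) \<partial>lborel) = ennreal (moll e h) * (\<integral>\<^sup>+x. ennreal (norm (u x)) \<partial>lborel)"
      by (subst nn_integral_cmult) auto
  qed
  also have "\<dots> = (\<integral>\<^sup>+x. ennreal (norm (u x)) \<partial>lborel)"
    using moll_integral(3)[OF e, where 'a='a] by (subst nn_integral_multc) auto
  finally show le: "(\<integral>\<^sup>+x. ennreal (norm (conv (moll e) u x)) \<partial>lborel) \<le> (\<integral>\<^sup>+x. ennreal (norm (u x)) \<partial>lborel)" .
  also have "\<dots> < \<infinity>" using u by (simp add: integrable_iff_bounded)
  finally show "integrable lborel (conv (moll e) u)" unfolding integrable_iff_bounded by simp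
qed

text \<open>Mollify, apply the classical chain rule on the support of \<phi>, and pass to the limit.
  T (Uk) converges in L1 because T is 1-Lipschitz. For T' (Uk) only continuity is known, so a
  subsequence converging almost everywhere is taken and paired with the L1 convergence of the
  gradients.\<close>

lemma weak_chain_rule_rep:
  fixes \<Omega> :: "'a::euclidean_space set"
  assumes s: "sob_rep \<Omega> U V"
    and T: "\<And>t. (T has_real_derivative T' t) (at t)" "continuous_on UNIV T'" "\<And>t. \<bar>T' t\<bar> \<le> 1" "T 0 = 0"
    and \<phi>: "\<phi> \<in> test_functions \<Omega>"
  shows "(LINT x|lborel. T (U x) *\<^sub>R classical_grad \<phi> x) = - (LINT x|lborel. (\<phi> x * T' (U x)) *\<^sub>R V x)"
proof -
  have \<Omega>: "open \<Omega>" and U: "U \<in> borel_measurable borel" "integrable lborel U"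
    and V: "V \<in> borel_measurable borel" "integrable lborel V"
    using s by (auto simp: sob_rep_def)
  have [measurable]: "T' \<in> borel_measurable borel" "T \<in> borel_measurable borel"
    using borel_measurable_continuous_onI[OF T(2)] DERIV_borel_measurable[OF T(1)] by auto
  obtain K R B where K0: "compact K" "K \<subseteq> \<Omega>" "\<forall>x. x \<notin> K \<longrightarrow> \<phi> x = 0 \<and> classical_grad \<phi> x = 0" "K \<subseteq> cball 0 R"
    "\<forall>x. \<bar>\<phi> x\<bar> \<le> B \<and> norm (classical_grad \<phi> x) \<le> B" using test_functionsD(5)[OF \<phi>] by blast
  have K: "compact K" "K \<subseteq> \<Omega>" "\<And>x. x \<notin> K \<Longrightarrow> \<phi> x = 0 \<and> classical_grad \<phi> x = 0" "K \<subseteq> cball 0 R"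
    "\<And>x. \<bar>\<phi> x\<bar> \<le> B" "\<And>x. norm (classical_grad \<phi> x) \<le> B"
    using K0 by simp_all
  note [measurable] = test_functionsD(3,4)[OF \<phi>] U(1) V(1)
  have B0: "B \<ge> 0" using K(5)[of 0] by linarith
  have "closed (- \<Omega>)" "K \<inter> - \<Omega> = {}" using \<Omega> K(2) by auto
  from separate_compact_closed[OF K(1) this] obtain d where d: "d > 0" "\<And>x y. x \<in> K \<Longrightarrow> y \<notin> \<Omega> \<Longrightarrow> d \<le> dist x y"
    by auto
  \<comment> \<open>With n + 2 in the denominator every radius is strictly below the distance d of
    the support to the complement of \<Omega>, already for n = 0.\<close>
  define e where "e n = d / real (n + 2)" for n
  have e: "e n > 0" "e n < d" for n using d(1) by (auto simp: e_def field_simps add_pos_nonneg)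
  have el: "e \<longlonglongrightarrow> 0" unfolding e_def by (rule LIMSEQ_ignore_initial_segment[of "\<lambda>n. d / real n" 0 2]) (rule lim_const_over_n)
  have sub: "cball x (e n) \<subseteq> \<Omega>" if "x \<in> K" for x n
    using d(2)[OF that] e[of n] by force
  note iU = conv_moll_integrable_whole(1)[OF e(1) U(2)] and iV = conv_moll_integrable_whole(1)[OF e(1) V(2)]
  obtain r :: "nat \<Rightarrow> nat" where r: "strict_mono r" "AE x in lborel. (\<lambda>n. conv (moll (e (r n))) U x) \<longlonglongrightarrow> U x"
    using conv_moll_tendsto_AE[OF e(1) el U(2) iU] by auto
  define Uk where "Uk n = conv (moll (e (r n))) U" for n
  define Vk where "Vk n = conv (moll (e (r n))) V" for n
  have er: "(\<lambda>n. e (r n)) \<longlonglongrightarrow> 0" using LIMSEQ_subseq_LIMSEQ[OF el r(1)] by (simp add: o_def)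
  have [measurable]: "Uk n \<in> borel_measurable borel" "Vk n \<in> borel_measurable borel" for n unfolding Uk_def Vk_def by measurable
  have sm: "smooth (Uk n)" for n
    unfolding Uk_def by (rule smooth_conv(1)[OF smooth_moll _ U(2), where R="e (r n)"]) (simp add: moll_eq_0[OF e(1)])
  have eqn: "(LINT x|lborel. T (Uk n x) *\<^sub>R classical_grad \<phi> x) = - (LINT x|lborel. (\<phi> x * T' (Uk n x)) *\<^sub>R Vk n x)" for n
  proof -
    have C: "C1_grad (\<lambda>x. T (Uk n x)) (\<lambda>x. T' (Uk n x) *\<^sub>R classical_grad (Uk n) x)"
      by (rule C1_grad_compose[OF smooth_C1_grad[OF sm] T(1,2)])
    note [measurable] = C1_grad_borel[OF smooth_C1_grad[OF sm]]
    have "(LINT x|lebesgue_on \<Omega>. T (Uk n x) *\<^sub>R classical_grad \<phi> x) = - (LINT x|lebesgue_on \<Omega>. \<phi> x *\<^sub>R (T' (Uk n x) *\<^sub>R classical_grad (Uk n) x))"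
      using C1_grad_has_weak_grad[OF \<Omega> C] \<phi> by (simp add: has_weak_grad_def)
    moreover have "(LINT x|lebesgue_on \<Omega>. T (Uk n x) *\<^sub>R classical_grad \<phi> x) = (LINT x|lborel. T (Uk n x) *\<^sub>R classical_grad \<phi> x)"
      by (rule lebesgue_on_lborel(2)) (use \<Omega> K in auto)
    moreover have "(LINT x|lebesgue_on \<Omega>. \<phi> x *\<^sub>R (T' (Uk n x) *\<^sub>R classical_grad (Uk n) x)) = (LINT x|lborel. \<phi> x *\<^sub>R (T' (Uk n x) *\<^sub>R classical_grad (Uk n) x))"
      by (rule lebesgue_on_lborel(2)) (use \<Omega> K in auto)
    moreover have "(\<lambda>x. \<phi> x *\<^sub>R (T' (Uk n x) *\<^sub>R classical_grad (Uk n) x)) = (\<lambda>x. (\<phi> x * T' (Uk n x)) *\<^sub>R Vk n x)"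
    proof
      fix x show "\<phi> x *\<^sub>R (T' (Uk n x) *\<^sub>R classical_grad (Uk n) x) = (\<phi> x * T' (Uk n x)) *\<^sub>R Vk n x"
        using conv_moll_weak_grad[OF s e(1) sub, of x "r n"] K(3)[of x] by (cases "x \<in> K") (auto simp: Uk_def Vk_def)
    qed
    ultimately show ?thesis by metis
  qed
  have LU: "(\<lambda>n. \<integral>\<^sup>+x. ennreal (norm (Uk n x - U x)) \<partial>lborel) \<longlonglongrightarrow> 0"
    unfolding Uk_def by (rule conv_moll_tendsto[OF U(2) e(1) er])
  have LV: "(\<lambda>n. \<integral>\<^sup>+x. ennreal (norm (Vk n x - V x)) \<partial>lborel) \<longlonglongrightarrow> 0"
    unfolding Vk_def by (rule conv_moll_tendsto[OF V(2) e(1) er])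
  have TL: "\<bar>T a - T b\<bar> \<le> \<bar>a - b\<bar>" for a b using lipschitz_from_deriv[OF T(1,3)] .
  have TI: "integrable lborel (\<lambda>x. T (w x))" if "integrable lborel w" "w \<in> borel_measurable borel" for w :: "'a \<Rightarrow> real"
  proof (rule bochner_bound[OF that(1)])
    show "(\<lambda>x. T (w x)) \<in> borel_measurable lborel" using that(2) by measurable
    show "AE x in lborel. norm (T (w x)) \<le> norm (w x)" using TL[of _ 0] T(4) by auto
  qed
  have 1: "(\<lambda>n. LINT x|lborel. T (Uk n x) *\<^sub>R classical_grad \<phi> x) \<longlonglongrightarrow> (LINT x|lborel. T (U x) *\<^sub>R classical_grad \<phi> x)"
  proof -
    have LT: "(\<lambda>n. \<integral>\<^sup>+x. ennreal (norm (T (Uk n x) - T (U x))) \<partial>lborel) \<longlonglongrightarrow> 0"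
      by (rule tendsto_sandwich[OF _ _ tendsto_const LU]) (auto intro!: always_eventually nn_integral_mono TL ennreal_leI)
    \<comment> \<open>\<open>L1_mult_tendsto\<close> multiplies by real factors; here the bounded
      factor is the vector \<nabla>\<phi>, so its coordinates are treated one at a time.\<close>
    have "(\<lambda>n. LINT x|lborel. (classical_grad \<phi> x \<bullet> b) *\<^sub>R T (Uk n x)) \<longlonglongrightarrow> (LINT x|lborel. (classical_grad \<phi> x \<bullet> b) *\<^sub>R T (U x))" if "b \<in> Basis" for b
      by (rule L1_mult_tendsto[where B=B]) (use that TI iU U LT K(6) in \<open>auto simp: Uk_def intro: order_trans[OF Basis_le_norm]\<close>)
    moreover have sp: "(LINT x|lborel. T (w x) *\<^sub>R classical_grad \<phi> x) \<bullet> b = (LINT x|lborel. (classical_grad \<phi> x \<bullet> b) *\<^sub>R T (w x))"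
      if w: "integrable lborel w" "w \<in> borel_measurable borel" for b w
    proof -
      note [measurable] = w(2)
      have "integrable lborel (\<lambda>x. T (w x) *\<^sub>R classical_grad \<phi> x)"
        by (rule bochner_bound[OF integrable_mult_right[OF TI[OF w], of B]])
          (use K(6) B0 in \<open>auto simp: abs_mult mult.commute[of B] intro!: mult_left_mono\<close>)
      then show ?thesis by (simp add: integral_inner_left[symmetric] mult.commute)
    qed
    ultimately have c: "(\<lambda>n. (LINT x|lborel. T (Uk n x) *\<^sub>R classical_grad \<phi> x) \<bullet> b) \<longlonglongrightarrow> (LINT x|lborel. T (U x) *\<^sub>R classical_grad \<phi> x) \<bullet> b"
      if "b \<in> Basis" for b
      using that sp[of "Uk _" b] sp[of U b] iU U by (simp add: Uk_def)
    have "(\<lambda>n. \<Sum>b\<in>Basis. ((LINT x|lborel. T (Uk n x) *\<^sub>R classical_grad \<phi> x) \<bullet> b) *\<^sub>R b) \<longlonglongrightarrow>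
       (\<Sum>b\<in>Basis. ((LINT x|lborel. T (U x) *\<^sub>R classical_grad \<phi> x) \<bullet> b) *\<^sub>R b)"
      by (intro tendsto_sum tendsto_scaleR c tendsto_const)
    then show ?thesis by (simp only: euclidean_representation)
  qed
  have 2: "(\<lambda>n. LINT x|lborel. (\<phi> x * T' (Uk n x)) *\<^sub>R Vk n x) \<longlonglongrightarrow> (LINT x|lborel. (\<phi> x * T' (U x)) *\<^sub>R V x)"
  proof (rule L1_mult_tendsto[where B=B])
    show "\<bar>\<phi> x * T' (Uk n x)\<bar> \<le> B" "\<bar>\<phi> x * T' (U x)\<bar> \<le> B" for n x
      using mult_mono[OF K(5)[of x] T(3)[of "Uk n x"] B0] mult_mono[OF K(5)[of x] T(3)[of "U x"] B0] by (auto simp: abs_mult)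
    have ct: "isCont T' t" for t using T(2) by (simp add: continuous_on_eq_continuous_at)
    show "AE x in lborel. (\<lambda>n. \<phi> x * T' (Uk n x)) \<longlonglongrightarrow> \<phi> x * T' (U x)"
      using r(2)
    proof eventually_elim
      case (elim x)
      show ?case by (intro tendsto_intros isCont_tendsto_compose[OF ct]) (use elim in \<open>simp add: Uk_def\<close>)
    qed
  qed (use iV V LV in \<open>auto simp: Vk_def\<close>)
  show ?thesis
    using LIMSEQ_unique[OF 1] tendsto_minus[OF 2] unfolding eqn by blast
qed

lemma weak_chain_rule:
  fixes \<Omega> :: "'a::euclidean_space set"
  assumes \<Omega>: "open \<Omega>" and w: "has_weak_grad \<Omega> u G" and i: "integrable (lebesgue_on \<Omega>) u" "integrable (lebesgue_on \<Omega>) G"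
    and T: "\<And>t. (T has_real_derivative T' t) (at t)" "continuous_on UNIV T'" "\<And>t. \<bar>T' t\<bar> \<le> 1" "T 0 = 0"
  shows "has_weak_grad \<Omega> (\<lambda>x. T (u x)) (\<lambda>x. T' (u x) *\<^sub>R G x)"
    "integrable (lebesgue_on \<Omega>) (\<lambda>x. T (u x))" "integrable (lebesgue_on \<Omega>) (\<lambda>x. T' (u x) *\<^sub>R G x)"
proof -
  have [measurable]: "u \<in> borel_measurable (lebesgue_on \<Omega>)" "G \<in> borel_measurable (lebesgue_on \<Omega>)" using i by auto
  have Tm[measurable]: "T' \<in> borel_measurable borel" "T \<in> borel_measurable borel"
    using borel_measurable_continuous_onI[OF T(2)] DERIV_borel_measurable[OF T(1)] by auto
  have TL: "\<bar>T a - T b\<bar> \<le> \<bar>a - b\<bar>" for a b using lipschitz_from_deriv[OF T(1,3)] .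
  show i1: "integrable (lebesgue_on \<Omega>) (\<lambda>x. T (u x))"
    by (rule bochner_bound[OF i(1)]) (use TL[of _ 0] T(4) in auto)
  show i2: "integrable (lebesgue_on \<Omega>) (\<lambda>x. T' (u x) *\<^sub>R G x)"
  proof (rule bochner_bound[OF i(2)])
    have "norm (T' (u x) *\<^sub>R G x) \<le> norm (G x)" for x
      using mult_right_mono[OF T(3)[of "u x"] norm_ge_zero[of "G x"]] by simp
    then show "AE x in lebesgue_on \<Omega>. norm (T' (u x) *\<^sub>R G x) \<le> norm (G x)" by simp
  qed measurable
  obtain U V where s: "sob_rep \<Omega> U V" and ae: "AE x in lebesgue_on \<Omega>. u x = U x" "AE x in lebesgue_on \<Omega>. G x = V x"
    by (rule sob_rep_exists[OF \<Omega> w i]) blast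
  have UV: "U \<in> borel_measurable borel" "V \<in> borel_measurable borel" "\<And>x. x \<notin> \<Omega> \<Longrightarrow> U x = 0" "\<And>x. x \<notin> \<Omega> \<Longrightarrow> V x = 0"
    using s by (auto simp: sob_rep_def)
  note [measurable] = UV(1,2) UV(1,2)[THEN borel_measurable_lebesgue_on]
  show "has_weak_grad \<Omega> (\<lambda>x. T (u x)) (\<lambda>x. T' (u x) *\<^sub>R G x)"
    unfolding has_weak_grad_def
  proof safe
    show "locally_integrable_on (\<lambda>x. T (u x)) \<Omega>" "locally_integrable_on (\<lambda>x. T' (u x) *\<^sub>R G x) \<Omega>"
      using locally_integrable_on_integrable[OF \<Omega>] i1 i2 by auto
    fix \<phi> assume \<phi>: "\<phi> \<in> test_functions \<Omega>"
    note [measurable] = test_functionsD(3,4)[OF \<phi>] test_functionsD(3,4)[OF \<phi>, THEN borel_measurable_lebesgue_on]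
    have "(LINT x|lebesgue_on \<Omega>. T (u x) *\<^sub>R classical_grad \<phi> x) = (LINT x|lebesgue_on \<Omega>. T (U x) *\<^sub>R classical_grad \<phi> x)"
      by (rule integral_cong_AE) (use ae(1) in auto)
    also have "\<dots> = (LINT x|lborel. T (U x) *\<^sub>R classical_grad \<phi> x)"
      by (rule lebesgue_on_lborel(2)) (use \<Omega> UV(3) T(4) in auto)
    also have "\<dots> = - (LINT x|lborel. (\<phi> x * T' (U x)) *\<^sub>R V x)"
      by (rule weak_chain_rule_rep[OF s T \<phi>])
    also have "(LINT x|lborel. (\<phi> x * T' (U x)) *\<^sub>R V x) = (LINT x|lebesgue_on \<Omega>. (\<phi> x * T' (U x)) *\<^sub>R V x)"
      by (rule lebesgue_on_lborel(2)[symmetric]) (use \<Omega> UV(4) in auto)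
    also have "\<dots> = (LINT x|lebesgue_on \<Omega>. \<phi> x *\<^sub>R T' (u x) *\<^sub>R G x)"
    proof (rule integral_cong_AE)
      show "AE x in lebesgue_on \<Omega>. (\<phi> x * T' (U x)) *\<^sub>R V x = \<phi> x *\<^sub>R T' (u x) *\<^sub>R G x"
        using ae by eventually_elim simp
    qed measurable
    finally show "(LINT x|lebesgue_on \<Omega>. T (u x) *\<^sub>R classical_grad \<phi> x) = - (LINT x|lebesgue_on \<Omega>. \<phi> x *\<^sub>R T' (u x) *\<^sub>R G x)" .
  qed
qed

section \<open>The positive part of a Sobolev function\<close>

lemma DERIV_max_square: "((\<lambda>s::real. (max s 0)\<^sup>2) has_real_derivative 2 * max s 0) (at s)"
proof -
  consider "s > 0" | "s < 0" | "s = 0" by linarith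
  then show ?thesis
  proof cases
    case 1
    have "((\<lambda>s. s\<^sup>2) has_real_derivative 2 * max s 0) (at s)" using 1 by (auto intro!: derivative_eq_intros)
    then show ?thesis by (rule has_field_derivative_transform_within_open[where S="{0<..}"]) (use 1 in auto)
  next
    case 2
    have "((\<lambda>s. 0) has_real_derivative 2 * max s 0) (at s)" using 2 by auto
    then show ?thesis by (rule has_field_derivative_transform_within_open[where S="{..<0}"]) (use 2 in auto)
  next
    case 3
    have l: "(\<lambda>h::real. \<bar>h\<bar>) \<midarrow>0\<rightarrow> 0" using tendsto_rabs_zero[OF tendsto_ident_at] by simp
    have "(\<lambda>h::real. (max h 0)\<^sup>2 / h) \<midarrow>0\<rightarrow> 0"
      by (rule tendsto_0_le[OF l, where K=1]) (auto simp: max_def power2_eq_square)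
    then show ?thesis unfolding 3 by (simp add: DERIV_def)
  qed
qed

text \<open>Regularising the positive part itself, rather than |s|, gives a function that is 0 for
  all s \<le> 0 when \<epsilon> > 0 and has derivative 0 at 0 for every \<epsilon>. This is why the
  limit gradient comes out as 0 on the set u = 0.\<close>

definition smooth_pos :: "real \<Rightarrow> real \<Rightarrow> real" where
  "smooth_pos \<epsilon> s = sqrt ((max s 0)\<^sup>2 + \<epsilon>\<^sup>2) - \<epsilon>"

lemma smooth_pos_props:
  assumes "\<epsilon> > 0"
  shows "(smooth_pos \<epsilon> has_real_derivative max s 0 / sqrt ((max s 0)\<^sup>2 + \<epsilon>\<^sup>2)) (at s)"
    "continuous_on UNIV (\<lambda>s. max s 0 / sqrt ((max s 0)\<^sup>2 + \<epsilon>\<^sup>2))"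
    "\<bar>max s 0 / sqrt ((max s 0)\<^sup>2 + \<epsilon>\<^sup>2)\<bar> \<le> 1" "smooth_pos \<epsilon> 0 = 0"
    "\<bar>smooth_pos \<epsilon> s - max s 0\<bar> \<le> \<epsilon>" "\<bar>smooth_pos \<epsilon> s\<bar> \<le> \<bar>s\<bar>"
proof -
  have p: "(max s 0)\<^sup>2 + \<epsilon>\<^sup>2 > 0" for s using assms by (simp add: add_nonneg_pos)
  show "(smooth_pos \<epsilon> has_real_derivative max s 0 / sqrt ((max s 0)\<^sup>2 + \<epsilon>\<^sup>2)) (at s)"
  proof -
    have "((\<lambda>s. (max s 0)\<^sup>2 + \<epsilon>\<^sup>2) has_real_derivative 2 * max s 0) (at s)"
      using DERIV_add[OF DERIV_max_square[of s] DERIV_const] by (simp only: add_0_right)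
    from DERIV_chain2[OF DERIV_real_sqrt[OF p[of s]] this]
    have "((\<lambda>s. sqrt ((max s 0)\<^sup>2 + \<epsilon>\<^sup>2)) has_real_derivative max s 0 / sqrt ((max s 0)\<^sup>2 + \<epsilon>\<^sup>2)) (at s)"
      by (simp add: field_simps)
    from DERIV_diff[OF this DERIV_const, of \<epsilon>] show ?thesis by (simp add: smooth_pos_def[abs_def])
  qed
  have "sqrt ((max s 0)\<^sup>2 + \<epsilon>\<^sup>2) \<noteq> 0" for s using real_sqrt_gt_zero[OF p[of s]] by (metis less_irrefl)
  then show "continuous_on UNIV (\<lambda>s. max s 0 / sqrt ((max s 0)\<^sup>2 + \<epsilon>\<^sup>2))"
    by (intro continuous_intros) auto
  have "max s 0 \<le> sqrt ((max s 0)\<^sup>2 + \<epsilon>\<^sup>2)" by (rule real_le_rsqrt) simp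
  then show "\<bar>max s 0 / sqrt ((max s 0)\<^sup>2 + \<epsilon>\<^sup>2)\<bar> \<le> 1"
    using p[of s] by (simp add: divide_le_eq)
  show "smooth_pos \<epsilon> 0 = 0" using assms by (simp add: smooth_pos_def)
  have u: "sqrt ((max s 0)\<^sup>2 + \<epsilon>\<^sup>2) \<le> max s 0 + \<epsilon>"
    using assms by (intro real_le_lsqrt) (auto simp: power2_sum)
  moreover have "\<epsilon> \<le> sqrt ((max s 0)\<^sup>2 + \<epsilon>\<^sup>2)" by (rule real_le_rsqrt) simp
  moreover note \<open>max s 0 \<le> sqrt ((max s 0)\<^sup>2 + \<epsilon>\<^sup>2)\<close>
  ultimately show "\<bar>smooth_pos \<epsilon> s - max s 0\<bar> \<le> \<epsilon>" "\<bar>smooth_pos \<epsilon> s\<bar> \<le> \<bar>s\<bar>"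
    by (auto simp: smooth_pos_def abs_le_iff max_def split: if_splits)
qed

lemma has_weak_grad_pos:
  fixes \<Omega> :: "'a::euclidean_space set"
  assumes \<Omega>: "open \<Omega>" and w: "has_weak_grad \<Omega> u G" and i: "integrable (lebesgue_on \<Omega>) u" "integrable (lebesgue_on \<Omega>) G"
  shows "has_weak_grad \<Omega> (\<lambda>x. max (u x) 0) (\<lambda>x. if u x > 0 then G x else 0)"
proof -
  have [measurable]: "u \<in> borel_measurable (lebesgue_on \<Omega>)" "G \<in> borel_measurable (lebesgue_on \<Omega>)" using i by auto
  have i1: "integrable (lebesgue_on \<Omega>) (\<lambda>x. max (u x) 0)" by (rule bochner_bound[OF i(1)]) auto
  have i2: "integrable (lebesgue_on \<Omega>) (\<lambda>x. if u x > 0 then G x else 0)" by (rule bochner_bound[OF i(2)]) auto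
  define \<epsilon> where "\<epsilon> n = inverse (real (Suc n))" for n
  have \<epsilon>: "\<epsilon> n > 0" for n by (simp add: \<epsilon>_def)
  have \<epsilon>l: "\<epsilon> \<longlonglongrightarrow> 0" unfolding \<epsilon>_def by (rule LIMSEQ_inverse_real_of_nat)
  define D where "D n s = max s 0 / sqrt ((max s 0)\<^sup>2 + (\<epsilon> n)\<^sup>2)" for n s
  have [measurable]: "smooth_pos (\<epsilon> n) \<in> borel_measurable borel" "D n \<in> borel_measurable borel" for n
    unfolding smooth_pos_def[abs_def] D_def by measurable
  note c = weak_chain_rule[OF \<Omega> w i smooth_pos_props(1)[OF \<epsilon>] smooth_pos_props(2)[OF \<epsilon>] smooth_pos_props(3)[OF \<epsilon>] smooth_pos_props(4)[OF \<epsilon>], folded D_def]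
  have D1: "\<bar>D n s\<bar> \<le> 1" for n s using smooth_pos_props(3)[OF \<epsilon>] by (simp add: D_def)
  have Dl: "(\<lambda>n. D n s) \<longlonglongrightarrow> (if s > 0 then 1 else 0)" for s
  proof (cases "s > 0")
    case True
    have "(\<lambda>n. max s 0 / sqrt ((max s 0)\<^sup>2 + (\<epsilon> n)\<^sup>2)) \<longlonglongrightarrow> max s 0 / sqrt ((max s 0)\<^sup>2 + 0\<^sup>2)"
      by (intro tendsto_intros \<epsilon>l) (use True in auto)
    then show ?thesis using True by (simp add: D_def)
  qed (simp add: D_def)
  show "has_weak_grad \<Omega> (\<lambda>x. max (u x) 0) (\<lambda>x. if u x > 0 then G x else 0)"
  proof (rule weak_grad_test_limit[OF \<Omega> c i1 i2])
    have "(\<lambda>n. LINT x|lebesgue_on \<Omega>. \<bar>smooth_pos (\<epsilon> n) (u x) - max (u x) 0\<bar>) \<longlonglongrightarrow> (LINT x|lebesgue_on \<Omega>. 0)"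
    proof (rule integral_dominated_convergence[where w="\<lambda>x. 2 * \<bar>u x\<bar>"])
      show "AE x in lebesgue_on \<Omega>. (\<lambda>n. \<bar>smooth_pos (\<epsilon> n) (u x) - max (u x) 0\<bar>) \<longlonglongrightarrow> 0"
      proof (intro AE_I2)
        fix x
        show "(\<lambda>n. \<bar>smooth_pos (\<epsilon> n) (u x) - max (u x) 0\<bar>) \<longlonglongrightarrow> 0"
          by (rule tendsto_sandwich[OF _ _ tendsto_const \<epsilon>l]) (auto intro!: always_eventually smooth_pos_props(5) \<epsilon>)
      qed
      show "AE x in lebesgue_on \<Omega>. norm \<bar>smooth_pos (\<epsilon> n) (u x) - max (u x) 0\<bar> \<le> 2 * \<bar>u x\<bar>" for n
      proof (intro AE_I2)
        fix x
        show "norm \<bar>smooth_pos (\<epsilon> n) (u x) - max (u x) 0\<bar> \<le> 2 * \<bar>u x\<bar>"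
          using smooth_pos_props(6)[OF \<epsilon>, of n "u x"] by (auto simp: max_def split: if_splits)
      qed
    qed (use i in auto)
    then show "(\<lambda>n. LINT x|lebesgue_on \<Omega>. \<bar>smooth_pos (\<epsilon> n) (u x) - max (u x) 0\<bar>) \<longlonglongrightarrow> 0" by simp
    have "(\<lambda>n. LINT x|lebesgue_on \<Omega>. norm (D n (u x) *\<^sub>R G x - (if u x > 0 then G x else 0))) \<longlonglongrightarrow> (LINT x|lebesgue_on \<Omega>. 0)"
    proof (rule integral_dominated_convergence[where w="\<lambda>x. 2 * norm (G x)"])
      show "AE x in lebesgue_on \<Omega>. (\<lambda>n. norm (D n (u x) *\<^sub>R G x - (if u x > 0 then G x else 0))) \<longlonglongrightarrow> 0"
      proof (intro AE_I2)
        fix x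
        have "(\<lambda>n. norm (D n (u x) *\<^sub>R G x - (if u x > 0 then G x else 0))) \<longlonglongrightarrow> norm ((if u x > 0 then 1 else 0) *\<^sub>R G x - (if u x > 0 then G x else 0))"
          by (intro tendsto_intros Dl)
        then show "(\<lambda>n. norm (D n (u x) *\<^sub>R G x - (if u x > 0 then G x else 0))) \<longlonglongrightarrow> 0" by (simp split: if_splits)
      qed
      show "AE x in lebesgue_on \<Omega>. norm (norm (D n (u x) *\<^sub>R G x - (if u x > 0 then G x else 0))) \<le> 2 * norm (G x)" for n
      proof (intro AE_I2)
        fix x
        have "norm (D n (u x) *\<^sub>R G x - (if u x > 0 then G x else 0)) \<le> norm (D n (u x) *\<^sub>R G x) + norm (if u x > 0 then G x else 0)"
          by (rule norm_triangle_ineq4)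
        also have "norm (D n (u x) *\<^sub>R G x) \<le> 1 * norm (G x)" using D1 by (simp add: mult_right_mono mult_left_le_one_le)
        finally show "norm (norm (D n (u x) *\<^sub>R G x - (if u x > 0 then G x else 0))) \<le> 2 * norm (G x)"
          using norm_ge_zero[of "G x"] by (cases "u x > 0") (simp, simp only: if_False norm_zero diff_zero real_norm_def abs_norm_cancel, linarith)
      qed
    qed (use i in auto)
    then show "(\<lambda>n. LINT x|lebesgue_on \<Omega>. norm (D n (u x) *\<^sub>R G x - (if u x > 0 then G x else 0))) \<longlonglongrightarrow> 0" by simp
  qed
qed

section \<open>A weighted Poincare inequality\<close>

lemma emeasure_ball_scale:
  fixes z :: "'a::euclidean_space"
  assumes "r > 0"
  shows "emeasure lborel (ball z r) = ennreal (r ^ DIM('a)) * emeasure lborel (ball (0::'a) 1)"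
proof -
  have "emeasure lborel (ball z r) = (\<integral>\<^sup>+x. indicator (ball z r) x \<partial>lborel)" by simp
  also have "\<dots> = ennreal (\<bar>r\<bar> ^ DIM('a)) * (\<integral>\<^sup>+x. indicator (ball z r) (z + r *\<^sub>R x) \<partial>lborel)"
    by (rule nn_integral_lborel_affine[OF borel_measurable_indicator]) (use assms in auto)
  also have "(\<lambda>x. indicator (ball z r) (z + r *\<^sub>R x)) = (indicator (ball (0::'a) 1) :: 'a \<Rightarrow> ennreal)"
    using assms by (auto simp: fun_eq_iff indicator_def dist_norm)
  finally show ?thesis using assms by simp
qed

lemma nn_integral_add_indicator:
  assumes [measurable]: "f \<in> borel_measurable M" "S \<in> sets M"
  shows "(\<integral>\<^sup>+x. a * f x + b * indicator S x \<partial>M) = a * (\<integral>\<^sup>+x. f x \<partial>M) + b * emeasure M S"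
  by (subst nn_integral_add) (auto simp: nn_integral_cmult nn_integral_cmult_indicator)

text \<open>Splitting at the height \<open>B r powr (- n / q)\<close> replaces Hoelder's inequality.\<close>
lemma ball_L1_bound:
  fixes h :: "'a::euclidean_space \<Rightarrow> real"
  assumes [measurable]: "h \<in> borel_measurable borel" and q: "q > 1" and B: "B > 0" and r: "r > 0"
    and hB: "(\<integral>\<^sup>+x. ennreal (\<bar>h x\<bar> powr q) \<partial>lborel) \<le> ennreal (B powr q)"
  shows "(\<integral>\<^sup>+x. indicator (ball z r) x * ennreal \<bar>h x\<bar> \<partial>lborel)
      \<le> ennreal ((1 + measure lborel (ball (0::'a) 1)) * B * r powr (DIM('a) - DIM('a) / q))"
proof -
  define n where "n = real DIM('a)"
  define c where "c = measure lborel (ball (0::'a) 1)"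
  have c: "emeasure lborel (ball (0::'a) 1) = ennreal c" "c \<ge> 0"
    unfolding c_def using emeasure_bounded_finite[OF bounded_ball, of "0::'a" 1] by (auto simp: emeasure_eq_ennreal_measure)
  define l where "l = B * r powr (- n / q)"
  have l: "l > 0" using B r by (simp add: l_def)
  have pt: "\<bar>t\<bar> \<le> l powr (1 - q) * \<bar>t\<bar> powr q + l" for t
  proof (cases "\<bar>t\<bar> \<le> l")
    case False
    then have "\<bar>t\<bar> powr (1 - q) \<le> l powr (1 - q)" using l q by (intro powr_mono2') auto
    then have "\<bar>t\<bar> powr (1 - q) * \<bar>t\<bar> powr q \<le> l powr (1 - q) * \<bar>t\<bar> powr q" by (rule mult_right_mono) simp
    moreover have "\<bar>t\<bar> powr (1 - q) * \<bar>t\<bar> powr q = \<bar>t\<bar>" using False l by (simp flip: powr_add)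
    ultimately show ?thesis using l by simp
  next
    case True
    have "l powr (1 - q) * \<bar>t\<bar> powr q \<ge> 0" by simp
    then show ?thesis using True by linarith
  qed
  have "(\<integral>\<^sup>+x. indicator (ball z r) x * ennreal \<bar>h x\<bar> \<partial>lborel) \<le>
     (\<integral>\<^sup>+x. ennreal (l powr (1 - q)) * ennreal (\<bar>h x\<bar> powr q) + ennreal l * indicator (ball z r) x \<partial>lborel)"
  proof (rule nn_integral_mono)
    fix x
    show "indicator (ball z r) x * ennreal \<bar>h x\<bar> \<le> ennreal (l powr (1 - q)) * ennreal (\<bar>h x\<bar> powr q) + ennreal l * indicator (ball z r) x"
      using ennreal_leI[OF pt[of "h x"]] l by (auto simp: indicator_def ennreal_mult)
  qed
  also have "\<dots> = ennreal (l powr (1 - q)) * (\<integral>\<^sup>+x. ennreal (\<bar>h x\<bar> powr q) \<partial>lborel) + ennreal l * emeasure lborel (ball z r)"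
    by (rule nn_integral_add_indicator) auto
  also have "\<dots> \<le> ennreal (l powr (1 - q)) * ennreal (B powr q) + ennreal l * (ennreal (r ^ DIM('a)) * ennreal c)"
    using hB c by (intro add_mono mult_left_mono) (simp_all add: emeasure_ball_scale[OF r, of z])
  also have "\<dots> = ennreal (l powr (1 - q) * B powr q + l * (r powr n * c))"
    using l r c(2) by (simp add: ennreal_mult[symmetric] ennreal_plus[symmetric] powr_realpow n_def del: ennreal_plus)
  also have "l powr (1 - q) * B powr q = B * r powr (n - n / q)"
  proof -
    have "l powr (1 - q) = B powr (1 - q) * r powr (- n / q * (1 - q))"
      unfolding l_def using B r by (simp add: powr_mult powr_powr)
    moreover have "B powr (1 - q) * B powr q = B" using B by (simp flip: powr_add)
    moreover have "- n / q * (1 - q) = n - n / q" using q by (simp add: field_simps)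
    ultimately show ?thesis by (simp add: mult.assoc mult.left_commute)
  qed
  also have "l * (r powr n * c) = c * B * r powr (n - n / q)"
    unfolding l_def using r by (simp add: powr_add[symmetric] mult_ac)
  also have "B * r powr (n - n / q) + c * B * r powr (n - n / q) = (1 + c) * B * r powr (n - n / q)"
    by (simp add: algebra_simps)
  finally show ?thesis by (simp add: n_def c_def)
qed

text \<open>Average the fundamental theorem of calculus along the segments from x to the points y of
  a ball on which \<phi> vanishes. The substitution z = x + t (y - x) costs the Jacobian
  \<open>t powr - n\<close> with n = \<open>DIM('a)\<close> and confines z to distance t (6 R) from
  x. The integral over t is kept instead of being evaluated to the kernel |x - z|^(1 - n), so that
  Fubini can later be applied for each t.\<close>

lemma potential_estimate:
  fixes \<phi> :: "'a::euclidean_space \<Rightarrow> real"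
  assumes R: "R > 0" and C: "C1_grad \<phi> g" and s: "\<And>x. norm x \<ge> R \<Longrightarrow> \<phi> x = 0" and x: "norm x < R"
  shows "emeasure lborel (ball (0::'a) R) * ennreal \<bar>\<phi> x\<bar> \<le> ennreal (6 * R) *
    (\<integral>\<^sup>+t. indicator {0<..1} t * ennreal (t powr - real DIM('a)) *
       (\<integral>\<^sup>+z. indicator (ball z (t * (6 * R))) x * ennreal (norm (g z)) \<partial>lborel) \<partial>lborel)"
proof -
  note [measurable] = C1_grad_borel[OF C]
  obtain b :: 'a where b: "norm b = 1" using norm_Basis nonempty_Basis by blast
  \<comment> \<open>At distance 3 R from the origin the ball of radius R around c0 stays outside the
    support of \<phi>, and its points are closer than 6 R to every x with |x| < R.\<close>
  define c0 where "c0 = (3 * R) *\<^sub>R b"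
  have nc: "norm c0 = 3 * R" using b R by (simp add: c0_def)
  have far: "norm y \<ge> R" "norm (y - x) < 6 * R" if "y \<in> ball c0 R" for y
    using that nc x R norm_triangle_ineq2[of c0 y] norm_triangle_ineq2[of y c0] norm_triangle_ineq4[of y x]
    by (auto simp: dist_norm norm_minus_commute)
  define D where "D = 6 * R"
  have D: "D > 0" using R by (simp add: D_def)
  define S where "S = ball x D"
  have [measurable]: "S \<in> sets borel" by (simp add: S_def)
  have seg: "ennreal \<bar>\<phi> x\<bar> \<le> ennreal D * (\<integral>\<^sup>+t. indicator {0<..1} t * ennreal (norm (g (x + t *\<^sub>R (y - x)))) \<partial>lborel)"
    if "y \<in> ball c0 R" for y
  proof -
    have "ennreal \<bar>\<phi> x\<bar> = ennreal \<bar>\<phi> (x + (y - x)) - \<phi> x\<bar>" using s[OF far(1)[OF that]] by simp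
    also have "\<dots> \<le> ennreal (norm (y - x)) * (\<integral>\<^sup>+t. indicator {0..1} t * ennreal (norm (g (x + t *\<^sub>R (y - x)))) \<partial>lborel)"
      by (rule C1_grad_segment[OF C])
    also have "(\<integral>\<^sup>+t. indicator {0..1} t * ennreal (norm (g (x + t *\<^sub>R (y - x)))) \<partial>lborel) =
       (\<integral>\<^sup>+t. indicator {0<..1} t * ennreal (norm (g (x + t *\<^sub>R (y - x)))) \<partial>lborel)"
    proof (rule nn_integral_cong_AE)
      have "AE t in lborel. t \<noteq> (0::real)" by (rule AE_lborel_singleton)
      then show "AE t in lborel. indicator {0..1} t * ennreal (norm (g (x + t *\<^sub>R (y - x))))
         = indicator {0<..1} t * ennreal (norm (g (x + t *\<^sub>R (y - x))))"
        by eventually_elim (auto simp: indicator_def)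
    qed
    also have "ennreal (norm (y - x)) * \<dots> \<le> ennreal D * \<dots>"
      using far(2)[OF that] by (intro mult_right_mono ennreal_leI) (auto simp: D_def)
    finally show ?thesis .
  qed
  have "emeasure lborel (ball (0::'a) R) * ennreal \<bar>\<phi> x\<bar> = (\<integral>\<^sup>+y. ennreal \<bar>\<phi> x\<bar> * indicator (ball c0 R) y \<partial>lborel)"
    by (simp add: nn_integral_cmult_indicator emeasure_ball_scale[OF R, of c0] emeasure_ball_scale[OF R, of 0] mult.commute)
  also have "\<dots> \<le> (\<integral>\<^sup>+y. ennreal D * (\<integral>\<^sup>+t. indicator {0<..1} t * (indicator S y * ennreal (norm (g (x + t *\<^sub>R (y - x))))) \<partial>lborel) \<partial>lborel)"
  proof (rule nn_integral_mono)
    fix y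
    show "ennreal \<bar>\<phi> x\<bar> * indicator (ball c0 R) y \<le> ennreal D * (\<integral>\<^sup>+t. indicator {0<..1} t * (indicator S y * ennreal (norm (g (x + t *\<^sub>R (y - x))))) \<partial>lborel)"
      using seg[of y] far(2)[of y] by (cases "y \<in> ball c0 R") (auto simp: dist_norm norm_minus_commute D_def S_def)
  qed
  also have "\<dots> = ennreal D * (\<integral>\<^sup>+y. (\<integral>\<^sup>+t. indicator {0<..1} t * (indicator S y * ennreal (norm (g (x + t *\<^sub>R (y - x))))) \<partial>lborel) \<partial>lborel)"
    by (rule nn_integral_cmult) measurable
  also have "(\<integral>\<^sup>+y. (\<integral>\<^sup>+t. indicator {0<..1} t * (indicator S y * ennreal (norm (g (x + t *\<^sub>R (y - x))))) \<partial>lborel) \<partial>lborel)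
     = (\<integral>\<^sup>+t. (\<integral>\<^sup>+y. indicator {0<..1} t * (indicator S y * ennreal (norm (g (x + t *\<^sub>R (y - x))))) \<partial>lborel) \<partial>lborel)"
    by (rule lborel_pair.Fubini'[symmetric]) measurable
  also have "\<dots> = (\<integral>\<^sup>+t. indicator {0<..1} t * ennreal (t powr - real DIM('a)) *
       (\<integral>\<^sup>+z. indicator (ball z (t * D)) x * ennreal (norm (g z)) \<partial>lborel) \<partial>lborel)"
  proof (intro nn_integral_cong)
    fix t :: real
    show "(\<integral>\<^sup>+y. indicator {0<..1} t * (indicator S y * ennreal (norm (g (x + t *\<^sub>R (y - x))))) \<partial>lborel) =
      indicator {0<..1} t * ennreal (t powr - real DIM('a)) * (\<integral>\<^sup>+z. indicator (ball z (t * D)) x * ennreal (norm (g z)) \<partial>lborel)"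
    proof (cases "t \<in> {0<..1}")
      case True
      then have t: "t > 0" by simp
      have m[measurable]: "(\<lambda>z. indicator (ball z (t * D)) x * ennreal (norm (g z))) \<in> borel_measurable borel"
      proof -
        have "(\<lambda>z. indicator (ball z (t * D)) x * ennreal (norm (g z))) = (\<lambda>z. indicator (ball x (t * D)) z * ennreal (norm (g z)))"
          by (auto simp: indicator_def dist_commute)
        moreover have gen: "(\<lambda>z. indicator Sz z * ennreal (norm (g z))) \<in> borel_measurable borel" if "Sz \<in> sets borel" for Sz
          using that by measurable
        have "(\<lambda>z. indicator (ball x (t * D)) z * ennreal (norm (g z))) \<in> borel_measurable borel"
          by (rule gen) simp
        ultimately show ?thesis by metis
      qed
      have "(\<integral>\<^sup>+z. indicator (ball z (t * D)) x * ennreal (norm (g z)) \<partial>lborel) =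
         ennreal (\<bar>t\<bar> ^ DIM('a)) * (\<integral>\<^sup>+y. indicator (ball ((x - t *\<^sub>R x) + t *\<^sub>R y) (t * D)) x * ennreal (norm (g ((x - t *\<^sub>R x) + t *\<^sub>R y))) \<partial>lborel)"
        by (rule nn_integral_lborel_affine[OF m]) (use t in auto)
      also have "(\<lambda>y. indicator (ball ((x - t *\<^sub>R x) + t *\<^sub>R y) (t * D)) x * ennreal (norm (g ((x - t *\<^sub>R x) + t *\<^sub>R y))))
         = (\<lambda>y. indicator S y * ennreal (norm (g (x + t *\<^sub>R (y - x)))))"
      proof
        fix y
        have eq: "(x - t *\<^sub>R x) + t *\<^sub>R y = x + t *\<^sub>R (y - x)" by (simp add: algebra_simps)
        have "dist (x + t *\<^sub>R (y - x)) x = t * dist x y" using t by (simp add: dist_norm norm_minus_commute)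
        then show "indicator (ball ((x - t *\<^sub>R x) + t *\<^sub>R y) (t * D)) x * ennreal (norm (g ((x - t *\<^sub>R x) + t *\<^sub>R y)))
          = indicator S y * ennreal (norm (g (x + t *\<^sub>R (y - x))))"
          unfolding eq using t by (simp add: indicator_def S_def)
      qed
      finally have "ennreal (t powr - real DIM('a)) * (\<integral>\<^sup>+z. indicator (ball z (t * D)) x * ennreal (norm (g z)) \<partial>lborel) =
        ennreal (t powr - real DIM('a)) * ennreal (\<bar>t\<bar> ^ DIM('a)) * (\<integral>\<^sup>+y. indicator S y * ennreal (norm (g (x + t *\<^sub>R (y - x)))) \<partial>lborel)"
        by (simp add: mult.assoc)
      also have "ennreal (t powr - real DIM('a)) * ennreal (\<bar>t\<bar> ^ DIM('a)) = 1"
        using t by (simp add: ennreal_mult[symmetric] powr_realpow[symmetric] powr_add[symmetric] del: powr_realpow)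
      finally show ?thesis using True by simp
    qed simp
  qed
  finally show ?thesis by (simp add: D_def)
qed

lemma nn_integral_powr_01:
  assumes "0 \<le> a" "a < 1"
  shows "(\<integral>\<^sup>+t. indicator {0<..1::real} t * ennreal (t powr - a) \<partial>lborel) < \<infinity>"
proof -
  have "((\<lambda>t. t powr - a) has_integral 1 powr (- a + 1) / (- a + 1)) {0..1}"
    by (rule has_integral_powr_from_0) (use assms in auto)
  then have "((\<lambda>t. if t \<in> {0..1} then t powr - a else 0) has_integral 1 / (1 - a)) UNIV"
    by (subst has_integral_restrict_UNIV) simp
  moreover have "(\<lambda>t. if t \<in> {0..1} then t powr - a else 0) = (\<lambda>t. indicator {0..1} t * t powr - a)"
    by (auto simp: indicator_def)
  ultimately have h: "((\<lambda>t. indicator {0..1} t * t powr - a) has_integral 1 / (1 - a)) UNIV"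
    by metis
  have "(\<integral>\<^sup>+t. ennreal (indicator {0..1} t * t powr - a) \<partial>lborel) < \<infinity>"
    using nn_integral_has_integral_lebesgue[OF _ h] by simp
  moreover have "(\<integral>\<^sup>+t. indicator {0<..1::real} t * ennreal (t powr - a) \<partial>lborel) \<le> (\<integral>\<^sup>+t. ennreal (indicator {0..1} t * t powr - a) \<partial>lborel)"
    by (intro nn_integral_mono) (auto simp: indicator_def)
  ultimately show ?thesis by (rule order.strict_trans1[rotated])
qed

text \<open>Insert \<open>potential_estimate\<close> and integrate in x first: the integral of |h|
  over a ball of radius t D is at most a constant times B (t D)^(n - n/q) by
  \<open>ball_L1_bound\<close>. Against the Jacobian t^(-n) this leaves t^(-n/q), which is
  integrable at 0 because q > n.\<close>

lemma weighted_poincare_test: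
  fixes R q :: real
  assumes R: "R > 0" and q: "q > DIM('a::euclidean_space)"
  shows "\<exists>K\<ge>0. \<forall>(\<phi> :: 'a \<Rightarrow> real) g h B. C1_grad \<phi> g \<longrightarrow> (\<forall>x. norm x \<ge> R \<longrightarrow> \<phi> x = 0) \<longrightarrow>
     h \<in> borel_measurable borel \<longrightarrow> B > 0 \<longrightarrow> (\<integral>\<^sup>+x. ennreal (\<bar>h x\<bar> powr q) \<partial>lborel) \<le> ennreal (B powr q) \<longrightarrow>
     (\<integral>\<^sup>+x. ennreal (\<bar>h x\<bar> * \<bar>\<phi> x\<bar>) \<partial>lborel) \<le> ennreal (K * B) * (\<integral>\<^sup>+x. ennreal (norm (g x)) \<partial>lborel)"
proof -
  define n where "n = real DIM('a)"
  have n1: "n \<ge> 1" by (simp add: n_def DIM_ge_Suc0 Suc_leI)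
  have nq: "q > n" "q > 1" "q > 0" using q n1 unfolding n_def by linarith+
  define c where "c = measure lborel (ball (0::'a) 1)"
  have c0: "c \<ge> 0" by (simp add: c_def)
  define D where "D = 6 * R"
  have D: "D > 0" using R by (simp add: D_def)
  define I0 where "I0 = enn2real (\<integral>\<^sup>+t. indicator {0<..1::real} t * ennreal (t powr - (n / q)) \<partial>lborel)"
  have I0: "(\<integral>\<^sup>+t. indicator {0<..1::real} t * ennreal (t powr - (n / q)) \<partial>lborel) = ennreal I0" "I0 \<ge> 0"
    unfolding I0_def using nn_integral_powr_01[of "n/q"] nq n1 by auto
  define V where "V = measure lborel (ball (0::'a) R)"
  have V: "emeasure lborel (ball (0::'a) R) = ennreal V"
    unfolding V_def using emeasure_bounded_finite[OF bounded_ball, of "0::'a" R] by (auto simp: emeasure_eq_ennreal_measure)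
  have V0: "V > 0" unfolding V_def using content_ball_pos[OF R, of "0::'a"] by simp
  \<comment> \<open>The factors in turn: the bound D on the segment length, the constant of
    \<open>ball_L1_bound\<close> at scale D, the integral over t, and division by the measure V of
    the ball used for averaging.\<close>
  define K where "K = D * ((1 + c) * D powr (n - n / q)) * I0 / V"
  have K: "K \<ge> 0" using D c0 I0 V0 by (simp add: K_def)
  have main: "(\<integral>\<^sup>+x. ennreal (\<bar>h x\<bar> * \<bar>\<phi> x\<bar>) \<partial>lborel) \<le> ennreal (K * B) * (\<integral>\<^sup>+x. ennreal (norm (g x)) \<partial>lborel)"
    if C: "C1_grad \<phi> g" and s: "\<forall>x. norm x \<ge> R \<longrightarrow> \<phi> x = 0" and h[measurable]: "h \<in> borel_measurable borel"
      and B: "B > 0" and hB: "(\<integral>\<^sup>+x. ennreal (\<bar>h x\<bar> powr q) \<partial>lborel) \<le> ennreal (B powr q)"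
    for \<phi> :: "'a \<Rightarrow> real" and g h B
  proof -
    note [measurable] = C1_grad_borel[OF C]
    let ?A = "\<lambda>x t z. ennreal \<bar>h x\<bar> * (indicator {0<..1} t * ennreal (t powr - n) * (indicator (ball z (t * D)) x * ennreal (norm (g z))))"
    let ?I = "\<lambda>x. \<integral>\<^sup>+p. ?A x (fst p) (snd p) \<partial>lborel"
    \<comment> \<open>Joint measurability needs attention only for the indicator of a ball whose
      centre and radius are variables too: it is the indicator of an open set in the product
      space.\<close>
    have mA: "(\<lambda>(x, p). ?A x (fst p) (snd p)) \<in> borel_measurable (lborel \<Otimes>\<^sub>M lborel)"
    proof -
      have *: "(\<lambda>p. indicator (ball (snd (snd p)) (fst (snd p) * D)) (fst p) :: ennreal) = indicator {p. dist (snd (snd p)) (fst p) < fst (snd p) * D}"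
        by (auto simp: fun_eq_iff indicator_def)
      have "{p :: 'a \<times> real \<times> 'a. dist (snd (snd p)) (fst p) < fst (snd p) * D} \<in> sets borel"
        by (intro borel_open open_Collect_less continuous_intros)
      then have [measurable]: "(\<lambda>p. indicator (ball (snd (snd p)) (fst (snd p) * D)) (fst p) :: ennreal) \<in> borel_measurable (borel :: ('a \<times> real \<times> 'a) measure)"
        unfolding * by simp
      have [measurable]: "fst \<in> borel \<rightarrow>\<^sub>M (borel :: 'b::euclidean_space measure)" "snd \<in> borel \<rightarrow>\<^sub>M (borel :: 'c::euclidean_space measure)"
        by (auto intro!: borel_measurable_continuous_onI continuous_intros)
      have "(\<lambda>q. ?A (fst q) (fst (snd q)) (snd (snd q))) \<in> borel_measurable borel" by measurable
      then show ?thesis by (simp add: case_prod_beta lborel_prod)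
    qed
    have mI: "?I \<in> borel_measurable lborel"
      using lborel.borel_measurable_nn_integral[OF mA] by simp
    \<comment> \<open>Treating (t, z) as one variable lets a single application of Fubini bring the
      x-integral inside.\<close>
    have tz: "(\<integral>\<^sup>+t. (\<integral>\<^sup>+z. F (t, z) \<partial>lborel) \<partial>lborel) = (\<integral>\<^sup>+p. F p \<partial>lborel)"
      if "F \<in> borel_measurable (lborel \<Otimes>\<^sub>M lborel)" for F :: "real \<times> 'a \<Rightarrow> ennreal"
      using lborel.nn_integral_fst[OF that] by (simp add: lborel_prod)
    have mAx: "(\<lambda>p. ?A x (fst p) (snd p)) \<in> borel_measurable (lborel \<Otimes>\<^sub>M lborel)" for x
      using measurable_Pair2[OF mA, of x] by (simp add: lborel_prod)
    have pt: "ennreal V * ennreal (\<bar>h x\<bar> * \<bar>\<phi> x\<bar>) \<le> ennreal D * ?I x" for x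
    proof (cases "norm x < R")
      case True
      have "ennreal V * ennreal (\<bar>h x\<bar> * \<bar>\<phi> x\<bar>) = ennreal \<bar>h x\<bar> * (emeasure lborel (ball (0::'a) R) * ennreal \<bar>\<phi> x\<bar>)"
        by (simp add: V ennreal_mult mult_ac)
      also have "\<dots> \<le> ennreal \<bar>h x\<bar> * (ennreal D * (\<integral>\<^sup>+t. indicator {0<..1} t * ennreal (t powr - n) *
         (\<integral>\<^sup>+z. indicator (ball z (t * D)) x * ennreal (norm (g z)) \<partial>lborel) \<partial>lborel))"
        unfolding D_def n_def using s by (intro mult_left_mono potential_estimate[OF R C _ True]) auto
      also have "\<dots> = ennreal D * (ennreal \<bar>h x\<bar> * (\<integral>\<^sup>+t. indicator {0<..1} t * ennreal (t powr - n) *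
         (\<integral>\<^sup>+z. indicator (ball z (t * D)) x * ennreal (norm (g z)) \<partial>lborel) \<partial>lborel))"
        by (simp add: mult_ac)
      also have "ennreal \<bar>h x\<bar> * (\<integral>\<^sup>+t. indicator {0<..1} t * ennreal (t powr - n) *
         (\<integral>\<^sup>+z. indicator (ball z (t * D)) x * ennreal (norm (g z)) \<partial>lborel) \<partial>lborel) = ?I x"
      proof -
        define Sx where "Sx = {p. dist (snd p) x < fst p * D}"
        have Sx: "Sx \<in> sets borel" unfolding Sx_def by (intro borel_open open_Collect_less continuous_intros)
        have ind: "indicator (ball z (t * D)) x = (indicator Sx (t, z) :: ennreal)" for t z by (auto simp: Sx_def indicator_def)
        have [measurable]: "(\<lambda>(t, z). indicator Sx (t, z) :: ennreal) \<in> borel_measurable (lborel \<Otimes>\<^sub>M lborel)"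
          using Sx by (simp add: lborel_prod)
        have [measurable]: "(\<lambda>z. indicator Sx (t, z) :: ennreal) \<in> borel_measurable lborel" for t
          using measurable_Pair2[OF \<open>(\<lambda>(t, z). indicator Sx (t, z) :: ennreal) \<in> borel_measurable (lborel \<Otimes>\<^sub>M lborel)\<close>, of t] by simp
        have mm: "(\<lambda>t. \<integral>\<^sup>+z. indicator Sx (t, z) * ennreal (norm (g z)) \<partial>lborel) \<in> borel_measurable lborel"
          by (rule lborel.borel_measurable_nn_integral) measurable
        have "?I x = (\<integral>\<^sup>+t. (\<integral>\<^sup>+z. ?A x t z \<partial>lborel) \<partial>lborel)"
          using tz[OF mAx[of x]] by simp
        also have "\<dots> = (\<integral>\<^sup>+t. ennreal \<bar>h x\<bar> * (indicator {0<..1} t * ennreal (t powr - n) * (\<integral>\<^sup>+z. indicator Sx (t, z) * ennreal (norm (g z)) \<partial>lborel)) \<partial>lborel)"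
          unfolding ind by (simp add: nn_integral_cmult)
        also have "\<dots> = ennreal \<bar>h x\<bar> * (\<integral>\<^sup>+t. indicator {0<..1} t * ennreal (t powr - n) * (\<integral>\<^sup>+z. indicator Sx (t, z) * ennreal (norm (g z)) \<partial>lborel) \<partial>lborel)"
          using mm by (intro nn_integral_cmult) measurable
        finally show ?thesis unfolding ind by simp
      qed
      finally show ?thesis .
    qed (use s in simp)
    have "ennreal V * (\<integral>\<^sup>+x. ennreal (\<bar>h x\<bar> * \<bar>\<phi> x\<bar>) \<partial>lborel) \<le> ennreal D * (\<integral>\<^sup>+x. ?I x \<partial>lborel)"
    proof -
      have "ennreal V * (\<integral>\<^sup>+x. ennreal (\<bar>h x\<bar> * \<bar>\<phi> x\<bar>) \<partial>lborel) = (\<integral>\<^sup>+x. ennreal V * ennreal (\<bar>h x\<bar> * \<bar>\<phi> x\<bar>) \<partial>lborel)"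
        by (rule nn_integral_cmult[symmetric]) measurable
      also have "\<dots> \<le> (\<integral>\<^sup>+x. ennreal D * ?I x \<partial>lborel)"
        by (rule nn_integral_mono) (rule pt)
      also have "\<dots> = ennreal D * (\<integral>\<^sup>+x. ?I x \<partial>lborel)"
        by (rule nn_integral_cmult[OF mI])
      finally show ?thesis .
    qed
    also have "(\<integral>\<^sup>+x. ?I x \<partial>lborel) = (\<integral>\<^sup>+p. (\<integral>\<^sup>+x. ?A x (fst p) (snd p) \<partial>lborel) \<partial>lborel)"
      by (rule lborel_pair.Fubini'[symmetric]) (rule mA)
    also have "\<dots> \<le> (\<integral>\<^sup>+p. (indicator {0<..1} (fst p) * ennreal (fst p powr - (n / q))) * (ennreal (norm (g (snd p))) * ennreal ((1 + c) * B * D powr (n - n / q))) \<partial>lborel)"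
    proof (rule nn_integral_mono)
      fix p :: "real \<times> 'a"
      obtain t z where p: "p = (t, z)" by (cases p)
      show "(\<integral>\<^sup>+x. ?A x (fst p) (snd p) \<partial>lborel) \<le> (indicator {0<..1} (fst p) * ennreal (fst p powr - (n / q))) * (ennreal (norm (g (snd p))) * ennreal ((1 + c) * B * D powr (n - n / q)))"
      proof (cases "t \<in> {0<..1}")
        case True
        then have t: "t > 0" by simp
        have "(\<integral>\<^sup>+x. ?A x (fst p) (snd p) \<partial>lborel) = (\<integral>\<^sup>+x. (ennreal (t powr - n) * ennreal (norm (g z))) * (indicator (ball z (t * D)) x * ennreal \<bar>h x\<bar>) \<partial>lborel)"
          using True by (intro nn_integral_cong) (simp add: p mult_ac)
        also have "\<dots> = (ennreal (t powr - n) * ennreal (norm (g z))) * (\<integral>\<^sup>+x. indicator (ball z (t * D)) x * ennreal \<bar>h x\<bar> \<partial>lborel)"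
        proof (rule nn_integral_cmult)
          define Sz where "Sz = ball z (t * D)"
          have [measurable]: "Sz \<in> sets borel" by (simp add: Sz_def)
          show "(\<lambda>x. indicator (ball z (t * D)) x * ennreal \<bar>h x\<bar>) \<in> borel_measurable lborel"
            unfolding Sz_def[symmetric] by measurable
        qed
        also have "\<dots> \<le> (ennreal (t powr - n) * ennreal (norm (g z))) * ennreal ((1 + c) * B * (t * D) powr (n - n / q))"
          unfolding c_def n_def using t D by (intro mult_left_mono ball_L1_bound[OF h nq(2) B _ hB]) auto
        also have "(t * D) powr (n - n / q) = t powr n * t powr (- (n / q)) * D powr (n - n / q)"
          using t D by (simp add: powr_mult powr_add[symmetric])
        also have "(ennreal (t powr - n) * ennreal (norm (g z))) * ennreal ((1 + c) * B * (t powr n * t powr (- (n / q)) * D powr (n - n / q)))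
          = ennreal (t powr - n * norm (g z) * ((1 + c) * B * (t powr n * t powr (- (n / q)) * D powr (n - n / q))))"
          using c0 B by (simp add: ennreal_mult[symmetric])
        also have "t powr - n * norm (g z) * ((1 + c) * B * (t powr n * t powr (- (n / q)) * D powr (n - n / q)))
          = (t powr - n * t powr n) * (t powr (- (n / q)) * (norm (g z) * ((1 + c) * B * D powr (n - n / q))))"
          by (simp add: mult_ac)
        also have "t powr - n * t powr n = 1" using t by (simp flip: powr_add)
        finally show ?thesis using True c0 B by (simp add: p ennreal_mult)
      qed (simp add: p)
    qed
    also have "\<dots> = (\<integral>\<^sup>+t. (\<integral>\<^sup>+z. (indicator {0<..1} t * ennreal (t powr - (n / q))) * (ennreal (norm (g z)) * ennreal ((1 + c) * B * D powr (n - n / q))) \<partial>lborel) \<partial>lborel)"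
    proof -
      have "(\<lambda>p. (indicator {0<..1} (fst p) * ennreal (fst p powr - (n / q))) * (ennreal (norm (g (snd p))) * ennreal ((1 + c) * B * D powr (n - n / q)))) \<in> borel_measurable (lborel \<Otimes>\<^sub>M lborel)"
        by measurable
      from tz[OF this] show ?thesis by simp
    qed
    also have "\<dots> = ennreal I0 * ((\<integral>\<^sup>+z. ennreal (norm (g z)) \<partial>lborel) * ennreal ((1 + c) * B * D powr (n - n / q)))"
      by (simp add: nn_integral_cmult nn_integral_multc I0(1))
    also have "ennreal D * \<dots> = ennreal V * (ennreal (K * B) * (\<integral>\<^sup>+z. ennreal (norm (g z)) \<partial>lborel))"
    proof -
      have "D * (I0 * ((1 + c) * B * D powr (n - n / q))) = V * (K * B)" using V0 by (simp add: K_def)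
      then have "ennreal D * (ennreal I0 * ennreal ((1 + c) * B * D powr (n - n / q))) = ennreal V * ennreal (K * B)"
        using D I0(2) c0 B V0 K by (simp add: ennreal_mult[symmetric])
      then have "ennreal D * (ennreal I0 * ennreal ((1 + c) * B * D powr (n - n / q))) * X = ennreal V * ennreal (K * B) * X" for X
        by simp
      moreover have "a * (b * (x * w)) = a * (b * w) * x" for a b x w :: ennreal by (simp add: mult_ac)
      ultimately show ?thesis by (metis mult.assoc)
    qed
    finally have "ennreal V * (\<integral>\<^sup>+x. ennreal (\<bar>h x\<bar> * \<bar>\<phi> x\<bar>) \<partial>lborel) \<le> ennreal V * (ennreal (K * B) * (\<integral>\<^sup>+z. ennreal (norm (g z)) \<partial>lborel))"
      by (auto simp: mult_left_mono)
    then show ?thesis using V0 by (subst (asm) ennreal_mult_le_mult_iff) auto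
  qed
  show ?thesis using K main by blast
qed

section \<open>Uniform convexity of the modular\<close>

lemma powr_tangent_1:
  fixes z p :: real
  assumes "p > 1" "z \<ge> 0" "z \<noteq> 1"
  shows "z powr p > 1 + p * (z - 1)"
proof (cases "z = 0")
  case True
  then show ?thesis using assms by simp
next
  case False
  then have z: "z > 0" using assms by simp
  have D: "((\<lambda>t. t powr p - 1 - p * (t - 1)) has_real_derivative p * (t powr (p - 1) - 1)) (at t)" if "t > 0" for t
    using that by (auto intro!: derivative_eq_intros simp: algebra_simps)
  consider "z > 1" | "z < 1" using assms by linarith
  then show ?thesis
  proof cases
    case 1
    obtain c where c: "c > 1" "c < z" "(z powr p - 1 - p * (z - 1)) - (1 powr p - 1 - p * (1 - 1)) = (z - 1) * (p * (c powr (p - 1) - 1))"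
      using MVT2[OF 1, of "\<lambda>t. t powr p - 1 - p * (t - 1)" "\<lambda>t. p * (t powr (p - 1) - 1)"] D by auto
    have "c powr (p - 1) > 1" using c assms powr_less_mono2[of "p - 1" 1 c] by simp
    then have "(z - 1) * (p * (c powr (p - 1) - 1)) > 0" using 1 assms by simp
    then show ?thesis using c(3) by simp
  next
    case 2
    obtain c where c: "c > z" "c < 1" "(1 powr p - 1 - p * (1 - 1)) - (z powr p - 1 - p * (z - 1)) = (1 - z) * (p * (c powr (p - 1) - 1))"
      using MVT2[OF 2, of "\<lambda>t. t powr p - 1 - p * (t - 1)" "\<lambda>t. p * (t powr (p - 1) - 1)"] D z by auto
    have "c powr (p - 1) < 1" using c z assms powr_less_mono2[of "p - 1" c 1] by simp
    then have "(1 - z) * (p * (c powr (p - 1) - 1)) < 0" using 2 assms by (intro mult_pos_neg) auto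
    then show ?thesis using c(3) by simp
  qed
qed

lemma powr_tangent:
  fixes x y p :: real
  assumes "p > 1" "x > 0" "y \<ge> 0"
  shows "y powr p \<ge> x powr p + p * x powr (p - 1) * (y - x)"
    and "y \<noteq> x \<Longrightarrow> y powr p > x powr p + p * x powr (p - 1) * (y - x)"
proof -
  have eq: "x powr p * (1 + p * (y / x - 1)) = x powr p + p * x powr (p - 1) * (y - x)"
  proof -
    have "x powr p = x powr (p - 1) * x" using powr_mult_base[of x "p - 1"] assms by (simp add: mult.commute)
    then show ?thesis using assms by (simp add: field_simps)
  qed
  have yx: "y powr p = x powr p * (y / x) powr p" using assms by (simp add: powr_divide)
  show s: "y powr p > x powr p + p * x powr (p - 1) * (y - x)" if "y \<noteq> x"
  proof -
    have "(y / x) powr p > 1 + p * (y / x - 1)" by (rule powr_tangent_1) (use assms that in auto)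
    then have "x powr p * (y / x) powr p > x powr p * (1 + p * (y / x - 1))" using assms by simp
    then show ?thesis using eq yx by simp
  qed
  show "y powr p \<ge> x powr p + p * x powr (p - 1) * (y - x)"
    using s by (cases "y = x") auto
qed

lemma midpoint_arith:
  fixes A S T a b :: real
  assumes "A + b \<le> T" "a + b = 0"
  shows "A + a \<le> S \<Longrightarrow> A \<le> (S + T) / 2" "A + a < S \<Longrightarrow> A < (S + T) / 2"
  using assms by simp_all

lemma near_min_arith:
  fixes E F mi mj di dj dN mc :: real
  assumes "mi \<le> di + E" "mj \<le> dj + E" "di \<le> dN + E" "dj \<le> dN + E" "dN \<le> mc" "E + E = F"
  shows "(mi + mj) / 2 - mc \<le> F"
proof -
  have "mi + mj \<le> (dN + E + E) + (dN + E + E)" using assms(1-4) by (intro add_mono) linarith+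
  then show ?thesis using assms(5,6) by (simp add: field_simps)
qed

text \<open>Add the tangent inequalities at the midpoint for s and for t: the two linear terms
  cancel.\<close>

lemma powr_midpoint:
  fixes s t p :: real
  assumes "p > 1" "s \<ge> 0" "t \<ge> 0"
  shows "((s + t) / 2) powr p \<le> (s powr p + t powr p) / 2"
    and "s \<noteq> t \<Longrightarrow> ((s + t) / 2) powr p < (s powr p + t powr p) / 2"
proof -
  define x where "x = (s + t) / 2"
  have e: "p * x powr (p - 1) * (s - x) + p * x powr (p - 1) * (t - x) = 0"
    by (simp add: x_def field_simps)
  show "((s + t) / 2) powr p \<le> (s powr p + t powr p) / 2"
  proof (cases "s + t = 0")
    case False
    then have "x > 0" using assms by (simp add: x_def)
    from midpoint_arith(1)[OF powr_tangent(1)[OF assms(1) this assms(3)] e powr_tangent(1)[OF assms(1) this assms(2)]]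
    show ?thesis unfolding x_def[symmetric] .
  qed (use assms in simp)
  assume ne: "s \<noteq> t"
  then have x: "x > 0" "s \<noteq> x" using assms by (auto simp: x_def)
  from midpoint_arith(2)[OF powr_tangent(1)[OF assms(1) x(1) assms(3)] e powr_tangent(2)[OF assms(1) x(1) assms(2) x(2)]]
  show "((s + t) / 2) powr p < (s powr p + t powr p) / 2" unfolding x_def[symmetric] .
qed

text \<open>The defect in midpoint convexity of |z|^p. Its integral is what remains when the
  modulars of two functions are compared with the modular of their midpoint.\<close>

definition powr_gap :: "real \<Rightarrow> 'b::real_inner \<Rightarrow> 'b \<Rightarrow> real" where
  "powr_gap p a b = (norm a powr p + norm b powr p) / 2 - norm ((1/2) *\<^sub>R (a + b)) powr p"

text \<open>Strictness has two sources. If the norms differ, t^p is strictly convex on the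
  half-line; if they agree, the parallelogram law makes the midpoint strictly shorter.\<close>

lemma powr_gap:
  fixes a b :: "'b::real_inner"
  assumes p: "p > 1"
  shows "powr_gap p a b \<ge> 0" "a \<noteq> b \<Longrightarrow> powr_gap p a b > 0"
proof -
  have le: "norm ((1/2) *\<^sub>R (a + b)) \<le> (norm a + norm b) / 2" using norm_triangle_ineq[of a b] by simp
  have 1: "norm ((1/2) *\<^sub>R (a + b)) powr p \<le> ((norm a + norm b) / 2) powr p"
    using le p by (intro powr_mono2) auto
  show "powr_gap p a b \<ge> 0" using 1 powr_midpoint(1)[OF p, of "norm a" "norm b"] by (simp add: powr_gap_def)
  assume ne: "a \<noteq> b"
  show "powr_gap p a b > 0"
  proof (cases "norm a = norm b")
    case False
    then show ?thesis using 1 powr_midpoint(2)[OF p, of "norm a" "norm b"] by (simp add: powr_gap_def)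
  next
    case True
    have "(norm (a + b))\<^sup>2 + (norm (a - b))\<^sup>2 = 2 * (norm a)\<^sup>2 + 2 * (norm b)\<^sup>2"
      by (simp add: power2_norm_eq_inner inner_add_left inner_add_right inner_diff_left inner_diff_right inner_commute)
    then have "(norm (a + b))\<^sup>2 = (2 * norm a)\<^sup>2 - (norm (a - b))\<^sup>2" using True by (simp add: power_mult_distrib)
    moreover have "(norm (a - b))\<^sup>2 > 0" using ne by simp
    ultimately have "(norm (a + b))\<^sup>2 < (2 * norm a)\<^sup>2" by linarith
    then have "norm (a + b) < 2 * norm a" by (rule power2_less_imp_less) simp
    then have "norm ((1/2) *\<^sub>R (a + b)) powr p < norm a powr p" using p by (intro powr_less_mono2) auto
    then show ?thesis using True by (simp add: powr_gap_def)
  qed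
qed

lemma powr_add_le:
  fixes a b p pp :: real
  assumes "0 \<le> a" "0 \<le> b" "0 \<le> p" "p \<le> pp"
  shows "(a + b) powr p \<le> 2 powr pp * (a powr p + b powr p)"
proof -
  have "(a + b) powr p \<le> (2 * max a b) powr p" using assms by (intro powr_mono2) auto
  also have "\<dots> = 2 powr p * (max a b) powr p" using assms by (simp add: powr_mult)
  also have "\<dots> \<le> 2 powr pp * (a powr p + b powr p)"
    using assms by (intro mult_mono powr_mono) (auto simp: max_def)
  finally show ?thesis .
qed

text \<open>By homogeneity it suffices to bound the gap below on the unit sphere of pairs, where compactness applies.\<close>
lemma uniform_convexity_powr:
  assumes pm: "pm > 1" "pm \<le> pp" and \<epsilon>: "\<epsilon> > 0"
  shows "\<exists>C>0. \<forall>p a (b::'b::euclidean_space). pm \<le> p \<longrightarrow> p \<le> pp \<longrightarrow>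
     norm (a - b) powr p \<le> \<epsilon> * (norm a powr p + norm b powr p) + C * powr_gap p a b"
proof -
  \<comment> \<open>For nearby directions |a - b| \<le> r \<delta>. As \<delta> \<le> 1 and p \<ge>
    1, \<delta>^p \<le> \<delta>, and r \<le> |a| + |b| costs at most the factor
    \<open>2 powr pp\<close>; together this stays below \<epsilon>.\<close>
  define \<delta> where "\<delta> = min 1 (\<epsilon> / 2 powr pp)"
  have \<delta>: "\<delta> > 0" "\<delta> \<le> 1" "\<delta> * 2 powr pp \<le> \<epsilon>"
  proof -
    show "\<delta> > 0" "\<delta> \<le> 1" using \<epsilon> by (auto simp: \<delta>_def)
    have "\<delta> \<le> \<epsilon> / 2 powr pp" by (simp add: \<delta>_def)
    then show "\<delta> * 2 powr pp \<le> \<epsilon>" by (simp add: pos_le_divide_eq)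
  qed
  \<comment> \<open>The exponent is made a coordinate of the compact set, so the minimum of the gap
    is uniform in p as well.\<close>
  define S where "S = {pm..pp} \<times> {x :: 'b \<times> 'b. norm x = 1 \<and> \<delta> \<le> norm (fst x - snd x)}"
  have S: "compact S"
  proof -
    have "{x :: 'b \<times> 'b. norm x = 1 \<and> \<delta> \<le> norm (fst x - snd x)} = sphere 0 1 \<inter> {x. \<delta> \<le> norm (fst x - snd x)}"
      by auto
    moreover have "closed {x :: 'b \<times> 'b. \<delta> \<le> norm (fst x - snd x)}" by (intro closed_Collect_le continuous_intros)
    ultimately show ?thesis unfolding S_def by (simp add: compact_Times compact_Int_closed)
  qed
  have cont: "continuous_on S (\<lambda>(p, x). powr_gap p (fst x) (snd x))"
    unfolding powr_gap_def case_prod_beta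
    by (intro continuous_intros continuous_on_powr') (use pm in \<open>auto simp: S_def\<close>)
  have "\<exists>m>0. \<forall>y\<in>S. m \<le> (\<lambda>(p, x). powr_gap p (fst x) (snd x)) y"
  proof (cases "S = {}")
    case False
    from continuous_attains_inf[OF S False cont] obtain y where y: "y \<in> S"
      "\<And>z. z \<in> S \<Longrightarrow> (\<lambda>(p, x). powr_gap p (fst x) (snd x)) y \<le> (\<lambda>(p, x). powr_gap p (fst x) (snd x)) z" by blast
    obtain p a b where yp: "y = (p, (a, b))" by (metis surj_pair)
    have "a \<noteq> b" "p > 1" using y(1) \<delta> pm by (auto simp: yp S_def)
    then have "powr_gap p a b > 0" by (intro powr_gap) auto
    then show ?thesis using y(2) by (intro exI[of _ "powr_gap p a b"]) (auto simp: yp)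
  qed (auto intro: exI[of _ 1])
  then obtain m where m: "m > 0" "\<And>p a b. (p, (a, b)) \<in> S \<Longrightarrow> m \<le> powr_gap p a b" by fastforce
  define C where "C = 2 powr pp / m"
  have C: "C > 0" using m by (simp add: C_def)
  have "norm (a - b) powr p \<le> \<epsilon> * (norm a powr p + norm b powr p) + C * powr_gap p a b" if p: "pm \<le> p" "p \<le> pp" for p and a b :: 'b
  proof (cases "a = 0 \<and> b = 0")
    case True
    then show ?thesis using \<epsilon> by (simp add: powr_gap_def)
  next
    case False
    define r where "r = norm (a, b)"
    have r: "r > 0" using False by (simp add: r_def zero_prod_def)
    have rle: "r \<le> norm a + norm b" unfolding r_def by (rule norm_Pair_le)
    have rge: "norm a \<le> r" "norm b \<le> r" using norm_fst_le[of a b] norm_snd_le[of b a] by (auto simp: r_def)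
    have gap0: "powr_gap p a b \<ge> 0" using powr_gap(1)[of p a b] p pm by simp
    define a' where "a' = a /\<^sub>R r"
    define b' where "b' = b /\<^sub>R r"
    have ab: "a = r *\<^sub>R a'" "b = r *\<^sub>R b'" using r by (auto simp: a'_def b'_def)
    have n1: "norm (a', b') = 1"
    proof -
      have "(a, b) = r *\<^sub>R (a', b')" using ab by simp
      then have "r = r * norm (a', b')" using r unfolding r_def by (metis norm_scaleR abs_of_pos r_def)
      then show ?thesis using r by simp
    qed
    show ?thesis
    proof (cases "\<delta> \<le> norm (a' - b')")
      case True
      then have "m \<le> powr_gap p a' b'" using n1 p by (intro m) (auto simp: S_def)
      moreover have "powr_gap p a b = r powr p * powr_gap p a' b'"
      proof -
        have "norm ((1/2) *\<^sub>R (a + b)) = r * norm ((1/2) *\<^sub>R (a' + b'))"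
          unfolding ab using r by (simp flip: scaleR_add_right)
        then have 1: "norm ((1/2) *\<^sub>R (a + b)) powr p = r powr p * norm ((1/2) *\<^sub>R (a' + b')) powr p"
          by (simp only: powr_mult)
        have "norm a = r * norm a'" "norm b = r * norm b'" using ab r by simp_all
        then have 2: "norm a powr p = r powr p * norm a' powr p" "norm b powr p = r powr p * norm b' powr p"
          by (simp_all only: powr_mult)
        show ?thesis unfolding powr_gap_def 1 2 by (simp only: right_diff_distrib distrib_left add_divide_distrib times_divide_eq_right)
      qed
      ultimately have "r powr p * m \<le> powr_gap p a b" using r by (simp add: mult_left_mono)
      then have "C * (r powr p * m) \<le> C * powr_gap p a b" using C by (intro mult_left_mono) auto
      then have g: "2 powr pp * r powr p \<le> C * powr_gap p a b" using m by (simp add: C_def)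
      have "norm (a - b) powr p \<le> (2 * r) powr p" using norm_triangle_ineq4[of a b] rge p pm by (intro powr_mono2) auto
      also have "\<dots> = 2 powr p * r powr p" using r by (simp add: powr_mult)
      also have "\<dots> \<le> 2 powr pp * r powr p" using p by (intro mult_right_mono powr_mono) auto
      also note g
      finally show ?thesis using \<epsilon> by (simp add: add_increasing)
    next
      case False
      have "norm (a - b) = r * norm (a' - b')" unfolding ab using r by (simp flip: scaleR_diff_right)
      then have "norm (a - b) \<le> r * \<delta>" using False r by simp
      then have "norm (a - b) powr p \<le> (r * \<delta>) powr p" using p pm by (intro powr_mono2) auto
      also have "\<dots> = \<delta> powr p * r powr p" using r \<delta> by (simp add: powr_mult mult.commute)
      also have "\<dots> \<le> \<delta> powr 1 * (norm a + norm b) powr p"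
        using \<delta> p pm r rle by (intro mult_mono powr_mono' powr_mono2) auto
      also have "\<dots> \<le> \<delta> * (2 powr pp * (norm a powr p + norm b powr p))"
        using \<delta> p pm by (auto intro!: mult_left_mono powr_add_le)
      also have "\<dots> \<le> \<epsilon> * (norm a powr p + norm b powr p)"
        using mult_right_mono[OF \<delta>(3), of "norm a powr p + norm b powr p"] by (simp add: mult.assoc)
      finally show ?thesis using gap0 C by (simp add: add_increasing2)
    qed
  qed
  then show ?thesis using C by blast
qed

section \<open>Comparison of s with its powers, and the modular\<close>

lemma le_one_plus_powr: "0 \<le> s \<Longrightarrow> 1 \<le> p \<Longrightarrow> s \<le> 1 + s powr (p::real)"
proof (cases "s \<le> 1")
  case False
  assume "1 \<le> p"
  then have "s powr 1 \<le> s powr p" using False by (intro powr_mono) auto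
  then show ?thesis using False by simp
qed (simp add: add_increasing2)

text \<open>For s > \<eta> write s = s^(1-p) s^p and bound the first factor by \<eta>^(1-p); since
  \<eta> \<le> 1 the worst exponent is pp, so the constant does not depend on p.\<close>

lemma le_small_plus_powr:
  fixes s \<eta> p pp :: real
  assumes "0 < \<eta>" "\<eta> \<le> 1" "0 \<le> s" "1 \<le> p" "p \<le> pp"
  shows "s \<le> \<eta> + \<eta> powr (1 - pp) * s powr (p::real)"
proof (cases "s \<le> \<eta>")
  case False
  then have s: "s > 0" using assms by simp
  have "s = s powr (1 - p) * s powr p" using s by (simp flip: powr_add)
  also have "\<dots> \<le> \<eta> powr (1 - p) * s powr p" using False assms by (intro mult_right_mono powr_mono2') auto
  also have "\<dots> \<le> \<eta> powr (1 - pp) * s powr p" using assms by (intro mult_right_mono powr_mono') auto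
  finally show ?thesis using assms by simp
qed (use assms in \<open>simp add: add_increasing2\<close>)

text \<open>Beyond the threshold \<epsilon> s^(pm-1) \<ge> 1. The maximum with 1 ensures s > 1
  there, so that pm may be replaced by any larger p; the constant is thus uniform in the
  exponent.\<close>

lemma le_powr_young:
  fixes s \<epsilon> p pm :: real
  assumes "0 < \<epsilon>" "0 \<le> s" "1 < pm" "pm \<le> p"
  shows "s \<le> \<epsilon> * s powr p + max 1 (\<epsilon> powr (1 / (1 - pm)))"
proof (cases "s \<le> max 1 (\<epsilon> powr (1 / (1 - pm)))")
  case False
  have s: "s > 1" "s > \<epsilon> powr (1 / (1 - pm))" using False by (simp_all add: not_le)
  have "(\<epsilon> powr (1 / (1 - pm))) powr (pm - 1) \<le> s powr (pm - 1)" using s assms by (intro powr_mono2) auto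
  moreover have "(\<epsilon> powr (1 / (1 - pm))) powr (pm - 1) = inverse \<epsilon>"
  proof -
    have "(1 / (1 - pm)) * (pm - 1) = -1" using assms by (simp add: field_simps)
    then show ?thesis using assms by (simp add: powr_powr powr_minus)
  qed
  moreover have "s powr (pm - 1) \<le> s powr (p - 1)" using s assms by (intro powr_mono) auto
  ultimately have "inverse \<epsilon> \<le> s powr (p - 1)" by simp
  then have "\<epsilon> * inverse \<epsilon> \<le> \<epsilon> * s powr (p - 1)" using assms by (intro mult_left_mono) auto
  then have "1 \<le> \<epsilon> * s powr (p - 1)" using assms by simp
  then have "s * 1 \<le> s * (\<epsilon> * s powr (p - 1))" using s by (intro mult_left_mono) auto
  also have "\<dots> = \<epsilon> * s powr p" using s by (simp add: powr_mult_base)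
  finally show ?thesis by (simp add: add_increasing2)
qed (use assms in \<open>simp add: add_increasing\<close>)

lemma norm_fst_snd_le: "norm (fst y) \<le> norm y" "norm (snd y) \<le> norm y"
  by (metis norm_fst_le norm_snd_le prod.collapse)+

lemma L1_tendsto_linear:
  fixes F :: "nat \<Rightarrow> 'a \<Rightarrow> 'b::{banach, second_countable_topology}" and T :: "'b \<Rightarrow> 'c::{banach, second_countable_topology}"
  assumes i: "\<And>n. integrable M (F n)" and l: "(\<lambda>n. LINT x|M. norm (F n x)) \<longlonglongrightarrow> 0" and T: "bounded_linear T" "\<And>y. norm (T y) \<le> norm y"
  shows "(\<lambda>n. LINT x|M. norm (T (F n x))) \<longlonglongrightarrow> 0"
proof (rule tendsto_sandwich[OF _ _ tendsto_const l]; intro always_eventually allI)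
  show "(LINT x|M. norm (T (F n x))) \<le> (LINT x|M. norm (F n x))" for n
    by (rule bochner_mono) (use i integrable_bounded_linear[OF T(1) i] T(2) in auto)
qed simp

text \<open>A vector-valued version of \<open>var_modular\<close> over an arbitrary measure: it
  serves functions, gradients and pairs of both, and also constant exponents.\<close>

definition pmod :: "'a measure \<Rightarrow> ('a \<Rightarrow> real) \<Rightarrow> ('a \<Rightarrow> 'b::real_normed_vector) \<Rightarrow> ennreal" where
  "pmod M p h = (\<integral>\<^sup>+x. ennreal (norm (h x) powr p x) \<partial>M)"

text \<open>The lower bound 1 for the exponent is included so that L1 itself becomes an instance,
  see \<open>L1_complete\<close>. The strict bound 1 < pm is assumed where uniform convexity
  enters.\<close>

locale exponent = finite_measure M for M :: "'a measure" +
  fixes p :: "'a \<Rightarrow> real" and pm pp :: real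
  assumes p_meas[measurable]: "p \<in> borel_measurable M"
    and pm: "1 \<le> pm" and pp: "\<And>x. x \<in> space M \<Longrightarrow> pm \<le> p x \<and> p x \<le> pp"
    and pmpp: "pm \<le> pp"
begin

lemma pmod_mono:
  assumes "\<And>x. x \<in> space M \<Longrightarrow> norm (f x) \<le> norm (g x)" shows "pmod M p f \<le> pmod M p g"
  unfolding pmod_def
proof (intro nn_integral_mono ennreal_leI powr_mono2)
  fix x assume "x \<in> space M"
  then show "0 \<le> p x" using pp[of x] pm by linarith
qed (use assms in auto)

lemma pmod_cong_AE: "AE x in M. norm (f x) = norm (g x) \<Longrightarrow> pmod M p f = pmod M p g"
  unfolding pmod_def by (rule nn_integral_cong_AE) auto

lemma pmod_add:
  assumes [measurable]: "f \<in> borel_measurable M" "g \<in> borel_measurable M"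
  shows "pmod M p (\<lambda>x. f x + g x) \<le> ennreal (2 powr pp) * (pmod M p f + pmod M p g)"
proof -
  have "pmod M p (\<lambda>x. f x + g x) \<le> (\<integral>\<^sup>+x. ennreal (2 powr pp) * (ennreal (norm (f x) powr p x) + ennreal (norm (g x) powr p x)) \<partial>M)"
    unfolding pmod_def
  proof (rule nn_integral_mono)
    fix x assume x: "x \<in> space M"
    have "norm (f x + g x) powr p x \<le> (norm (f x) + norm (g x)) powr p x"
      using pp[OF x] pm by (intro powr_mono2 norm_triangle_ineq) auto
    also have "\<dots> \<le> 2 powr pp * (norm (f x) powr p x + norm (g x) powr p x)"
      using pp[OF x] pm by (intro powr_add_le) auto
    finally show "ennreal (norm (f x + g x) powr p x) \<le> ennreal (2 powr pp) * (ennreal (norm (f x) powr p x) + ennreal (norm (g x) powr p x))"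
      by (simp add: ennreal_mult[symmetric] ennreal_plus[symmetric] ennreal_leI del: ennreal_plus)
  qed
  also have "\<dots> = ennreal (2 powr pp) * (pmod M p f + pmod M p g)"
    unfolding pmod_def by (subst nn_integral_cmult; simp add: nn_integral_add)
  finally show ?thesis .
qed

lemma pmod_scale:
  "pmod M p (\<lambda>x. c *\<^sub>R f x) \<le> ennreal (max 1 (\<bar>c\<bar> powr pp)) * pmod M p f" if [measurable]: "f \<in> borel_measurable M"
proof -
  have "pmod M p (\<lambda>x. c *\<^sub>R f x) \<le> (\<integral>\<^sup>+x. ennreal (max 1 (\<bar>c\<bar> powr pp)) * ennreal (norm (f x) powr p x) \<partial>M)"
    unfolding pmod_def
  proof (rule nn_integral_mono)
    fix x assume x: "x \<in> space M"
    have "\<bar>c\<bar> powr p x \<le> max 1 (\<bar>c\<bar> powr pp)"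
    proof (cases "\<bar>c\<bar> \<le> 1")
      case True
      then have "\<bar>c\<bar> powr p x \<le> 1 powr p x" using pp[OF x] pm by (intro powr_mono2) auto
      then show ?thesis by simp
    next
      case False
      then have "\<bar>c\<bar> powr p x \<le> \<bar>c\<bar> powr pp" using pp[OF x] by (intro powr_mono) auto
      then show ?thesis by simp
    qed
    then have "norm (c *\<^sub>R f x) powr p x \<le> max 1 (\<bar>c\<bar> powr pp) * norm (f x) powr p x"
      by (simp add: powr_mult mult_right_mono)
    then show "ennreal (norm (c *\<^sub>R f x) powr p x) \<le> ennreal (max 1 (\<bar>c\<bar> powr pp)) * ennreal (norm (f x) powr p x)"
      by (simp add: ennreal_mult[symmetric] ennreal_leI)
  qed
  also have "\<dots> = ennreal (max 1 (\<bar>c\<bar> powr pp)) * pmod M p f"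
    unfolding pmod_def by (rule nn_integral_cmult) measurable
  finally show ?thesis .
qed

lemma pmod_diff:
  fixes f g :: "'a \<Rightarrow> 'b::{banach, second_countable_topology}"
  assumes [measurable]: "f \<in> borel_measurable M" "g \<in> borel_measurable M"
  shows "pmod M p (\<lambda>x. f x - g x) \<le> ennreal (2 powr pp) * (pmod M p f + pmod M p g)"
proof -
  have "pmod M p (\<lambda>x. f x + - g x) \<le> ennreal (2 powr pp) * (pmod M p f + pmod M p (\<lambda>x. - g x))"
    by (rule pmod_add) measurable
  then show ?thesis by (simp add: pmod_def)
qed

lemma pmod_finite_integrable:
  fixes f :: "'a \<Rightarrow> 'b::{banach, second_countable_topology}"
  assumes [measurable]: "f \<in> borel_measurable M" and f: "pmod M p f < \<infinity>"
  shows "integrable M f" "integrable M (\<lambda>x. norm (f x) powr p x)"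
    "pmod M p f = ennreal (LINT x|M. norm (f x) powr p x)"
proof -
  show i: "integrable M (\<lambda>x. norm (f x) powr p x)"
    using f by (simp add: integrable_iff_bounded pmod_def)
  then have "integrable M (\<lambda>x. 1 + norm (f x) powr p x)" by simp
  then show "integrable M f"
  proof (rule bochner_bound)
    show "AE x in M. norm (f x) \<le> norm (1 + norm (f x) powr p x)"
    proof (rule AE_I2)
      fix x assume "x \<in> space M"
      then have "norm (f x) \<le> 1 + norm (f x) powr p x" using pp[of x] pm by (intro le_one_plus_powr) auto
      then show "norm (f x) \<le> norm (1 + norm (f x) powr p x)" by simp
    qed
  qed measurable
  show "pmod M p f = ennreal (LINT x|M. norm (f x) powr p x)"
    unfolding pmod_def by (rule nn_integral_eq_integral[OF i]) simp
qed

lemma pmod_L1_bound: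
  fixes f :: "'a \<Rightarrow> 'b::{banach, second_countable_topology}"
  assumes "f \<in> borel_measurable M" and "0 < \<eta>" "\<eta> \<le> 1" and f: "pmod M p f < \<infinity>"
  shows "(LINT x|M. norm (f x)) \<le> \<eta> * measure M (space M) + \<eta> powr (1 - pp) * (LINT x|M. norm (f x) powr p x)"
proof -
  note i = pmod_finite_integrable[OF assms(1) f]
  have "(LINT x|M. norm (f x)) \<le> (LINT x|M. \<eta> + \<eta> powr (1 - pp) * norm (f x) powr p x)"
  proof (rule bochner_mono)
    fix x assume "x \<in> space M"
    then show "norm (f x) \<le> \<eta> + \<eta> powr (1 - pp) * norm (f x) powr p x"
      using pp pm assms by (intro le_small_plus_powr) (auto intro: order_trans[of 1 pm])
  qed (use i in auto)
  also have "\<dots> = \<eta> * measure M (space M) + \<eta> powr (1 - pp) * (LINT x|M. norm (f x) powr p x)"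
    using i by (simp add: mult.commute)
  finally show ?thesis .
qed

text \<open>In \<open>pmod_L1_bound\<close> choose \<eta> first, to make the term with the total
  measure small, and only then \<delta> relative to the resulting constant \<eta>^(1-pp).\<close>

lemma pmod_small_L1:
  assumes "e > 0"
  obtains \<delta> where "\<delta> > 0" "\<And>f :: 'a \<Rightarrow> 'b::{banach, second_countable_topology}. f \<in> borel_measurable M \<Longrightarrow> pmod M p f \<le> ennreal \<delta> \<Longrightarrow> (LINT x|M. norm (f x)) < e"
proof -
  define \<eta> where "\<eta> = min 1 (e / (2 * (measure M (space M) + 1)))"
  have m0: "measure M (space M) \<ge> 0" by simp
  have \<eta>: "\<eta> > 0" "\<eta> \<le> 1" using \<open>e > 0\<close> m0 by (auto simp: \<eta>_def add_nonneg_pos)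
  have "\<eta> * measure M (space M) \<le> e / (2 * (measure M (space M) + 1)) * measure M (space M)"
    by (intro mult_right_mono) (auto simp: \<eta>_def)
  also have "\<dots> = e / 2 * (measure M (space M) / (measure M (space M) + 1))" by simp
  also have "\<dots> \<le> e / 2 * 1" using \<open>e>0\<close> m0 by (intro mult_left_mono divide_succ_le_1) auto
  finally have 1: "\<eta> * measure M (space M) \<le> e / 2" by simp
  define \<delta> where "\<delta> = e / (4 * \<eta> powr (1 - pp))"
  have \<delta>: "\<delta> > 0" using \<open>e > 0\<close> \<eta> by (simp add: \<delta>_def)
  have "(LINT x|M. norm (f x)) < e" if f: "f \<in> borel_measurable M" "pmod M p f \<le> ennreal \<delta>" for f :: "'a \<Rightarrow> 'b"
  proof -
    have fin: "pmod M p f < \<infinity>" using f(2) by (rule le_less_trans) simp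
    have "(LINT x|M. norm (f x) powr p x) \<le> \<delta>" using f(2) \<delta> unfolding pmod_finite_integrable(3)[OF f(1) fin] by (subst (asm) ennreal_le_iff) auto
    then have "\<eta> powr (1 - pp) * (LINT x|M. norm (f x) powr p x) \<le> \<eta> powr (1 - pp) * \<delta>" by (rule mult_left_mono) simp
    also have "\<dots> = e / 4" using \<eta> by (simp add: \<delta>_def)
    finally show ?thesis using pmod_L1_bound[OF f(1) \<eta> fin] 1 \<open>e > 0\<close> by simp
  qed
  with \<delta> show ?thesis by (rule that)
qed

lemma pmod_tendsto_L1:
  fixes f :: "nat \<Rightarrow> 'a \<Rightarrow> 'b::{banach, second_countable_topology}"
  assumes m: "\<And>n. f n \<in> borel_measurable M" and l: "(\<lambda>n. pmod M p (f n)) \<longlonglongrightarrow> 0"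
  shows "(\<lambda>n. LINT x|M. norm (f n x)) \<longlonglongrightarrow> 0"
proof (rule order_tendstoI)
  fix e :: real assume "0 < e"
  then obtain \<delta> where \<delta>: "\<delta> > 0" "\<And>f :: 'a \<Rightarrow> 'b. f \<in> borel_measurable M \<Longrightarrow> pmod M p f \<le> ennreal \<delta> \<Longrightarrow> (LINT x|M. norm (f x)) < e"
    by (rule pmod_small_L1) blast
  have "\<forall>\<^sub>F n in sequentially. pmod M p (f n) < ennreal \<delta>" by (rule order_tendstoD(2)[OF l]) (simp add: \<delta>(1))
  then show "\<forall>\<^sub>F n in sequentially. (LINT x|M. norm (f n x)) < e" by eventually_elim (intro \<delta>(2) m less_imp_le)
next
  fix e :: real assume "e < 0"
  then show "\<forall>\<^sub>F n in sequentially. e < (LINT x|M. norm (f n x))" by (intro always_eventually allI less_le_trans[OF _ Bochner_Integration.integral_nonneg]) auto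
qed

text \<open>A Cauchy sequence for the modular is Cauchy in L1 on a finite measure space, so a
  subsequence converges almost everywhere; Fatou's lemma then carries the Cauchy estimate over to
  the limit.\<close>

lemma pmod_complete:
  fixes h :: "nat \<Rightarrow> 'a \<Rightarrow> 'b::{banach, second_countable_topology}"
  assumes m[measurable]: "\<And>n. h n \<in> borel_measurable M" and fin: "\<And>n. pmod M p (h n) < \<infinity>"
    and cauchy: "\<And>e. e > 0 \<Longrightarrow> \<exists>N. \<forall>i\<ge>N. \<forall>j\<ge>N. pmod M p (\<lambda>x. h i x - h j x) \<le> ennreal e"
  obtains H where "H \<in> borel_measurable M" "pmod M p H < \<infinity>" "(\<lambda>n. pmod M p (\<lambda>x. h n x - H x)) \<longlonglongrightarrow> 0"
proof -
  have i: "integrable M (h n)" for n by (rule pmod_finite_integrable[OF m fin])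
  have "\<exists>N. \<forall>i\<ge>N. \<forall>j\<ge>N. (LINT x|M. norm (h i x - h j x)) < e" if "e > 0" for e
  proof -
    obtain \<delta> where \<delta>: "\<delta> > 0" "\<And>f :: 'a \<Rightarrow> 'b. f \<in> borel_measurable M \<Longrightarrow> pmod M p f \<le> ennreal \<delta> \<Longrightarrow> (LINT x|M. norm (f x)) < e"
      by (rule pmod_small_L1[OF \<open>e > 0\<close>]) blast
    obtain N where "\<And>i j. i \<ge> N \<Longrightarrow> j \<ge> N \<Longrightarrow> pmod M p (\<lambda>x. h i x - h j x) \<le> ennreal \<delta>" using cauchy[OF \<delta>(1)] by blast
    then show ?thesis by (intro exI[of _ N] allI impI \<delta>(2)) auto
  qed
  from cauchy_L1_AE_cauchy_subseq[OF i this] obtain r :: "nat \<Rightarrow> nat" where r: "strict_mono r" "AE x in M. Cauchy (\<lambda>i. h (r i) x)"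
    by blast
  define H where "H x = lim (\<lambda>i. h (r i) x)" for x
  have Hm[measurable]: "H \<in> borel_measurable M" unfolding H_def by measurable
  have Hl: "AE x in M. (\<lambda>i. h (r i) x) \<longlonglongrightarrow> H x"
    using r(2) by eventually_elim (auto simp: H_def Cauchy_convergent_iff convergent_LIMSEQ_iff)
  have bound: "pmod M p (\<lambda>x. h n x - H x) \<le> ennreal e" if N: "\<And>i j. i \<ge> N \<Longrightarrow> j \<ge> N \<Longrightarrow> pmod M p (\<lambda>x. h i x - h j x) \<le> ennreal e" "n \<ge> N" for n N e
  proof -
    have "pmod M p (\<lambda>x. h n x - H x) \<le> (\<integral>\<^sup>+x. liminf (\<lambda>i. ennreal (norm (h n x - h (r i) x) powr p x)) \<partial>M)"
      unfolding pmod_def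
    proof (rule nn_integral_mono_AE)
      show "AE x in M. ennreal (norm (h n x - H x) powr p x) \<le> liminf (\<lambda>i. ennreal (norm (h n x - h (r i) x) powr p x))"
        using Hl AE_space
      proof eventually_elim
        case (elim x)
        have "p x > 0" using pp[OF elim(2)] pm by simp
        have "(\<lambda>i. norm (h n x - h (r i) x) powr p x) \<longlonglongrightarrow> norm (h n x - H x) powr p x"
          by (intro tendsto_powr' tendsto_intros elim(1)) (use \<open>p x > 0\<close> in auto)
        then have "(\<lambda>i. ennreal (norm (h n x - h (r i) x) powr p x)) \<longlonglongrightarrow> ennreal (norm (h n x - H x) powr p x)"
          by (rule tendsto_ennrealI)
        from lim_imp_Liminf[OF trivial_limit_sequentially this] show ?case by simp
      qed
    qed
    also have "\<dots> \<le> liminf (\<lambda>i. \<integral>\<^sup>+x. ennreal (norm (h n x - h (r i) x) powr p x) \<partial>M)"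
      by (rule nn_integral_liminf) measurable
    also have "\<dots> \<le> ennreal e"
    proof (rule Liminf_le)
      show "\<forall>\<^sub>F i in sequentially. (\<integral>\<^sup>+x. ennreal (norm (h n x - h (r i) x) powr p x) \<partial>M) \<le> ennreal e"
      proof (rule eventually_sequentiallyI[of N])
        fix i assume "N \<le> i"
        then have "N \<le> r i" using seq_suble[OF r(1), of i] by linarith
        from N(1)[OF N(2) this] show "(\<integral>\<^sup>+x. ennreal (norm (h n x - h (r i) x) powr p x) \<partial>M) \<le> ennreal e"
          by (simp add: pmod_def)
      qed
    qed simp
    finally show ?thesis .
  qed
  have lim0: "(\<lambda>n. pmod M p (\<lambda>x. h n x - H x)) \<longlonglongrightarrow> 0"
  proof (rule order_tendstoI)
    fix a :: ennreal assume "0 < a"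
    then obtain e where e: "e > 0" "ennreal e < a" using ennreal_pos_real_below by blast
    obtain N where "\<And>i j. i \<ge> N \<Longrightarrow> j \<ge> N \<Longrightarrow> pmod M p (\<lambda>x. h i x - h j x) \<le> ennreal e" using cauchy[OF e(1)] by blast
    from bound[OF this] show "\<forall>\<^sub>F n in sequentially. pmod M p (\<lambda>x. h n x - H x) < a"
      using e(2) by (intro eventually_sequentiallyI[of N]) (auto intro: le_less_trans)
  qed simp
  have "pmod M p H < \<infinity>"
  proof -
    obtain N where "\<And>i j. i \<ge> N \<Longrightarrow> j \<ge> N \<Longrightarrow> pmod M p (\<lambda>x. h i x - h j x) \<le> ennreal 1" using cauchy[of 1] by auto
    from bound[OF this order_refl] have b1: "pmod M p (\<lambda>x. h N x - H x) \<le> ennreal 1" .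
    have "pmod M p H = pmod M p (\<lambda>x. h N x - (h N x - H x))" by simp
    also have "\<dots> \<le> ennreal (2 powr pp) * (pmod M p (h N) + pmod M p (\<lambda>x. h N x - H x))" by (rule pmod_diff) measurable
    also have "\<dots> < \<infinity>" using fin[of N] le_less_trans[OF b1] by (auto simp: ennreal_mult_less_top)
    finally show ?thesis .
  qed
  then show ?thesis using that Hm lim0 by blast
qed

text \<open>Near-minimisers of the modular over shrinking midpoint-convex sets are Cauchy by uniform convexity.\<close>
lemma midpoint_convex_limit:
  fixes D :: "nat \<Rightarrow> ('a \<Rightarrow> 'b::euclidean_space) set"
  assumes meas: "\<And>j h. h \<in> D j \<Longrightarrow> h \<in> borel_measurable M" and bdd: "\<And>j h. h \<in> D j \<Longrightarrow> pmod M p h \<le> ennreal R"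
    and pm1: "1 < pm" and ne: "\<And>j. D j \<noteq> {}" and dec: "\<And>i j. i \<le> j \<Longrightarrow> D j \<subseteq> D i"
    and mid: "\<And>j a b. a \<in> D j \<Longrightarrow> b \<in> D j \<Longrightarrow> (\<lambda>x. (1/2) *\<^sub>R (a x + b x)) \<in> D j"
  obtains h H where "\<And>j. h j \<in> D j" "H \<in> borel_measurable M" "pmod M p H < \<infinity>" "(\<lambda>n. pmod M p (\<lambda>x. h n x - H x)) \<longlonglongrightarrow> 0"
proof -
  define m where "m h = (LINT x|M. norm (h x) powr p x)" for h :: "'a \<Rightarrow> 'b"
  have fin: "pmod M p h < \<infinity>" if "h \<in> D j" for h j
    using bdd[OF that] by (auto intro: le_less_trans)
  have m0: "m h \<ge> 0" for h by (simp add: m_def)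
  have mR: "m h \<le> max 0 R" if "h \<in> D j" for h j
  proof -
    have "ennreal (m h) \<le> ennreal (max 0 R)"
      using bdd[OF that] pmod_finite_integrable(3)[OF meas[OF that] fin[OF that]] by (auto simp: m_def max_def ennreal_neg)
    then show ?thesis by (subst (asm) ennreal_le_iff) auto
  qed
  \<comment> \<open>The infima increase as the sets shrink and stay below max 0 R, so they form a
    Cauchy sequence: near-minimisers over different sets have nearly the same modular.\<close>
  define d where "d j = Inf (m ` D j)" for j
  have bb: "bdd_below (m ` D j)" for j using m0 by (auto intro!: bdd_belowI[of _ 0])
  have d_le: "d j \<le> m h" if "h \<in> D j" for h j unfolding d_def using that bb by (intro cInf_lower) auto
  have d_mono: "mono d" unfolding d_def by (intro monoI cInf_superset_mono image_mono) (use ne dec bb in auto)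
  have d_R: "d j \<le> max 0 R" for j using ne[of j] d_le mR by (metis ex_in_conv order_trans)
  have dB: "Bseq d"
  proof (rule BseqI'[where K="max 0 R"])
    have "d n \<ge> 0" for n unfolding d_def by (rule cInf_greatest) (use ne m0 in auto)
    then show "norm (d n) \<le> max 0 R" for n using d_R by simp
  qed
  have "convergent d" using Bseq_mono_convergent[OF dB] d_mono by (simp add: mono_def)
  then have dc: "Cauchy d" by (simp add: Cauchy_convergent_iff)
  have "\<exists>h. h \<in> D j \<and> m h < d j + 1 / real (Suc j)" for j
  proof -
    have "Inf (m ` D j) < d j + 1 / real (Suc j)" by (simp add: d_def)
    then show ?thesis using cInf_lessD[of "m ` D j" "d j + 1 / real (Suc j)"] ne by auto
  qed
  then obtain h where h: "\<And>j. h j \<in> D j" "\<And>j. m (h j) < d j + 1 / real (Suc j)" by metis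
  note hm[measurable] = meas[OF h(1)]
  have gap: "\<exists>N. \<forall>i\<ge>N. \<forall>j\<ge>N. pmod M p (\<lambda>x. h i x - h j x) \<le> ennreal e" if "e > 0" for e
  proof -
    \<comment> \<open>Half of e is reserved for the term with \<epsilon>, the modulars being at most
      max 0 R; the other half is C times the convexity gap, whence the tolerances e / (4 C)
      below.\<close>
    define \<epsilon> where "\<epsilon> = e / (4 * (max 0 R + 1))"
    have \<epsilon>: "\<epsilon> > 0" using \<open>e > 0\<close> by (simp add: \<epsilon>_def add_nonneg_pos)
    obtain C where C: "C > 0" "\<And>q a (b::'b). pm \<le> q \<Longrightarrow> q \<le> pp \<Longrightarrow> norm (a - b) powr q \<le> \<epsilon> * (norm a powr q + norm b powr q) + C * powr_gap q a b"
      using uniform_convexity_powr[OF pm1 pmpp \<epsilon>] by blast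
    have "e / (4 * C) > 0" using C \<open>e > 0\<close> by simp
    then obtain N1 where N1: "\<And>i j. i \<ge> N1 \<Longrightarrow> j \<ge> N1 \<Longrightarrow> \<bar>d i - d j\<bar> < e / (4 * C)"
      using dc unfolding Cauchy_def dist_real_def by meson
    obtain N2 where N2: "1 / real (Suc N2) < e / (4 * C)" using reals_Archimedean[OF \<open>e / (4 * C) > 0\<close>] by (auto simp: inverse_eq_divide)
    have "pmod M p (\<lambda>x. h i x - h j x) \<le> ennreal e" if ij: "i \<ge> max N1 N2" "j \<ge> max N1 N2" for i j
    proof -
      \<comment> \<open>Both functions, and hence their midpoint, belong to the set with index ?N,
        so the modular of the midpoint is at least the infimum there; this bounds the gap from
        above.\<close>
      let ?N = "max N1 N2"
      let ?c = "\<lambda>x. (1/2) *\<^sub>R (h i x + h j x)"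
      have hN: "h i \<in> D ?N" "h j \<in> D ?N" using h(1) dec[OF ij(1)] dec[OF ij(2)] by auto
      have cN: "?c \<in> D ?N" by (rule mid[OF hN])
      have df: "pmod M p (\<lambda>x. h i x - h j x) < \<infinity>"
        by (rule le_less_trans[OF pmod_diff]) (use fin[OF hN(1)] fin[OF hN(2)] in \<open>auto simp: ennreal_mult_less_top\<close>)
      note ii = pmod_finite_integrable(2)[OF meas[OF hN(1)] fin[OF hN(1)]] pmod_finite_integrable(2)[OF meas[OF hN(2)] fin[OF hN(2)]]
        pmod_finite_integrable(2)[OF meas[OF cN] fin[OF cN]] pmod_finite_integrable(2)[OF _ df]
      have "m (\<lambda>x. h i x - h j x) \<le> (LINT x|M. \<epsilon> * (norm (h i x) powr p x + norm (h j x) powr p x) + C * ((norm (h i x) powr p x + norm (h j x) powr p x) / 2 - norm (?c x) powr p x))"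
        unfolding m_def
      proof (rule bochner_mono)
        fix x assume "x \<in> space M"
        then show "norm (h i x - h j x) powr p x \<le> \<epsilon> * (norm (h i x) powr p x + norm (h j x) powr p x) + C * ((norm (h i x) powr p x + norm (h j x) powr p x) / 2 - norm (?c x) powr p x)"
          using C(2)[of "p x" "h i x" "h j x"] pp[of x] by (simp add: powr_gap_def)
      qed (use ii in auto)
      also have "\<dots> = \<epsilon> * (m (h i) + m (h j)) + C * ((m (h i) + m (h j)) / 2 - m ?c)"
        unfolding m_def using ii by simp
      also have "\<dots> \<le> \<epsilon> * (2 * max 0 R) + C * (e / (2 * C))"
      proof (intro add_mono mult_left_mono)
        show "m (h i) + m (h j) \<le> 2 * max 0 R" using mR[OF hN(1)] mR[OF hN(2)] by simp
        have "1 / real (Suc i) \<le> 1 / real (Suc N2)" "1 / real (Suc j) \<le> 1 / real (Suc N2)" using ij by (auto intro!: divide_left_mono)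
        then have "m (h i) \<le> d i + e / (4 * C)" "m (h j) \<le> d j + e / (4 * C)" using h(2)[of i] h(2)[of j] N2 by auto
        moreover have "d i \<le> d ?N + e / (4 * C)" "d j \<le> d ?N + e / (4 * C)" using N1[of i ?N] N1[of j ?N] ij by auto
        moreover have "d ?N \<le> m ?c" by (rule d_le[OF cN])
        moreover have "e / (4 * C) + e / (4 * C) = e / (2 * C)" by (simp add: field_simps)
        ultimately show "(m (h i) + m (h j)) / 2 - m ?c \<le> e / (2 * C)" by (rule near_min_arith)
      qed (use \<epsilon> C in auto)
      also have "\<dots> \<le> e / 2 + e / 2"
      proof (intro add_mono)
        have "\<epsilon> * (2 * max 0 R) = e / 2 * (max 0 R / (max 0 R + 1))" unfolding \<epsilon>_def by (simp add: field_simps)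
        also have "\<dots> \<le> e / 2 * 1" using \<open>e > 0\<close> by (intro mult_left_mono divide_succ_le_1) auto
        finally show "\<epsilon> * (2 * max 0 R) \<le> e / 2" by simp
      qed (use C in simp)
      finally have "m (\<lambda>x. h i x - h j x) \<le> e" by simp
      then show ?thesis using pmod_finite_integrable(3)[OF _ df] by (simp add: m_def ennreal_leI)
    qed
    then show ?thesis by blast
  qed
  show ?thesis
    by (rule pmod_complete[OF hm fin[OF h(1)] gap]) (auto intro: that[OF h(1)])
qed

end

section \<open>Sobolev functions of variable exponent\<close>

text \<open>An open set is a countable union of boxes, and on each box, being compact, local
  integrability provides measurability.\<close>

lemma locally_integrable_measurable:
  fixes h :: "'a::euclidean_space \<Rightarrow> 'b::euclidean_space"
  assumes \<Omega>: "open \<Omega>" and h: "locally_integrable_on h \<Omega>"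
  shows "h \<in> borel_measurable (lebesgue_on \<Omega>)"
proof -
  obtain D where D: "countable D" "D \<subseteq> Pow \<Omega>" "\<And>X. X \<in> D \<Longrightarrow> \<exists>a b. X = cbox a b" "\<Union>D = \<Omega>"
    using open_countable_Union_open_cbox[OF \<Omega>] by metis
  show ?thesis
  proof (rule measurableI)
    fix A :: "'b set" assume A: "A \<in> sets borel"
    have X: "h -` A \<inter> X \<in> sets lebesgue" if XD: "X \<in> D" for X
    proof -
      obtain a b where ab: "X = cbox a b" using D(3)[OF XD] by blast
      have "X \<subseteq> \<Omega>" using D(2) XD by auto
      then have "integrable (lebesgue_on X) h" using h by (simp add: locally_integrable_on_def ab)
      then have "h \<in> borel_measurable (lebesgue_on X)" by auto
      then have "h -` A \<inter> space (lebesgue_on X) \<in> sets (lebesgue_on X)" using A by (rule measurable_sets)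
      then show ?thesis by (simp add: ab sets_restrict_space_iff)
    qed
    have "h -` A \<inter> \<Omega> = (\<Union>X\<in>D. h -` A \<inter> X)" using D(4) by auto
    moreover have "(\<Union>X\<in>D. h -` A \<inter> X) \<in> sets lebesgue"
      by (rule sets.countable_UN'[OF D(1)]) (use X in blast)
    ultimately have "h -` A \<inter> \<Omega> \<in> sets lebesgue" by simp
    then show "h -` A \<inter> space (lebesgue_on \<Omega>) \<in> sets (lebesgue_on \<Omega>)"
      using \<Omega> by (simp add: sets_restrict_space_iff)
  qed simp
qed

text \<open>Guarantees that the infimum in \<open>luxemburg_norm\<close> is taken over a nonempty
  set. Since q \<ge> 1, dividing by l \<ge> 1 lowers the modular by at least the factor l, so l =
  max 1 m works.\<close>

lemma luxemburg_nonempty: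
  assumes [measurable]: "q \<in> borel_measurable (lebesgue_on \<Omega>)" and q: "\<And>x. x \<in> \<Omega> \<Longrightarrow> 1 \<le> q x" and f: "f \<in> var_Lp \<Omega> q"
  shows "\<exists>l>0. var_modular \<Omega> q (\<lambda>x. f x / l) \<le> 1"
proof -
  have [measurable]: "f \<in> borel_measurable (lebesgue_on \<Omega>)" and fin: "var_modular \<Omega> q f < \<infinity>" using f by (auto simp: var_Lp_def)
  obtain m where m: "var_modular \<Omega> q f = ennreal m" "m \<ge> 0" using fin by (cases "var_modular \<Omega> q f") auto
  define l where "l = max 1 m"
  have l: "l \<ge> 1" by (simp add: l_def)
  have "ennreal l * var_modular \<Omega> q (\<lambda>x. f x / l) \<le> ennreal l * 1"
  proof -
    have "var_modular \<Omega> q (\<lambda>x. f x / l) \<le> (\<integral>\<^sup>+x. ennreal (\<bar>f x\<bar> powr q x / l) \<partial>lebesgue_on \<Omega>)"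
      unfolding var_modular_def
    proof (intro nn_integral_mono ennreal_leI)
      fix x assume "x \<in> space (lebesgue_on \<Omega>)"
      then have "1 \<le> q x" using q by simp
      then have "l powr 1 \<le> l powr q x" using l by (intro powr_mono) auto
      then have "\<bar>f x\<bar> powr q x / l powr q x \<le> \<bar>f x\<bar> powr q x / l" using l by (intro divide_left_mono) auto
      then show "\<bar>f x / l\<bar> powr q x \<le> \<bar>f x\<bar> powr q x / l" using l by (simp add: powr_divide)
    qed
    then have "ennreal l * var_modular \<Omega> q (\<lambda>x. f x / l) \<le> ennreal l * (\<integral>\<^sup>+x. ennreal (\<bar>f x\<bar> powr q x / l) \<partial>lebesgue_on \<Omega>)"
      by (rule mult_left_mono) simp
    also have "\<dots> \<le> var_modular \<Omega> q f"
    proof -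
      have "ennreal l * (\<integral>\<^sup>+x. ennreal (\<bar>f x\<bar> powr q x / l) \<partial>lebesgue_on \<Omega>) = (\<integral>\<^sup>+x. ennreal l * ennreal (\<bar>f x\<bar> powr q x / l) \<partial>lebesgue_on \<Omega>)"
        by (rule nn_integral_cmult[symmetric]) measurable
      also have "\<dots> = var_modular \<Omega> q f" unfolding var_modular_def
        using l by (intro nn_integral_cong) (simp add: ennreal_mult[symmetric])
      finally show ?thesis by simp
    qed
    also have "\<dots> \<le> ennreal l * 1" unfolding m(1) by (simp add: l_def)
    finally show ?thesis .
  qed
  then have "var_modular \<Omega> q (\<lambda>x. f x / l) \<le> 1"
    using l by (subst (asm) ennreal_mult_le_mult_iff) auto
  then show ?thesis using l by (intro exI[of _ l]) auto
qed

lemma borel_measurable_Pair_vec: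
  fixes f :: "'a \<Rightarrow> 'b::euclidean_space" and g :: "'a \<Rightarrow> 'c::euclidean_space"
  shows "f \<in> borel_measurable M \<Longrightarrow> g \<in> borel_measurable M \<Longrightarrow> (\<lambda>x. (f x, g x)) \<in> borel_measurable M"
  by (rule borel_measurable_Pair)

lemma borel_measurable_fst_snd:
  fixes H :: "'a \<Rightarrow> 'b::euclidean_space \<times> 'c::euclidean_space"
  assumes "H \<in> borel_measurable M"
  shows "(\<lambda>x. fst (H x)) \<in> borel_measurable M" "(\<lambda>x. snd (H x)) \<in> borel_measurable M"
  by (rule measurable_compose[OF assms], rule borel_measurable_continuous_onI, intro continuous_intros)+

text \<open>Log-Hoelder continuity appears in the form in which mollification consumes it: at scale
  e the oscillation of p times ln (1/e) is bounded. The restriction to e \<le> 1/2 keeps the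
  logarithm away from 0.\<close>

locale var_domain =
  fixes \<Omega> :: "'a::euclidean_space set" and p :: "'a \<Rightarrow> real" and pm pp Lh :: real
  assumes \<Omega>_open: "open \<Omega>" and \<Omega>_bdd: "bounded \<Omega>" and p_cont: "continuous_on \<Omega> p"
    and pm1: "1 < pm" and pmpp': "pm \<le> pp" and pp': "\<And>x. x \<in> \<Omega> \<Longrightarrow> pm \<le> p x \<and> p x \<le> pp"
    and log_hoelder: "\<And>e x y. 0 < e \<Longrightarrow> e \<le> 1/2 \<Longrightarrow> x \<in> \<Omega> \<Longrightarrow> y \<in> \<Omega> \<Longrightarrow> norm (x - y) \<le> e \<Longrightarrow> \<bar>p x - p y\<bar> * ln (1 / e) \<le> Lh"
begin

abbreviation "M \<equiv> lebesgue_on \<Omega>"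

lemma \<Omega>_borel: "\<Omega> \<in> sets borel" using \<Omega>_open by simp

lemma p_meas': "p \<in> borel_measurable M"
  using p_cont \<Omega>_open by (intro continuous_imp_measurable_on_sets_lebesgue) auto

lemma finite_M: "finite_measure M"
proof
  have "emeasure M (space M) = emeasure lborel \<Omega>"
    using \<Omega>_open by (simp add: emeasure_restrict_space)
  then show "emeasure M (space M) \<noteq> \<infinity>" using emeasure_bounded_finite[OF \<Omega>_bdd] by auto
qed

sublocale exponent M p pm pp
proof -
  interpret finite_measure M by (rule finite_M)
  show "exponent M p pm pp"
    by unfold_locales (use p_meas' pm1 pp' pmpp' in auto)
qed

text \<open>A Sobolev function \<open>u\<close> is represented by the pair \<open>H = (u, \<nabla>u)\<close>, so that a single
  modular controls both components.\<close>
definition sob :: "('a \<Rightarrow> real \<times> 'a) \<Rightarrow> bool" where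
  "sob H \<longleftrightarrow> has_weak_grad \<Omega> (\<lambda>x. fst (H x)) (\<lambda>x. snd (H x)) \<and> H \<in> borel_measurable M \<and> pmod M p H < \<infinity>"

definition jet :: "('a \<Rightarrow> real) \<Rightarrow> 'a \<Rightarrow> real \<times> 'a" where
  "jet \<phi> x = (\<phi> x, classical_grad \<phi> x)"

text \<open>Closure of the test functions in the sense of the modular instead of the Luxemburg norm.
  \<open>var_W1p_0_iff\<close> shows that the space is the same.\<close>

definition sob0 :: "('a \<Rightarrow> real \<times> 'a) \<Rightarrow> bool" where
  "sob0 H \<longleftrightarrow> sob H \<and> (\<forall>e>0. \<exists>\<phi>\<in>test_functions \<Omega>. pmod M p (\<lambda>x. H x - jet \<phi> x) \<le> ennreal e)"

lemma sobD:
  assumes "sob H"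
  shows "has_weak_grad \<Omega> (\<lambda>x. fst (H x)) (\<lambda>x. snd (H x))" "H \<in> borel_measurable M" "pmod M p H < \<infinity>"
    "integrable M H" "integrable M (\<lambda>x. fst (H x))" "integrable M (\<lambda>x. snd (H x))"
    "(\<lambda>x. fst (H x)) \<in> borel_measurable M" "(\<lambda>x. snd (H x)) \<in> borel_measurable M"
proof -
  show *: "has_weak_grad \<Omega> (\<lambda>x. fst (H x)) (\<lambda>x. snd (H x))" "H \<in> borel_measurable M" "pmod M p H < \<infinity>"
    using assms by (auto simp: sob_def)
  show i: "integrable M H" by (rule pmod_finite_integrable(1)[OF *(2,3)])
  show "integrable M (\<lambda>x. fst (H x))" "integrable M (\<lambda>x. snd (H x))"
    using integrable_bounded_linear[OF bounded_linear_fst i] integrable_bounded_linear[OF bounded_linear_snd i] by auto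
  then show "(\<lambda>x. fst (H x)) \<in> borel_measurable M" "(\<lambda>x. snd (H x)) \<in> borel_measurable M" by auto
qed

lemma pmod_Pair_le:
  fixes u :: "'a \<Rightarrow> real" and G :: "'a \<Rightarrow> 'a"
  assumes "u \<in> borel_measurable M" "G \<in> borel_measurable M"
  shows "pmod M p (\<lambda>x. (u x, G x)) \<le> ennreal (2 powr pp) * (pmod M p u + pmod M p G)"
proof -
  have "pmod M p (\<lambda>x. (u x, G x)) \<le> pmod M p (\<lambda>x. \<bar>u x\<bar> + norm (G x))"
  proof (rule pmod_mono)
    fix x show "norm (u x, G x) \<le> norm (\<bar>u x\<bar> + norm (G x))"
      using norm_Pair_le[of "u x" "G x"] by simp
  qed
  also have "\<dots> \<le> ennreal (2 powr pp) * (pmod M p (\<lambda>x. \<bar>u x\<bar>) + pmod M p (\<lambda>x. norm (G x)))"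
    by (rule pmod_add) (use assms in auto)
  finally show ?thesis by (simp add: pmod_def)
qed

lemma pmod_fst_snd_le: "pmod M p (\<lambda>x. fst (H x)) \<le> pmod M p H" "pmod M p (\<lambda>x. snd (H x)) \<le> pmod M p H"
  for H :: "'a \<Rightarrow> real \<times> 'a"
  by (rule pmod_mono, metis norm_fst_le norm_snd_le prod.collapse)+

lemma sob_lin:
  assumes H: "sob H" and K: "sob K" shows "sob (\<lambda>x. a *\<^sub>R H x + b *\<^sub>R K x)"
  unfolding sob_def
proof (intro conjI)
  note [measurable] = sobD(2)[OF H] sobD(2)[OF K]
  show "has_weak_grad \<Omega> (\<lambda>x. fst (a *\<^sub>R H x + b *\<^sub>R K x)) (\<lambda>x. snd (a *\<^sub>R H x + b *\<^sub>R K x))"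
    using has_weak_grad_add[OF \<Omega>_open has_weak_grad_scale[OF sobD(1)[OF H], of a] has_weak_grad_scale[OF sobD(1)[OF K], of b]] by simp
  show "(\<lambda>x. a *\<^sub>R H x + b *\<^sub>R K x) \<in> borel_measurable M" by measurable
  have "pmod M p (\<lambda>x. a *\<^sub>R H x + b *\<^sub>R K x) \<le> ennreal (2 powr pp) * (pmod M p (\<lambda>x. a *\<^sub>R H x) + pmod M p (\<lambda>x. b *\<^sub>R K x))"
    by (rule pmod_add) measurable
  also have "\<dots> \<le> ennreal (2 powr pp) * (ennreal (max 1 (\<bar>a\<bar> powr pp)) * pmod M p H + ennreal (max 1 (\<bar>b\<bar> powr pp)) * pmod M p K)"
    by (intro mult_left_mono add_mono pmod_scale) auto
  also have "\<dots> < \<infinity>" using sobD(3)[OF H] sobD(3)[OF K] by (auto simp: ennreal_mult_less_top)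
  finally show "pmod M p (\<lambda>x. a *\<^sub>R H x + b *\<^sub>R K x) < \<infinity>" .
qed

lemma pmod_bounded_finite:
  assumes "\<And>x. x \<in> \<Omega> \<Longrightarrow> norm (f x) \<le> B"
  shows "pmod M p f \<le> ennreal (max 1 (B powr pp) * measure M (space M))" "pmod M p f < \<infinity>"
proof -
  have "pmod M p f \<le> (\<integral>\<^sup>+x. ennreal (max 1 (B powr pp)) \<partial>M)"
    unfolding pmod_def
  proof (intro nn_integral_mono ennreal_leI)
    fix x assume x: "x \<in> space M"
    then have n: "norm (f x) \<le> B" "0 \<le> B" using assms[of x] order_trans[OF norm_ge_zero[of "f x"]] by auto
    have p: "1 < p x" "p x \<le> pp" using pp'[of x] pm1 x by auto
    have "norm (f x) powr p x \<le> B powr p x" using n p by (intro powr_mono2) auto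
    also have "\<dots> \<le> max 1 (B powr pp)"
    proof (cases "B \<le> 1")
      case True
      then have "B powr p x \<le> 1 powr p x" using n p by (intro powr_mono2) auto
      then show ?thesis by simp
    next
      case False
      then have "B powr p x \<le> B powr pp" using p by (intro powr_mono) auto
      then show ?thesis by simp
    qed
    finally show "norm (f x) powr p x \<le> max 1 (B powr pp)" .
  qed
  also have "\<dots> = ennreal (max 1 (B powr pp) * measure M (space M))"
    by (simp add: emeasure_eq_measure ennreal_mult)
  finally show "pmod M p f \<le> ennreal (max 1 (B powr pp) * measure M (space M))" .
  then show "pmod M p f < \<infinity>" by (rule le_less_trans) simp
qed

lemma sob_jet:
  assumes \<phi>: "\<phi> \<in> test_functions \<Omega>" shows "sob (jet \<phi>)"
  unfolding sob_def jet_def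
proof (intro conjI)
  obtain B where B: "\<forall>x. \<bar>\<phi> x\<bar> \<le> B \<and> norm (classical_grad \<phi> x) \<le> B" using test_functionsD(5)[OF \<phi>] by blast
  show "has_weak_grad \<Omega> (\<lambda>x. fst (\<phi> x, classical_grad \<phi> x)) (\<lambda>x. snd (\<phi> x, classical_grad \<phi> x))"
    using C1_grad_has_weak_grad[OF \<Omega>_open test_functionsD(2)[OF \<phi>]] by simp
  show "(\<lambda>x. (\<phi> x, classical_grad \<phi> x)) \<in> borel_measurable M"
    by (intro borel_measurable_Pair_vec borel_measurable_lebesgue_on test_functionsD(3,4)[OF \<phi>])
  show "pmod M p (\<lambda>x. (\<phi> x, classical_grad \<phi> x)) < \<infinity>"
  proof (rule pmod_bounded_finite(2)[where B="B + B"])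
    fix x show "norm (\<phi> x, classical_grad \<phi> x) \<le> B + B"
      using B norm_Pair_le[of "\<phi> x" "classical_grad \<phi> x"] by (smt (verit) real_norm_def)
  qed
qed

lemma jet_meas: "\<phi> \<in> test_functions \<Omega> \<Longrightarrow> jet \<phi> \<in> borel_measurable M"
  using sobD(2)[OF sob_jet] .

lemma jet_lin:
  assumes "\<phi> \<in> test_functions \<Omega>" "\<psi> \<in> test_functions \<Omega>"
  shows "(\<lambda>x. a * \<phi> x + b * \<psi> x) \<in> test_functions \<Omega>" "jet (\<lambda>x. a * \<phi> x + b * \<psi> x) = (\<lambda>x. a *\<^sub>R jet \<phi> x + b *\<^sub>R jet \<psi> x)"
proof -
  have s: "smooth \<phi>" "smooth \<psi>" using assms by (auto simp: test_functions_iff)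
  obtain K1 K2 where K: "compact K1" "K1 \<subseteq> \<Omega>" "\<And>x. x \<notin> K1 \<Longrightarrow> \<phi> x = 0" "compact K2" "K2 \<subseteq> \<Omega>" "\<And>x. x \<notin> K2 \<Longrightarrow> \<psi> x = 0"
    using assms unfolding test_functions_iff by metis
  show "(\<lambda>x. a * \<phi> x + b * \<psi> x) \<in> test_functions \<Omega>"
    unfolding test_functions_iff
  proof (intro conjI exI[of _ "K1 \<union> K2"])
    show "smooth (\<lambda>x. a * \<phi> x + b * \<psi> x)" by (intro smooth_add smooth_mult smooth_const s)
  qed (use K in \<open>auto simp: compact_Un\<close>)
  have "C1_grad (\<lambda>x. a * \<phi> x + b * \<psi> x) (\<lambda>x. a *\<^sub>R classical_grad \<phi> x + b *\<^sub>R classical_grad \<psi> x)"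
    using smooth_C1_grad[OF s(1)] smooth_C1_grad[OF s(2)] unfolding C1_grad_def
    by (auto intro!: derivative_eq_intros continuous_intros simp: inner_add_left)
  from C1_grad_classical[OF this] show "jet (\<lambda>x. a * \<phi> x + b * \<psi> x) = (\<lambda>x. a *\<^sub>R jet \<phi> x + b *\<^sub>R jet \<psi> x)"
    by (auto simp: jet_def)
qed

lemma sob0_jet: "\<phi> \<in> test_functions \<Omega> \<Longrightarrow> sob0 (jet \<phi>)"
  unfolding sob0_def using sob_jet by (auto simp: pmod_def intro!: bexI[of _ \<phi>])

lemma sob0_limit:
  assumes H: "sob H" and K: "\<And>n. sob0 (K n)" and l: "(\<lambda>n. pmod M p (\<lambda>x. K n x - H x)) \<longlonglongrightarrow> 0"
  shows "sob0 H"
  unfolding sob0_def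
proof (intro conjI allI impI)
  fix e :: real assume "e > 0"
  define c where "c = e / (2 * 2 powr pp)"
  have c: "c > 0" using \<open>e > 0\<close> by (simp add: c_def)
  have "\<forall>\<^sub>F n in sequentially. pmod M p (\<lambda>x. K n x - H x) < ennreal c"
    using c by (intro order_tendstoD(2)[OF l]) auto
  then obtain n where n: "pmod M p (\<lambda>x. K n x - H x) < ennreal c" by (auto simp: eventually_sequentially)
  obtain \<phi> where \<phi>: "\<phi> \<in> test_functions \<Omega>" "pmod M p (\<lambda>x. K n x - jet \<phi> x) \<le> ennreal c"
    using K[of n] c by (auto simp: sob0_def)
  note [measurable] = sobD(2)[OF H] jet_meas[OF \<phi>(1)]
  have [measurable]: "K n \<in> borel_measurable M" using K[of n] by (auto simp: sob0_def sob_def)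
  have "pmod M p (\<lambda>x. H x - jet \<phi> x) = pmod M p (\<lambda>x. (K n x - jet \<phi> x) - (K n x - H x))" by simp
  also have "\<dots> \<le> ennreal (2 powr pp) * (pmod M p (\<lambda>x. K n x - jet \<phi> x) + pmod M p (\<lambda>x. K n x - H x))"
    by (rule pmod_diff) measurable
  also have "\<dots> \<le> ennreal (2 powr pp) * (ennreal c + ennreal c)"
    using \<phi>(2) n by (intro mult_left_mono add_mono) auto
  also have "\<dots> = ennreal (2 powr pp * (c + c))" using c by (simp add: ennreal_mult flip: ennreal_plus)
  also have "2 powr pp * (c + c) = e" by (simp add: c_def)
  finally show "\<exists>\<phi>\<in>test_functions \<Omega>. pmod M p (\<lambda>x. H x - jet \<phi> x) \<le> ennreal e" using \<phi>(1) by blast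
qed (rule H)

lemma sob0_approx:
  assumes "sob0 H"
  obtains \<phi> where "\<And>n. \<phi> n \<in> test_functions \<Omega>" "(\<lambda>n. pmod M p (\<lambda>x. H x - jet (\<phi> n) x)) \<longlonglongrightarrow> 0"
    "\<And>n. pmod M p (\<lambda>x. H x - jet (\<phi> n) x) \<le> ennreal (1 / real (Suc n))"
proof -
  have "\<exists>\<phi>\<in>test_functions \<Omega>. pmod M p (\<lambda>x. H x - jet \<phi> x) \<le> ennreal (1 / real (Suc n))" for n
    using assms by (auto simp: sob0_def)
  then obtain \<phi> where \<phi>: "\<And>n. \<phi> n \<in> test_functions \<Omega>" "\<And>n. pmod M p (\<lambda>x. H x - jet (\<phi> n) x) \<le> ennreal (1 / real (Suc n))"
    by metis
  have "(\<lambda>n. ennreal (1 / real (Suc n))) \<longlonglongrightarrow> ennreal 0"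
    by (intro tendsto_ennrealI LIMSEQ_Suc lim_const_over_n[of 1])
  then have l: "(\<lambda>n. ennreal (1 / real (Suc n))) \<longlonglongrightarrow> 0" by simp
  have "(\<lambda>n. pmod M p (\<lambda>x. H x - jet (\<phi> n) x)) \<longlonglongrightarrow> 0"
    by (rule tendsto_sandwich[OF _ _ tendsto_const l]) (use \<phi>(2) in auto)
  with \<phi> show ?thesis using that by blast
qed

lemma pmod_minus_commute: "pmod M p (\<lambda>x. f x - g x) = pmod M p (\<lambda>x. g x - f x)"
  by (simp add: pmod_def norm_minus_commute)

lemma sob0_lin:
  assumes H: "sob0 H" and K: "sob0 K" shows "sob0 (\<lambda>x. a *\<^sub>R H x + b *\<^sub>R K x)"
proof -
  obtain \<phi> where \<phi>: "\<And>n. \<phi> n \<in> test_functions \<Omega>" "(\<lambda>n. pmod M p (\<lambda>x. H x - jet (\<phi> n) x)) \<longlonglongrightarrow> 0" by (rule sob0_approx[OF H]) blast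
  obtain \<psi> where \<psi>: "\<And>n. \<psi> n \<in> test_functions \<Omega>" "(\<lambda>n. pmod M p (\<lambda>x. K x - jet (\<psi> n) x)) \<longlonglongrightarrow> 0" by (rule sob0_approx[OF K]) blast
  have sHK: "sob H" "sob K" using H K by (auto simp: sob0_def)
  note [measurable] = sobD(2)[OF sHK(1)] sobD(2)[OF sHK(2)] jet_meas[OF \<phi>(1)] jet_meas[OF \<psi>(1)]
  show ?thesis
  proof (rule sob0_limit[where K="\<lambda>n. jet (\<lambda>x. a * \<phi> n x + b * \<psi> n x)"])
    show "sob (\<lambda>x. a *\<^sub>R H x + b *\<^sub>R K x)" by (rule sob_lin[OF sHK])
    show "sob0 (jet (\<lambda>x. a * \<phi> n x + b * \<psi> n x))" for n by (rule sob0_jet[OF jet_lin(1)[OF \<phi>(1) \<psi>(1)]])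
    have *: "pmod M p (\<lambda>x. jet (\<lambda>x. a * \<phi> n x + b * \<psi> n x) x - (a *\<^sub>R H x + b *\<^sub>R K x)) \<le>
      ennreal (2 powr pp) * (ennreal (max 1 (\<bar>a\<bar> powr pp)) * pmod M p (\<lambda>x. H x - jet (\<phi> n) x) + ennreal (max 1 (\<bar>b\<bar> powr pp)) * pmod M p (\<lambda>x. K x - jet (\<psi> n) x))" for n
    proof -
      have "pmod M p (\<lambda>x. jet (\<lambda>x. a * \<phi> n x + b * \<psi> n x) x - (a *\<^sub>R H x + b *\<^sub>R K x)) = pmod M p (\<lambda>x. a *\<^sub>R (H x - jet (\<phi> n) x) + b *\<^sub>R (K x - jet (\<psi> n) x))"
        unfolding jet_lin(2)[OF \<phi>(1) \<psi>(1)] by (subst pmod_minus_commute) (simp add: algebra_simps)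
      also have "\<dots> \<le> ennreal (2 powr pp) * (pmod M p (\<lambda>x. a *\<^sub>R (H x - jet (\<phi> n) x)) + pmod M p (\<lambda>x. b *\<^sub>R (K x - jet (\<psi> n) x)))"
        by (rule pmod_add) measurable
      also have "\<dots> \<le> ennreal (2 powr pp) * (ennreal (max 1 (\<bar>a\<bar> powr pp)) * pmod M p (\<lambda>x. H x - jet (\<phi> n) x) + ennreal (max 1 (\<bar>b\<bar> powr pp)) * pmod M p (\<lambda>x. K x - jet (\<psi> n) x))"
        by (intro mult_left_mono add_mono pmod_scale) auto
      finally show ?thesis .
    qed
    have "(\<lambda>n. ennreal (2 powr pp) * (ennreal (max 1 (\<bar>a\<bar> powr pp)) * pmod M p (\<lambda>x. H x - jet (\<phi> n) x) + ennreal (max 1 (\<bar>b\<bar> powr pp)) * pmod M p (\<lambda>x. K x - jet (\<psi> n) x)))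
      \<longlonglongrightarrow> ennreal (2 powr pp) * (ennreal (max 1 (\<bar>a\<bar> powr pp)) * 0 + ennreal (max 1 (\<bar>b\<bar> powr pp)) * 0)"
      by (intro ennreal_tendsto_cmult tendsto_add \<phi>(2) \<psi>(2)) auto
    then have l0: "(\<lambda>n. ennreal (2 powr pp) * (ennreal (max 1 (\<bar>a\<bar> powr pp)) * pmod M p (\<lambda>x. H x - jet (\<phi> n) x) + ennreal (max 1 (\<bar>b\<bar> powr pp)) * pmod M p (\<lambda>x. K x - jet (\<psi> n) x))) \<longlonglongrightarrow> 0"
      by simp
    show "(\<lambda>n. pmod M p (\<lambda>x. jet (\<lambda>x. a * \<phi> n x + b * \<psi> n x) x - (a *\<^sub>R H x + b *\<^sub>R K x))) \<longlonglongrightarrow> 0"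
      by (rule tendsto_sandwich[OF _ _ tendsto_const l0]) (use * in auto)
  qed
qed

text \<open>The dyadic convex combinations of the members with index at least j. Uniform convexity
  compares a pair with its midpoint only, so no other convex combinations are formed.\<close>

inductive_set midhull :: "(nat \<Rightarrow> 'a \<Rightarrow> 'b::real_vector) \<Rightarrow> nat \<Rightarrow> ('a \<Rightarrow> 'b) set" for K :: "nat \<Rightarrow> 'a \<Rightarrow> 'b" and j :: nat where
  base: "i \<ge> j \<Longrightarrow> K i \<in> midhull K j"
| mid: "a \<in> midhull K j \<Longrightarrow> b \<in> midhull K j \<Longrightarrow> (\<lambda>x. (1/2) *\<^sub>R (a x + b x)) \<in> midhull K j"

lemma midhull_induct_pred:
  assumes "h \<in> midhull K j" "\<And>i. i \<ge> j \<Longrightarrow> P (K i)" "\<And>a b. P a \<Longrightarrow> P b \<Longrightarrow> P (\<lambda>x. (1/2) *\<^sub>R (a x + b x))"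
  shows "P h"
  using assms(1) by (induction) (use assms(2,3) in auto)

lemma midhull_sob:
  assumes "\<And>i. sob (K i)" "h \<in> midhull K j" shows "sob h"
  using assms(2)
proof (rule midhull_induct_pred)
  fix a b assume "sob a" "sob b"
  from sob_lin[OF this, of "1/2" "1/2"] show "sob (\<lambda>x. (1/2) *\<^sub>R (a x + b x))" by (simp add: scaleR_add_right)
qed (rule assms(1))

lemma midhull_sob0:
  assumes "\<And>i. sob0 (K i)" "h \<in> midhull K j" shows "sob0 h"
  using assms(2)
proof (rule midhull_induct_pred)
  fix a b assume "sob0 a" "sob0 b"
  from sob0_lin[OF this, of "1/2" "1/2"] show "sob0 (\<lambda>x. (1/2) *\<^sub>R (a x + b x))" by (simp add: scaleR_add_right)
qed (rule assms(1))

text \<open>A bound on a midpoint-convex integral passes from two functions to their midpoint, hence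
  to the whole hull. It is used for the modular, for the L1 distance to a fixed function and for the
  integral of f.\<close>

lemma midhull_integral_le:
  assumes K: "\<And>i. sob (K i)" and \<Phi>: "\<And>a. sob a \<Longrightarrow> integrable M (\<lambda>x. \<Phi> x (a x))"
    and conv: "\<And>x y z. x \<in> \<Omega> \<Longrightarrow> \<Phi> x ((1/2) *\<^sub>R (y + z)) \<le> (\<Phi> x y + \<Phi> x z) / 2"
    and c: "\<And>i. i \<ge> j \<Longrightarrow> (LINT x|M. \<Phi> x (K i x)) \<le> c" and h: "h \<in> midhull K j"
  shows "(LINT x|M. \<Phi> x (h x)) \<le> (c::real)"
proof -
  have "sob h \<and> (LINT x|M. \<Phi> x (h x)) \<le> c"
    using h
  proof (rule midhull_induct_pred)
    fix a b assume ab: "sob a \<and> (LINT x|M. \<Phi> x (a x)) \<le> c" "sob b \<and> (LINT x|M. \<Phi> x (b x)) \<le> c"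
    have s: "sob (\<lambda>x. (1/2) *\<^sub>R (a x + b x))" using sob_lin[of a b "1/2" "1/2"] ab by (simp add: scaleR_add_right)
    have i: "integrable M (\<lambda>x. \<Phi> x (a x))" "integrable M (\<lambda>x. \<Phi> x (b x))" using ab \<Phi> by auto
    have "(LINT x|M. \<Phi> x ((1/2) *\<^sub>R (a x + b x))) \<le> (LINT x|M. (\<Phi> x (a x) + \<Phi> x (b x)) / 2)"
      by (rule bochner_mono[OF \<Phi>[OF s]]) (use i conv in auto)
    also have "\<dots> = ((LINT x|M. \<Phi> x (a x)) + (LINT x|M. \<Phi> x (b x))) / 2" using i by simp
    also have "\<dots> \<le> c" using ab by simp
    finally show "sob (\<lambda>x. (1/2) *\<^sub>R (a x + b x)) \<and> (LINT x|M. \<Phi> x ((1/2) *\<^sub>R (a x + b x))) \<le> c" using s by simp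
  qed (use K c in simp)
  then show ?thesis ..
qed

lemma midhull_pmod_le:
  assumes K: "\<And>i. sob (K i)" "\<And>i. pmod M p (K i) \<le> ennreal R" and h: "h \<in> midhull K j"
  shows "pmod M p h \<le> ennreal R"
proof -
  have R: "ennreal R = ennreal (max 0 R)" by (simp add: max_def ennreal_neg)
  have eq: "pmod M p a = ennreal (LINT x|M. norm (a x) powr p x)" if "sob a" for a by (rule pmod_finite_integrable(3)[OF sobD(2,3)[OF that]])
  have "(LINT x|M. norm (h x) powr p x) \<le> max 0 R"
  proof (rule midhull_integral_le[where \<Phi>="\<lambda>x y. norm y powr p x", OF K(1) _ _ _ h])
    show "integrable M (\<lambda>x. norm (a x) powr p x)" if "sob a" for a by (rule pmod_finite_integrable(2)[OF sobD(2,3)[OF that]])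
    show "norm ((1/2) *\<^sub>R (y + z)) powr p x \<le> (norm y powr p x + norm z powr p x) / 2" if "x \<in> \<Omega>" for x and y z :: "real \<times> 'a"
      using powr_gap(1)[of "p x" y z] pp'[OF that] pm1 by (simp add: powr_gap_def)
    show "(LINT x|M. norm (K i x) powr p x) \<le> max 0 R" for i using K(2)[of i] unfolding R eq[OF K(1)] by (subst (asm) ennreal_le_iff) auto
  qed
  then show ?thesis unfolding R eq[OF midhull_sob[OF K(1) h]] by (rule ennreal_leI)
qed

lemma midhull_L1:
  fixes w :: "'a \<Rightarrow> real"
  assumes K: "\<And>i. sob (K i)" and w: "integrable M w" and e: "\<And>i. i \<ge> j \<Longrightarrow> (LINT x|M. \<bar>fst (K i x) - w x\<bar>) \<le> e" and h: "h \<in> midhull K j"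
  shows "(LINT x|M. \<bar>fst (h x) - w x\<bar>) \<le> e"
proof (rule midhull_integral_le[where \<Phi>="\<lambda>x y. \<bar>fst y - w x\<bar>", OF K _ _ e h])
  show "integrable M (\<lambda>x. \<bar>fst (a x) - w x\<bar>)" if "sob a" for a using sobD(5)[OF that] w by simp
  show "\<bar>fst ((1/2) *\<^sub>R (y + z)) - w x\<bar> \<le> (\<bar>fst y - w x\<bar> + \<bar>fst z - w x\<bar>) / 2" for x and y z :: "real \<times> 'a"
  proof -
    have "fst ((1/2) *\<^sub>R (y + z)) - w x = ((fst y - w x) + (fst z - w x)) / 2" by (simp add: field_simps)
    then have "\<bar>fst ((1/2) *\<^sub>R (y + z)) - w x\<bar> = \<bar>(fst y - w x) + (fst z - w x)\<bar> / 2" by (simp only: abs_divide abs_numeral)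
    also have "\<dots> \<le> (\<bar>fst y - w x\<bar> + \<bar>fst z - w x\<bar>) / 2" by (intro divide_right_mono abs_triangle_ineq) simp
    finally show ?thesis .
  qed
qed

lemma pmod_tendsto_L1_fst_snd:
  assumes l: "(\<lambda>n. pmod M p (\<lambda>x. H x - K n x)) \<longlonglongrightarrow> 0" and s: "sob H" "\<And>n. sob (K n)"
  shows "(\<lambda>n. LINT x|M. \<bar>fst (H x) - fst (K n x)\<bar>) \<longlonglongrightarrow> 0" "(\<lambda>n. LINT x|M. norm (snd (H x) - snd (K n x))) \<longlonglongrightarrow> 0"
proof -
  have s': "sob (\<lambda>x. H x - K n x)" for n using sob_lin[OF s(1) s(2)[of n], of 1 "-1"] by simp
  note L = L1_tendsto_linear[OF sobD(4)[OF s'] pmod_tendsto_L1[OF sobD(2)[OF s'] l]]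
  show "(\<lambda>n. LINT x|M. \<bar>fst (H x) - fst (K n x)\<bar>) \<longlonglongrightarrow> 0" using L[OF bounded_linear_fst norm_fst_snd_le(1)] by simp
  show "(\<lambda>n. LINT x|M. norm (snd (H x) - snd (K n x))) \<longlonglongrightarrow> 0" using L[OF bounded_linear_snd norm_fst_snd_le(2)] by simp
qed

lemma midhull_antimono: "i \<le> j \<Longrightarrow> midhull K j \<subseteq> midhull K i"
proof
  fix h assume ij: "i \<le> j" and "h \<in> midhull K j"
  from this(2) show "h \<in> midhull K i"
    by (rule midhull_induct_pred) (use ij in \<open>auto intro: midhull.intros\<close>)
qed

text \<open>The function h n combines only members K i with i \<ge> n, so its first component still
  tends to w in L1; this identifies the modular limit, and closedness of weak gradients under L1
  convergence makes it a Sobolev pair.\<close>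

lemma sob_weak_limit:
  fixes w :: "'a \<Rightarrow> real"
  assumes K: "\<And>i. sob (K i)" "\<And>i. pmod M p (K i) \<le> ennreal R" and w: "integrable M w"
    and l: "(\<lambda>n. LINT x|M. \<bar>fst (K n x) - w x\<bar>) \<longlonglongrightarrow> 0"
  obtains H h where "sob H" "\<And>x. fst (H x) = w x" "\<And>n. h n \<in> midhull K n" "(\<lambda>n. pmod M p (\<lambda>x. h n x - H x)) \<longlonglongrightarrow> 0"
proof -
  obtain h H0 where h: "\<And>n. h n \<in> midhull K n" and H0: "H0 \<in> borel_measurable M" "pmod M p H0 < \<infinity>"
    and lim: "(\<lambda>n. pmod M p (\<lambda>x. h n x - H0 x)) \<longlonglongrightarrow> 0"
  proof (rule midpoint_convex_limit[OF _ _ pm1, of "midhull K" R])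
    show "h \<in> borel_measurable M" if "h \<in> midhull K j" for h j using midhull_sob[OF K(1) that] sobD(2) by blast
    show "pmod M p h \<le> ennreal R" if "h \<in> midhull K j" for h j by (rule midhull_pmod_le[OF K that])
    show "midhull K j \<noteq> {}" for j using midhull.base[of j j K] by auto
    show "midhull K j \<subseteq> midhull K i" if "i \<le> j" for i j by (rule midhull_antimono[OF that])
    show "(\<lambda>x. (1/2) *\<^sub>R (a x + b x)) \<in> midhull K j" if "a \<in> midhull K j" "b \<in> midhull K j" for a b j
      by (rule midhull.mid[OF that])
  qed blast
  have hs: "sob (h n)" for n by (rule midhull_sob[OF K(1) h])
  note [measurable] = H0(1) sobD(2)[OF hs]
  have iH0: "integrable M H0" by (rule pmod_finite_integrable(1)[OF H0])
  have iHf: "integrable M (\<lambda>x. fst (H0 x))" "integrable M (\<lambda>x. snd (H0 x))"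
    using integrable_bounded_linear[OF bounded_linear_fst iH0] integrable_bounded_linear[OF bounded_linear_snd iH0] by auto
  have L: "(\<lambda>n. LINT x|M. norm (h n x - H0 x)) \<longlonglongrightarrow> 0" by (rule pmod_tendsto_L1[OF _ lim]) measurable
  have id: "integrable M (\<lambda>x. h n x - H0 x)" for n using sobD(4)[OF hs] iH0 by auto
  have Lf: "(\<lambda>n. LINT x|M. \<bar>fst (h n x) - fst (H0 x)\<bar>) \<longlonglongrightarrow> 0" using L1_tendsto_linear[OF id L bounded_linear_fst norm_fst_snd_le(1)] by simp
  have Ls: "(\<lambda>n. LINT x|M. norm (snd (h n x) - snd (H0 x))) \<longlonglongrightarrow> 0" using L1_tendsto_linear[OF id L bounded_linear_snd norm_fst_snd_le(2)] by simp
  have Lw: "(\<lambda>n. LINT x|M. \<bar>fst (h n x) - w x\<bar>) \<longlonglongrightarrow> 0"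
  proof (rule LIMSEQ_I)
    fix e :: real assume "e > 0"
    then obtain N where N: "\<And>n. n \<ge> N \<Longrightarrow> norm ((LINT x|M. \<bar>fst (K n x) - w x\<bar>) - 0) < e / 2" using LIMSEQ_D[OF l, of "e/2"] by auto
    have "(LINT x|M. \<bar>fst (h n x) - w x\<bar>) \<le> e / 2" if "n \<ge> N" for n
      by (rule midhull_L1[OF K(1) w _ h]) (use N that in \<open>fastforce intro: less_imp_le\<close>)
    then show "\<exists>N. \<forall>n\<ge>N. norm ((LINT x|M. \<bar>fst (h n x) - w x\<bar>) - 0) < e"
      using \<open>e > 0\<close> by (intro exI[of _ N]) fastforce
  qed
  have wae: "AE x in M. fst (H0 x) = w x"
  proof -
    have "(LINT x|M. \<bar>fst (H0 x) - w x\<bar>) \<le> (LINT x|M. \<bar>fst (h n x) - fst (H0 x)\<bar>) + (LINT x|M. \<bar>fst (h n x) - w x\<bar>)" for n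
    proof -
      have "(LINT x|M. \<bar>fst (H0 x) - w x\<bar>) \<le> (LINT x|M. \<bar>fst (h n x) - fst (H0 x)\<bar> + \<bar>fst (h n x) - w x\<bar>)"
        by (rule bochner_mono) (use sobD(5)[OF hs] iHf w in auto)
      also have "\<dots> = (LINT x|M. \<bar>fst (h n x) - fst (H0 x)\<bar>) + (LINT x|M. \<bar>fst (h n x) - w x\<bar>)"
        using sobD(5)[OF hs] iHf w by simp
      finally show ?thesis .
    qed
    moreover have "(\<lambda>n. (LINT x|M. \<bar>fst (h n x) - fst (H0 x)\<bar>) + (LINT x|M. \<bar>fst (h n x) - w x\<bar>)) \<longlonglongrightarrow> 0 + 0"
      by (intro tendsto_add Lf Lw)
    ultimately have "(LINT x|M. \<bar>fst (H0 x) - w x\<bar>) \<le> 0"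
      using LIMSEQ_le_const[of _ "0 + 0" "LINT x|M. \<bar>fst (H0 x) - w x\<bar>"] by fastforce
    then have "(LINT x|M. \<bar>fst (H0 x) - w x\<bar>) = 0" by (simp add: antisym)
    moreover have "(LINT x|M. \<bar>fst (H0 x) - w x\<bar>) = 0 \<longleftrightarrow> (AE x in M. \<bar>fst (H0 x) - w x\<bar> = 0)"
      by (rule integral_nonneg_eq_0_iff_AE) (use iHf w in auto)
    ultimately show ?thesis by simp
  qed
  \<comment> \<open>The first component is known to equal w only almost everywhere; it is replaced
    by w so that the conclusion holds at every point.\<close>
  define H where "H x = (w x, snd (H0 x))" for x
  have HH0: "AE x in M. H x = H0 x" using wae by eventually_elim (simp add: H_def prod_eq_iff)
  have wg: "has_weak_grad \<Omega> w (\<lambda>x. snd (H0 x))"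
    by (rule weak_grad_test_limit[OF \<Omega>_open sobD(1)[OF hs] sobD(5)[OF hs] sobD(6)[OF hs] w iHf(2) Lw Ls])
  have "sob H"
    unfolding sob_def
  proof (intro conjI)
    show "has_weak_grad \<Omega> (\<lambda>x. fst (H x)) (\<lambda>x. snd (H x))" using wg by (simp add: H_def)
    have "w \<in> borel_measurable M" "(\<lambda>x. snd (H0 x)) \<in> borel_measurable M" using w iHf by auto
    then show "H \<in> borel_measurable M" unfolding H_def[abs_def] by (rule borel_measurable_Pair_vec)
    have "pmod M p H = pmod M p H0" by (rule pmod_cong_AE) (use HH0 in auto)
    then show "pmod M p H < \<infinity>" using H0 by simp
  qed
  moreover have "(\<lambda>n. pmod M p (\<lambda>x. h n x - H x)) = (\<lambda>n. pmod M p (\<lambda>x. h n x - H0 x))"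
    by (rule ext, rule pmod_cong_AE) (use HH0 in auto)
  then have "(\<lambda>n. pmod M p (\<lambda>x. h n x - H x)) \<longlonglongrightarrow> 0" using lim by simp
  ultimately show ?thesis using that[of H h] h by (simp add: H_def)
qed

text \<open>The main device for proving membership in \<open>sob0\<close>: first components converge
  in L1, gradients merely stay bounded in the modular, and the midpoints, which remain in the linear
  space \<open>sob0\<close>, do the rest.\<close>

lemma sob0_weak_closed:
  fixes w :: "'a \<Rightarrow> real"
  assumes K: "\<And>i. sob0 (K i)" "\<And>i. pmod M p (K i) \<le> ennreal R" and w: "integrable M w"
    and l: "(\<lambda>n. LINT x|M. \<bar>fst (K n x) - w x\<bar>) \<longlonglongrightarrow> 0"
  shows "\<exists>H. sob0 H \<and> (\<forall>x. fst (H x) = w x)"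
proof -
  have Ks: "sob (K i)" for i using K(1)[of i] by (simp add: sob0_def)
  obtain H h where H: "sob H" "\<And>x. fst (H x) = w x" "\<And>n. h n \<in> midhull K n" "(\<lambda>n. pmod M p (\<lambda>x. h n x - H x)) \<longlonglongrightarrow> 0"
    by (rule sob_weak_limit[OF Ks K(2) w l]) blast
  have "sob0 H" by (rule sob0_limit[OF H(1) midhull_sob0[OF K(1) H(3)] H(4)])
  then show ?thesis using H(2) by blast
qed

lemma sob_unique_AE:
  assumes "sob H" "sob K" "AE x in M. fst (H x) = fst (K x)"
  shows "AE x in M. H x = K x"
proof -
  have "has_weak_grad \<Omega> (\<lambda>x. fst (K x)) (\<lambda>x. snd (H x))"
    by (rule has_weak_grad_cong_AE[OF \<Omega>_open sobD(1)[OF assms(1)] sobD(5,6)[OF assms(1)] sobD(7)[OF assms(2)] sobD(8)[OF assms(1)] assms(3)]) simp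
  from has_weak_grad_unique[OF \<Omega>_open this sobD(1)[OF assms(2)]] assms(3)
  show ?thesis by eventually_elim (simp add: prod_eq_iff)
qed

lemma sob_cong_AE:
  assumes H: "sob H" and K: "K \<in> borel_measurable M" "AE x in M. H x = K x"
  shows "sob K" "sob0 H \<Longrightarrow> sob0 K"
proof -
  have e: "pmod M p (\<lambda>x. H x - f x) = pmod M p (\<lambda>x. K x - f x)" for f
    by (rule pmod_cong_AE) (use K(2) in auto)
  show s: "sob K"
    unfolding sob_def
  proof (intro conjI)
    show "has_weak_grad \<Omega> (\<lambda>x. fst (K x)) (\<lambda>x. snd (K x))"
      by (rule has_weak_grad_cong_AE[OF \<Omega>_open sobD(1)[OF H] sobD(5,6)[OF H] borel_measurable_fst_snd[OF K(1)]]) (use K(2) in auto)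
    have "pmod M p H = pmod M p K" by (rule pmod_cong_AE) (use K(2) in auto)
    then show "pmod M p K < \<infinity>" using sobD(3)[OF H] by simp
  qed (rule K(1))
  show "sob0 K" if "sob0 H" using that s e by (simp add: sob0_def)
qed

text \<open>The first component determines the gradient almost everywhere, so membership established
  for a pair found as an abstract limit transfers to the given pair.\<close>

lemma sob0_unique: "sob0 H \<Longrightarrow> sob K \<Longrightarrow> (\<And>x. fst (H x) = fst (K x)) \<Longrightarrow> sob0 K"
  using sob_cong_AE(2)[of H K] sob_unique_AE[of H K] sobD(2)[of K] by (auto simp: sob0_def)

lemma sob_const: "sob (\<lambda>x. (k, 0))"
  unfolding sob_def
proof (intro conjI)
  have "C1_grad (\<lambda>x::'a. k) (\<lambda>x. 0)" by (simp add: C1_grad_def)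
  from C1_grad_has_weak_grad[OF \<Omega>_open this] show "has_weak_grad \<Omega> (\<lambda>x. fst (k, 0)) (\<lambda>x. snd (k, 0))" by simp
  show "pmod M p (\<lambda>x. (k, 0::'a)) < \<infinity>" by (rule pmod_bounded_finite(2)[where B="\<bar>k\<bar>"]) (simp add: norm_Pair)
qed simp

definition pos_jet :: "('a \<Rightarrow> real \<times> 'a) \<Rightarrow> 'a \<Rightarrow> real \<times> 'a" where
  "pos_jet H x = (if fst (H x) > 0 then H x else 0)"

lemma sob_pos_jet: "sob H \<Longrightarrow> sob (pos_jet H)"
  unfolding sob_def[of "pos_jet H"]
proof (intro conjI)
  assume H: "sob H"
  have 1: "fst (pos_jet H x) = max (fst (H x)) 0" "snd (pos_jet H x) = (if fst (H x) > 0 then snd (H x) else 0)" for x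
    by (auto simp: pos_jet_def)
  show "has_weak_grad \<Omega> (\<lambda>x. fst (pos_jet H x)) (\<lambda>x. snd (pos_jet H x))"
    unfolding 1 by (rule has_weak_grad_pos[OF \<Omega>_open sobD(1)[OF H] sobD(5,6)[OF H]])
  note [measurable] = sobD(2,7)[OF H]
  show "pos_jet H \<in> borel_measurable M" unfolding pos_jet_def[abs_def] by measurable
  have "pmod M p (pos_jet H) \<le> pmod M p H" by (rule pmod_mono) (simp add: pos_jet_def)
  then show "pmod M p (pos_jet H) < \<infinity>" using sobD(3)[OF H] by simp
qed

section \<open>Luxemburg norm against modular\<close>

lemma luxemburg_ge_0: "0 \<le> luxemburg_norm \<Omega> p f" if "f \<in> var_Lp \<Omega> p"
  unfolding luxemburg_norm_def
proof (rule cInf_greatest)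
  show "{l. 0 < l \<and> var_modular \<Omega> p (\<lambda>x. f x / l) \<le> 1} \<noteq> {}"
    using luxemburg_nonempty[OF p_meas' _ that] pp' pm1 by (force intro: less_imp_le)
qed auto

text \<open>For l < 1 and p \<ge> 1 one has l^p \<le> l, so the modular of f is at most l times that
  of f / l.\<close>

lemma luxemburg_less_modular:
  assumes f: "f \<in> var_Lp \<Omega> p" and e: "luxemburg_norm \<Omega> p f < e" "e \<le> 1"
  shows "var_modular \<Omega> p f \<le> ennreal e"
proof -
  have ne: "{l. 0 < l \<and> var_modular \<Omega> p (\<lambda>x. f x / l) \<le> 1} \<noteq> {}"
    using luxemburg_nonempty[OF p_meas' _ f] pp' pm1 by (force intro: less_imp_le)
  obtain l where l: "l > 0" "var_modular \<Omega> p (\<lambda>x. f x / l) \<le> 1" "l < e"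
    using cInf_lessD[OF ne e(1)[unfolded luxemburg_norm_def]] by auto
  have [measurable]: "f \<in> borel_measurable M" using f by (auto simp: var_Lp_def)
  have "var_modular \<Omega> p f \<le> (\<integral>\<^sup>+x. ennreal l * ennreal (\<bar>f x / l\<bar> powr p x) \<partial>M)"
    unfolding var_modular_def
  proof (rule nn_integral_mono)
    fix x assume "x \<in> space M"
    then have p: "1 \<le> p x" using pp'[of x] pm1 by auto
    have "\<bar>f x\<bar> powr p x = l powr p x * \<bar>f x / l\<bar> powr p x" using l by (simp flip: powr_mult)
    also have "\<dots> \<le> l powr 1 * \<bar>f x / l\<bar> powr p x" using l p e by (intro mult_right_mono powr_mono') auto
    finally show "ennreal (\<bar>f x\<bar> powr p x) \<le> ennreal l * ennreal (\<bar>f x / l\<bar> powr p x)"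
      using l by (simp add: ennreal_mult[symmetric] ennreal_leI)
  qed
  also have "\<dots> = ennreal l * var_modular \<Omega> p (\<lambda>x. f x / l)"
    unfolding var_modular_def by (rule nn_integral_cmult) measurable
  also have "\<dots> \<le> ennreal l * 1" using l by (intro mult_left_mono) auto
  also have "\<dots> \<le> ennreal e" using l by (simp add: ennreal_leI)
  finally show ?thesis .
qed

text \<open>The reverse comparison costs the largest exponent: for e \<le> 1, dividing by e
  multiplies the modular by at most e^(-pp).\<close>

lemma modular_luxemburg_le:
  assumes [measurable]: "f \<in> borel_measurable M" and e: "0 < e" "e \<le> 1" and m: "var_modular \<Omega> p f \<le> ennreal (e powr pp)"
  shows "luxemburg_norm \<Omega> p f \<le> e"
  unfolding luxemburg_norm_def
proof (rule cInf_lower)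
  have "var_modular \<Omega> p (\<lambda>x. f x / e) \<le> (\<integral>\<^sup>+x. ennreal (e powr (- pp)) * ennreal (\<bar>f x\<bar> powr p x) \<partial>M)"
    unfolding var_modular_def
  proof (rule nn_integral_mono)
    fix x assume "x \<in> space M"
    then have p: "p x \<le> pp" using pp'[of x] by auto
    have "\<bar>f x / e\<bar> powr p x = e powr (- p x) * \<bar>f x\<bar> powr p x" using e by (simp add: powr_divide powr_minus field_simps)
    also have "\<dots> \<le> e powr (- pp) * \<bar>f x\<bar> powr p x" using e p by (intro mult_right_mono powr_mono') auto
    finally show "ennreal (\<bar>f x / e\<bar> powr p x) \<le> ennreal (e powr (- pp)) * ennreal (\<bar>f x\<bar> powr p x)"
      by (simp add: ennreal_mult[symmetric] ennreal_leI)
  qed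
  also have "\<dots> = ennreal (e powr (- pp)) * var_modular \<Omega> p f"
    unfolding var_modular_def by (rule nn_integral_cmult) measurable
  also have "\<dots> \<le> ennreal (e powr (- pp)) * ennreal (e powr pp)" using m by (rule mult_left_mono) simp
  also have "\<dots> = 1" using e by (simp add: ennreal_mult[symmetric] powr_add[symmetric])
  finally show "e \<in> {l. 0 < l \<and> var_modular \<Omega> p (\<lambda>x. f x / l) \<le> 1}" using e by simp
qed (auto intro: bdd_belowI[of _ 0])

lemma pmod_real: "pmod M p (u :: 'a \<Rightarrow> real) = var_modular \<Omega> p u"
  by (simp add: pmod_def var_modular_def)

lemma pmod_norm: "pmod M p G = var_modular \<Omega> p (\<lambda>x. norm (G x))"
  by (simp add: pmod_def var_modular_def)

lemma sob_Pair_iff: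
  "sob (\<lambda>x. (u x, G x)) \<longleftrightarrow> has_weak_grad \<Omega> u G \<and> u \<in> var_Lp \<Omega> p \<and> (\<lambda>x. norm (G x)) \<in> var_Lp \<Omega> p"
proof safe
  assume s: "sob (\<lambda>x. (u x, G x))"
  show "has_weak_grad \<Omega> u G" using sobD(1)[OF s] by simp
  have "pmod M p u < \<infinity>" "pmod M p G < \<infinity>" using pmod_fst_snd_le[of "\<lambda>x. (u x, G x)"] sobD(3)[OF s] by (auto intro: le_less_trans)
  then show "u \<in> var_Lp \<Omega> p" "(\<lambda>x. norm (G x)) \<in> var_Lp \<Omega> p"
    using sobD(7,8)[OF s] by (auto simp: var_Lp_def pmod_real pmod_norm)
next
  assume w: "has_weak_grad \<Omega> u G" and u: "u \<in> var_Lp \<Omega> p" and G: "(\<lambda>x. norm (G x)) \<in> var_Lp \<Omega> p"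
  have m: "u \<in> borel_measurable M" "G \<in> borel_measurable M"
    using locally_integrable_measurable[OF \<Omega>_open] w by (auto simp: has_weak_grad_def)
  have "pmod M p (\<lambda>x. (u x, G x)) < \<infinity>"
    by (rule le_less_trans[OF pmod_Pair_le[OF m]])
      (use u G in \<open>auto simp: var_Lp_def pmod_real pmod_norm[of G] ennreal_mult_less_top\<close>)
  then show "sob (\<lambda>x. (u x, G x))" using w borel_measurable_Pair_vec[OF m] by (simp add: sob_def)
qed

lemma var_W1p_iff: "u \<in> var_W1p \<Omega> p \<longleftrightarrow> (\<exists>G. sob (\<lambda>x. (u x, G x)))"
  unfolding var_W1p_def sob_Pair_iff by auto

lemma sob_weak_grad:
  assumes "sob (\<lambda>x. (u x, G x))"
  shows "sob (\<lambda>x. (u x, weak_grad \<Omega> u x))" "AE x in M. weak_grad \<Omega> u x = G x"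
proof -
  have w: "has_weak_grad \<Omega> u (weak_grad \<Omega> u)" unfolding weak_grad_def
    by (rule someI[of "has_weak_grad \<Omega> u"]) (use sobD(1)[OF assms] in simp)
  show ae: "AE x in M. weak_grad \<Omega> u x = G x"
    by (rule has_weak_grad_unique[OF \<Omega>_open w]) (use sobD(1)[OF assms] in simp)
  have m: "u \<in> borel_measurable M" "weak_grad \<Omega> u \<in> borel_measurable M"
    using locally_integrable_measurable[OF \<Omega>_open] w by (auto simp: has_weak_grad_def)
  show "sob (\<lambda>x. (u x, weak_grad \<Omega> u x))"
    by (rule sob_cong_AE(1)[OF assms borel_measurable_Pair_vec[OF m]]) (use ae in auto)
qed

text \<open>Norm and modular have the same null sequences, by \<open>luxemburg_less_modular\<close>
  and \<open>modular_luxemburg_le\<close>. The other difference to be bridged is that the norm uses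
  the chosen \<open>weak_grad\<close> while pairs carry their own gradient; the two agree almost
  everywhere.\<close>

lemma var_W1p_0_iff: "u \<in> var_W1p_0 \<Omega> p \<longleftrightarrow> (\<exists>G. sob0 (\<lambda>x. (u x, G x)))"
proof safe
  assume u: "u \<in> var_W1p_0 \<Omega> p"
  then obtain G where G: "sob (\<lambda>x. (u x, G x))" by (auto simp: var_W1p_0_def var_W1p_iff)
  have "\<exists>\<phi>\<in>test_functions \<Omega>. pmod M p (\<lambda>x. (u x, G x) - jet \<phi> x) \<le> ennreal e" if "e > 0" for e
  proof -
    \<comment> \<open>Capped at 1 because the comparison of norm and modular holds only for levels
      up to 1; the remaining factor compensates the quasi-triangle constant in
      \<open>pmod_Pair_le\<close>.\<close>
    define e' where "e' = min 1 (e / (2 * 2 powr pp))"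
    have e': "e' > 0" "e' \<le> 1" using \<open>e > 0\<close> by (auto simp: e'_def)
    obtain \<phi> where \<phi>: "\<phi> \<in> test_functions \<Omega>" "W1p_norm \<Omega> p (\<lambda>x. u x - \<phi> x) < e'" using u e'(1) by (auto simp: var_W1p_0_def)
    let ?D = "\<lambda>x. (u x - \<phi> x, G x - classical_grad \<phi> x)"
    have sD: "sob ?D" using sob_lin[OF G sob_jet[OF \<phi>(1)], of 1 "-1"] by (simp add: jet_def)
    note W = sob_weak_grad[OF sD]
    have L: "(\<lambda>x. u x - \<phi> x) \<in> var_Lp \<Omega> p" "(\<lambda>x. norm (weak_grad \<Omega> (\<lambda>x. u x - \<phi> x) x)) \<in> var_Lp \<Omega> p"
      using W(1) unfolding sob_Pair_iff by auto
    have "luxemburg_norm \<Omega> p (\<lambda>x. u x - \<phi> x) < e'" "luxemburg_norm \<Omega> p (\<lambda>x. norm (weak_grad \<Omega> (\<lambda>x. u x - \<phi> x) x)) < e'"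
      using \<phi>(2) luxemburg_ge_0[OF L(1)] luxemburg_ge_0[OF L(2)] unfolding W1p_norm_def by linarith+
    then have b: "pmod M p (\<lambda>x. u x - \<phi> x) \<le> ennreal e'" "pmod M p (weak_grad \<Omega> (\<lambda>x. u x - \<phi> x)) \<le> ennreal e'"
      using luxemburg_less_modular[OF L(1) _ e'(2)] luxemburg_less_modular[OF L(2) _ e'(2)] by (auto simp: pmod_real pmod_norm)
    have "pmod M p (\<lambda>x. (u x, G x) - jet \<phi> x) = pmod M p (\<lambda>x. (u x - \<phi> x, weak_grad \<Omega> (\<lambda>x. u x - \<phi> x) x))"
      by (rule pmod_cong_AE) (use W(2) in \<open>auto simp: jet_def\<close>)
    also have "\<dots> \<le> ennreal (2 powr pp) * (pmod M p (\<lambda>x. u x - \<phi> x) + pmod M p (weak_grad \<Omega> (\<lambda>x. u x - \<phi> x)))"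
      by (rule pmod_Pair_le) (use sobD(7,8)[OF W(1)] in auto)
    also have "\<dots> \<le> ennreal (2 powr pp) * (ennreal e' + ennreal e')" by (intro mult_left_mono add_mono b) simp
    also have "\<dots> = ennreal (2 powr pp * (e' + e'))" using e' by (simp add: ennreal_mult flip: ennreal_plus)
    also have "\<dots> \<le> ennreal e"
    proof (rule ennreal_leI)
      have "e' \<le> e / (2 * 2 powr pp)" by (simp add: e'_def)
      then show "2 powr pp * (e' + e') \<le> e" by (simp add: field_simps)
    qed
    finally show ?thesis using \<phi>(1) by blast
  qed
  then show "\<exists>G. sob0 (\<lambda>x. (u x, G x))" using G by (auto simp: sob0_def)
next
  fix G assume s0: "sob0 (\<lambda>x. (u x, G x))"
  then have G: "sob (\<lambda>x. (u x, G x))" by (simp add: sob0_def)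
  have "\<exists>\<phi>\<in>test_functions \<Omega>. W1p_norm \<Omega> p (\<lambda>x. u x - \<phi> x) < e" if "e > 0" for e
  proof -
    define e' where "e' = min 1 (e / 3)"
    have e': "e' > 0" "e' \<le> 1" "e' + e' < e" using \<open>e > 0\<close> by (auto simp: e'_def)
    obtain \<phi> where \<phi>: "\<phi> \<in> test_functions \<Omega>" "pmod M p (\<lambda>x. (u x, G x) - jet \<phi> x) \<le> ennreal (e' powr pp)"
    proof -
      have "e' powr pp > 0" using e'(1) by simp
      then show ?thesis using s0 that unfolding sob0_def by blast
    qed
    let ?D = "\<lambda>x. (u x - \<phi> x, G x - classical_grad \<phi> x)"
    have sD: "sob ?D" using sob_lin[OF G sob_jet[OF \<phi>(1)], of 1 "-1"] by (simp add: jet_def)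
    note W = sob_weak_grad[OF sD]
    have "pmod M p (\<lambda>x. (u x, G x) - jet \<phi> x) = pmod M p (\<lambda>x. (u x - \<phi> x, weak_grad \<Omega> (\<lambda>x. u x - \<phi> x) x))"
      by (rule pmod_cong_AE) (use W(2) in \<open>auto simp: jet_def\<close>)
    then have "pmod M p (\<lambda>x. u x - \<phi> x) \<le> ennreal (e' powr pp)" "pmod M p (weak_grad \<Omega> (\<lambda>x. u x - \<phi> x)) \<le> ennreal (e' powr pp)"
      using \<phi>(2) pmod_fst_snd_le[of "\<lambda>x. (u x - \<phi> x, weak_grad \<Omega> (\<lambda>x. u x - \<phi> x) x)"] by (auto intro: order_trans)
    then have "luxemburg_norm \<Omega> p (\<lambda>x. u x - \<phi> x) \<le> e'" "luxemburg_norm \<Omega> p (\<lambda>x. norm (weak_grad \<Omega> (\<lambda>x. u x - \<phi> x) x)) \<le> e'"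
      using modular_luxemburg_le[OF _ e'(1,2)] sobD(7,8)[OF W(1)] by (auto simp: pmod_real pmod_norm)
    then show ?thesis using \<phi>(1) e'(3) by (auto simp: W1p_norm_def intro!: bexI[of _ \<phi>])
  qed
  then show "u \<in> var_W1p_0 \<Omega> p" using G by (auto simp: var_W1p_0_def var_W1p_iff)
qed

end

section \<open>Mollification and truncation in the variable exponent space\<close>

context var_domain
begin

lemma Lh_nonneg: "0 \<le> Lh" if ne: "\<Omega> \<noteq> {}"
proof -
  obtain x where "x \<in> \<Omega>" using ne by blast
  from log_hoelder[of "1/2" x x] this show ?thesis by simp
qed

text \<open>Let s be the mollification of |H| at x and q a lower bound for p on the ball of radius
  e. Jensen's inequality with the fixed exponent q bounds s^q by 1 plus the mollification of |H|^p.
  The missing factor s^(p x - q) is bounded independently of e: s grows at most like e^(-n), while p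
  x - q is at most Lh / ln (1/e).\<close>

lemma moll_powr_pointwise:
  fixes H :: "'a \<Rightarrow> 'b::euclidean_space"
  assumes Hm[measurable]: "H \<in> borel_measurable borel" and H: "integrable lborel H" "\<And>x. x \<notin> \<Omega> \<Longrightarrow> H x = 0"
    and E: "integrable lborel E" "\<And>y. y \<in> \<Omega> \<Longrightarrow> E y = norm (H y) powr p y" "\<And>y. y \<notin> \<Omega> \<Longrightarrow> E y = 0"
    and e: "0 < e" "e \<le> 1/2" and x: "x \<in> \<Omega>"
    and m: "m = (LINT y|lborel. norm (H y)) / bump_mass TYPE('a)"
    and A: "A = (max 1 m) powr (Lh / ln 2) * exp (real DIM('a) * Lh)"
  shows "norm (conv (moll e) H x) powr p x \<le> 1 + A * (1 + conv (moll e) E x)"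
proof -
  have Lh: "Lh \<ge> 0" using Lh_nonneg x by blast
  have A0: "A \<ge> 0" by (simp add: A)
  define s where "s = (LINT y|lborel. moll e (x - y) *\<^sub>R norm (H y))"
  have iN: "integrable lborel (\<lambda>y. moll e (x - y) *\<^sub>R norm (H y))"
    by (rule conv_moll_integrable[OF e(1)]) (use H in auto)
  have iE: "integrable lborel (\<lambda>y. moll e (x - y) *\<^sub>R E y)"
    by (rule conv_moll_integrable[OF e(1) E(1)])
  have i0: "integrable lborel (\<lambda>y. moll e (x - y))" "(LINT y|lborel. moll e (x - y)) = 1"
    using lborel_integral_affine[of "-1" "moll e" x] moll_integral[OF e(1), where 'a='a] by auto
  have Epos: "E y \<ge> 0" for y using E(2,3)[of y] by (cases "y \<in> \<Omega>") auto
  have T0: "conv (moll e) E x \<ge> 0" unfolding conv_def by (intro Bochner_Integration.integral_nonneg) (simp add: Epos moll_nonneg[OF e(1)])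
  have Ss: "norm (conv (moll e) H x) \<le> s"
  proof -
    have "norm (conv (moll e) H x) \<le> (LINT y|lborel. norm (moll e (x - y) *\<^sub>R H y))" unfolding conv_def by (rule integral_norm_bound)
    also have "\<dots> = s" unfolding s_def by (simp add: moll_nonneg[OF e(1)])
    finally show ?thesis .
  qed
  have px: "1 < p x" using pp'[OF x] pm1 by auto
  show ?thesis
  proof (cases "s \<le> 1")
    case True
    then have "norm (conv (moll e) H x) powr p x \<le> 1 powr p x" using Ss px by (intro powr_mono2) auto
    moreover have "0 \<le> A * (1 + conv (moll e) E x)" using A0 T0 by simp
    ultimately show ?thesis by simp
  next
    case False
    then have s1: "s > 1" by simp
    have le: "ln (1/e) \<ge> ln 2" "ln (1/e) > 0" "ln (2::real) > 0"
    proof -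
      have "2 \<le> 1/e" using e by (simp add: field_simps)
      then show "ln (1/e) \<ge> ln 2" using e by simp
      then show "ln (1/e) > 0" by (rule less_le_trans[rotated]) simp
    qed simp
    define w where "w = Lh / ln (1/e)"
    have w: "w \<ge> 0" "w \<le> Lh / ln 2"
      using divide_nonneg_pos[OF Lh le(2)] divide_left_mono[OF le(1) Lh mult_pos_pos[OF le(2,3)]] by (simp_all only: w_def)
    \<comment> \<open>By \<open>log_hoelder\<close>, p differs from p x by at most w on the ball, so
      q lies below p there; the maximum with 1 keeps the power q convex.\<close>
    define q where "q = max 1 (p x - w)"
    have q: "q \<ge> 1" "p x - q \<le> w" "0 \<le> p x - q" using px w by (auto simp: q_def)
    have qp: "q \<le> p y" if "y \<in> \<Omega>" "norm (x - y) \<le> e" for y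
    proof -
      have "\<bar>p x - p y\<bar> * ln (1/e) \<le> Lh" by (rule log_hoelder[OF e x that])
      then have "\<bar>p x - p y\<bar> \<le> w" using le(2) by (simp only: w_def pos_le_divide_eq)
      moreover have "1 < p y" using pp'[OF that(1)] pm1 by auto
      ultimately show ?thesis by (auto simp: q_def)
    qed
    have jen: "s powr q \<le> 1 + conv (moll e) E x"
    proof -
      \<comment> \<open>The tangent of t^q at s; integrated against the kernel its linear part
        vanishes, which is Jensen's inequality. The 1 in \<open>1 + E y\<close> pays for points with
        |H y| \<le> 1, where passing from q to the larger exponent p y would decrease the
        power.\<close>
      have tan: "s powr q + q * s powr (q - 1) * (t - s) \<le> t powr q" if "t \<ge> 0" for t
        using powr_tangent(1)[of q s t] s1 q that by (cases "q = 1") auto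
      have "(LINT y|lborel. moll e (x - y) * (s powr q - q * s powr (q - 1) * s) + q * s powr (q - 1) * (moll e (x - y) *\<^sub>R norm (H y)))
         \<le> (LINT y|lborel. moll e (x - y) + moll e (x - y) *\<^sub>R E y)"
      proof (rule bochner_mono)
        show "integrable lborel (\<lambda>y. moll e (x - y) * (s powr q - q * s powr (q - 1) * s) + q * s powr (q - 1) * (moll e (x - y) *\<^sub>R norm (H y)))"
          by (intro bochner_add integrable_mult_left integrable_mult_right i0 iN)
        show "integrable lborel (\<lambda>y. moll e (x - y) + moll e (x - y) *\<^sub>R E y)" using i0 iE by auto
        fix y
        have "moll e (x - y) * (s powr q + q * s powr (q - 1) * (norm (H y) - s)) \<le> moll e (x - y) * (1 + E y)"
        proof (cases "norm (x - y) < e")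
          case True
          have "norm (H y) powr q \<le> 1 + E y"
          proof (cases "y \<in> \<Omega>")
            case yO: True
            show ?thesis
            proof (cases "norm (H y) \<le> 1")
              case n1: True
              then have "norm (H y) powr q \<le> 1 powr q" using q by (intro powr_mono2) auto
              then show ?thesis using Epos[of y] by simp
            next
              case False
              then have "norm (H y) powr q \<le> norm (H y) powr p y" using qp[OF yO] True by (intro powr_mono) auto
              then show ?thesis using E(2)[OF yO] by simp
            qed
          next
            case False
            then show ?thesis using H(2)[OF False] E(3)[OF False] by simp
          qed
          then show ?thesis using tan[of "norm (H y)"] moll_nonneg[OF e(1), of "x - y"] by (intro mult_left_mono) auto
        next
          case False
          then show ?thesis using moll_eq_0[OF e(1), of "x - y"] by simp
        qed
        then show "moll e (x - y) * (s powr q - q * s powr (q - 1) * s) + q * s powr (q - 1) * (moll e (x - y) *\<^sub>R norm (H y))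
          \<le> moll e (x - y) + moll e (x - y) *\<^sub>R E y" by (simp add: algebra_simps)
      qed
      also have "(LINT y|lborel. moll e (x - y) + moll e (x - y) *\<^sub>R E y) = 1 + conv (moll e) E x"
        using i0 iE by (simp add: conv_def)
      also have "(LINT y|lborel. moll e (x - y) * (s powr q - q * s powr (q - 1) * s) + q * s powr (q - 1) * (moll e (x - y) *\<^sub>R norm (H y)))
         = (s powr q - q * s powr (q - 1) * s) + q * s powr (q - 1) * s"
        using i0 iN by (subst Bochner_Integration.integral_add) (auto simp: s_def)
      finally show ?thesis by simp
    qed
    \<comment> \<open>The kernel is at most 1 / (e^n \<open>bump_mass\<close>), so s \<le> m
      (1/e)^n. Raising (1/e)^n to the power w = Lh / ln (1/e) gives exactly exp (n Lh), free of e;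
      the power of max 1 m is controlled because e \<le> 1/2.\<close>
    have sup: "s powr (p x - q) \<le> A"
    proof -
      have "s \<le> (LINT y|lborel. 1 / (e ^ DIM('a) * bump_mass TYPE('a)) * norm (H y))"
        unfolding s_def
        by (rule bochner_mono[OF iN]) (use H mult_right_mono[OF moll_le[OF e(1), where 'a='a] norm_ge_zero] in \<open>auto\<close>)
      also have "\<dots> = m * (1/e) powr real DIM('a)"
        using e by (simp add: m powr_realpow power_one_over field_simps)
      also have "\<dots> \<le> max 1 m * (1/e) powr real DIM('a)" by (intro mult_right_mono) auto
      finally have "s powr (p x - q) \<le> (max 1 m * (1/e) powr real DIM('a)) powr (p x - q)"
        using s1 q by (intro powr_mono2) auto
      also have "\<dots> \<le> (max 1 m * (1/e) powr real DIM('a)) powr w"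
      proof (rule powr_mono[OF q(2)])
        have "1 \<le> (1/e) powr real DIM('a)" using e by (intro ge_one_powr_ge_zero) (auto simp: field_simps)
        then show "1 \<le> max 1 m * (1/e) powr real DIM('a)" by (metis max.cobounded1 mult_mono' mult_1 zero_le_one)
      qed
      also have "\<dots> = (max 1 m) powr w * (1/e) powr (real DIM('a) * w)"
        by (simp add: powr_mult powr_powr)
      also have "(1/e) powr (real DIM('a) * w) = exp (real DIM('a) * Lh)"
        using e le by (simp add: powr_def w_def)
      also have "(max 1 m) powr w * exp (real DIM('a) * Lh) \<le> A"
        unfolding A using w by (intro mult_right_mono powr_mono) auto
      finally show ?thesis .
    qed
    have "norm (conv (moll e) H x) powr p x \<le> s powr p x" using Ss px by (intro powr_mono2) auto
    also have "\<dots> = s powr (p x - q) * s powr q" using s1 by (simp flip: powr_add)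
    also have "\<dots> \<le> A * (1 + conv (moll e) E x)" using sup jen A0 by (intro mult_mono) auto
    finally show ?thesis by simp
  qed
qed

text \<open>Integrate the pointwise bound; the mollification of E does not increase the L1 norm, so
  the bound does not depend on e.\<close>

lemma moll_pmod_bound:
  fixes H :: "'a \<Rightarrow> 'b::euclidean_space"
  assumes Hm: "H \<in> borel_measurable borel" and H: "integrable lborel H" "\<And>x. x \<notin> \<Omega> \<Longrightarrow> H x = 0"
    and fin: "pmod M p H < \<infinity>"
  shows "\<exists>C. \<forall>e. 0 < e \<and> e \<le> 1/2 \<longrightarrow> pmod M p (conv (moll e) H) \<le> ennreal C"
proof -
  have HM: "H \<in> borel_measurable M" by (rule borel_measurable_lebesgue_on[OF Hm])
  have iM: "integrable M (\<lambda>x. norm (H x) powr p x)" by (rule pmod_finite_integrable(2)[OF HM fin])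
  \<comment> \<open>Values of p outside \<Omega> are arbitrary, so the exponent is multiplied by the
    indicator too; this makes E Borel on the whole space.\<close>
  define E where "E y = indicator \<Omega> y * norm (H y) powr (indicator \<Omega> y * p y)" for y
  have pb: "(\<lambda>y. indicator \<Omega> y * p y) \<in> borel_measurable borel"
    using borel_measurable_continuous_on_indicator[OF \<Omega>_borel p_cont] by simp
  have Eb[measurable]: "E \<in> borel_measurable borel" unfolding E_def using pb Hm \<Omega>_borel by measurable
  have E0: "E y = 0" if "y \<notin> \<Omega>" for y using that by (simp add: E_def)
  have E1: "E y = norm (H y) powr p y" if "y \<in> \<Omega>" for y using that by (simp add: E_def)
  have Enn: "E y \<ge> 0" for y by (simp add: E_def)
  have "integrable M E" by (rule Bochner_Integration.integrable_cong[THEN iffD2, OF refl _ iM]) (use E1 in auto)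
  then have iE: "integrable lborel E" using lebesgue_on_lborel(1)[OF \<Omega>_borel Eb E0] by simp
  define m where "m = (LINT y|lborel. norm (H y)) / bump_mass TYPE('a)"
  define A where "A = (max 1 m) powr (Lh / ln 2) * exp (real DIM('a) * Lh)"
  have A0: "A \<ge> 0" by (simp add: A_def)
  have "pmod M p (conv (moll e) H) \<le> ennreal ((1 + A) * measure M (space M) + A * (LINT y|lborel. E y))" if e: "0 < e" "e \<le> 1/2" for e
  proof -
    have [measurable]: "conv (moll e) E \<in> borel_measurable borel" by measurable
    have T0: "conv (moll e) E x \<ge> 0" for x unfolding conv_def by (intro Bochner_Integration.integral_nonneg) (simp add: Enn moll_nonneg[OF e(1)])
    have m2: "(\<lambda>x. ennreal (conv (moll e) E x)) \<in> borel_measurable M"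
      by (rule measurable_compose[OF borel_measurable_lebesgue_on]) measurable
    have "pmod M p (conv (moll e) H) \<le> (\<integral>\<^sup>+x. ennreal (1 + A) + ennreal A * ennreal (conv (moll e) E x) \<partial>M)"
      unfolding pmod_def
    proof (rule nn_integral_mono)
      fix x assume "x \<in> space M"
      then have "x \<in> \<Omega>" by simp
      from moll_powr_pointwise[OF Hm H iE E1 E0 e this m_def A_def]
      have "norm (conv (moll e) H x) powr p x \<le> (1 + A) + A * conv (moll e) E x" by (simp add: algebra_simps)
      then show "ennreal (norm (conv (moll e) H x) powr p x) \<le> ennreal (1 + A) + ennreal A * ennreal (conv (moll e) E x)"
        using A0 T0 by (simp add: ennreal_mult[symmetric] ennreal_plus[symmetric] ennreal_leI del: ennreal_plus)
    qed
    also have "\<dots> = ennreal (1 + A) * emeasure M (space M) + ennreal A * (\<integral>\<^sup>+x. ennreal (conv (moll e) E x) \<partial>M)"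
      using m2 by (simp add: nn_integral_add nn_integral_cmult)
    also have "\<dots> \<le> ennreal (1 + A) * emeasure M (space M) + ennreal A * (\<integral>\<^sup>+x. ennreal (E x) \<partial>lborel)"
    proof (intro add_mono mult_left_mono)
      have "(\<integral>\<^sup>+x. ennreal (conv (moll e) E x) \<partial>M) = (\<integral>\<^sup>+x. ennreal (conv (moll e) E x) * indicator \<Omega> x \<partial>lborel)"
        using \<Omega>_open by (simp add: nn_integral_restrict_space nn_integral_completion)
      also have "\<dots> \<le> (\<integral>\<^sup>+x. ennreal (norm (conv (moll e) E x)) \<partial>lborel)"
        by (rule nn_integral_mono) (auto simp: indicator_def T0)
      also have "\<dots> \<le> (\<integral>\<^sup>+x. ennreal (norm (E x)) \<partial>lborel)" by (rule conv_moll_integrable_whole(2)[OF e(1) iE])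
      finally show "(\<integral>\<^sup>+x. ennreal (conv (moll e) E x) \<partial>M) \<le> (\<integral>\<^sup>+x. ennreal (E x) \<partial>lborel)" using Enn by simp
    qed auto
    also have "(\<integral>\<^sup>+x. ennreal (E x) \<partial>lborel) = ennreal (LINT x|lborel. E x)" by (rule nn_integral_eq_integral[OF iE]) (simp add: Enn)
    also have "ennreal (1 + A) * emeasure M (space M) + ennreal A * ennreal (LINT x|lborel. E x) = ennreal ((1 + A) * measure M (space M) + A * (LINT y|lborel. E y))"
      using A0 by (simp add: emeasure_eq_measure ennreal_mult[symmetric] ennreal_plus[symmetric] Enn del: ennreal_plus)
    finally show ?thesis .
  qed
  then show ?thesis by blast
qed

text \<open>Small mollifications of H are test functions, bounded in the modular by
  \<open>moll_pmod_bound\<close>, and converge in L1. By \<open>sob0_weak_closed\<close> this is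
  enough; convergence of the mollifications in the modular is never shown.\<close>

lemma sob0_compact_support:
  assumes H: "sob H" and K: "compact K" "K \<subseteq> \<Omega>" "\<And>x. x \<in> \<Omega> \<Longrightarrow> x \<notin> K \<Longrightarrow> H x = 0"
  shows "sob0 H"
proof -
  obtain U0 V0 where r0: "sob_rep \<Omega> U0 V0" and ae0: "AE x in M. fst (H x) = U0 x" "AE x in M. snd (H x) = V0 x"
    by (rule sob_rep_exists[OF \<Omega>_open sobD(1)[OF H] sobD(5,6)[OF H]]) blast
  \<comment> \<open>The representatives vanish off K only almost everywhere; the indicator makes
    this hold at every point, so that convolutions vanish exactly away from K.\<close>
  define U where "U x = indicator K x *\<^sub>R U0 x" for x
  define V where "V x = indicator K x *\<^sub>R V0 x" for x
  have Kb: "K \<in> sets borel" using K(1) by (simp add: borel_compact)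
  have Um[measurable]: "U \<in> borel_measurable borel" and Vm[measurable]: "V \<in> borel_measurable borel"
    using r0 Kb unfolding U_def V_def sob_rep_def by auto
  have iU: "integrable lborel U" and iV: "integrable lborel V"
  proof -
    have K': "K \<in> sets lborel" using Kb by simp
    have "integrable lborel U0" "integrable lborel V0" using r0 by (auto simp: sob_rep_def)
    then show "integrable lborel U" "integrable lborel V"
      using integrable_mult_indicator[OF K', of U0] integrable_mult_indicator[OF K', of V0] by (auto simp: U_def[abs_def] V_def[abs_def])
  qed
  have aeU: "AE x in M. fst (H x) = U x"
    using ae0(1) AE_space
  proof eventually_elim
    case (elim x)
    then show ?case using K(3)[of x] by (cases "x \<in> K") (auto simp: U_def)
  qed
  have aeV: "AE x in M. snd (H x) = V x"
    using ae0(2) AE_space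
  proof eventually_elim
    case (elim x)
    then show ?case using K(3)[of x] by (cases "x \<in> K") (auto simp: V_def)
  qed
  have zU: "U x = 0" "V x = 0" if "x \<notin> K" for x using that by (auto simp: U_def V_def)
  have rep: "sob_rep \<Omega> U V"
    unfolding sob_rep_def
  proof (intro conjI allI impI)
    show "has_weak_grad \<Omega> U V"
      by (rule has_weak_grad_cong_AE[OF \<Omega>_open sobD(1)[OF H] sobD(5,6)[OF H] borel_measurable_lebesgue_on[OF Um] borel_measurable_lebesgue_on[OF Vm] aeU aeV])
  qed (use \<Omega>_open iU iV K(2) zU in \<open>auto simp: Um Vm\<close>)
  have "closed (- \<Omega>)" "K \<inter> - \<Omega> = {}" using \<Omega>_open K(2) by auto
  from separate_compact_closed[OF K(1) this] obtain d where d: "d > 0" "\<And>x y. x \<in> K \<Longrightarrow> y \<notin> \<Omega> \<Longrightarrow> d \<le> dist x y"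
    by auto
  \<comment> \<open>Two conditions meet here: 2 e < d, since a ball of radius e around a point of K
    + cball 0 e must stay in \<Omega>, and e \<le> 1/2 for \<open>log_hoelder\<close>. Dividing min
    1 d by at least 3 gives both.\<close>
  define e where "e n = min 1 d / real (n + 3)" for n
  have e: "e n > 0" "2 * e n < d" "e n \<le> 1/2" for n
  proof -
    show "e n > 0" using d(1) by (simp add: e_def)
    have "e n \<le> min 1 d / 3" unfolding e_def by (intro divide_left_mono) (use d(1) in auto)
    then show "2 * e n < d" "e n \<le> 1/2" using d(1) by auto
  qed
  have el: "e \<longlonglongrightarrow> 0" unfolding e_def by (rule LIMSEQ_ignore_initial_segment[of "\<lambda>n. min 1 d / real n" 0 3]) (rule lim_const_over_n)
  define \<phi> where "\<phi> n = conv (moll (e n)) U" for n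
  have far: "conv (moll (e n)) U x = 0" "conv (moll (e n)) V x = 0" if "\<And>y. y \<in> K \<Longrightarrow> norm (x - y) \<ge> e n" for x n
  proof -
    have "moll (e n) (x - y) *\<^sub>R U y = 0" "moll (e n) (x - y) *\<^sub>R V y = 0" for y
      using that[of y] moll_eq_0[OF e(1), of n "x - y"] zU[of y] by (cases "y \<in> K"; simp)+
    then show "conv (moll (e n)) U x = 0" "conv (moll (e n)) V x = 0" unfolding conv_def by (simp_all only: Bochner_Integration.integral_zero)
  qed
  \<comment> \<open>The Minkowski sum of K and a closed ball: compact, and outside it both
    convolutions vanish.\<close>
  define Kn where "Kn n = (\<lambda>(x, y). x + y) ` (K \<times> cball 0 (e n))" for n
  have Knc: "compact (Kn n)" for n
    unfolding Kn_def by (intro compact_continuous_image compact_Times K(1) continuous_intros) (auto simp: case_prod_beta intro!: continuous_intros)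
  have Kn_far: "norm (x - y) \<ge> e n" if "x \<notin> Kn n" "y \<in> K" for x y n
  proof (rule ccontr)
    assume "\<not> norm (x - y) \<ge> e n"
    then have "(y, x - y) \<in> K \<times> cball 0 (e n)" using that by simp
    then have "y + (x - y) \<in> Kn n" unfolding Kn_def by (metis (mono_tags, lifting) case_prod_conv image_eqI)
    then show False using that by simp
  qed
  have Kn_sub: "cball z (e n) \<subseteq> \<Omega>" if "z \<in> Kn n" for z n
  proof
    fix y assume y: "y \<in> cball z (e n)"
    from that obtain a b where ab: "z = a + b" "a \<in> K" "norm b \<le> e n" unfolding Kn_def by auto
    show "y \<in> \<Omega>"
    proof (rule ccontr)
      assume "y \<notin> \<Omega>"
      then have "d \<le> dist a y" using d(2) ab by blast
      also have "\<dots> \<le> dist a z + dist z y" by (rule dist_triangle)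
      also have "\<dots> \<le> e n + e n" using y ab by (intro add_mono) (auto simp: dist_norm)
      finally show False using e(2)[of n] by simp
    qed
  qed
  have \<phi>t: "\<phi> n \<in> test_functions \<Omega>" for n
    unfolding test_functions_iff
  proof (intro conjI exI[of _ "Kn n"])
    show "smooth (\<phi> n)" unfolding \<phi>_def by (rule smooth_conv(1)[OF smooth_moll _ iU, where R="e n"]) (simp add: moll_eq_0[OF e(1)])
    show "Kn n \<subseteq> \<Omega>" using Kn_sub e(1) by (meson centre_in_cball less_imp_le subset_iff)
    show "\<forall>x. x \<notin> Kn n \<longrightarrow> \<phi> n x = 0" unfolding \<phi>_def using far(1) Kn_far by blast
  qed (rule Knc)
  have jet\<phi>: "jet (\<phi> n) x = (conv (moll (e n)) U x, conv (moll (e n)) V x)" for n x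
  proof (cases "x \<in> Kn n")
    case True
    then show ?thesis using conv_moll_weak_grad[OF rep e(1) Kn_sub] by (simp add: jet_def \<phi>_def)
  next
    case False
    have "((\<lambda>x. 0) has_derivative (\<lambda>v. 0)) (at x)" by simp
    then have "(\<phi> n has_derivative (\<lambda>v. 0)) (at x)"
      by (rule has_derivative_transform_within_open[of _ _ _ _ "- Kn n"])
        (use False Kn_far far(1) Knc in \<open>auto simp: compact_imp_closed \<phi>_def\<close>)
    then have "frechet_derivative (\<phi> n) (at x) = (\<lambda>v. 0)" using frechet_derivative_at by metis
    then have "classical_grad (\<phi> n) x = 0" by (simp add: classical_grad_def)
    moreover have "conv (moll (e n)) V x = 0" using far(2) Kn_far False by blast
    ultimately show ?thesis by (simp add: jet_def \<phi>_def)
  qed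
  have pU: "pmod M p U < \<infinity>" "pmod M p V < \<infinity>"
  proof -
    have "pmod M p U = pmod M p (\<lambda>x. fst (H x))" by (rule pmod_cong_AE) (use aeU in auto)
    moreover have "pmod M p V = pmod M p (\<lambda>x. snd (H x))" by (rule pmod_cong_AE) (use aeV in auto)
    ultimately show "pmod M p U < \<infinity>" "pmod M p V < \<infinity>" using pmod_fst_snd_le[of H] sobD(3)[OF H] by (auto intro: le_less_trans)
  qed
  have zO: "U x = 0" "V x = 0" if "x \<notin> \<Omega>" for x using zU[of x] K(2) that by auto
  obtain C1 where C1: "\<And>e. 0 < e \<Longrightarrow> e \<le> 1/2 \<Longrightarrow> pmod M p (conv (moll e) U) \<le> ennreal C1" using moll_pmod_bound[OF Um iU zO(1) pU(1)] by auto
  obtain C2 where C2: "\<And>e. 0 < e \<Longrightarrow> e \<le> 1/2 \<Longrightarrow> pmod M p (conv (moll e) V) \<le> ennreal C2" using moll_pmod_bound[OF Vm iV zO(2) pU(2)] by auto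
  have bd: "pmod M p (jet (\<phi> n)) \<le> ennreal (2 powr pp * (max 0 C1 + max 0 C2))" for n
  proof -
    have [measurable]: "conv (moll (e n)) U \<in> borel_measurable M" "conv (moll (e n)) V \<in> borel_measurable M"
      by (rule borel_measurable_lebesgue_on, measurable)+
    have "pmod M p (jet (\<phi> n)) = pmod M p (\<lambda>x. (conv (moll (e n)) U x, conv (moll (e n)) V x))"
      by (rule arg_cong[where f = "pmod M p"]) (rule ext, rule jet\<phi>)
    also have "\<dots> \<le> ennreal (2 powr pp) * (pmod M p (conv (moll (e n)) U) + pmod M p (conv (moll (e n)) V))"
      by (rule pmod_Pair_le) measurable
    also have "\<dots> \<le> ennreal (2 powr pp) * (ennreal (max 0 C1) + ennreal (max 0 C2))"
      using C1[OF e(1,3)] C2[OF e(1,3)] by (intro mult_left_mono add_mono) (auto simp: max_def ennreal_neg)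
    also have "\<dots> = ennreal (2 powr pp * (max 0 C1 + max 0 C2))" by (simp add: ennreal_mult flip: ennreal_plus)
    finally show ?thesis .
  qed
  have L: "(\<lambda>n. LINT x|M. \<bar>fst (jet (\<phi> n) x) - fst (H x)\<bar>) \<longlonglongrightarrow> 0"
  proof -
    have i\<phi>: "integrable lborel (\<lambda>x. \<bar>\<phi> n x - U x\<bar>)" for n
      unfolding \<phi>_def using conv_moll_integrable_whole(1)[OF e(1) iU] iU by (intro integrable_abs bochner_diff)
    have le: "(LINT x|M. \<bar>fst (jet (\<phi> n) x) - fst (H x)\<bar>) = (LINT x|lborel. \<bar>\<phi> n x - U x\<bar>)" for n
    proof -
      have [measurable]: "\<phi> n \<in> borel_measurable borel" by (rule test_functionsD(3)[OF \<phi>t])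
      note [measurable] = borel_measurable_lebesgue_on[OF \<open>\<phi> n \<in> borel_measurable borel\<close>] borel_measurable_lebesgue_on[OF Um] sobD(7)[OF H]
      have "(LINT x|M. \<bar>fst (jet (\<phi> n) x) - fst (H x)\<bar>) = (LINT x|M. \<bar>\<phi> n x - U x\<bar>)"
        by (rule integral_cong_AE) (use aeU in \<open>auto simp: jet_def\<close>)
      also have "\<dots> = (LINT x|lborel. \<bar>\<phi> n x - U x\<bar>)"
      proof (rule lebesgue_on_lborel(2)[OF \<Omega>_borel])
        fix x assume x: "x \<notin> \<Omega>"
        then have "x \<notin> Kn n" using Kn_sub[of x n] e(1)[of n] by (meson centre_in_cball less_imp_le subset_iff)
        then have "\<phi> n x = 0" unfolding \<phi>_def using far(1) Kn_far by blast
        then show "\<bar>\<phi> n x - U x\<bar> = 0" using zO[OF x] by simp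
      qed measurable
      finally show ?thesis .
    qed
    have "(\<lambda>n. ennreal (LINT x|lborel. \<bar>\<phi> n x - U x\<bar>)) \<longlonglongrightarrow> ennreal 0"
      using conv_moll_tendsto[OF iU e(1) el] nn_integral_eq_integral[OF i\<phi>] by (simp add: \<phi>_def)
    then have "(\<lambda>n. LINT x|lborel. \<bar>\<phi> n x - U x\<bar>) \<longlonglongrightarrow> 0" by (subst (asm) tendsto_ennreal_iff) auto
    then show ?thesis by (simp add: le)
  qed
  obtain H' where H': "sob0 H'" "\<And>x. fst (H' x) = fst (H x)"
    using sob0_weak_closed[OF sob0_jet[OF \<phi>t] bd sobD(5)[OF H] L] by blast
  show ?thesis by (rule sob0_unique[OF H'(1) H H'(2)])
qed

text \<open>The truncation is the limit of minima with the compactly supported functions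
  \<open>\<phi>\<^sub>n\<^sup>+ + \<eta>\<^sub>n\<^sup>+\<close>, where \<open>\<phi>\<^sub>n \<rightarrow> u - \<psi>\<close> and \<open>\<eta>\<^sub>n \<rightarrow> (|\<psi>| - k)\<^sup>+\<close>.\<close>
lemma sob0_truncation:
  assumes P: "sob P" and U: "sob U" and UP: "sob0 (\<lambda>x. U x - P x)"
    and Q: "sob0 Q" "\<And>x. fst (Q x) = max (\<bar>fst (P x)\<bar> - k) 0" and k: "0 \<le> k" "k \<le> k'"
  shows "sob0 (pos_jet (\<lambda>x. U x - (k', 0)))"
proof -
  obtain \<phi> where \<phi>: "\<And>n. \<phi> n \<in> test_functions \<Omega>" "(\<lambda>n. pmod M p (\<lambda>x. (U x - P x) - jet (\<phi> n) x)) \<longlonglongrightarrow> 0"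
     "\<And>n. pmod M p (\<lambda>x. (U x - P x) - jet (\<phi> n) x) \<le> ennreal (1 / real (Suc n))" by (rule sob0_approx[OF UP]) blast
  obtain \<eta> where \<eta>: "\<And>n. \<eta> n \<in> test_functions \<Omega>" "(\<lambda>n. pmod M p (\<lambda>x. Q x - jet (\<eta> n) x)) \<longlonglongrightarrow> 0"
     "\<And>n. pmod M p (\<lambda>x. Q x - jet (\<eta> n) x) \<le> ennreal (1 / real (Suc n))" by (rule sob0_approx[OF Q(1)]) blast
  have sQ: "sob Q" and sUP: "sob (\<lambda>x. U x - P x)" using Q UP by (auto simp: sob0_def)
  note sj = sob_jet[OF \<phi>(1)] sob_jet[OF \<eta>(1)]
  have jb: "\<exists>R. \<forall>n. pmod M p (jet (\<phi> n)) \<le> ennreal R"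
    if F: "sob F" "\<And>n. \<phi> n \<in> test_functions \<Omega>" "\<And>n. pmod M p (\<lambda>x. F x - jet (\<phi> n) x) \<le> ennreal (1 / real (Suc n))" for F \<phi>
  proof -
    obtain r where r: "pmod M p F = ennreal r" "r \<ge> 0" using sobD(3)[OF F(1)] by (cases "pmod M p F") auto
    have "pmod M p (jet (\<phi> n)) \<le> ennreal (2 powr pp * (r + 1))" for n
    proof -
      note [measurable] = sobD(2)[OF F(1)] jet_meas[OF F(2)]
      have "pmod M p (jet (\<phi> n)) = pmod M p (\<lambda>x. F x - (F x - jet (\<phi> n) x))" by simp
      also have "\<dots> \<le> ennreal (2 powr pp) * (pmod M p F + pmod M p (\<lambda>x. F x - jet (\<phi> n) x))" by (rule pmod_diff) measurable
      also have "\<dots> \<le> ennreal (2 powr pp) * (ennreal r + ennreal 1)"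
        using r by (intro mult_left_mono add_mono order_trans[OF F(3)] ennreal_leI) auto
      also have "\<dots> = ennreal (2 powr pp * (r + 1))" using r by (simp add: ennreal_mult ennreal_plus)
      finally show ?thesis .
    qed
    then show ?thesis by blast
  qed
  obtain R1 where R1: "\<And>n. pmod M p (jet (\<phi> n)) \<le> ennreal R1" using jb[OF sUP \<phi>(1,3)] by auto
  obtain R2 where R2: "\<And>n. pmod M p (jet (\<eta> n)) \<le> ennreal R2" using jb[OF sQ \<eta>(1,3)] by auto
  define P' where "P' x = P x - (k', 0)" for x
  have sP': "sob P'"
  proof -
    have "P' = (\<lambda>x. 1 *\<^sub>R P x + (-1) *\<^sub>R (k', 0))" by (simp add: P'_def fun_eq_iff prod_eq_iff)
    then show ?thesis using sob_lin[OF P sob_const[of k'], of 1 "-1"] by simp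
  qed
  obtain r where r: "pmod M p P' = ennreal r" "r \<ge> 0" using sobD(3)[OF sP'] by (cases "pmod M p P'") auto
  define V0 where "V0 n x = P' x + jet (\<phi> n) x" for n x
  define V where "V n = pos_jet (V0 n)" for n
  define B where "B n x = pos_jet (jet (\<phi> n)) x + pos_jet (jet (\<eta> n)) x" for n x
  define D where "D n x = V n x - B n x" for n x
  \<comment> \<open>W n is the minimum of V n and B n, written with the positive part. Where both
    test functions vanish, B n = 0 while V n has nonnegative first component, so W n = 0 there and
    \<open>sob0_compact_support\<close> applies.\<close>
  define W where "W n x = V n x - pos_jet (D n) x" for n x
  have sV0: "sob (V0 n)" for n using sob_lin[OF sP' sj(1)[of n], of 1 1] by (simp add: V0_def[abs_def])
  have sV: "sob (V n)" for n unfolding V_def by (rule sob_pos_jet[OF sV0])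
  have sB: "sob (B n)" for n using sob_lin[OF sob_pos_jet[OF sj(1)[of n]] sob_pos_jet[OF sj(2)[of n]], of 1 1] by (simp add: B_def[abs_def])
  have sD: "sob (D n)" for n using sob_lin[OF sV[of n] sB[of n], of 1 "-1"] by (simp add: D_def[abs_def])
  have sW: "sob (W n)" for n using sob_lin[OF sV[of n] sob_pos_jet[OF sD[of n]], of 1 "-1"] by (simp add: W_def[abs_def])
  have W0: "sob0 (W n)" for n
  proof -
    obtain K1 where K1: "compact K1" "K1 \<subseteq> \<Omega>" "\<forall>x. x \<notin> K1 \<longrightarrow> \<phi> n x = 0 \<and> classical_grad (\<phi> n) x = 0" using test_functionsD(5)[OF \<phi>(1)[of n]] by blast
    obtain K2 where K2: "compact K2" "K2 \<subseteq> \<Omega>" "\<forall>x. x \<notin> K2 \<longrightarrow> \<eta> n x = 0 \<and> classical_grad (\<eta> n) x = 0" using test_functionsD(5)[OF \<eta>(1)[of n]] by blast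
    show ?thesis
    proof (rule sob0_compact_support[OF sW])
      show "compact (K1 \<union> K2)" "K1 \<union> K2 \<subseteq> \<Omega>" using K1 K2 by (auto simp: compact_Un)
      fix x assume "x \<notin> K1 \<union> K2"
      then have "B n x = 0" using K1(3) K2(3) by (auto simp: B_def pos_jet_def jet_def)
      then show "W n x = 0" by (auto simp: W_def D_def pos_jet_def V_def)
    qed
  qed
  \<comment> \<open>Only independence of n matters for \<open>sob0_weak_closed\<close>; the constant
    is what repeated use of the quasi-triangle inequality leaves.\<close>
  have bd: "pmod M p (W n) \<le> ennreal (2 powr pp * ((2 powr pp * (2 powr pp * (r + max 0 R1) )) + 2 powr pp * (2 powr pp * (r + max 0 R1) + 2 powr pp * (max 0 R1 + max 0 R2))))" for n
  proof -
    note [measurable] = sobD(2)[OF sV] sobD(2)[OF sB] sobD(2)[OF sD] sobD(2)[OF sP'] sobD(2)[OF sV0] sobD(2)[OF sj(1)] sobD(2)[OF sj(2)]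
      sobD(2)[OF sob_pos_jet[OF sj(1)]] sobD(2)[OF sob_pos_jet[OF sj(2)]] sobD(2)[OF sob_pos_jet[OF sD]]
    have pj: "pmod M p (pos_jet F) \<le> pmod M p F" for F by (rule pmod_mono) (simp add: pos_jet_def)
    have R: "ennreal R1 \<le> ennreal (max 0 R1)" "ennreal R2 \<le> ennreal (max 0 R2)" by (auto intro: ennreal_leI)
    have bV: "pmod M p (V n) \<le> ennreal (2 powr pp * (r + max 0 R1))"
    proof -
      have "pmod M p (V n) \<le> pmod M p (V0 n)" unfolding V_def by (rule pj)
      also have "\<dots> \<le> ennreal (2 powr pp) * (pmod M p P' + pmod M p (jet (\<phi> n)))" unfolding V0_def by (rule pmod_add) measurable
      also have "\<dots> \<le> ennreal (2 powr pp) * (ennreal r + ennreal (max 0 R1))" using r R1[of n] R by (intro mult_left_mono add_mono) (auto intro: order_trans)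
      also have "\<dots> = ennreal (2 powr pp * (r + max 0 R1))" using r by (simp add: ennreal_mult flip: ennreal_plus)
      finally show ?thesis .
    qed
    have bB: "pmod M p (B n) \<le> ennreal (2 powr pp * (max 0 R1 + max 0 R2))"
    proof -
      have "pmod M p (B n) \<le> ennreal (2 powr pp) * (pmod M p (pos_jet (jet (\<phi> n))) + pmod M p (pos_jet (jet (\<eta> n))))" unfolding B_def by (rule pmod_add) measurable
      also have "\<dots> \<le> ennreal (2 powr pp) * (ennreal (max 0 R1) + ennreal (max 0 R2))"
        using R1[of n] R2[of n] R pj[of "jet (\<phi> n)"] pj[of "jet (\<eta> n)"] by (intro mult_left_mono add_mono) (auto intro: order_trans)
      also have "\<dots> = ennreal (2 powr pp * (max 0 R1 + max 0 R2))" by (simp add: ennreal_mult flip: ennreal_plus)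
      finally show ?thesis .
    qed
    have bD: "pmod M p (pos_jet (D n)) \<le> ennreal (2 powr pp * (2 powr pp * (r + max 0 R1) + 2 powr pp * (max 0 R1 + max 0 R2)))"
    proof -
      have "pmod M p (pos_jet (D n)) \<le> pmod M p (D n)" by (rule pj)
      also have "\<dots> \<le> ennreal (2 powr pp) * (pmod M p (V n) + pmod M p (B n))" unfolding D_def by (rule pmod_diff) measurable
      also have "\<dots> \<le> ennreal (2 powr pp) * (ennreal (2 powr pp * (r + max 0 R1)) + ennreal (2 powr pp * (max 0 R1 + max 0 R2)))"
        by (intro mult_left_mono add_mono bV bB) simp
      also have "\<dots> = ennreal (2 powr pp * (2 powr pp * (r + max 0 R1) + 2 powr pp * (max 0 R1 + max 0 R2)))"
        using r by (subst ennreal_plus[symmetric], simp, simp, subst ennreal_mult) auto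
      finally show ?thesis .
    qed
    have "pmod M p (W n) \<le> ennreal (2 powr pp) * (pmod M p (V n) + pmod M p (pos_jet (D n)))" unfolding W_def by (rule pmod_diff) measurable
    also have "\<dots> \<le> ennreal (2 powr pp) * (ennreal (2 powr pp * (2 powr pp * (r + max 0 R1))) + ennreal (2 powr pp * (2 powr pp * (r + max 0 R1) + 2 powr pp * (max 0 R1 + max 0 R2))))"
    proof (intro mult_left_mono add_mono bD)
      have "1 \<le> 2 powr pp" using pm1 pmpp' by (intro ge_one_powr_ge_zero) auto
      then have "1 * (2 powr pp * (r + max 0 R1)) \<le> 2 powr pp * (2 powr pp * (r + max 0 R1))" using r by (intro mult_right_mono) auto
      then show "pmod M p (V n) \<le> ennreal (2 powr pp * (2 powr pp * (r + max 0 R1)))" by (intro order_trans[OF bV] ennreal_leI) simp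
    qed simp
    also have "\<dots> = ennreal (2 powr pp * ((2 powr pp * (2 powr pp * (r + max 0 R1) )) + 2 powr pp * (2 powr pp * (r + max 0 R1) + 2 powr pp * (max 0 R1 + max 0 R2))))"
      using r by (subst ennreal_plus[symmetric], simp, simp, subst ennreal_mult) auto
    finally show ?thesis .
  qed
  define w where "w x = fst (pos_jet (\<lambda>x. U x - (k', 0)) x)" for x
  have sU': "sob (\<lambda>x. U x - (k', 0))"
  proof -
    have "(\<lambda>x. U x - (k', 0)) = (\<lambda>x. 1 *\<^sub>R U x + (-1) *\<^sub>R (k', 0))" by (simp add: fun_eq_iff prod_eq_iff)
    then show ?thesis using sob_lin[OF U sob_const[of k'], of 1 "-1"] by simp
  qed
  have sT: "sob (pos_jet (\<lambda>x. U x - (k', 0)))" by (rule sob_pos_jet[OF sU'])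
  have iw: "integrable M w" unfolding w_def by (rule sobD(5)[OF sT])
  have L\<phi>: "(\<lambda>n. LINT x|M. \<bar>fst (U x - P x) - fst (jet (\<phi> n) x)\<bar>) \<longlonglongrightarrow> 0" by (rule pmod_tendsto_L1_fst_snd(1)[OF \<phi>(2) sUP sj(1)])
  have L\<eta>: "(\<lambda>n. LINT x|M. \<bar>fst (Q x) - fst (jet (\<eta> n) x)\<bar>) \<longlonglongrightarrow> 0" by (rule pmod_tendsto_L1_fst_snd(1)[OF \<eta>(2) sQ sj(2)])
  \<comment> \<open>In the limit the minimum is inactive: since U - k' = (U - P) + (P - k') and k'
    \<ge> k, the positive part of U - k' is at most (U - P)^+ + (|P| - k)^+. Hence W n differs from
    it only by the two approximation errors.\<close>
  have pt: "\<bar>fst (W n x) - w x\<bar> \<le> 2 * \<bar>fst (U x - P x) - fst (jet (\<phi> n) x)\<bar> + \<bar>fst (Q x) - fst (jet (\<eta> n) x)\<bar>" for n x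
  proof -
    have fp: "fst (pos_jet F x) = max (fst (F x)) 0" for F x by (auto simp: pos_jet_def)
    define a where "a = fst (U x)"
    define b where "b = fst (P x)"
    define f where "f = \<phi> n x"
    define h where "h = \<eta> n x"
    have mm: "s - max (s - t) 0 = min s t" for s t :: real by (simp add: max_def min_def)
    have W: "fst (W n x) = min (max (b - k' + f) 0) (max f 0 + max h 0)"
      by (simp add: W_def fp D_def V_def B_def V0_def P'_def jet_def a_def b_def f_def h_def mm)
    have w: "w x = max (a - k') 0" by (simp add: w_def fp a_def)
    have q: "fst (Q x) = max (\<bar>b\<bar> - k) 0" by (simp add: Q(2) b_def)
    have "\<bar>min (max (b - k' + f) 0) (max f 0 + max h 0) - max (a - k') 0\<bar> \<le> 2 * \<bar>a - b - f\<bar> + \<bar>max (\<bar>b\<bar> - k) 0 - h\<bar>"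
      using k by (auto simp: min_def max_def abs_if)
    then show ?thesis by (simp add: W w q) (simp add: a_def b_def f_def h_def jet_def)
  qed
  have L: "(\<lambda>n. LINT x|M. \<bar>fst (W n x) - w x\<bar>) \<longlonglongrightarrow> 0"
  proof -
    have "(\<lambda>n. 2 * (LINT x|M. \<bar>fst (U x - P x) - fst (jet (\<phi> n) x)\<bar>) + (LINT x|M. \<bar>fst (Q x) - fst (jet (\<eta> n) x)\<bar>)) \<longlonglongrightarrow> 2 * 0 + 0"
      by (intro tendsto_intros L\<phi> L\<eta>)
    then have l0: "(\<lambda>n. 2 * (LINT x|M. \<bar>fst (U x - P x) - fst (jet (\<phi> n) x)\<bar>) + (LINT x|M. \<bar>fst (Q x) - fst (jet (\<eta> n) x)\<bar>)) \<longlonglongrightarrow> 0" by simp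
    show ?thesis
    proof (rule tendsto_sandwich[OF _ _ tendsto_const l0]; intro always_eventually allI)
      fix n
      note ii = sobD(5)[OF sUP] sobD(5)[OF sj(1)[of n]] sobD(5)[OF sQ] sobD(5)[OF sj(2)[of n]] sobD(5)[OF sW[of n]]
      have "(LINT x|M. \<bar>fst (W n x) - w x\<bar>) \<le> (LINT x|M. 2 * \<bar>fst (U x - P x) - fst (jet (\<phi> n) x)\<bar> + \<bar>fst (Q x) - fst (jet (\<eta> n) x)\<bar>)"
        by (rule bochner_mono[OF _ _ pt]) (use ii iw in \<open>auto intro!: integrable_abs bochner_diff bochner_add integrable_mult_right\<close>)
      also have "\<dots> = 2 * (LINT x|M. \<bar>fst (U x - P x) - fst (jet (\<phi> n) x)\<bar>) + (LINT x|M. \<bar>fst (Q x) - fst (jet (\<eta> n) x)\<bar>)"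
        using ii by (subst Bochner_Integration.integral_add) (auto intro!: integrable_abs bochner_diff integrable_mult_right)
      finally show "(LINT x|M. \<bar>fst (W n x) - w x\<bar>) \<le> 2 * (LINT x|M. \<bar>fst (U x - P x) - fst (jet (\<phi> n) x)\<bar>) + (LINT x|M. \<bar>fst (Q x) - fst (jet (\<eta> n) x)\<bar>)" .
    qed simp
  qed
  obtain H' where H': "sob0 H'" "\<And>x. fst (H' x) = w x"
    using sob0_weak_closed[OF W0 bd iw L] by blast
  show ?thesis by (rule sob0_unique[OF H'(1) sT]) (simp add: H'(2) w_def)
qed

end

section \<open>Compactness\<close>

text \<open>Kept as a predicate of \<Omega> and q so that the final constant can select K by
  \<open>SOME\<close> from these two data alone.\<close>

definition poincare_const :: "'a::euclidean_space set \<Rightarrow> real \<Rightarrow> real \<Rightarrow> bool" where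
  "poincare_const \<Omega> q K \<longleftrightarrow> 0 \<le> K \<and> (\<forall>\<phi>\<in>test_functions \<Omega>. \<forall>h B. h \<in> borel_measurable borel \<longrightarrow> B > 0 \<longrightarrow>
     (\<integral>\<^sup>+x. ennreal (\<bar>h x\<bar> powr q) \<partial>lborel) \<le> ennreal (B powr q) \<longrightarrow>
     (\<integral>\<^sup>+x. ennreal (\<bar>h x\<bar> * \<bar>\<phi> x\<bar>) \<partial>lborel) \<le> ennreal (K * B) * (\<integral>\<^sup>+x. ennreal (norm (classical_grad \<phi> x)) \<partial>lborel))"

lemma poincare_const_exists:
  fixes \<Omega> :: "'a::euclidean_space set"
  assumes "bounded \<Omega>" "real DIM('a) < q"
  shows "\<exists>K. poincare_const \<Omega> q K"
proof -
  obtain R where R: "R > 0" "\<Omega> \<subseteq> ball 0 R" using bounded_subset_ballD[OF assms(1)] by blast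
  obtain K where K: "K \<ge> 0" "\<forall>(\<phi> :: 'a \<Rightarrow> real) g h B. C1_grad \<phi> g \<longrightarrow> (\<forall>x. norm x \<ge> R \<longrightarrow> \<phi> x = 0) \<longrightarrow>
     h \<in> borel_measurable borel \<longrightarrow> B > 0 \<longrightarrow> (\<integral>\<^sup>+x. ennreal (\<bar>h x\<bar> powr q) \<partial>lborel) \<le> ennreal (B powr q) \<longrightarrow>
     (\<integral>\<^sup>+x. ennreal (\<bar>h x\<bar> * \<bar>\<phi> x\<bar>) \<partial>lborel) \<le> ennreal (K * B) * (\<integral>\<^sup>+x. ennreal (norm (g x)) \<partial>lborel)"
    using weighted_poincare_test[OF R(1) assms(2)] by blast
  have "poincare_const \<Omega> q K"
    unfolding poincare_const_def
  proof (intro conjI ballI allI impI K(1))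
    fix \<phi> h :: "'a \<Rightarrow> real" and B :: real assume \<phi>: "\<phi> \<in> test_functions \<Omega>" and h: "h \<in> borel_measurable borel" "B > 0" "(\<integral>\<^sup>+x. ennreal (\<bar>h x\<bar> powr q) \<partial>lborel) \<le> ennreal (B powr q)"
    obtain C where "C \<subseteq> \<Omega>" "\<And>x. x \<notin> C \<Longrightarrow> \<phi> x = 0" using \<phi> by (auto simp: test_functions_iff)
    then have "\<phi> x = 0" if "norm x \<ge> R" for x using R(2) that by force
    then show "(\<integral>\<^sup>+x. ennreal (\<bar>h x\<bar> * \<bar>\<phi> x\<bar>) \<partial>lborel) \<le> ennreal (K * B) * (\<integral>\<^sup>+x. ennreal (norm (classical_grad \<phi> x)) \<partial>lborel)"
      using K(2) test_functionsD(2)[OF \<phi>] h by blast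
  qed
  then show ?thesis by blast
qed

text \<open>L1 is the modular space of the constant exponent 1, so \<open>pmod_complete\<close>
  applies.\<close>

lemma (in finite_measure) L1_complete:
  fixes s :: "nat \<Rightarrow> 'a \<Rightarrow> real"
  assumes i: "\<And>n. integrable M (s n)"
    and c: "\<And>e. e > 0 \<Longrightarrow> \<exists>N. \<forall>i\<ge>N. \<forall>j\<ge>N. (LINT x|M. norm (s i x - s j x)) < e"
  obtains w where "integrable M w" "(\<lambda>n. LINT x|M. \<bar>s n x - w x\<bar>) \<longlonglongrightarrow> 0"
proof -
  interpret e: exponent M "\<lambda>_. 1" 1 1 by unfold_locales auto
  have m: "s n \<in> borel_measurable M" for n using i by auto
  have pm: "pmod M (\<lambda>_. 1) v = ennreal (LINT x|M. norm (v x))" if "integrable M v" for v :: "'a \<Rightarrow> real"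
    using nn_integral_eq_integral[OF integrable_norm[OF that]] by (simp add: pmod_def)
  have d: "integrable M (\<lambda>x. s i x - s j x)" for i j using i by simp
  obtain w where w: "w \<in> borel_measurable M" "pmod M (\<lambda>_. 1) w < \<infinity>" "(\<lambda>n. pmod M (\<lambda>_. 1) (\<lambda>x. s n x - w x)) \<longlonglongrightarrow> 0"
  proof (rule e.pmod_complete[OF m])
    show "pmod M (\<lambda>_. 1) (s n) < \<infinity>" for n by (simp add: pm[OF i])
    show "\<exists>N. \<forall>i\<ge>N. \<forall>j\<ge>N. pmod M (\<lambda>_. 1) (\<lambda>x. s i x - s j x) \<le> ennreal e" if "e > 0" for e
      unfolding pm[OF d] using c[OF that] by (meson ennreal_leI less_imp_le)
  qed blast
  have "(\<lambda>n. LINT x|M. \<bar>s n x - w x\<bar>) \<longlonglongrightarrow> 0" using e.pmod_tendsto_L1[OF _ w(3)] m w(1) by simp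
  then show ?thesis by (rule that[OF e.pmod_finite_integrable(1)[OF w(1,2)]])
qed

context var_domain
begin

lemma test_lborel_M:
  assumes \<phi>: "\<phi> \<in> test_functions \<Omega>"
  shows "(\<integral>\<^sup>+x. ennreal (norm (classical_grad \<phi> x)) \<partial>lborel) = ennreal (LINT x|M. norm (classical_grad \<phi> x))"
    "(\<integral>\<^sup>+x. ennreal \<bar>\<phi> x\<bar> \<partial>lborel) = ennreal (LINT x|M. \<bar>\<phi> x\<bar>)"
    "integrable lborel \<phi>"
proof -
  obtain K where K: "K \<subseteq> \<Omega>" "\<forall>x. x \<notin> K \<longrightarrow> \<phi> x = 0 \<and> classical_grad \<phi> x = 0" using test_functionsD(5)[OF \<phi>] by blast
  have z: "\<phi> x = 0" "classical_grad \<phi> x = 0" if "x \<notin> \<Omega>" for x using K that by blast+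
  note i = sobD(5,6)[OF sob_jet[OF \<phi>]]
  have i': "integrable M \<phi>" "integrable M (classical_grad \<phi>)" using i by (simp_all add: jet_def)
  show "(\<integral>\<^sup>+x. ennreal (norm (classical_grad \<phi> x)) \<partial>lborel) = ennreal (LINT x|M. norm (classical_grad \<phi> x))"
    by (subst nn_integral_lebesgue_on_lborel[OF \<Omega>_borel, symmetric], simp add: z, rule nn_integral_eq_integral) (use i' in auto)
  show "(\<integral>\<^sup>+x. ennreal \<bar>\<phi> x\<bar> \<partial>lborel) = ennreal (LINT x|M. \<bar>\<phi> x\<bar>)"
    by (subst nn_integral_lebesgue_on_lborel[OF \<Omega>_borel, symmetric], simp add: z, rule nn_integral_eq_integral) (use i' in auto)
  show "integrable lborel \<phi>"
    using lebesgue_on_lborel(1)[OF \<Omega>_borel test_functionsD(3)[OF \<phi>] z(1)] i' by simp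
qed

text \<open>Fatou's lemma along test functions converging to D: on the right the gradients converge
  in L1, on the left almost everywhere convergence of a subsequence is enough. The integrability of
  h times D comes with the estimate.\<close>

lemma weighted_poincare:
  assumes pc: "poincare_const \<Omega> q K" and h: "h \<in> borel_measurable M" "B > 0"
    and hB: "(\<integral>\<^sup>+x. ennreal (\<bar>h x\<bar> powr q) \<partial>M) \<le> ennreal (B powr q)" and D: "sob0 D"
  shows "integrable M (\<lambda>x. h x * fst (D x))" "(LINT x|M. \<bar>h x * fst (D x)\<bar>) \<le> K * B * (LINT x|M. norm (snd (D x)))"
proof -
  have K0: "K \<ge> 0" using pc by (simp add: poincare_const_def)
  have sD: "sob D" using D by (simp add: sob0_def)
  obtain \<phi> where \<phi>: "\<And>n. \<phi> n \<in> test_functions \<Omega>" "(\<lambda>n. pmod M p (\<lambda>x. D x - jet (\<phi> n) x)) \<longlonglongrightarrow> 0" by (rule sob0_approx[OF D]) blast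
  note sj = sob_jet[OF \<phi>(1)]
  have L1: "(\<lambda>n. LINT x|M. \<bar>fst (D x) - \<phi> n x\<bar>) \<longlonglongrightarrow> 0" using pmod_tendsto_L1_fst_snd(1)[OF \<phi>(2) sD sj] by (simp add: jet_def)
  have L2: "(\<lambda>n. LINT x|M. norm (snd (D x) - classical_grad (\<phi> n) x)) \<longlonglongrightarrow> 0" using pmod_tendsto_L1_fst_snd(2)[OF \<phi>(2) sD sj] by (simp add: jet_def)
  have i\<phi>: "integrable M (\<phi> n)" "integrable M (classical_grad (\<phi> n))" for n using sobD(5,6)[OF sj] by (simp_all add: jet_def)
  obtain r :: "nat \<Rightarrow> nat" where r: "strict_mono r" "AE x in M. (\<lambda>n. fst (D x) - \<phi> (r n) x) \<longlonglongrightarrow> 0"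
    using tendsto_L1_AE_subseq[of M "\<lambda>n x. fst (D x) - \<phi> n x"] L1 sobD(5)[OF sD] i\<phi> by auto
  obtain h' where h': "h' \<in> borel_measurable borel" "\<And>x. x \<notin> \<Omega> \<Longrightarrow> h' x = 0" "AE x in M. h x = h' x"
    by (rule lebesgue_on_borel_rep[OF \<Omega>_borel h(1)]) blast
  have h'B: "(\<integral>\<^sup>+x. ennreal (\<bar>h' x\<bar> powr q) \<partial>lborel) \<le> ennreal (B powr q)"
  proof -
    have "(\<integral>\<^sup>+x. ennreal (\<bar>h' x\<bar> powr q) \<partial>lborel) = (\<integral>\<^sup>+x. ennreal (\<bar>h' x\<bar> powr q) \<partial>M)"
      by (rule nn_integral_lebesgue_on_lborel[OF \<Omega>_borel, symmetric]) (simp add: h'(2))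
    also have "\<dots> = (\<integral>\<^sup>+x. ennreal (\<bar>h x\<bar> powr q) \<partial>M)" by (rule nn_integral_cong_AE) (use h'(3) in auto)
    finally show ?thesis using hB by simp
  qed
  note [measurable] = h(1) sobD(7)[OF sD] borel_measurable_integrable[OF i\<phi>(1)]
  have bn: "(\<integral>\<^sup>+x. ennreal \<bar>h x * \<phi> n x\<bar> \<partial>M) \<le> ennreal (K * B * (LINT x|M. norm (classical_grad (\<phi> n) x)))" for n
  proof -
    have "(\<integral>\<^sup>+x. ennreal \<bar>h x * \<phi> n x\<bar> \<partial>M) = (\<integral>\<^sup>+x. ennreal (\<bar>h' x\<bar> * \<bar>\<phi> n x\<bar>) \<partial>M)"
      by (rule nn_integral_cong_AE) (use h'(3) in \<open>auto simp: abs_mult\<close>)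
    also have "\<dots> = (\<integral>\<^sup>+x. ennreal (\<bar>h' x\<bar> * \<bar>\<phi> n x\<bar>) \<partial>lborel)" by (rule nn_integral_lebesgue_on_lborel[OF \<Omega>_borel]) (simp add: h'(2))
    also have "\<dots> \<le> ennreal (K * B) * (\<integral>\<^sup>+x. ennreal (norm (classical_grad (\<phi> n) x)) \<partial>lborel)"
      using pc \<phi>(1) h'(1) h(2) h'B unfolding poincare_const_def by blast
    also have "\<dots> = ennreal (K * B * (LINT x|M. norm (classical_grad (\<phi> n) x)))"
      using K0 h(2) by (simp add: test_lborel_M[OF \<phi>(1)] ennreal_mult)
    finally show ?thesis .
  qed
  have gl: "(\<lambda>n. LINT x|M. norm (classical_grad (\<phi> (r n)) x)) \<longlonglongrightarrow> (LINT x|M. norm (snd (D x)))"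
  proof (rule LIM_zero_cancel, rule tendsto_0_le[of "\<lambda>n. LINT x|M. norm (snd (D x) - classical_grad (\<phi> (r n)) x)" _ _ 1])
    show "(\<lambda>n. LINT x|M. norm (snd (D x) - classical_grad (\<phi> (r n)) x)) \<longlonglongrightarrow> 0"
      using LIMSEQ_subseq_LIMSEQ[OF L2 r(1)] by (simp add: o_def)
    show "\<forall>\<^sub>F n in sequentially. norm ((LINT x|M. norm (classical_grad (\<phi> (r n)) x)) - (LINT x|M. norm (snd (D x)))) \<le> norm (LINT x|M. norm (snd (D x) - classical_grad (\<phi> (r n)) x)) * 1"
    proof (intro always_eventually allI)
      fix n
      have "norm ((LINT x|M. norm (classical_grad (\<phi> (r n)) x)) - (LINT x|M. norm (snd (D x)))) = norm (LINT x|M. norm (classical_grad (\<phi> (r n)) x) - norm (snd (D x)))"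
        using i\<phi> sobD(6)[OF sD] by simp
      also have "\<dots> \<le> (LINT x|M. norm (norm (classical_grad (\<phi> (r n)) x) - norm (snd (D x))))" by (rule integral_norm_bound)
      also have "\<dots> \<le> (LINT x|M. norm (snd (D x) - classical_grad (\<phi> (r n)) x))"
      proof (rule bochner_mono)
        show "norm (norm (classical_grad (\<phi> (r n)) x) - norm (snd (D x))) \<le> norm (snd (D x) - classical_grad (\<phi> (r n)) x)" for x
          using norm_triangle_ineq3[of "classical_grad (\<phi> (r n)) x" "snd (D x)"] by (simp add: norm_minus_commute)
      qed (use i\<phi> sobD(6)[OF sD] in auto)
      finally show "norm ((LINT x|M. norm (classical_grad (\<phi> (r n)) x)) - (LINT x|M. norm (snd (D x)))) \<le> norm (LINT x|M. norm (snd (D x) - classical_grad (\<phi> (r n)) x)) * 1"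
        by simp
    qed
  qed
  have "(\<integral>\<^sup>+x. ennreal \<bar>h x * fst (D x)\<bar> \<partial>M) \<le> (\<integral>\<^sup>+x. liminf (\<lambda>n. ennreal \<bar>h x * \<phi> (r n) x\<bar>) \<partial>M)"
  proof (rule nn_integral_mono_AE)
    show "AE x in M. ennreal \<bar>h x * fst (D x)\<bar> \<le> liminf (\<lambda>n. ennreal \<bar>h x * \<phi> (r n) x\<bar>)"
      using r(2)
    proof eventually_elim
      case (elim x)
      have "(\<lambda>n. fst (D x) - (fst (D x) - \<phi> (r n) x)) \<longlonglongrightarrow> fst (D x) - 0" by (intro tendsto_intros elim)
      then have "(\<lambda>n. \<phi> (r n) x) \<longlonglongrightarrow> fst (D x)" by simp
      then have "(\<lambda>n. ennreal \<bar>h x * \<phi> (r n) x\<bar>) \<longlonglongrightarrow> ennreal \<bar>h x * fst (D x)\<bar>" by (intro tendsto_ennrealI tendsto_intros)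
      from lim_imp_Liminf[OF trivial_limit_sequentially this] show ?case by simp
    qed
  qed
  also have "\<dots> \<le> liminf (\<lambda>n. \<integral>\<^sup>+x. ennreal \<bar>h x * \<phi> (r n) x\<bar> \<partial>M)" by (rule nn_integral_liminf) measurable
  also have "\<dots> \<le> liminf (\<lambda>n. ennreal (K * B * (LINT x|M. norm (classical_grad (\<phi> (r n)) x))))" by (rule Liminf_mono) (use bn in auto)
  also have "\<dots> = ennreal (K * B * (LINT x|M. norm (snd (D x))))"
    by (rule lim_imp_Liminf[OF trivial_limit_sequentially]) (intro tendsto_ennrealI tendsto_intros gl)
  finally have fin: "(\<integral>\<^sup>+x. ennreal \<bar>h x * fst (D x)\<bar> \<partial>M) \<le> ennreal (K * B * (LINT x|M. norm (snd (D x))))" .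
  then show i: "integrable M (\<lambda>x. h x * fst (D x))"
    by (intro integrableI_bounded) (auto intro: le_less_trans)
  have "ennreal (LINT x|M. \<bar>h x * fst (D x)\<bar>) = (\<integral>\<^sup>+x. ennreal \<bar>h x * fst (D x)\<bar> \<partial>M)"
    by (subst nn_integral_eq_integral) (use i in auto)
  also note fin
  finally show "(LINT x|M. \<bar>h x * fst (D x)\<bar>) \<le> K * B * (LINT x|M. norm (snd (D x)))"
    using K0 h(2) by (subst (asm) ennreal_le_iff) (auto intro!: mult_nonneg_nonneg)
qed

section \<open>Rellich's theorem\<close>

lemma conv_moll_uniform:
  fixes u :: "'a \<Rightarrow> real"
  assumes e: "e > 0" and u: "integrable lborel u" and B: "(LINT x|lborel. \<bar>u x\<bar>) \<le> B"
  shows "\<bar>conv (moll e) u x\<bar> \<le> 1 / (e ^ DIM('a) * bump_mass TYPE('a)) * B"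
    and "(\<And>z. \<bar>moll e (x - z) - moll e (y - z)\<bar> \<le> \<delta>) \<Longrightarrow> \<bar>conv (moll e) u x - conv (moll e) u y\<bar> \<le> \<delta> * B"
proof -
  have c0: "1 / (e ^ DIM('a) * bump_mass TYPE('a)) \<ge> 0" using e bump_mass_pos[where 'a='a] by simp
  have i: "integrable lborel (\<lambda>y. moll e (x - y) *\<^sub>R u y)" for x by (rule conv_moll_integrable[OF e u])
  have "\<bar>conv (moll e) u x\<bar> \<le> (LINT y|lborel. \<bar>moll e (x - y) *\<^sub>R u y\<bar>)"
    unfolding conv_def using integral_norm_bound[of lborel "\<lambda>y. moll e (x - y) *\<^sub>R u y"] by simp
  also have "\<dots> \<le> (LINT y|lborel. 1 / (e ^ DIM('a) * bump_mass TYPE('a)) * \<bar>u y\<bar>)"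
  proof (rule bochner_mono)
    show "\<bar>moll e (x - y) *\<^sub>R u y\<bar> \<le> 1 / (e ^ DIM('a) * bump_mass TYPE('a)) * \<bar>u y\<bar>" for y
      using mult_right_mono[OF moll_le[OF e, of "x - y"], of "\<bar>u y\<bar>"] by (simp add: abs_mult moll_nonneg[OF e])
  qed (use i u in auto)
  also have "\<dots> = 1 / (e ^ DIM('a) * bump_mass TYPE('a)) * (LINT y|lborel. \<bar>u y\<bar>)" by (rule integral_mult_right_zero)
  also have "\<dots> \<le> 1 / (e ^ DIM('a) * bump_mass TYPE('a)) * B" by (rule mult_left_mono[OF B c0])
  finally show "\<bar>conv (moll e) u x\<bar> \<le> 1 / (e ^ DIM('a) * bump_mass TYPE('a)) * B" .
  assume \<delta>: "\<And>z. \<bar>moll e (x - z) - moll e (y - z)\<bar> \<le> \<delta>"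
  have d0: "\<delta> \<ge> 0" using \<delta>[of 0] by linarith
  have "conv (moll e) u x - conv (moll e) u y = (LINT z|lborel. (moll e (x - z) - moll e (y - z)) * u z)"
    unfolding conv_def using i[of x] i[of y] by (simp add: left_diff_distrib)
  also have "\<bar>\<dots>\<bar> \<le> (LINT z|lborel. \<bar>(moll e (x - z) - moll e (y - z)) * u z\<bar>)"
    using integral_norm_bound[of lborel "\<lambda>z. (moll e (x - z) - moll e (y - z)) * u z"] by simp
  also have "\<dots> \<le> (LINT z|lborel. \<delta> * \<bar>u z\<bar>)"
  proof (rule bochner_mono)
    show "integrable lborel (\<lambda>z. \<bar>(moll e (x - z) - moll e (y - z)) * u z\<bar>)"
      using i[of x] i[of y] by (simp add: left_diff_distrib)
    show "\<bar>(moll e (x - z) - moll e (y - z)) * u z\<bar> \<le> \<delta> * \<bar>u z\<bar>" for z using \<delta>[of z] by (simp add: abs_mult mult_right_mono)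
  qed (use u in auto)
  also have "\<dots> \<le> \<delta> * B" using mult_left_mono[OF B d0] by simp
  finally show "\<bar>conv (moll e) u x - conv (moll e) u y\<bar> \<le> \<delta> * B" .
qed

text \<open>For a fixed radius the mollified functions are equibounded and equicontinuous, so a
  diagonal subsequence converges at every point for all radii e m at once, and in L1 by dominated
  convergence. The gradient bound makes each mollification close to \<phi> n in L1 uniformly in n,
  so the subsequence of \<phi> is Cauchy in L1.\<close>

lemma rellich_test:
  fixes \<phi> :: "nat \<Rightarrow> 'a \<Rightarrow> real"
  assumes \<phi>: "\<And>n. \<phi> n \<in> test_functions \<Omega>" and G: "\<And>n. (LINT x|M. norm (classical_grad (\<phi> n) x)) \<le> B1" and B0: "\<And>n. (LINT x|lborel. \<bar>\<phi> n x\<bar>) \<le> B"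
  obtains r :: "nat \<Rightarrow> nat" and w where "strict_mono r" "integrable M w" "(\<lambda>n. LINT x|M. \<bar>\<phi> (r n) x - w x\<bar>) \<longlonglongrightarrow> 0"
proof -
  define e where "e m = inverse (real (Suc m))" for m
  have e: "e m > 0" for m by (simp add: e_def)
  define C where "C m = 1 / (e m ^ DIM('a) * bump_mass TYPE('a))" for m
  have C: "C m > 0" for m using e bump_mass_pos[where 'a='a] by (simp add: C_def)
  note i\<phi> = test_lborel_M(3)[OF \<phi>]
  note bd = conv_moll_uniform(1)[OF e i\<phi> B0, folded C_def]
  have Bn: "B \<ge> 0" using order_trans[OF _ B0[of 0]] by simp
  define c where "c m n x = conv (moll (e m)) (\<phi> n) x" for m n x
  obtain Q :: "'a set" where Q: "countable Q" "\<And>X. open X \<Longrightarrow> X \<noteq> {} \<Longrightarrow> \<exists>d\<in>Q. d \<in> X" using countable_dense_setE by blast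
  have cnt: "countable ((UNIV :: nat set) \<times> Q)" using Q(1) by simp
  \<comment> \<open>Dividing by C m gives all values, for all radii and points, the common bound B,
    as the extraction of one subsequence for the countable index set requires.\<close>
  define s where "s n y = c (fst y) n (snd y) / C (fst y)" for n and y :: "nat \<times> 'a"
  have sB: "norm (s n y) \<le> B" for n y
    using bd[of "fst y" n "snd y"] C[of "fst y"] by (simp add: c_def s_def divide_le_eq mult.commute abs_of_pos)
  obtain k :: "nat \<Rightarrow> nat" where k: "strict_mono k" "\<And>y. y \<in> UNIV \<times> Q \<Longrightarrow> \<exists>l. (\<lambda>n. s (k n) y) \<longlonglongrightarrow> l"
    by (rule function_convergent_subsequence[OF cnt, of s B]) (use sB in auto)
  have cQ: "Cauchy (\<lambda>n. c m (k n) x)" if "x \<in> Q" for m x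
  proof -
    obtain l where "(\<lambda>n. c m (k n) x / C m) \<longlonglongrightarrow> l" using k(2)[of "(m, x)"] \<open>x \<in> Q\<close> by (auto simp: s_def)
    then have "(\<lambda>n. C m * (c m (k n) x / C m)) \<longlonglongrightarrow> C m * l" by (intro tendsto_intros)
    then have "(\<lambda>n. c m (k n) x) \<longlonglongrightarrow> C m * l" using C[of m] by simp
    then show ?thesis by (rule LIMSEQ_imp_Cauchy)
  qed
  \<comment> \<open>The kernel is Lipschitz and the \<phi> n are bounded in L1, so convergence at
    the dense points of Q spreads to all points.\<close>
  have call: "Cauchy (\<lambda>n. c m (k n) x)" for m x
  proof (rule metric_CauchyI)
    fix \<epsilon> :: real assume \<epsilon>: "\<epsilon> > 0"
    define \<delta> where "\<delta> = \<epsilon> / (3 * (B + 1))"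
    have \<delta>: "\<delta> > 0" using \<epsilon> Bn by (simp add: \<delta>_def)
    have \<delta>B: "\<delta> * B \<le> \<epsilon> / 3"
    proof -
      have "\<delta> * B = \<epsilon> / 3 * (B / (B + 1))" by (simp add: \<delta>_def)
      also have "\<dots> \<le> \<epsilon> / 3 * 1" using \<epsilon> Bn by (intro mult_left_mono divide_succ_le_1) auto
      finally show ?thesis by simp
    qed
    have sup: "\<forall>x::'a. norm x > e m \<longrightarrow> moll (e m) x = 0" by (simp add: moll_eq_0[OF e])
    have CG: "C1_grad (moll (e m)) (classical_grad (moll (e m) :: 'a \<Rightarrow> real))" by (rule smooth_C1_grad[OF smooth_moll])
    obtain G where G: "\<And>x::'a. norm (classical_grad (moll (e m)) x) \<le> G" using C1_grad_bounded[OF CG sup] by blast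
    have G0: "G \<ge> 0" using order_trans[OF norm_ge_zero G] by blast
    have lip: "\<bar>moll (e m) a - moll (e m) b\<bar> \<le> G * norm (a - b)" for a b :: 'a
    proof -
      have "norm (moll (e m) a - moll (e m) b) \<le> G * norm (a - b)"
      proof (rule differentiable_bound[of UNIV _ "\<lambda>x v. classical_grad (moll (e m)) x \<bullet> v"])
        show "(moll (e m) has_derivative (\<lambda>v. classical_grad (moll (e m)) x \<bullet> v)) (at x within UNIV)" for x :: 'a
          using CG by (simp add: C1_grad_def)
        show "onorm (\<lambda>v. classical_grad (moll (e m)) x \<bullet> v) \<le> G" for x :: 'a
        proof (rule onorm_le)
          fix v show "norm (classical_grad (moll (e m)) x \<bullet> v) \<le> G * norm v"
            using order_trans[OF Cauchy_Schwarz_ineq2 mult_right_mono[OF G norm_ge_zero]] by simp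
        qed
      qed auto
      then show ?thesis by simp
    qed
    have "\<delta> / (G + 1) > 0" using \<delta> G0 by simp
    then obtain y where y: "y \<in> Q" "y \<in> ball x (\<delta> / (G + 1))" using Q(2)[of "ball x (\<delta> / (G + 1))"] by auto
    have xy: "\<bar>moll (e m) (x - z) - moll (e m) (y - z)\<bar> \<le> \<delta>" for z
    proof -
      have "\<bar>moll (e m) (x - z) - moll (e m) (y - z)\<bar> \<le> G * norm (x - y)" using lip[of "x - z" "y - z"] by simp
      also have "\<dots> \<le> G * (\<delta> / (G + 1))" using y(2) G0 by (intro mult_left_mono) (auto simp: dist_norm)
      also have "\<dots> = \<delta> * (G / (G + 1))" by simp
      also have "\<dots> \<le> \<delta> * 1" using \<delta> G0 by (intro mult_left_mono divide_succ_le_1) auto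
      finally show ?thesis by simp
    qed
    have near: "\<bar>c m n x - c m n y\<bar> \<le> \<epsilon> / 3" for n
      unfolding c_def using conv_moll_uniform(2)[OF e i\<phi> B0 xy, of n] \<delta>B by linarith
    obtain N where N: "\<And>i j. i \<ge> N \<Longrightarrow> j \<ge> N \<Longrightarrow> dist (c m (k i) y) (c m (k j) y) < \<epsilon> / 3"
      using metric_CauchyD[OF cQ[OF y(1), of m], of "\<epsilon>/3"] \<epsilon> by auto
    have "dist (c m (k i) x) (c m (k j) x) < \<epsilon>" if "i \<ge> N" "j \<ge> N" for i j
      using N[OF that] near[of "k i"] near[of "k j"] unfolding dist_real_def by linarith
    then show "\<exists>N. \<forall>i\<ge>N. \<forall>j\<ge>N. dist (c m (k i) x) (c m (k j) x) < \<epsilon>" by blast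
  qed
  define g where "g m x = lim (\<lambda>n. c m (k n) x)" for m x
  have cm[measurable]: "c m n \<in> borel_measurable M" for m n
    unfolding c_def[abs_def] by (rule borel_measurable_lebesgue_on) (use test_functionsD(3)[OF \<phi>] in measurable)
  have gm[measurable]: "g m \<in> borel_measurable M" for m unfolding g_def[abs_def] by measurable
  have gl: "(\<lambda>n. c m (k n) x) \<longlonglongrightarrow> g m x" for m x
    using call[of m x] by (auto simp: g_def Cauchy_convergent_iff convergent_LIMSEQ_iff)
  have cb: "\<bar>c m n x\<bar> \<le> C m * B" for m n x using bd[of m n x] by (simp add: c_def)
  have gb: "\<bar>g m x\<bar> \<le> C m * B" for m x
    by (rule tendsto_upperbound[OF tendsto_rabs[OF gl[of m x]] always_eventually trivial_limit_sequentially]) (use cb in auto)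
  have ic: "integrable M (c m n)" "integrable M (g m)" for m n
  proof -
    have ib: "integrable M v" if [measurable]: "v \<in> borel_measurable M" and v: "\<And>x. \<bar>v x\<bar> \<le> C m * B" for v
      by (rule integrable_const_bound[of _ "C m * B"]) (use v in auto)
    show "integrable M (c m n)" by (rule ib[OF cm cb])
    show "integrable M (g m)" by (rule ib[OF gm gb])
  qed
  have cl: "(\<lambda>n. LINT x|M. \<bar>c m (k n) x - g m x\<bar>) \<longlonglongrightarrow> 0" for m
  proof -
    have "(\<lambda>n. LINT x|M. \<bar>c m (k n) x - g m x\<bar>) \<longlonglongrightarrow> (LINT x|M. 0)"
    proof (rule integral_dominated_convergence[where w="\<lambda>x. 2 * (C m * B)"])
      show "AE x in M. (\<lambda>n. \<bar>c m (k n) x - g m x\<bar>) \<longlonglongrightarrow> 0"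
      proof (rule AE_I2)
        fix x
        have "(\<lambda>n. \<bar>c m (k n) x - g m x\<bar>) \<longlonglongrightarrow> \<bar>g m x - g m x\<bar>" by (intro tendsto_intros gl)
        then show "(\<lambda>n. \<bar>c m (k n) x - g m x\<bar>) \<longlonglongrightarrow> 0" by simp
      qed
      show "AE x in M. norm \<bar>c m (k n) x - g m x\<bar> \<le> 2 * (C m * B)" for n
      proof (rule AE_I2)
        fix x
        show "norm \<bar>c m (k n) x - g m x\<bar> \<le> 2 * (C m * B)" using cb[of m "k n" x] gb[of m x] abs_triangle_ineq4[of "c m (k n) x" "g m x"] by simp
      qed
    qed auto
    then show ?thesis by simp
  qed
  have i\<phi>M: "integrable M (\<phi> n)" for n using sobD(5)[OF sob_jet[OF \<phi>]] by (simp add: jet_def)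
  \<comment> \<open>The only place where the gradients enter: translations by less than e m move
    \<phi> n by at most e m times the L1 norm of its gradient.\<close>
  have approx: "(LINT x|M. \<bar>c m n x - \<phi> n x\<bar>) \<le> e m * max 0 B1" for m n
  proof -
    have G': "(\<integral>\<^sup>+x. ennreal (norm (classical_grad (\<phi> n) x)) \<partial>lborel) \<le> ennreal (max 0 B1)"
      unfolding test_lborel_M(1)[OF \<phi>] using G[of n] by (intro ennreal_leI) simp
    have "ennreal (LINT x|M. \<bar>c m n x - \<phi> n x\<bar>) = (\<integral>\<^sup>+x. ennreal \<bar>c m n x - \<phi> n x\<bar> \<partial>M)"
      by (subst nn_integral_eq_integral) (use ic i\<phi>M in auto)
    also have "\<dots> = (\<integral>\<^sup>+x. ennreal \<bar>c m n x - \<phi> n x\<bar> * indicator \<Omega> x \<partial>lborel)"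
      using \<Omega>_open by (simp add: nn_integral_restrict_space nn_integral_completion)
    also have "\<dots> \<le> (\<integral>\<^sup>+x. ennreal (norm (conv (moll (e m)) (\<phi> n) x - \<phi> n x)) \<partial>lborel)"
      by (rule nn_integral_mono) (auto simp: indicator_def c_def)
    also have "\<dots> \<le> ennreal (e m) * ennreal (max 0 B1)"
    proof (rule conv_moll_L1[OF e i\<phi>])
      fix h :: 'a assume h: "norm h < e m"
      have "L1_modulus (\<phi> n) h \<le> ennreal (norm h) * (\<integral>\<^sup>+x. ennreal (norm (classical_grad (\<phi> n) x)) \<partial>lborel)"
        unfolding L1_modulus_def using C1_grad_translation_L1[OF test_functionsD(2)[OF \<phi>], of n h] by simp
      also have "\<dots> \<le> ennreal (e m) * ennreal (max 0 B1)" using h G' by (intro mult_mono ennreal_leI) auto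
      finally show "L1_modulus (\<phi> n) h \<le> ennreal (e m) * ennreal (max 0 B1)" .
    qed
    also have "\<dots> = ennreal (e m * max 0 B1)" using e[of m] by (simp add: ennreal_mult)
    finally show ?thesis using e[of m] by (subst (asm) ennreal_le_iff) auto
  qed
  have "\<exists>N. \<forall>i\<ge>N. \<forall>j\<ge>N. (LINT x|M. norm (\<phi> (k i) x - \<phi> (k j) x)) < \<epsilon>" if \<epsilon>: "\<epsilon> > 0" for \<epsilon>
  proof -
    have "\<epsilon> / (5 * (max 0 B1 + 1)) > 0" using \<epsilon> by (simp add: add_nonneg_pos)
    then obtain m where "inverse (real (Suc m)) < \<epsilon> / (5 * (max 0 B1 + 1))" using reals_Archimedean by blast
    then have m: "e m \<le> \<epsilon> / (5 * (max 0 B1 + 1))" by (simp add: e_def)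
    have em: "e m * max 0 B1 \<le> \<epsilon> / 5"
    proof -
      have "e m * max 0 B1 \<le> \<epsilon> / (5 * (max 0 B1 + 1)) * max 0 B1" by (rule mult_right_mono[OF m]) simp
      also have "\<dots> = \<epsilon> / 5 * (max 0 B1 / (max 0 B1 + 1))" by simp
      also have "\<dots> \<le> \<epsilon> / 5 * 1" using \<epsilon> by (intro mult_left_mono divide_succ_le_1) auto
      finally show ?thesis by simp
    qed
    obtain N where N: "\<And>n. n \<ge> N \<Longrightarrow> norm ((LINT x|M. \<bar>c m (k n) x - g m x\<bar>) - 0) < \<epsilon> / 5" using LIMSEQ_D[OF cl[of m], of "\<epsilon>/5"] \<epsilon> by auto
    have "(LINT x|M. norm (\<phi> (k i) x - \<phi> (k j) x)) < \<epsilon>" if "i \<ge> N" "j \<ge> N" for i j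
    proof -
      have "(LINT x|M. norm (\<phi> (k i) x - \<phi> (k j) x)) \<le> (LINT x|M. \<bar>c m (k i) x - \<phi> (k i) x\<bar> + \<bar>c m (k i) x - g m x\<bar> + \<bar>c m (k j) x - g m x\<bar> + \<bar>c m (k j) x - \<phi> (k j) x\<bar>)"
      proof (rule bochner_mono)
        show "integrable M (\<lambda>x. norm (\<phi> (k i) x - \<phi> (k j) x))" by (intro integrable_norm bochner_diff i\<phi>M)
        show "integrable M (\<lambda>x. \<bar>c m (k i) x - \<phi> (k i) x\<bar> + \<bar>c m (k i) x - g m x\<bar> + \<bar>c m (k j) x - g m x\<bar> + \<bar>c m (k j) x - \<phi> (k j) x\<bar>)"
          by (intro bochner_add integrable_abs bochner_diff i\<phi>M ic)
        show "norm (\<phi> (k i) x - \<phi> (k j) x) \<le> \<bar>c m (k i) x - \<phi> (k i) x\<bar> + \<bar>c m (k i) x - g m x\<bar> + \<bar>c m (k j) x - g m x\<bar> + \<bar>c m (k j) x - \<phi> (k j) x\<bar>" for x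
          unfolding real_norm_def by linarith
      qed
      also have "\<dots> = (LINT x|M. \<bar>c m (k i) x - \<phi> (k i) x\<bar>) + (LINT x|M. \<bar>c m (k i) x - g m x\<bar>) + (LINT x|M. \<bar>c m (k j) x - g m x\<bar>) + (LINT x|M. \<bar>c m (k j) x - \<phi> (k j) x\<bar>)"
        by (simp only: Bochner_Integration.integral_add bochner_add integrable_abs bochner_diff i\<phi>M ic)
      also have "\<dots> < \<epsilon>"
      proof -
        have "(LINT x|M. \<bar>c m (k i) x - g m x\<bar>) < \<epsilon> / 5" "(LINT x|M. \<bar>c m (k j) x - g m x\<bar>) < \<epsilon> / 5"
          using N[OF that(1)] N[OF that(2)] unfolding real_norm_def diff_0_right by linarith+
        then show ?thesis using approx[of m "k i"] approx[of m "k j"] em \<epsilon> by linarith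
      qed
      finally show ?thesis .
    qed
    then show ?thesis by blast
  qed
  from L1_complete[OF i\<phi>M this] obtain w where w: "integrable M w" "(\<lambda>n. LINT x|M. \<bar>\<phi> (k n) x - w x\<bar>) \<longlonglongrightarrow> 0" by blast
  show ?thesis by (rule that[OF k(1) w])
qed

text \<open>Replace each D n by a test function with first component within 1 / (n + 1) and gradient
  within 1 in L1: the first error disappears along the sequence, the second merely raises the
  gradient bound to B + 1.\<close>

lemma rellich:
  assumes D: "\<And>n. sob0 (D n)" and G: "\<And>n. (LINT x|M. norm (snd (D n x))) \<le> B"
  obtains r :: "nat \<Rightarrow> nat" and w where "strict_mono r" "integrable M w" "(\<lambda>n. LINT x|M. \<bar>fst (D (r n) x) - w x\<bar>) \<longlonglongrightarrow> 0"
proof -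
  have sD: "sob (D n)" for n using D[of n] by (simp add: sob0_def)
  have "\<exists>\<phi>\<in>test_functions \<Omega>. (LINT x|M. \<bar>fst (D n x) - \<phi> x\<bar>) < 1 / real (Suc n) \<and> (LINT x|M. norm (snd (D n x) - classical_grad \<phi> x)) < 1" for n
  proof -
    obtain \<phi> where \<phi>: "\<And>i. \<phi> i \<in> test_functions \<Omega>" "(\<lambda>i. pmod M p (\<lambda>x. D n x - jet (\<phi> i) x)) \<longlonglongrightarrow> 0" by (rule sob0_approx[OF D[of n]]) blast
    note sj = sob_jet[OF \<phi>(1)]
    have L1: "(\<lambda>i. LINT x|M. \<bar>fst (D n x) - \<phi> i x\<bar>) \<longlonglongrightarrow> 0" using pmod_tendsto_L1_fst_snd(1)[OF \<phi>(2) sD sj] by (simp add: jet_def)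
    have L2: "(\<lambda>i. LINT x|M. norm (snd (D n x) - classical_grad (\<phi> i) x)) \<longlonglongrightarrow> 0" using pmod_tendsto_L1_fst_snd(2)[OF \<phi>(2) sD sj] by (simp add: jet_def)
    have "\<forall>\<^sub>F i in sequentially. (LINT x|M. \<bar>fst (D n x) - \<phi> i x\<bar>) < 1 / real (Suc n) \<and> (LINT x|M. norm (snd (D n x) - classical_grad (\<phi> i) x)) < 1"
      by (intro eventually_conj order_tendstoD(2)[OF L1] order_tendstoD(2)[OF L2]) auto
    then show ?thesis using \<phi>(1) by (auto simp: eventually_sequentially)
  qed
  then have "\<forall>n. \<exists>\<phi>. \<phi> \<in> test_functions \<Omega> \<and> (LINT x|M. \<bar>fst (D n x) - \<phi> x\<bar>) < 1 / real (Suc n) \<and> (LINT x|M. norm (snd (D n x) - classical_grad \<phi> x)) < 1"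
    unfolding Bex_def by (rule allI)
  from choice[OF this] obtain \<phi> where \<phi>: "\<And>n. \<phi> n \<in> test_functions \<Omega>" "\<And>n. (LINT x|M. \<bar>fst (D n x) - \<phi> n x\<bar>) < 1 / real (Suc n)"
     "\<And>n. (LINT x|M. norm (snd (D n x) - classical_grad (\<phi> n) x)) < 1" by - (erule exE, blast)
  have i\<phi>: "integrable M (\<phi> n)" "integrable M (classical_grad (\<phi> n))" for n using sobD(5,6)[OF sob_jet[OF \<phi>(1)]] by (simp_all add: jet_def)
  have G\<phi>: "(LINT x|M. norm (classical_grad (\<phi> n) x)) \<le> B + 1" for n
  proof -
    have "(LINT x|M. norm (classical_grad (\<phi> n) x)) \<le> (LINT x|M. norm (snd (D n x)) + norm (snd (D n x) - classical_grad (\<phi> n) x))"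
    proof (rule bochner_mono)
      show "norm (classical_grad (\<phi> n) x) \<le> norm (snd (D n x)) + norm (snd (D n x) - classical_grad (\<phi> n) x)" for x
        using norm_triangle_ineq4[of "snd (D n x)" "snd (D n x) - classical_grad (\<phi> n) x"] by simp
    qed (use i\<phi> sobD(6)[OF sD] in auto)
    also have "\<dots> = (LINT x|M. norm (snd (D n x))) + (LINT x|M. norm (snd (D n x) - classical_grad (\<phi> n) x))"
      using i\<phi> sobD(6)[OF sD] by simp
    finally show ?thesis using G[of n] \<phi>(3)[of n] by linarith
  qed
  obtain K where K: "poincare_const \<Omega> (real DIM('a) + 1) K" using poincare_const_exists[OF \<Omega>_bdd, of "real DIM('a) + 1"] by auto
  have K0: "K \<ge> 0" using K by (simp add: poincare_const_def)
  \<comment> \<open>The L1 bound on the test functions comes from the weighted inequality with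
    weight 1 and the exponent n + 1, chosen simply to exceed the dimension n; b dominates the norm
    of that weight.\<close>
  define b where "b = max 1 (measure M (space M))"
  have b: "b > 0" by (simp add: b_def)
  have b1: "(\<integral>\<^sup>+x. ennreal (\<bar>1::real\<bar> powr (real DIM('a) + 1)) \<partial>M) \<le> ennreal (b powr (real DIM('a) + 1))"
  proof -
    have "b powr 1 \<le> b powr (real DIM('a) + 1)" by (intro powr_mono) (auto simp: b_def)
    then have "measure M (space M) \<le> b powr (real DIM('a) + 1)" using b by (simp add: b_def)
    then show ?thesis by (simp add: emeasure_eq_measure ennreal_leI)
  qed
  have B\<phi>: "(LINT x|lborel. \<bar>\<phi> n x\<bar>) \<le> K * b * (B + 1)" for n
  proof -
    have "(LINT x|M. \<bar>1 * fst (jet (\<phi> n) x)\<bar>) \<le> K * b * (LINT x|M. norm (snd (jet (\<phi> n) x)))"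
      by (rule weighted_poincare(2)[OF K _ b b1 sob0_jet[OF \<phi>(1)]]) simp
    also have "\<dots> \<le> K * b * (B + 1)" using G\<phi>[of n] K0 b by (intro mult_left_mono) (auto simp: jet_def)
    finally have "(LINT x|M. \<bar>\<phi> n x\<bar>) \<le> K * b * (B + 1)" by (simp add: jet_def)
    moreover have "(LINT x|lborel. \<bar>\<phi> n x\<bar>) = (LINT x|M. \<bar>\<phi> n x\<bar>)"
      using test_lborel_M(2,3)[OF \<phi>(1)[of n]] by (subst (asm) nn_integral_eq_integral) auto
    ultimately show ?thesis by simp
  qed
  obtain r :: "nat \<Rightarrow> nat" and w where r: "strict_mono r" "integrable M w" "(\<lambda>n. LINT x|M. \<bar>\<phi> (r n) x - w x\<bar>) \<longlonglongrightarrow> 0"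
    by (rule rellich_test[where \<phi>=\<phi>, OF \<phi>(1) G\<phi> B\<phi>]) blast
  have "(\<lambda>n. LINT x|M. \<bar>fst (D (r n) x) - w x\<bar>) \<longlonglongrightarrow> 0"
  proof (rule tendsto_sandwich[OF _ _ tendsto_const])
    have "(\<lambda>n. 1 / real (Suc (r n)) + (LINT x|M. \<bar>\<phi> (r n) x - w x\<bar>)) \<longlonglongrightarrow> 0 + 0"
      using LIMSEQ_subseq_LIMSEQ[OF LIMSEQ_Suc[OF lim_const_over_n[of 1]] r(1)] by (intro tendsto_add r(3)) (simp add: o_def)
    then show "(\<lambda>n. 1 / real (Suc (r n)) + (LINT x|M. \<bar>\<phi> (r n) x - w x\<bar>)) \<longlonglongrightarrow> 0" by simp
    show "\<forall>\<^sub>F n in sequentially. (LINT x|M. \<bar>fst (D (r n) x) - w x\<bar>) \<le> 1 / real (Suc (r n)) + (LINT x|M. \<bar>\<phi> (r n) x - w x\<bar>)"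
    proof (intro always_eventually allI)
      fix n
      have "(LINT x|M. \<bar>fst (D (r n) x) - w x\<bar>) \<le> (LINT x|M. \<bar>fst (D (r n) x) - \<phi> (r n) x\<bar> + \<bar>\<phi> (r n) x - w x\<bar>)"
        by (rule bochner_mono) (use i\<phi> r(2) sobD(5)[OF sD] in auto)
      also have "\<dots> = (LINT x|M. \<bar>fst (D (r n) x) - \<phi> (r n) x\<bar>) + (LINT x|M. \<bar>\<phi> (r n) x - w x\<bar>)"
        using i\<phi> r(2) sobD(5)[OF sD] by simp
      finally show "(LINT x|M. \<bar>fst (D (r n) x) - w x\<bar>) \<le> 1 / real (Suc (r n)) + (LINT x|M. \<bar>\<phi> (r n) x - w x\<bar>)"
        using \<phi>(2)[of "r n"] by simp
    qed
  qed simp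
  then show ?thesis using r(1,2) that by blast
qed

end

section \<open>Existence and boundedness of minimizers\<close>

lemma F_pot_nonneg: "0 < lam_m \<Longrightarrow> lam_m < lam_p \<Longrightarrow> 0 \<le> F_pot lam_p lam_m \<gamma> t"
  by (auto simp: F_pot_def indicator_def)

lemma F_pot_le:
  assumes "0 < lam_m" "lam_m < lam_p" "0 \<le> \<gamma>" "\<gamma> \<le> 1"
  shows "F_pot lam_p lam_m \<gamma> t \<le> 2 * lam_p * (1 + \<bar>t\<bar>)"
proof (cases "\<gamma> = 0")
  case True
  have "F_pot lam_p lam_m \<gamma> t \<le> lam_p" using True assms by (auto simp: F_pot_def indicator_def)
  also have "\<dots> \<le> 2 * lam_p * (1 + \<bar>t\<bar>)" using assms by (simp add: distrib_left)
  finally show ?thesis .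
next
  case False
  have p: "s powr \<gamma> \<le> 1 + s" if "s \<ge> 0" for s :: real
  proof (cases "s \<le> 1")
    case True
    then show ?thesis using powr_le1[of \<gamma> s] that assms by simp
  next
    case F: False
    then have "s powr \<gamma> \<le> s powr 1" using assms by (intro powr_mono) auto
    then show ?thesis using F by simp
  qed
  have "lam_p * (max t 0) powr \<gamma> \<le> lam_p * (1 + \<bar>t\<bar>)" "lam_m * (max (- t) 0) powr \<gamma> \<le> lam_p * (1 + \<bar>t\<bar>)"
    using p[of "max t 0"] p[of "max (-t) 0"] assms by (intro mult_mono; auto)+
  then show ?thesis using False by (simp add: F_pot_def)
qed

text \<open>For \<gamma> = 0 the only possible change when moving towards 0 is from the value lam_p
  to the smaller lam_m; for \<gamma> > 0 both powers are monotone.\<close>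

lemma F_pot_toward_0:
  assumes "0 < lam_m" "lam_m < lam_p" "0 \<le> \<gamma>" "0 \<le> v \<and> v \<le> u \<or> u \<le> v \<and> v \<le> 0"
  shows "F_pot lam_p lam_m \<gamma> v \<le> F_pot lam_p lam_m \<gamma> u"
proof (cases "\<gamma> = 0")
  case True
  then show ?thesis using assms by (auto simp: F_pot_def indicator_def)
next
  case False
  have "(max v 0) powr \<gamma> \<le> (max u 0) powr \<gamma>" "(max (-v) 0) powr \<gamma> \<le> (max (-u) 0) powr \<gamma>"
    using assms by (intro powr_mono2; auto)+
  then show ?thesis using False assms by (auto simp: F_pot_def intro!: add_mono mult_left_mono)
qed

lemma F_pot_measurable[measurable]: "F_pot lam_p lam_m \<gamma> \<in> borel_measurable borel"
  unfolding F_pot_def[abs_def] by measurable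

text \<open>For \<gamma> = 0 the larger value lam_p is taken on the open set t > 0, so the jump is
  lower semicontinuous; for \<gamma> > 0 the function is continuous.\<close>

lemma F_pot_lsc:
  assumes "0 < lam_m" "lam_m < lam_p" "0 \<le> \<gamma>" and X: "X \<longlonglongrightarrow> t"
  shows "ennreal (F_pot lam_p lam_m \<gamma> t) \<le> liminf (\<lambda>n. ennreal (F_pot lam_p lam_m \<gamma> (X n)))"
proof (cases "\<gamma> = 0")
  case True
  have "\<forall>\<^sub>F n in sequentially. F_pot lam_p lam_m \<gamma> t \<le> F_pot lam_p lam_m \<gamma> (X n)"
  proof (cases "t > 0")
    case t: True
    have "\<forall>\<^sub>F n in sequentially. X n > 0" by (rule order_tendstoD(1)[OF X t])
    then show ?thesis by eventually_elim (use t True in \<open>auto simp: F_pot_def\<close>)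
  next
    case False
    then show ?thesis using True assms by (auto simp: F_pot_def indicator_def)
  qed
  then show ?thesis by (intro Liminf_bounded) (auto elim!: eventually_mono intro: ennreal_leI)
next
  case False
  then have g: "\<gamma> > 0" using assms by simp
  have "(\<lambda>n. lam_p * (max (X n) 0) powr \<gamma> + lam_m * (max (- X n) 0) powr \<gamma>) \<longlonglongrightarrow> lam_p * (max t 0) powr \<gamma> + lam_m * (max (- t) 0) powr \<gamma>"
    by (intro tendsto_add tendsto_mult_left tendsto_powr' tendsto_max tendsto_minus tendsto_const X) (use g in auto)
  then have "(\<lambda>n. ennreal (F_pot lam_p lam_m \<gamma> (X n))) \<longlonglongrightarrow> ennreal (F_pot lam_p lam_m \<gamma> t)"
    using False by (intro tendsto_ennrealI) (simp add: F_pot_def)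
  from lim_imp_Liminf[OF trivial_limit_sequentially this] show ?thesis by simp
qed

text \<open>Stampacchia's lemma. Along the levels k0 + d (1 - 2^(-i)), which stay below k0 + d,
  induction gives a \<le> V r^i, which tends to 0. The condition on d is exactly what the induction
  step consumes.\<close>

lemma level_set_iteration:
  fixes a :: "real \<Rightarrow> real"
  assumes a: "\<And>k. k0 \<le> k \<Longrightarrow> 0 \<le> a k \<and> a k \<le> V" and anti: "\<And>k h. k0 \<le> k \<Longrightarrow> k \<le> h \<Longrightarrow> a h \<le> a k"
    and decay: "\<And>k h. k0 \<le> k \<Longrightarrow> k < h \<Longrightarrow> (h - k) * a h \<le> D * a k powr (1 + s)"
    and s: "s > 0" and D: "D \<ge> 0" and d: "d > 0" "2 powr (1 + 1 / s) * D * V powr s \<le> d"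
  shows "a (k0 + d) = 0"
proof -
  \<comment> \<open>Chosen so that r^s = 1/2: the gain from the exponent 1 + s then compensates the
    halving of the distance between consecutive levels.\<close>
  define r :: real where "r = 2 powr (- (1 / s))"
  have r: "0 < r" "r < 1" using s by (auto simp: r_def powr_minus_divide gr_one_powr)
  have V: "V \<ge> 0" using a[of k0] by auto
  define k where "k i = k0 + d * (1 - (1/2) ^ i)" for i :: nat
  have k: "k0 \<le> k i" "k i \<le> k0 + d" for i using d(1) by (auto simp: k_def mult_le_cancel_left1 power_le_one)
  have ks: "k (Suc i) - k i = d / 2 ^ Suc i" for i by (simp add: k_def field_simps power_one_over)
  have key: "a (k i) \<le> V * r ^ i" for i
  proof (induction i)
    case 0
    then show ?case using a[OF k(1)[of 0]] by simp
  next
    case (Suc i)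
    have pos: "d / 2 ^ Suc i > 0" using d(1) by simp
    have "d / 2 ^ Suc i * a (k (Suc i)) \<le> D * a (k i) powr (1 + s)"
      using decay[OF k(1)[of i], of "k (Suc i)"] pos unfolding ks[symmetric] by simp
    also have "\<dots> \<le> D * (V * r ^ i) powr (1 + s)" using Suc a[OF k(1)[of i]] s D by (intro mult_left_mono powr_mono2) auto
    also have "(V * r ^ i) powr (1 + s) = V * r ^ i * (V powr s * (1/2) ^ i)"
    proof (cases "V = 0")
      case False
      have "(r ^ i) powr s = (r powr s) ^ i" using r(1) by (simp add: powr_realpow[symmetric] powr_powr mult.commute)
      also have "r powr s = 2 powr (-1)" using s unfolding r_def powr_powr by simp
      also have "\<dots> = 1/2" by (simp add: powr_minus_divide)
      finally show ?thesis using False V r by (simp add: powr_add powr_mult)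
    qed simp
    also have "D * (V * r ^ i * (V powr s * (1/2) ^ i)) = V * r ^ i * (1/2) ^ i * (D * V powr s)" by simp
    also have "\<dots> \<le> V * r ^ i * (1/2) ^ i * (d * r / 2)"
    proof (rule mult_left_mono)
      have "2 powr (1 + 1 / s) = 2 / r" by (simp add: r_def powr_add powr_minus_divide)
      then have "2 * (D * V powr s) / r \<le> d" using d(2) by (simp add: mult.assoc)
      then have "2 * (D * V powr s) \<le> d * r" by (simp only: pos_divide_le_eq[OF r(1)])
      then show "D * V powr s \<le> d * r / 2" by simp
    qed (use V r in auto)
    also have "\<dots> = d / 2 ^ Suc i * (V * r ^ Suc i)" by (simp add: power_one_over field_simps)
    finally show ?case using pos by (simp only: mult_le_cancel_left_pos)
  qed
  have "(\<lambda>i. V * r ^ i) \<longlonglongrightarrow> V * 0" using r by (intro tendsto_mult_left LIMSEQ_power_zero) auto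
  moreover have "a (k0 + d) \<le> V * r ^ i" for i using anti[OF k[of i]] key[of i] by linarith
  ultimately have "a (k0 + d) \<le> 0" by (intro LIMSEQ_le_const[of "\<lambda>i. V * r ^ i"]) auto
  then show ?thesis using a[of "k0 + d"] d(1) by force
qed

text \<open>The parameter \<open>1 / (2 L K N + 2)\<close> of Young's inequality is small enough to absorb the gradient
  coming from the term \<open>g u\<close>.\<close>
definition degiorgi_bound :: "real \<Rightarrow> real \<Rightarrow> real \<Rightarrow> real \<Rightarrow> real \<Rightarrow> real \<Rightarrow> real" where
  "degiorgi_bound L K N pm q V = 2 powr (1 + q) * (K * (2 * (L\<^sup>2 + max 1 ((1 / (2 * (L * K * N) + 2)) powr (1 / (1 - pm)))))) * V powr (1 / q) + 1"

text \<open>P is the boundary datum with its gradient, and Q witnesses that k1 is an admissible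
  boundary level. The bound M\<psi> makes g times the datum integrable and the class of bounded
  competitors nonempty; it does not enter \<open>excess\<close>.\<close>

locale variational = var_domain \<Omega> p pm pp Lh for \<Omega> :: "'a::euclidean_space set" and p pm pp Lh +
  fixes f :: "'a \<Rightarrow> 'a \<Rightarrow> real" and L lam_p lam_m \<gamma> :: real and g :: "'a \<Rightarrow> real" and q K N :: real
    and P Q :: "'a \<Rightarrow> real \<times> 'a" and M\<psi> k1 :: real
  assumes f_cont: "continuous_on (\<Omega> \<times> UNIV) (\<lambda>(x, z). f x z)"
    and f_convex: "\<And>x. x \<in> \<Omega> \<Longrightarrow> convex_on UNIV (f x)"
    and f_lower: "\<And>x z. x \<in> \<Omega> \<Longrightarrow> norm z powr p x \<le> L * f x z"
    and f_upper: "\<And>x z. x \<in> \<Omega> \<Longrightarrow> f x z \<le> L * (2 powr pp * (1 + norm z powr p x))"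
    and f_zero: "\<And>x. x \<in> \<Omega> \<Longrightarrow> f x 0 \<le> L"
    and L1: "1 \<le> L" and lam: "0 < lam_m" "lam_m < lam_p" and \<gamma>: "0 \<le> \<gamma>" "\<gamma> \<le> 1"
    and g_meas[measurable]: "g \<in> borel_measurable M" and N: "N > 0" and g_q: "(\<integral>\<^sup>+x. ennreal (\<bar>g x\<bar> powr q) \<partial>M) \<le> ennreal (N powr q)"
    and pc: "poincare_const \<Omega> q K" and q1: "q > 1"
    and P: "sob P" and P_bdd: "AE x in M. \<bar>fst (P x)\<bar> \<le> M\<psi>"
    and Q: "sob0 Q" "\<And>x. fst (Q x) = max (\<bar>fst (P x)\<bar> - k1) 0" and k1: "0 \<le> k1"
begin

abbreviation "F \<equiv> F_pot lam_p lam_m \<gamma>"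

definition adm :: "('a \<Rightarrow> real \<times> 'a) \<Rightarrow> bool" where
  "adm H \<longleftrightarrow> sob H \<and> sob0 (\<lambda>x. H x - P x)"

definition dens :: "('a \<Rightarrow> real \<times> 'a) \<Rightarrow> 'a \<Rightarrow> real" where
  "dens H x = f x (snd (H x)) + F (fst (H x)) + g x * fst (H x)"

definition en :: "('a \<Rightarrow> real \<times> 'a) \<Rightarrow> real" where
  "en H = (LINT x|M. dens H x)"

lemmas F_nonneg = F_pot_nonneg[OF lam, where \<gamma>=\<gamma>] and F_le = F_pot_le[OF lam \<gamma>]

lemma K_nonneg: "0 \<le> K" using pc by (simp add: poincare_const_def)

lemma f_nonneg: "x \<in> \<Omega> \<Longrightarrow> 0 \<le> f x z"
  using order_trans[OF powr_ge_zero f_lower[of x z]] L1 by (simp add: zero_le_mult_iff)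

lemma f_meas:
  assumes "G \<in> borel_measurable M" shows "(\<lambda>x. f x (G x)) \<in> borel_measurable M"
proof -
  have c: "(\<lambda>y. indicator (\<Omega> \<times> UNIV) y *\<^sub>R (case y of (x, z) \<Rightarrow> f x z)) \<in> borel_measurable borel"
    by (rule borel_measurable_continuous_on_indicator[OF _ f_cont]) (use \<Omega>_open in \<open>auto intro: borel_open open_Times\<close>)
  have "(\<lambda>x::'a. x) \<in> borel_measurable M" by (rule borel_measurable_lebesgue_on) simp
  from measurable_compose[OF borel_measurable_Pair_vec[OF this assms] c]
  have "(\<lambda>x. indicator (\<Omega> \<times> UNIV) (x, G x) *\<^sub>R f x (G x)) \<in> borel_measurable M" by simp
  then show ?thesis by (rule measurable_cong[THEN iffD1, rotated]) simp
qed

lemma f_integrable: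
  assumes H: "sob H" shows "integrable M (\<lambda>x. f x (snd (H x)))"
proof (rule bochner_bound)
  have "pmod M p (\<lambda>x. snd (H x)) < \<infinity>" using pmod_fst_snd_le(2)[of H] sobD(3)[OF H] by (rule le_less_trans)
  then have "integrable M (\<lambda>x. norm (snd (H x)) powr p x)" by (rule pmod_finite_integrable(2)[OF sobD(8)[OF H]])
  then show "integrable M (\<lambda>x. L * (2 powr pp * (1 + norm (snd (H x)) powr p x)))" by simp
  show "AE x in M. norm (f x (snd (H x))) \<le> norm (L * (2 powr pp * (1 + norm (snd (H x)) powr p x)))"
  proof (rule AE_I2)
    fix x assume "x \<in> space M"
    then have "x \<in> \<Omega>" by simp
    from f_nonneg[OF this, of "snd (H x)"] f_upper[OF this, of "snd (H x)"] show "norm (f x (snd (H x))) \<le> norm (L * (2 powr pp * (1 + norm (snd (H x)) powr p x)))"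
      unfolding real_norm_def by linarith
  qed
qed (rule f_meas[OF sobD(8)[OF H]])

lemma F_integrable:
  assumes u: "integrable M u" shows "integrable M (\<lambda>x. F (u x))"
proof (rule bochner_bound)
  show "integrable M (\<lambda>x. 2 * lam_p * (1 + \<bar>u x\<bar>))" using u by simp
  show "AE x in M. norm (F (u x)) \<le> norm (2 * lam_p * (1 + \<bar>u x\<bar>))"
  proof (rule AE_I2)
    fix x show "norm (F (u x)) \<le> norm (2 * lam_p * (1 + \<bar>u x\<bar>))" using F_nonneg[of "u x"] F_le[of "u x"] unfolding real_norm_def by linarith
  qed
  show "(\<lambda>x. F (u x)) \<in> borel_measurable M" by (rule measurable_compose[OF borel_measurable_integrable[OF u] F_pot_measurable])
qed

lemma g_integrable: "integrable M g"
proof (rule bochner_bound)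
  have "(\<integral>\<^sup>+x. ennreal (\<bar>g x\<bar> powr q) \<partial>M) < \<infinity>" using g_q by (rule le_less_trans) simp
  then have "integrable M (\<lambda>x. \<bar>g x\<bar> powr q)" by (intro integrableI_bounded) auto
  then show "integrable M (\<lambda>x. 1 + \<bar>g x\<bar> powr q)" by simp
  show "AE x in M. norm (g x) \<le> norm (1 + \<bar>g x\<bar> powr q)"
  proof (rule AE_I2)
    fix x show "norm (g x) \<le> norm (1 + \<bar>g x\<bar> powr q)" using le_one_plus_powr[of "\<bar>g x\<bar>" q] q1 powr_ge_zero[of "\<bar>g x\<bar>" q] by simp
  qed
qed measurable

lemma g_bounded_integrable:
  assumes [measurable]: "u \<in> borel_measurable M" and b: "AE x in M. \<bar>u x\<bar> \<le> b"
  shows "integrable M (\<lambda>x. g x * u x)"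
proof (rule bochner_bound)
  show "integrable M (\<lambda>x. b * g x)" using g_integrable by simp
  show "AE x in M. norm (g x * u x) \<le> norm (b * g x)"
    using b
  proof eventually_elim
    case (elim x)
    from mult_left_mono[OF elim abs_ge_zero[of "g x"]] elim show ?case by (simp add: abs_mult mult.commute)
  qed
qed measurable

text \<open>Write u as (u - P) + P: the first summand lies in \<open>sob0\<close>, where the
  weighted inequality applies to g, and the second is bounded.\<close>

lemma adm_integrable:
  assumes H: "adm H"
  shows "integrable M (\<lambda>x. g x * fst (H x))" "integrable M (dens H)"
proof -
  have sH: "sob H" and D: "sob0 (\<lambda>x. H x - P x)" using H by (auto simp: adm_def)
  have "integrable M (\<lambda>x. g x * fst (H x - P x))" by (rule weighted_poincare(1)[OF pc g_meas N g_q D])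
  from bochner_add[OF this g_bounded_integrable[OF sobD(7)[OF P] P_bdd]]
  show *: "integrable M (\<lambda>x. g x * fst (H x))" by (simp add: algebra_simps)
  show "integrable M (dens H)" unfolding dens_def[abs_def]
    by (intro bochner_add f_integrable[OF sH] F_integrable[OF sobD(5)[OF sH]] *)
qed

lemma en_split:
  assumes H: "adm H"
  shows "en H = (LINT x|M. f x (snd (H x))) + (LINT x|M. F (fst (H x))) + (LINT x|M. g x * fst (H x))"
proof -
  have sH: "sob H" using H by (auto simp: adm_def)
  note i = f_integrable[OF sH] F_integrable[OF sobD(5)[OF sH]] adm_integrable(1)[OF H]
  show ?thesis unfolding en_def dens_def by (simp only: Bochner_Integration.integral_add bochner_add i)
qed

lemma adm_P: "adm P"
  using P sob0_lin[OF Q(1) Q(1), of 1 "-1"] by (simp add: adm_def zero_prod_def)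

text \<open>The sign \<sigma> treats truncation from above and from below together: \<sigma> P has
  the same Q, because Q sees only |P|.\<close>

lemma adm_truncate:
  assumes H: "adm H" and k: "k1 \<le> k" and \<sigma>: "\<sigma> = 1 \<or> \<sigma> = -1"
  shows "sob0 (pos_jet (\<lambda>x. \<sigma> *\<^sub>R H x - (k, 0)))" "adm (\<lambda>x. H x - \<sigma> *\<^sub>R pos_jet (\<lambda>x. \<sigma> *\<^sub>R H x - (k, 0)) x)"
proof -
  define T where "T = pos_jet (\<lambda>x. \<sigma> *\<^sub>R H x - (k, 0))"
  have sH: "sob H" and D: "sob0 (\<lambda>x. H x - P x)" using H by (auto simp: adm_def)
  have T0: "sob0 T" unfolding T_def
  proof (rule sob0_truncation[of "\<lambda>x. \<sigma> *\<^sub>R P x" _ Q k1])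
    show "sob (\<lambda>x. \<sigma> *\<^sub>R P x)" using sob_lin[OF P P, of \<sigma> 0] by simp
    show "sob (\<lambda>x. \<sigma> *\<^sub>R H x)" using sob_lin[OF sH sH, of \<sigma> 0] by simp
    show "sob0 (\<lambda>x. \<sigma> *\<^sub>R H x - \<sigma> *\<^sub>R P x)" using sob0_lin[OF D D, of \<sigma> 0] by (simp add: scaleR_diff_right)
    show "fst (Q x) = max (\<bar>fst (\<sigma> *\<^sub>R P x)\<bar> - k1) 0" for x using \<sigma> Q(2) by auto
  qed (use Q(1) k1 k in auto)
  then show "sob0 (pos_jet (\<lambda>x. \<sigma> *\<^sub>R H x - (k, 0)))" by (simp add: T_def)
  have sT: "sob T" using T0 by (simp add: sob0_def)
  have "sob (\<lambda>x. H x - \<sigma> *\<^sub>R T x)" using sob_lin[OF sH sT, of 1 "-\<sigma>"] by simp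
  moreover have "sob0 (\<lambda>x. H x - \<sigma> *\<^sub>R T x - P x)" using sob0_lin[OF D T0, of 1 "-\<sigma>"] by (simp add: algebra_simps)
  ultimately show "adm (\<lambda>x. H x - \<sigma> *\<^sub>R pos_jet (\<lambda>x. \<sigma> *\<^sub>R H x - (k, 0)) x)" by (simp add: adm_def T_def)
qed


section \<open>The direct method among bounded competitors\<close>

lemma f_tendsto:
  assumes "x \<in> \<Omega>" "(G \<longlongrightarrow> z) A" shows "((\<lambda>n. f x (G n)) \<longlongrightarrow> f x z) A"
  using continuous_on_tendsto_compose[OF f_cont tendsto_Pair[OF tendsto_const assms(2)], of x] assms(1) by simp

lemma nn_f_eq:
  assumes "sob H" shows "(\<integral>\<^sup>+x. ennreal (f x (snd (H x))) \<partial>M) = ennreal (LINT x|M. f x (snd (H x)))"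
  by (rule nn_integral_eq_integral[OF f_integrable[OF assms]], rule AE_I2, rule f_nonneg) simp

lemma midhull_f:
  assumes W: "\<And>i. sob (W i)" "\<And>i. i \<ge> j \<Longrightarrow> (LINT x|M. f x (snd (W i x))) \<le> c" and h: "h \<in> midhull W j"
  shows "(LINT x|M. f x (snd (h x))) \<le> c"
proof (rule midhull_integral_le[where \<Phi>="\<lambda>x y. f x (snd y)", OF W(1) f_integrable _ W(2) h])
  fix x and y z :: "real \<times> 'a" assume "x \<in> \<Omega>"
  from convex_onD[OF f_convex[OF this], of "1/2" "snd y" "snd z"]
  show "f x (snd ((1/2) *\<^sub>R (y + z))) \<le> (f x (snd y) + f x (snd z)) / 2" by (simp add: scaleR_add_right)
qed

text \<open>Gradients converge in L1, so Fatou's lemma and continuity of f suffice along a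
  subsequence converging almost everywhere. Convexity has already been spent in
  \<open>midhull_f\<close>, on the passage to midpoints.\<close>

lemma f_lsc:
  assumes H: "sob H" and h: "\<And>n. sob (h n)" and l: "(\<lambda>n. pmod M p (\<lambda>x. h n x - H x)) \<longlonglongrightarrow> 0"
    and c: "\<And>n. n \<ge> n0 \<Longrightarrow> (LINT x|M. f x (snd (h n x))) \<le> c"
  shows "(LINT x|M. f x (snd (H x))) \<le> c"
proof -
  have l': "(\<lambda>n. pmod M p (\<lambda>x. H x - h n x)) \<longlonglongrightarrow> 0" using l by (simp add: pmod_minus_commute[of H])
  have L: "(\<lambda>n. LINT x|M. norm (snd (H x) - snd (h n x))) \<longlonglongrightarrow> 0" by (rule pmod_tendsto_L1_fst_snd(2)[OF l' H h])
  have iD: "integrable M (\<lambda>x. snd (H x) - snd (h n x))" for n by (intro bochner_diff sobD(6)[OF H] sobD(6)[OF h])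
  obtain r :: "nat \<Rightarrow> nat" where r: "strict_mono r" "AE x in M. (\<lambda>n. snd (H x) - snd (h (r n) x)) \<longlonglongrightarrow> 0"
    using tendsto_L1_AE_subseq[of M "\<lambda>n x. snd (H x) - snd (h n x)", OF iD L] by auto
  have c0: "0 \<le> c"
    using order_trans[OF Bochner_Integration.integral_nonneg c[OF order_refl]] f_nonneg by simp
  have "ennreal (LINT x|M. f x (snd (H x))) = (\<integral>\<^sup>+x. ennreal (f x (snd (H x))) \<partial>M)" by (rule nn_f_eq[OF H, symmetric])
  also have "\<dots> \<le> (\<integral>\<^sup>+x. liminf (\<lambda>n. ennreal (f x (snd (h (r n) x)))) \<partial>M)"
  proof (rule nn_integral_mono_AE)
    show "AE x in M. ennreal (f x (snd (H x))) \<le> liminf (\<lambda>n. ennreal (f x (snd (h (r n) x))))"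
      using r(2) AE_space
    proof eventually_elim
      case (elim x)
      have "(\<lambda>n. snd (H x) - (snd (H x) - snd (h (r n) x))) \<longlonglongrightarrow> snd (H x) - 0" by (intro tendsto_diff tendsto_const elim)
      then have "(\<lambda>n. snd (h (r n) x)) \<longlonglongrightarrow> snd (H x)" by simp
      then have "(\<lambda>n. ennreal (f x (snd (h (r n) x)))) \<longlonglongrightarrow> ennreal (f x (snd (H x)))"
        using elim(2) by (intro tendsto_ennrealI f_tendsto) simp
      from lim_imp_Liminf[OF trivial_limit_sequentially this] show ?case by simp
    qed
  qed
  also have "\<dots> \<le> liminf (\<lambda>n. \<integral>\<^sup>+x. ennreal (f x (snd (h (r n) x))) \<partial>M)"
    by (rule nn_integral_liminf) (intro measurable_compose[OF _ measurable_ennreal] f_meas sobD(8)[OF h])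
  also have "\<dots> \<le> ennreal c"
  proof (rule Liminf_le)
    show "\<forall>\<^sub>F n in sequentially. (\<integral>\<^sup>+x. ennreal (f x (snd (h (r n) x))) \<partial>M) \<le> ennreal c"
    proof (rule eventually_sequentiallyI[of n0])
      fix n assume "n0 \<le> n"
      then have "n0 \<le> r n" using seq_suble[OF r(1), of n] by linarith
      then show "(\<integral>\<^sup>+x. ennreal (f x (snd (h (r n) x))) \<partial>M) \<le> ennreal c" unfolding nn_f_eq[OF h] by (intro ennreal_leI c)
    qed
  qed simp
  finally show ?thesis by (simp only: ennreal_le_iff[OF c0])
qed

text \<open>The limit pair H arises from midpoints h, but its first component is the limit u of the
  original W. So the bound for f comes from h, while F and g u are evaluated along W.\<close>

lemma energy_lsc:
  assumes W: "\<And>n. adm (W n)" and Kb: "\<And>n. AE x in M. \<bar>fst (W n x)\<bar> \<le> b" and R: "\<And>n. pmod M p (W n) \<le> ennreal R"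
    and u: "integrable M u" "(\<lambda>n. LINT x|M. \<bar>fst (W n x) - u x\<bar>) \<longlonglongrightarrow> 0" and ae: "AE x in M. (\<lambda>n. fst (W n x)) \<longlonglongrightarrow> u x"
    and lf: "(\<lambda>n. LINT x|M. f x (snd (W n x))) \<longlonglongrightarrow> lf" and m: "(\<lambda>n. en (W n)) \<longlonglongrightarrow> m"
  obtains H where "adm H" "AE x in M. \<bar>fst (H x)\<bar> \<le> b" "en H \<le> m"
proof -
  have sK: "sob (W n)" and K0: "sob0 (\<lambda>x. W n x - P x)" for n using W[of n] by (auto simp: adm_def)
  obtain H h where H: "sob H" "\<And>x. fst (H x) = u x" and h: "\<And>n. h n \<in> midhull W n" "(\<lambda>n. pmod M p (\<lambda>x. h n x - H x)) \<longlonglongrightarrow> 0"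
    by (rule sob_weak_limit[OF sK R u]) blast
  have sh: "sob (h n)" for n by (rule midhull_sob[OF sK h(1)])
  have h0: "sob0 (\<lambda>x. h n x - P x)" for n
    using h(1)[of n]
  proof (rule midhull_induct_pred)
    fix a b assume ab: "sob0 (\<lambda>x. a x - P x)" "sob0 (\<lambda>x. b x - P x)"
    have "(\<lambda>x. (1/2) *\<^sub>R (a x - P x) + (1/2) *\<^sub>R (b x - P x)) = (\<lambda>x. (1/2) *\<^sub>R (a x + b x) - P x)"
    proof
      fix x
      have "P x = (1/2) *\<^sub>R P x + (1/2) *\<^sub>R P x" unfolding scaleR_add_left[symmetric] by simp
      then show "(1/2) *\<^sub>R (a x - P x) + (1/2) *\<^sub>R (b x - P x) = (1/2) *\<^sub>R (a x + b x) - P x"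
        by (simp add: scaleR_diff_right scaleR_add_right algebra_simps)
    qed
    then show "sob0 (\<lambda>x. (1/2) *\<^sub>R (a x + b x) - P x)" using sob0_lin[OF ab, of "1/2" "1/2"] by simp
  qed (rule K0)
  have H0: "sob0 (\<lambda>x. H x - P x)"
  proof (rule sob0_limit[OF _ h0])
    show "sob (\<lambda>x. H x - P x)" using sob_lin[OF H(1) P, of 1 "-1"] by simp
  qed (use h(2) in simp)
  have aH: "adm H" using H(1) H0 by (simp add: adm_def)
  have Kball: "AE x in M. \<forall>n. \<bar>fst (W n x)\<bar> \<le> b" using Kb by (simp add: AE_all_countable)
  have ub: "AE x in M. \<bar>u x\<bar> \<le> b"
    using ae Kball
  proof eventually_elim
    case (elim x)
    then show ?case by (intro tendsto_upperbound[OF tendsto_rabs[OF elim(1)]]) auto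
  qed
  have fl: "(LINT x|M. f x (snd (H x))) \<le> lf"
  proof (rule field_le_epsilon)
    fix e :: real assume "e > 0"
    then have "\<forall>\<^sub>F n in sequentially. (LINT x|M. f x (snd (W n x))) < lf + e" by (intro order_tendstoD(2)[OF lf]) simp
    then obtain n0 where n0: "\<And>n. n \<ge> n0 \<Longrightarrow> (LINT x|M. f x (snd (W n x))) \<le> lf + e" unfolding eventually_sequentially using less_imp_le by blast
    show "(LINT x|M. f x (snd (H x))) \<le> lf + e"
    proof (rule f_lsc[OF H(1) sh h(2)])
      fix n assume "n0 \<le> n"
      then show "(LINT x|M. f x (snd (h n x))) \<le> lf + e" using n0 by (intro midhull_f[OF sK _ h(1)]) simp
    qed
  qed
  have gl: "(\<lambda>n. LINT x|M. g x * fst (W n x)) \<longlonglongrightarrow> (LINT x|M. g x * u x)"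
  proof (rule integral_dominated_convergence[where w="\<lambda>x. b * \<bar>g x\<bar>"])
    show "(\<lambda>x. g x * u x) \<in> borel_measurable M" "(\<lambda>x. g x * fst (W n x)) \<in> borel_measurable M" for n
      by (intro borel_measurable_times g_meas borel_measurable_integrable[OF u(1)] sobD(7)[OF sK])+
    show "integrable M (\<lambda>x. b * \<bar>g x\<bar>)" using g_integrable by simp
    show "AE x in M. (\<lambda>n. g x * fst (W n x)) \<longlonglongrightarrow> g x * u x" using ae by eventually_elim (rule tendsto_mult_left)
    show "AE x in M. norm (g x * fst (W n x)) \<le> b * \<bar>g x\<bar>" for n
      using Kb[of n]
    proof eventually_elim
      case (elim x)
      from mult_right_mono[OF elim abs_ge_zero[of "g x"]] show ?case by (simp add: abs_mult mult.commute)
    qed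
  qed
  have iF: "integrable M (\<lambda>x. F (fst (W n x)))" for n by (rule F_integrable[OF sobD(5)[OF sK]])
  \<comment> \<open>The limit of the integrals of F is forced by the limits of the other quantities;
    for this the integrals of f are assumed to converge, not only to be bounded.\<close>
  define c where "c = m - lf - (LINT x|M. g x * u x)"
  have Fc: "(\<lambda>n. LINT x|M. F (fst (W n x))) \<longlonglongrightarrow> c"
  proof -
    have "(\<lambda>n. en (W n) - (LINT x|M. f x (snd (W n x))) - (LINT x|M. g x * fst (W n x))) \<longlonglongrightarrow> c"
      unfolding c_def by (intro tendsto_diff m lf gl)
    then show ?thesis by (simp add: en_split[OF W])
  qed
  have c0: "c \<ge> 0" by (rule LIMSEQ_le_const[OF Fc]) (intro exI allI impI Bochner_Integration.integral_nonneg F_nonneg)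
  have "ennreal (LINT x|M. F (u x)) = (\<integral>\<^sup>+x. ennreal (F (u x)) \<partial>M)"
    by (rule nn_integral_eq_integral[symmetric, OF F_integrable[OF u(1)]]) (simp add: F_nonneg)
  also have "\<dots> \<le> (\<integral>\<^sup>+x. liminf (\<lambda>n. ennreal (F (fst (W n x)))) \<partial>M)"
    by (rule nn_integral_mono_AE, rule AE_mp[OF ae], rule AE_I2, rule impI, rule F_pot_lsc[OF lam \<gamma>(1)])
  also have "\<dots> \<le> liminf (\<lambda>n. \<integral>\<^sup>+x. ennreal (F (fst (W n x))) \<partial>M)"
    by (rule nn_integral_liminf) (intro measurable_compose[OF _ measurable_ennreal] borel_measurable_integrable[OF iF])
  also have "\<dots> = liminf (\<lambda>n. ennreal (LINT x|M. F (fst (W n x))))"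
    by (subst nn_integral_eq_integral[OF iF]) (simp_all add: F_nonneg)
  also have "\<dots> = ennreal c" by (rule lim_imp_Liminf[OF trivial_limit_sequentially tendsto_ennrealI[OF Fc]])
  finally have "(LINT x|M. F (u x)) \<le> c" by (simp only: ennreal_le_iff[OF c0])
  then have "en H \<le> m" using fl unfolding en_split[OF aH] H(2) c_def by linarith
  then show ?thesis using that[OF aH] ub by (simp add: H(2))
qed

text \<open>With |u| \<le> b the term g u costs at most b times the L1 norm of g, so the energy
  controls the integral of f and thereby the modular of the gradient; then Rellich's theorem and
  \<open>energy_lsc\<close> apply.\<close>

lemma exists_bounded_minimizer:
  assumes b: "M\<psi> \<le> b" "0 \<le> b"
  obtains H where "adm H" "AE x in M. \<bar>fst (H x)\<bar> \<le> b" "\<And>W. adm W \<Longrightarrow> AE x in M. \<bar>fst (W x)\<bar> \<le> b \<Longrightarrow> en H \<le> en W"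
proof -
  define A where "A = {H. adm H \<and> (AE x in M. \<bar>fst (H x)\<bar> \<le> b)}"
  define G where "G = b * (LINT x|M. \<bar>g x\<bar>)"
  have fen: "(LINT x|M. f x (snd (H x))) \<le> en H + G" if "H \<in> A" for H
  proof -
    have aH: "adm H" and bH: "AE x in M. \<bar>fst (H x)\<bar> \<le> b" using that by (auto simp: A_def)
    have "- G = (LINT x|M. - (b * \<bar>g x\<bar>))" by (simp add: G_def)
    also have "\<dots> \<le> (LINT x|M. g x * fst (H x))"
    proof (rule integral_mono_AE)
      show "AE x in M. - (b * \<bar>g x\<bar>) \<le> g x * fst (H x)"
        using bH
      proof eventually_elim
        case (elim x)
        from mult_right_mono[OF elim abs_ge_zero[of "g x"]] have "\<bar>g x * fst (H x)\<bar> \<le> b * \<bar>g x\<bar>" by (simp add: abs_mult mult.commute)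
        then show ?case by linarith
      qed
    qed (use g_integrable adm_integrable(1)[OF aH] in auto)
    moreover have "0 \<le> (LINT x|M. F (fst (H x)))" by (intro Bochner_Integration.integral_nonneg F_nonneg)
    ultimately show ?thesis unfolding en_split[OF aH] by linarith
  qed
  have f0: "0 \<le> (LINT x|M. f x (snd (H x)))" for H :: "'a \<Rightarrow> real \<times> 'a" by (rule Bochner_Integration.integral_nonneg) (simp add: f_nonneg)
  have PA: "P \<in> A" using adm_P P_bdd b(1) by (auto simp: A_def elim!: eventually_mono)
  have bb: "bdd_below (en ` A)"
  proof (rule bdd_belowI2[of _ "- G"])
    fix H assume "H \<in> A"
    from order_trans[OF f0 fen[OF this]] show "- G \<le> en H" by linarith
  qed
  define m where "m = (INF H\<in>A. en H)"
  have "\<exists>H. H \<in> A \<and> en H < m + 1 / real (Suc n)" for n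
  proof -
    have "m < m + 1 / real (Suc n)" by simp
    then show ?thesis unfolding m_def using cINF_less_iff[OF _ bb] PA by blast
  qed
  then obtain H where H: "\<And>n. H n \<in> A" "\<And>n. en (H n) < m + 1 / real (Suc n)" by metis
  have aH: "adm (H n)" and bH: "AE x in M. \<bar>fst (H n x)\<bar> \<le> b" for n using H(1)[of n] by (auto simp: A_def)
  have sH: "sob (H n)" and H0: "sob0 (\<lambda>x. H n x - P x)" for n using aH[of n] by (auto simp: adm_def)
  have ml: "m \<le> en W" if "W \<in> A" for W unfolding m_def by (rule cINF_lower[OF bb that])
  have fb: "(LINT x|M. f x (snd (H n x))) \<le> m + 1 + G" for n
  proof -
    have "1 / real (Suc n) \<le> 1" by simp
    then show ?thesis using fen[OF H(1)[of n]] H(2)[of n] by linarith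
  qed
  define R1 where "R1 = L * (m + 1 + G)"
  have R1: "pmod M p (\<lambda>x. snd (H n x)) \<le> ennreal R1" "(LINT x|M. norm (snd (H n x)) powr p x) \<le> R1" for n
  proof -
    have fin: "pmod M p (\<lambda>x. snd (H n x)) < \<infinity>" using pmod_fst_snd_le(2)[of "H n"] sobD(3)[OF sH] by (rule le_less_trans)
    note pf = pmod_finite_integrable[OF sobD(8)[OF sH] fin]
    have "(LINT x|M. norm (snd (H n x)) powr p x) \<le> (LINT x|M. L * f x (snd (H n x)))"
      by (rule bochner_mono[OF pf(2)]) (use f_integrable[OF sH] f_lower in auto)
    also have "\<dots> = L * (LINT x|M. f x (snd (H n x)))" by simp
    also have "\<dots> \<le> R1" unfolding R1_def using L1 by (intro mult_left_mono fb) simp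
    finally show "(LINT x|M. norm (snd (H n x)) powr p x) \<le> R1" .
    then show "pmod M p (\<lambda>x. snd (H n x)) \<le> ennreal R1" unfolding pf(3) by (rule ennreal_leI)
  qed
  have R1n: "R1 \<ge> 0" by (rule order_trans[OF _ R1(2)[of 0]]) simp
  define R2 where "R2 = max 1 (b powr pp) * measure M (space M)"
  have R2n: "R2 \<ge> 0" by (simp add: R2_def)
  have R2: "pmod M p (\<lambda>x. fst (H n x)) \<le> ennreal R2" for n
  proof -
    \<comment> \<open>\<open>pmod_bounded_finite\<close> asks for a bound at every point of
      \<Omega>, but |u| \<le> b holds only almost everywhere, so exceptional values are set to
      0.\<close>
    have "pmod M p (\<lambda>x. fst (H n x)) = pmod M p (\<lambda>x. if \<bar>fst (H n x)\<bar> \<le> b then fst (H n x) else 0)"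
      by (rule pmod_cong_AE) (use bH[of n] in auto)
    also have "\<dots> \<le> ennreal R2" unfolding R2_def by (rule pmod_bounded_finite(1)) (use b in auto)
    finally show ?thesis .
  qed
  define R where "R = 2 powr pp * (R2 + R1)"
  have R: "pmod M p (H n) \<le> ennreal R" for n
  proof -
    have "pmod M p (H n) = pmod M p (\<lambda>x. (fst (H n x), snd (H n x)))" by simp
    also have "\<dots> \<le> ennreal (2 powr pp) * (pmod M p (\<lambda>x. fst (H n x)) + pmod M p (\<lambda>x. snd (H n x)))"
      by (rule pmod_Pair_le[OF sobD(7,8)[OF sH]])
    also have "\<dots> \<le> ennreal (2 powr pp) * (ennreal R2 + ennreal R1)" by (intro mult_left_mono add_mono R1 R2) simp
    also have "\<dots> = ennreal R" using R1n R2n by (simp add: R_def ennreal_mult flip: ennreal_plus)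
    finally show ?thesis .
  qed
  have Gb: "(LINT x|M. norm (snd (H n x - P x))) \<le> (measure M (space M) + R1) + (LINT x|M. norm (snd (P x)))" for n
  proof -
    have "pmod M p (\<lambda>x. snd (H n x)) < \<infinity>" using pmod_fst_snd_le(2)[of "H n"] sobD(3)[OF sH] by (rule le_less_trans)
    from pmod_L1_bound[OF sobD(8)[OF sH] _ _ this, of 1]
    have l: "(LINT x|M. norm (snd (H n x))) \<le> measure M (space M) + R1" using R1(2)[of n] by simp
    have "(LINT x|M. norm (snd (H n x - P x))) \<le> (LINT x|M. norm (snd (H n x)) + norm (snd (P x)))"
      by (rule bochner_mono) (use sobD(6)[OF sH] sobD(6)[OF P] in \<open>auto intro: norm_triangle_ineq4\<close>)
    also have "\<dots> = (LINT x|M. norm (snd (H n x))) + (LINT x|M. norm (snd (P x)))"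
      using sobD(6)[OF sH] sobD(6)[OF P] by simp
    finally show ?thesis using l by linarith
  qed
  obtain r1 :: "nat \<Rightarrow> nat" and w where r1: "strict_mono r1" "integrable M w" "(\<lambda>n. LINT x|M. \<bar>fst (H (r1 n) x - P x) - w x\<bar>) \<longlonglongrightarrow> 0"
    by (rule rellich[where D="\<lambda>n x. H n x - P x", OF H0 Gb]) blast
  define u where "u x = w x + fst (P x)" for x
  have iu: "integrable M u" unfolding u_def[abs_def] by (intro bochner_add r1(2) sobD(5)[OF P])
  have ul: "(\<lambda>n. LINT x|M. \<bar>fst (H (r1 n) x) - u x\<bar>) \<longlonglongrightarrow> 0" using r1(3) by (simp add: u_def algebra_simps)
  have iD: "integrable M (\<lambda>x. fst (H (r1 n) x) - u x)" for n by (intro bochner_diff sobD(5)[OF sH] iu)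
  obtain r2 :: "nat \<Rightarrow> nat" where r2: "strict_mono r2" "AE x in M. (\<lambda>n. fst (H (r1 (r2 n)) x) - u x) \<longlonglongrightarrow> 0"
    using tendsto_L1_AE_subseq[of M "\<lambda>n x. fst (H (r1 n) x) - u x", OF iD] ul by auto
  \<comment> \<open>A third extraction, so that the integrals of f converge by themselves as
    \<open>energy_lsc\<close> demands.\<close>
  have "seq_compact {0..m + 1 + G}" by (intro compact_imp_seq_compact compact_Icc)
  moreover have "\<forall>n. (LINT x|M. f x (snd (H (r1 (r2 n)) x))) \<in> {0..m + 1 + G}" using fb f0 by simp
  ultimately obtain lf and r3 :: "nat \<Rightarrow> nat" where r3: "strict_mono r3" "(\<lambda>n. LINT x|M. f x (snd (H (r1 (r2 (r3 n))) x))) \<longlonglongrightarrow> lf"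
    by (rule seq_compactE) (simp add: o_def)
  define k where "k n = r1 (r2 (r3 n))" for n
  have k: "strict_mono k" using r1(1) r2(1) r3(1) by (auto simp: k_def strict_mono_def)
  have em: "(\<lambda>n. en (H n)) \<longlonglongrightarrow> m"
  proof (rule tendsto_sandwich[OF _ _ tendsto_const])
    show "(\<lambda>n. m + 1 / real (Suc n)) \<longlonglongrightarrow> m" using tendsto_add[OF tendsto_const[of m] LIMSEQ_Suc[OF lim_const_over_n[of 1]]] by simp
    show "\<forall>\<^sub>F n in sequentially. m \<le> en (H n)" using ml H(1) by simp
    show "\<forall>\<^sub>F n in sequentially. en (H n) \<le> m + 1 / real (Suc n)" by (intro always_eventually allI less_imp_le H(2))
  qed
  obtain U where U: "adm U" "AE x in M. \<bar>fst (U x)\<bar> \<le> b" "en U \<le> m"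
  proof (rule energy_lsc[of "\<lambda>n. H (k n)" b R u lf m])
    have "strict_mono (\<lambda>n. r2 (r3 n))" using r2(1) r3(1) by (auto simp: strict_mono_def)
    from LIMSEQ_subseq_LIMSEQ[OF ul this] show "(\<lambda>n. LINT x|M. \<bar>fst (H (k n) x) - u x\<bar>) \<longlonglongrightarrow> 0" by (simp add: k_def o_def)
    show "AE x in M. (\<lambda>n. fst (H (k n) x)) \<longlonglongrightarrow> u x"
      using r2(2)
    proof eventually_elim
      case (elim x)
      from LIM_zero_cancel[OF LIMSEQ_subseq_LIMSEQ[OF elim r3(1), unfolded o_def]] show ?case by (simp add: k_def)
    qed
    show "(\<lambda>n. en (H (k n))) \<longlonglongrightarrow> m" using LIMSEQ_subseq_LIMSEQ[OF em k] by (simp add: o_def)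
    show "(\<lambda>n. LINT x|M. f x (snd (H (k n) x))) \<longlonglongrightarrow> lf" using r3(2) by (simp add: k_def)
  qed (use aH bH R iu in auto)
  show ?thesis
  proof (rule that[OF U(1,2)])
    fix W assume "adm W" "AE x in M. \<bar>fst (W x)\<bar> \<le> b"
    then show "en U \<le> en W" using ml[of W] U(3) by (simp add: A_def)
  qed
qed


text \<open>With T the part of \<sigma> u above k, comparison with the truncation bounds the modular
  of \<nabla>T by the measure of the level set plus the integral of |g T|. The weighted inequality
  turns the latter into the L1 norm of \<nabla>T, which Young's inequality absorbs, so that norm is
  bounded by the measure of the level set. A second use of the weighted inequality, with the
  indicator of the level set, returns to T.\<close>

lemma level_set_estimate:
  assumes H: "adm H" and k: "k1 \<le> k" and \<sigma>: "\<sigma> = 1 \<or> \<sigma> = -1"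
    and min: "en H \<le> en (\<lambda>x. H x - \<sigma> *\<^sub>R pos_jet (\<lambda>x. \<sigma> *\<^sub>R H x - (k, 0)) x)" and h: "k < h"
  shows "(h - k) * measure M {x\<in>space M. h < \<sigma> * fst (H x)}
    \<le> K * (2 * (L\<^sup>2 + max 1 ((1 / (2 * (L * K * N) + 2)) powr (1 / (1 - pm))))) * measure M {x\<in>space M. k < \<sigma> * fst (H x)} powr (1 + 1 / q)"
proof -
  define T where "T = pos_jet (\<lambda>x. \<sigma> *\<^sub>R H x - (k, 0))"
  define V where "V x = H x - \<sigma> *\<^sub>R T x" for x
  define A where "A = {x\<in>space M. k < \<sigma> * fst (H x)}"
  have sH: "sob H" using H by (simp add: adm_def)
  have T0: "sob0 T" and aV: "adm V" using adm_truncate[OF H k \<sigma>] by (simp_all add: T_def V_def[abs_def])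
  have sT: "sob T" and sV: "sob V" using T0 aV by (auto simp: sob0_def adm_def)
  note [measurable] = sobD(7,8)[OF sH] sobD(7,8)[OF sT]
  have Am[measurable]: "A \<in> sets M" unfolding A_def by measurable
  have AO: "A \<inter> \<Omega> = A" by (auto simp: A_def)
  have fT: "fst (T x) = max (\<sigma> * fst (H x) - k) 0" for x by (simp add: T_def pos_jet_def)
  have sT': "snd (T x) = (if k < \<sigma> * fst (H x) then \<sigma> *\<^sub>R snd (H x) else 0)" for x by (simp add: T_def pos_jet_def)
  have nT: "norm (snd (T x)) = (if k < \<sigma> * fst (H x) then norm (snd (H x)) else 0)" for x using \<sigma> by (auto simp: sT')
  define a where "a = measure M A"
  define I where "I = (LINT x|M. norm (snd (T x)))"
  have I0: "I \<ge> 0" by (simp add: I_def)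
  have gT: "integrable M (\<lambda>x. g x * fst (T x))" "(LINT x|M. \<bar>g x * fst (T x)\<bar>) \<le> K * N * I"
    using weighted_poincare[OF pc g_meas N g_q T0] by (simp_all add: I_def)
  \<comment> \<open>On A the truncated pair has zero gradient, where f is at most L by
    \<open>f_zero\<close>; a further factor L comes from \<open>f_lower\<close>. This is the origin
    of L^2.\<close>
  have pt: "norm (snd (T x)) powr p x \<le> L * (dens H x - dens V x) + L\<^sup>2 * indicator A x + L * \<bar>g x * fst (T x)\<bar>" if x: "x \<in> space M" for x
  proof (cases "k < \<sigma> * fst (H x)")
    case True
    have xO: "x \<in> \<Omega>" using x by simp
    have sV0: "snd (V x) = 0" using True \<sigma> by (auto simp: V_def sT')
    have fV: "fst (V x) = \<sigma> * k" using True \<sigma> by (auto simp: V_def fT)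
    have F: "F (fst (V x)) \<le> F (fst (H x))"
      by (rule F_pot_toward_0[OF lam \<gamma>(1)]) (use True \<sigma> k k1 fV in auto)
    have "g x * fst (H x) - g x * fst (V x) = \<sigma> * (g x * fst (T x))" by (simp add: V_def algebra_simps)
    moreover have "\<bar>\<sigma> * (g x * fst (T x))\<bar> = \<bar>g x * fst (T x)\<bar>" using \<sigma> by auto
    ultimately have gd: "g x * fst (H x) - g x * fst (V x) \<ge> - \<bar>g x * fst (T x)\<bar>" by linarith
    have "f x (snd (H x)) \<le> dens H x - dens V x + L + \<bar>g x * fst (T x)\<bar>"
      using F gd f_zero[OF xO] unfolding dens_def sV0 by linarith
    then have "L * f x (snd (H x)) \<le> L * (dens H x - dens V x + L + \<bar>g x * fst (T x)\<bar>)" using L1 by (intro mult_left_mono) auto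
    moreover have "norm (snd (T x)) powr p x \<le> L * f x (snd (H x))" using f_lower[OF xO, of "snd (H x)"] True by (simp add: nT)
    moreover have "x \<in> A" using True x by (simp add: A_def)
    ultimately show ?thesis by (simp add: algebra_simps power2_eq_square)
  next
    case False
    then have "T x = 0" by (simp add: T_def pos_jet_def)
    then show ?thesis using False by (simp add: V_def dens_def A_def)
  qed
  have "pmod M p (\<lambda>x. snd (T x)) < \<infinity>" using pmod_fst_snd_le(2)[of T] sobD(3)[OF sT] by (rule le_less_trans)
  note pT = pmod_finite_integrable(2)[OF sobD(8)[OF sT] this]
  have iA: "integrable M (\<lambda>x. indicator A x :: real)" by (rule integrable_const_bound[of _ 1]) (auto simp: indicator_def)
  note iHV = bochner_diff[OF adm_integrable(2)[OF H] adm_integrable(2)[OF aV]]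
  have E: "(LINT x|M. norm (snd (T x)) powr p x) \<le> L\<^sup>2 * a + L * (K * N * I)"
  proof -
    have "(LINT x|M. norm (snd (T x)) powr p x) \<le> (LINT x|M. L * (dens H x - dens V x) + L\<^sup>2 * indicator A x + L * \<bar>g x * fst (T x)\<bar>)"
      by (rule bochner_mono[OF pT _ pt]) (use iHV iA gT(1) in \<open>intro bochner_add integrable_mult_right integrable_abs\<close>)
    also have "\<dots> = L * (LINT x|M. dens H x - dens V x) + L\<^sup>2 * a + L * (LINT x|M. \<bar>g x * fst (T x)\<bar>)"
      using iHV iA gT(1) by (simp add: Bochner_Integration.integral_add a_def AO del: Bochner_Integration.integral_diff)
    also have "(LINT x|M. dens H x - dens V x) = en H - en V"
      unfolding en_def by (rule Bochner_Integration.integral_diff[OF adm_integrable(2)[OF H] adm_integrable(2)[OF aV]])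
    also have "L * (en H - en V) + L\<^sup>2 * a + L * (LINT x|M. \<bar>g x * fst (T x)\<bar>) \<le> 0 + L\<^sup>2 * a + L * (K * N * I)"
      using min gT(2) L1 by (intro add_mono mult_left_mono order_refl) (auto simp: V_def[abs_def] T_def mult_le_0_iff)
    finally show ?thesis by simp
  qed
  define \<epsilon> where "\<epsilon> = 1 / (2 * (L * K * N) + 2)"
  define c where "c = max 1 (\<epsilon> powr (1 / (1 - pm)))"
  have LKN: "L * K * N \<ge> 0" using L1 K_nonneg N by simp
  have \<epsilon>: "0 < \<epsilon>" "\<epsilon> \<le> 1" "\<epsilon> * (L * K * N) \<le> 1 / 2" using LKN by (auto simp: \<epsilon>_def divide_le_eq)
  have "I \<le> (LINT x|M. \<epsilon> * norm (snd (T x)) powr p x + c * indicator A x)"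
    unfolding I_def
  proof (rule bochner_mono)
    show "integrable M (\<lambda>x. norm (snd (T x)))" using sobD(6)[OF sT] by simp
    show "integrable M (\<lambda>x. \<epsilon> * norm (snd (T x)) powr p x + c * indicator A x)" using pT iA by simp
    fix x assume x: "x \<in> space M"
    show "norm (snd (T x)) \<le> \<epsilon> * norm (snd (T x)) powr p x + c * indicator A x"
    proof (cases "x \<in> A")
      case True
      have "norm (snd (T x)) \<le> \<epsilon> * norm (snd (T x)) powr p x + c"
        unfolding c_def by (rule le_powr_young[OF \<epsilon>(1) norm_ge_zero pm1]) (use pp'[of x] x in simp)
      then show ?thesis using True by simp
    next
      case False
      then show ?thesis using x by (simp add: nT A_def)
    qed
  qed
  also have "\<dots> = \<epsilon> * (LINT x|M. norm (snd (T x)) powr p x) + c * a" using pT iA by (simp add: a_def AO)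
  also have "\<dots> \<le> \<epsilon> * (L\<^sup>2 * a + L * (K * N * I)) + c * a" using E \<epsilon>(1) by simp
  also have "\<dots> = \<epsilon> * (L\<^sup>2 * a) + \<epsilon> * (L * K * N) * I + c * a" by (simp add: algebra_simps)
  also have "\<dots> \<le> 1 * (L\<^sup>2 * a) + 1/2 * I + c * a" using \<epsilon> I0 by (intro add_mono mult_right_mono order_refl) (auto simp: a_def)
  finally have Ia: "I \<le> 2 * (L\<^sup>2 + c) * a" by (simp add: algebra_simps)
  \<comment> \<open>The weight is now the indicator of A, with L^q norm
    \<open>a powr (1 / q)\<close>: this is the exponent beyond 1 that drives the iteration. The case
    a = 0 is separate because the bound on the weight must be positive.\<close>
  have fTi: "(LINT x|M. fst (T x)) \<le> K * (2 * (L\<^sup>2 + c)) * a powr (1 + 1 / q)" if a: "a > 0"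
  proof -
    have "(LINT x|M. \<bar>indicator A x * fst (T x)\<bar>) \<le> K * a powr (1 / q) * (LINT x|M. norm (snd (T x)))"
    proof (rule weighted_poincare(2)[OF pc _ _ _ T0])
      have "(\<integral>\<^sup>+x. ennreal (\<bar>indicator A x\<bar> powr q) \<partial>M) = (\<integral>\<^sup>+x. indicator A x \<partial>M)"
        by (rule nn_integral_cong) (simp add: indicator_def)
      also have "\<dots> = ennreal ((a powr (1 / q)) powr q)" using q1 a by (simp add: powr_powr a_def emeasure_eq_measure)
      finally show "(\<integral>\<^sup>+x. ennreal (\<bar>indicator A x\<bar> powr q) \<partial>M) \<le> ennreal ((a powr (1 / q)) powr q)" by simp
      show "a powr (1 / q) > 0" using a by simp
    qed measurable
    also have "(LINT x|M. \<bar>indicator A x * fst (T x)\<bar>) = (LINT x|M. fst (T x))"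
      by (rule Bochner_Integration.integral_cong) (auto simp: fT A_def indicator_def)
    also have "K * a powr (1 / q) * (LINT x|M. norm (snd (T x))) \<le> K * a powr (1 / q) * (2 * (L\<^sup>2 + c) * a)"
      using Ia K_nonneg unfolding I_def by (intro mult_left_mono) auto
    also have "\<dots> = K * (2 * (L\<^sup>2 + c)) * a powr (1 + 1 / q)" using a by (simp add: powr_add)
    finally show ?thesis .
  qed
  have sub: "{x\<in>space M. h < \<sigma> * fst (H x)} \<subseteq> A" using h by (auto simp: A_def)
  have EO: "{x \<in> \<Omega>. h < \<sigma> * fst (H x)} \<inter> \<Omega> = {x \<in> \<Omega>. h < \<sigma> * fst (H x)}" by auto
  have hm: "{x\<in>space M. h < \<sigma> * fst (H x)} \<in> sets M" by measurable
  have "(h - k) * measure M {x\<in>space M. h < \<sigma> * fst (H x)} \<le> K * (2 * (L\<^sup>2 + c)) * a powr (1 + 1 / q)"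
  proof (cases "a = 0")
    case True
    then have "measure M {x\<in>space M. h < \<sigma> * fst (H x)} = 0"
      using finite_measure_mono[OF sub Am] by (simp add: a_def measure_le_0_iff)
    then show ?thesis using True by simp
  next
    case False
    then have a: "a > 0" by (simp add: a_def zero_less_measure_iff)
    have "(h - k) * measure M {x\<in>space M. h < \<sigma> * fst (H x)} = (LINT x|M. (h - k) * indicator {x\<in>space M. h < \<sigma> * fst (H x)} x)"
      using hm EO by simp
    also have "\<dots> \<le> (LINT x|M. fst (T x))"
    proof (rule bochner_mono[OF integrable_mult_right sobD(5)[OF sT]])
      show "integrable M (indicator {x\<in>space M. h < \<sigma> * fst (H x)} :: 'a \<Rightarrow> real)"
        by (rule integrable_const_bound[of _ 1]) (use hm in \<open>auto simp: indicator_def intro!: borel_measurable_indicator\<close>)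
    qed (use h in \<open>auto simp: fT indicator_def\<close>)
    finally show ?thesis using fTi[OF a] by linarith
  qed
  then show ?thesis by (simp only: a_def A_def c_def \<epsilon>_def)
qed

section \<open>Boundedness of minimizers and removal of the constraint\<close>

lemma pos_jet_truncate:
  assumes "\<sigma> = 1 \<or> \<sigma> = -1" "0 \<le> k"
  shows "\<bar>fst (H x - \<sigma> *\<^sub>R pos_jet (\<lambda>x. \<sigma> *\<^sub>R H x - (k, 0)) x)\<bar> \<le> \<bar>fst (H x)\<bar>"
    and "\<sigma> * fst (H x - \<sigma> *\<^sub>R pos_jet (\<lambda>x. \<sigma> *\<^sub>R H x - (k, 0)) x) \<le> k"
    and "\<sigma> * fst (H x) \<le> k \<Longrightarrow> H x - \<sigma> *\<^sub>R pos_jet (\<lambda>x. \<sigma> *\<^sub>R H x - (k, 0)) x = H x"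
    and "snd (H x - \<sigma> *\<^sub>R pos_jet (\<lambda>x. \<sigma> *\<^sub>R H x - (k, 0)) x) \<in> {snd (H x), 0}"
  using assms by (auto simp: pos_jet_def)

abbreviation "excess \<equiv> degiorgi_bound L K N pm q (measure M (space M))"

text \<open>Truncation at k \<ge> k1 preserves admissibility and the bound b, so it is a legitimate
  competitor at every level. \<open>level_set_iteration\<close> runs with s = 1 / q and V the
  measure of \<Omega>, once for each sign; the added 1 in \<open>degiorgi_bound\<close> makes the
  height positive.\<close>

lemma minimizer_bound:
  assumes H: "adm H" "AE x in M. \<bar>fst (H x)\<bar> \<le> b"
    and min: "\<And>W. adm W \<Longrightarrow> AE x in M. \<bar>fst (W x)\<bar> \<le> b \<Longrightarrow> en H \<le> en W"
  shows "AE x in M. \<bar>fst (H x)\<bar> \<le> k1 + excess"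
proof -
  define D where "D = K * (2 * (L\<^sup>2 + max 1 ((1 / (2 * (L * K * N) + 2)) powr (1 / (1 - pm)))))"
  have D: "D \<ge> 0" using K_nonneg by (auto simp: D_def)
  have e: "excess > 0" "2 powr (1 + 1 / (1 / q)) * D * measure M (space M) powr (1 / q) \<le> excess"
  proof -
    have ex: "excess = 2 powr (1 + q) * D * measure M (space M) powr (1 / q) + 1" by (simp only: degiorgi_bound_def D_def)
    show "excess > 0" unfolding ex using D by (intro add_nonneg_pos mult_nonneg_nonneg) auto
    show "2 powr (1 + 1 / (1 / q)) * D * measure M (space M) powr (1 / q) \<le> excess" unfolding ex by simp
  qed
  have sH: "sob H" using H by (simp add: adm_def)
  note [measurable] = sobD(7)[OF sH]
  have *: "AE x in M. \<sigma> * fst (H x) \<le> k1 + excess" if \<sigma>: "\<sigma> = 1 \<or> \<sigma> = -1" for \<sigma>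
  proof -
    define a where "a k = measure M {x\<in>space M. k < \<sigma> * fst (H x)}" for k
    have lv: "{x\<in>space M. k < \<sigma> * fst (H x)} \<in> sets M" for k by measurable
    have "a (k1 + excess) = 0"
    proof (rule level_set_iteration[OF _ _ _ _ D e])
      show "0 \<le> a k \<and> a k \<le> measure M (space M)" for k unfolding a_def by (intro conjI measure_nonneg bounded_measure)
      show "a h \<le> a k" if "k \<le> h" for k h unfolding a_def by (rule finite_measure_mono[OF _ lv]) (use that in auto)
      show "(h - k) * a h \<le> D * a k powr (1 + 1 / q)" if "k1 \<le> k" "k < h" for k h
        unfolding a_def D_def
      proof (rule level_set_estimate[OF H(1) that(1) \<sigma> _ that(2)])
        show "en H \<le> en (\<lambda>x. H x - \<sigma> *\<^sub>R pos_jet (\<lambda>x. \<sigma> *\<^sub>R H x - (k, 0)) x)"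
        proof (rule min[OF adm_truncate(2)[OF H(1) that(1) \<sigma>]])
          show "AE x in M. \<bar>fst (H x - \<sigma> *\<^sub>R pos_jet (\<lambda>x. \<sigma> *\<^sub>R H x - (k, 0)) x)\<bar> \<le> b"
            using H(2)
          proof eventually_elim
            case (elim x)
            have "0 \<le> k" using k1 that by linarith
            from order_trans[OF pos_jet_truncate(1)[where H=H and x=x, OF \<sigma> this] elim] show ?case .
          qed
        qed
      qed
    qed (use q1 in auto)
    then have "{x\<in>space M. k1 + excess < \<sigma> * fst (H x)} \<in> null_sets M"
      using lv[of "k1 + excess"] by (simp add: a_def null_sets_def emeasure_eq_measure)
    then have "AE x in M. \<not> k1 + excess < \<sigma> * fst (H x)" by (rule AE_I'[OF _]) auto
    then show ?thesis by (simp add: not_less)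
  qed
  from *[OF disjI1[OF refl]] *[OF disjI2[OF refl]] show ?thesis by eventually_elim auto
qed

text \<open>V1 cuts W from above and V cuts V1 from below. At each point the truncation eventually
  equals W, and at worst it replaces the gradient by 0, where f is at most L; this yields an
  integrable majorant.\<close>

lemma truncation_energy_tendsto:
  assumes W: "adm W"
  obtains V where "\<And>n. adm (V n)" "\<And>n x. \<bar>fst (V n x)\<bar> \<le> k1 + real n" "(\<lambda>n. en (V n)) \<longlonglongrightarrow> en W"
proof -
  define V1 where "V1 n x = W x - 1 *\<^sub>R pos_jet (\<lambda>x. 1 *\<^sub>R W x - (k1 + real n, 0)) x" for n x
  define V where "V n x = V1 n x - (-1) *\<^sub>R pos_jet (\<lambda>x. (-1) *\<^sub>R V1 n x - (k1 + real n, 0)) x" for n x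
  have k: "0 \<le> k1 + real n" "k1 \<le> k1 + real n" for n using k1 by auto
  have a1: "adm (V1 n)" for n unfolding V1_def[abs_def] by (rule adm_truncate(2)[OF W k(2)]) simp
  have aV: "adm (V n)" for n unfolding V_def[abs_def] by (rule adm_truncate(2)[OF a1 k(2)]) simp
  have s: "(1::real) = 1 \<or> (1::real) = -1" "(-1::real) = 1 \<or> (-1::real) = -1" by auto
  have p1: "\<bar>fst (V1 n x)\<bar> \<le> \<bar>fst (W x)\<bar>" "1 * fst (V1 n x) \<le> k1 + real n" "1 * fst (W x) \<le> k1 + real n \<Longrightarrow> V1 n x = W x"
    "snd (V1 n x) \<in> {snd (W x), 0}" for n x
    unfolding V1_def by (rule pos_jet_truncate[OF s(1) k(1)]; assumption)+
  have p2: "\<bar>fst (V n x)\<bar> \<le> \<bar>fst (V1 n x)\<bar>" "-1 * fst (V n x) \<le> k1 + real n" "-1 * fst (V1 n x) \<le> k1 + real n \<Longrightarrow> V n x = V1 n x"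
    "snd (V n x) \<in> {snd (V1 n x), 0}" for n x
    unfolding V_def by (rule pos_jet_truncate[OF s(2) k(1)]; assumption)+
  have Vb: "\<bar>fst (V n x)\<bar> \<le> k1 + real n" for n x
  proof (cases "-1 * fst (V1 n x) \<le> k1 + real n")
    case True
    then show ?thesis using p1(2)[of n x] p2(3)[of n x] by auto
  next
    case False
    then have "fst (V n x) = - (k1 + real n)" by (simp add: V_def pos_jet_def)
    then show ?thesis using k(1)[of n] by simp
  qed
  have Vw: "\<bar>fst (V n x)\<bar> \<le> \<bar>fst (W x)\<bar>" for n x using p1(1)[of n x] p2(1)[of n x] by linarith
  have Vs: "snd (V n x) = snd (W x) \<or> snd (V n x) = 0" for n x using p1(4)[of n x] p2(4)[of n x] by auto
  have Ve: "\<forall>\<^sub>F n in sequentially. V n x = W x" for x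
  proof -
    obtain n0 :: nat where n0: "\<bar>fst (W x)\<bar> < real n0" using reals_Archimedean2 by blast
    show ?thesis
    proof (rule eventually_sequentiallyI[of n0])
      fix n assume "n0 \<le> n"
      then have "\<bar>fst (W x)\<bar> \<le> k1 + real n" using n0 k1 by simp
      then have "V1 n x = W x" using p1(3)[of x n] by simp
      moreover have "V n x = V1 n x" using p2(3)[of n x] \<open>V1 n x = W x\<close> \<open>\<bar>fst (W x)\<bar> \<le> k1 + real n\<close> by simp
      ultimately show "V n x = W x" by simp
    qed
  qed
  have sW: "sob W" using W by (simp add: adm_def)
  have "(\<lambda>n. en (V n)) \<longlonglongrightarrow> en W"
    unfolding en_def
  proof (rule integral_dominated_convergence[where w="\<lambda>x. (f x (snd (W x)) + L) + 2 * lam_p * (1 + \<bar>fst (W x)\<bar>) + \<bar>g x * fst (W x)\<bar>"])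
    show "dens W \<in> borel_measurable M" "dens (V n) \<in> borel_measurable M" for n
      using adm_integrable(2)[OF W] adm_integrable(2)[OF aV] by auto
    show "integrable M (\<lambda>x. (f x (snd (W x)) + L) + 2 * lam_p * (1 + \<bar>fst (W x)\<bar>) + \<bar>g x * fst (W x)\<bar>)"
      using sobD(5)[OF sW] adm_integrable(1)[OF W] f_integrable[OF sW]
      by (intro bochner_add integrable_mult_right integrable_abs integrable_const)
    show "AE x in M. (\<lambda>n. dens (V n) x) \<longlonglongrightarrow> dens W x"
    proof (rule AE_I2, rule tendsto_eventually)
      show "\<forall>\<^sub>F n in sequentially. dens (V n) x = dens W x" for x using Ve[of x] by eventually_elim (simp add: dens_def)
    qed
    show "AE x in M. norm (dens (V n) x) \<le> (f x (snd (W x)) + L) + 2 * lam_p * (1 + \<bar>fst (W x)\<bar>) + \<bar>g x * fst (W x)\<bar>" for n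
    proof (rule AE_I2)
      fix x assume "x \<in> space M"
      then have x: "x \<in> \<Omega>" by simp
      have 1: "f x (snd (V n x)) \<le> f x (snd (W x)) + L" using Vs[of n x] f_nonneg[OF x, of "snd (W x)"] f_zero[OF x] L1 by auto
      have "2 * lam_p * (1 + \<bar>fst (V n x)\<bar>) \<le> 2 * lam_p * (1 + \<bar>fst (W x)\<bar>)" using Vw[of n x] lam by (intro mult_left_mono) auto
      then have 2: "F (fst (V n x)) \<le> 2 * lam_p * (1 + \<bar>fst (W x)\<bar>)" using F_le[of "fst (V n x)"] by linarith
      have 3: "\<bar>g x * fst (V n x)\<bar> \<le> \<bar>g x * fst (W x)\<bar>" using Vw[of n x] by (simp add: abs_mult mult_left_mono)
      show "norm (dens (V n) x) \<le> (f x (snd (W x)) + L) + 2 * lam_p * (1 + \<bar>fst (W x)\<bar>) + \<bar>g x * fst (W x)\<bar>"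
        using 1 2 3 f_nonneg[OF x, of "snd (V n x)"] F_nonneg[of "fst (V n x)"] unfolding dens_def real_norm_def by linarith
    qed
  qed
  then show ?thesis using that[OF aV Vb] by blast
qed

lemma exists_minimizer:
  obtains H where "adm H" "AE x in M. \<bar>fst (H x)\<bar> \<le> k1 + excess" "\<And>W. adm W \<Longrightarrow> en H \<le> en W"
proof -
  define b where "b = max M\<psi> (k1 + \<bar>excess\<bar>)"
  have b: "M\<psi> \<le> b" "0 \<le> b" "k1 + excess \<le> b" using k1 by (auto simp: b_def)
  obtain H where H: "adm H" "AE x in M. \<bar>fst (H x)\<bar> \<le> b" and Hm: "\<And>W. adm W \<Longrightarrow> AE x in M. \<bar>fst (W x)\<bar> \<le> b \<Longrightarrow> en H \<le> en W"
    by (rule exists_bounded_minimizer[OF b(1,2)]) blast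
  note Hb = minimizer_bound[OF H Hm]
  show ?thesis
  proof (rule that[OF H(1) Hb])
    fix W assume W: "adm W"
    obtain V where V: "\<And>n. adm (V n)" "\<And>n x. \<bar>fst (V n x)\<bar> \<le> k1 + real n" "(\<lambda>n. en (V n)) \<longlonglongrightarrow> en W"
      by (rule truncation_energy_tendsto[OF W]) blast
    have "en H \<le> en (V n)" for n
    proof -
      \<comment> \<open>The competitor V n may exceed b, so the problem is also solved with the
        larger bound b'. By \<open>minimizer_bound\<close> its minimizer U obeys the old bound b,
        hence competes with H.\<close>
      define b' where "b' = max b (k1 + real n)"
      have b': "M\<psi> \<le> b'" "0 \<le> b'" using b by (auto simp: b'_def)
      obtain U where U: "adm U" "AE x in M. \<bar>fst (U x)\<bar> \<le> b'" and Um: "\<And>W. adm W \<Longrightarrow> AE x in M. \<bar>fst (W x)\<bar> \<le> b' \<Longrightarrow> en U \<le> en W"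
        by (rule exists_bounded_minimizer[OF b']) blast
      have "AE x in M. \<bar>fst (U x)\<bar> \<le> b" using minimizer_bound[OF U Um] b(3) by (auto elim!: eventually_mono)
      then have "en H \<le> en U" by (rule Hm[OF U(1)])
      also have "en U \<le> en (V n)" by (rule Um[OF V(1)]) (use V(2) in \<open>auto simp: b'_def intro: le_max_iff_disj[THEN iffD2]\<close>)
      finally show ?thesis .
    qed
    then show "en H \<le> en W" by (intro LIMSEQ_le_const[OF V(3)]) blast
  qed
qed


section \<open>Return from pairs to functions\<close>

lemma dens_measurable: "sob H \<Longrightarrow> dens H \<in> borel_measurable M"
  unfolding dens_def[abs_def]
  by (intro borel_measurable_add borel_measurable_times f_meas g_meas sobD(7,8) measurable_compose[OF _ F_pot_measurable])

text \<open>The chosen \<open>weak_grad\<close> agrees almost everywhere with any weak gradient, so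
  the integral does not depend on the choice.\<close>

lemma energy_eq:
  assumes "sob (\<lambda>x. (u x, G x))"
  shows "energy \<Omega> f lam_p lam_m g \<gamma> u = en (\<lambda>x. (u x, G x))"
proof -
  have "energy \<Omega> f lam_p lam_m g \<gamma> u = en (\<lambda>x. (u x, weak_grad \<Omega> u x))" by (simp add: energy_def en_def dens_def)
  also have "\<dots> = en (\<lambda>x. (u x, G x))"
    unfolding en_def
  proof (rule integral_cong_AE[OF dens_measurable[OF sob_weak_grad(1)[OF assms]] dens_measurable[OF assms]])
    show "AE x in M. dens (\<lambda>x. (u x, weak_grad \<Omega> u x)) x = dens (\<lambda>x. (u x, G x)) x"
      using sob_weak_grad(2)[OF assms] by eventually_elim (simp add: dens_def)
  qed
  finally show ?thesis .
qed

lemma admissible_iff: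
  "v \<in> admissible \<Omega> p (\<lambda>x. fst (P x)) \<longleftrightarrow> (\<exists>G. adm (\<lambda>x. (v x, G x)))"
proof
  assume "v \<in> admissible \<Omega> p (\<lambda>x. fst (P x))"
  then obtain G1 G2 where G: "sob (\<lambda>x. (v x, G1 x))" "sob0 (\<lambda>x. (v x - fst (P x), G2 x))"
    by (auto simp: admissible_def var_W1p_iff var_W1p_0_iff)
  \<comment> \<open>G1 and G2 come from separate existence statements; uniqueness of weak gradients
    reconciles them.\<close>
  have "sob0 (\<lambda>x. (v x, G1 x) - P x)"
    by (rule sob0_unique[OF G(2)]) (use sob_lin[OF G(1) P, of 1 "-1"] in auto)
  then show "\<exists>G. adm (\<lambda>x. (v x, G x))" using G(1) by (auto simp: adm_def)
next
  assume "\<exists>G. adm (\<lambda>x. (v x, G x))"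
  then obtain G where G: "sob (\<lambda>x. (v x, G x))" "sob0 (\<lambda>x. (v x, G x) - P x)" by (auto simp: adm_def)
  have "(\<lambda>x. (v x, G x) - P x) = (\<lambda>x. (v x - fst (P x), G x - snd (P x)))" by (simp add: fun_eq_iff prod_eq_iff)
  then have "sob0 (\<lambda>x. (v x - fst (P x), G x - snd (P x)))" using G(2) by simp
  then show "v \<in> admissible \<Omega> p (\<lambda>x. fst (P x))" using G(1) by (auto simp: admissible_def var_W1p_iff var_W1p_0_iff)
qed

lemma exists_bounded_energy_minimizer:
  "\<exists>u. is_minimizer (energy \<Omega> f lam_p lam_m g \<gamma>) (admissible \<Omega> p (\<lambda>x. fst (P x))) u \<and> Linf_norm \<Omega> u \<le> ereal (k1 + excess)"
proof -
  obtain H where H: "adm H" "AE x in M. \<bar>fst (H x)\<bar> \<le> k1 + excess" "\<And>W. adm W \<Longrightarrow> en H \<le> en W"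
    by (rule exists_minimizer) blast
  define u where "u x = fst (H x)" for x
  define G where "G x = snd (H x)" for x
  have HG: "H = (\<lambda>x. (u x, G x))" by (simp add: u_def G_def)
  have sH: "sob (\<lambda>x. (u x, G x))" using H(1) by (simp add: adm_def HG)
  have "is_minimizer (energy \<Omega> f lam_p lam_m g \<gamma>) (admissible \<Omega> p (\<lambda>x. fst (P x))) u"
    unfolding is_minimizer_def
  proof (intro conjI ballI)
    show "u \<in> admissible \<Omega> p (\<lambda>x. fst (P x))" unfolding admissible_iff using H(1) by (auto simp: HG)
    fix v assume "v \<in> admissible \<Omega> p (\<lambda>x. fst (P x))"
    then obtain G' where G': "adm (\<lambda>x. (v x, G' x))" unfolding admissible_iff by blast
    then have "sob (\<lambda>x. (v x, G' x))" by (simp add: adm_def)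
    note sv = this
    from H(3)[OF G'] show "energy \<Omega> f lam_p lam_m g \<gamma> u \<le> energy \<Omega> f lam_p lam_m g \<gamma> v"
      unfolding energy_eq[OF sv] energy_eq[OF sH] HG .
  qed
  moreover have "Linf_norm \<Omega> u \<le> ereal (k1 + excess)"
    unfolding Linf_norm_def
  proof (rule esssup_I)
    have [measurable]: "u \<in> borel_measurable M" using sobD(7)[OF sH] by simp
    show "(\<lambda>x. ereal \<bar>u x\<bar>) \<in> borel_measurable M" by measurable
    show "AE x in M. ereal \<bar>u x\<bar> \<le> ereal (k1 + excess)" using H(2) by (simp add: u_def)
  qed
  ultimately show ?thesis by blast
qed

end

text \<open>Shows that the set in \<open>bdry_Linf_norm\<close> is nonempty, so that its infimum can
  be approximated by members: above an almost everywhere bound the truncated function is 0 almost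
  everywhere.\<close>

lemma (in var_domain) bdry_set_nonempty:
  assumes P: "sob (\<lambda>x. (\<psi> x, G x))" and b: "AE x in M. \<bar>\<psi> x\<bar> \<le> b"
  shows "(\<lambda>x. max (\<bar>\<psi> x\<bar> - b) 0) \<in> var_W1p_0 \<Omega> p"
proof -
  have "(\<lambda>_::'a. 0::real) \<in> test_functions \<Omega>"
    unfolding test_functions_iff by (intro conjI exI[of _ "{}"] smooth_const) auto
  note j = sob0_jet[OF this]
  have z: "sob0 (\<lambda>x. (0, 0))" using sob0_lin[OF j j, of 0 0] by (simp add: zero_prod_def)
  have zs: "sob (\<lambda>x. (0, 0))" using z by (simp add: sob0_def)
  have [measurable]: "\<psi> \<in> borel_measurable M" using sobD(7)[OF P] by simp
  have m: "(\<lambda>x. (max (\<bar>\<psi> x\<bar> - b) 0, 0 :: 'a)) \<in> borel_measurable M" by (rule borel_measurable_Pair_vec) measurable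
  have "AE x in M. (0, 0) = (max (\<bar>\<psi> x\<bar> - b) 0, 0 :: 'a)" using b by eventually_elim auto
  from sob_cong_AE(2)[OF zs m this z] show ?thesis unfolding var_W1p_0_iff by (intro exI[of _ "\<lambda>_. 0"])
qed

section \<open>The hypotheses of the theorem in usable form\<close>

lemma square_powr_half: "0 \<le> t \<Longrightarrow> (t\<^sup>2) powr (a / 2) = t powr (a::real)"
proof (cases "t = 0")
  case False
  assume "0 \<le> t"
  then have "t\<^sup>2 = t powr 2" by (rule powr_numeral[symmetric])
  then show ?thesis by (simp only: powr_powr) simp
qed simp

text \<open>Since \<mu> \<le> 1, the square root of \<mu>^2 + |z|^2 lies between |z| and 1 + |z|,
  and at z = 0 it is at most 1. The constants thereby lose \<mu>.\<close>

lemma structure_conditions_growth: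
  assumes s: "structure_conditions \<Omega> L \<mu> \<omega> p f" and L: "1 \<le> L" and \<mu>: "0 \<le> \<mu>" "\<mu> \<le> 1"
    and x: "x \<in> \<Omega>" and p: "1 \<le> p x" "p x \<le> pp"
  shows "norm z powr p x \<le> L * f x z" "f x z \<le> L * (2 powr pp * (1 + norm z powr p x))" "f x 0 \<le> L"
proof -
  have s1: "inverse L * (\<mu>\<^sup>2 + (norm z)\<^sup>2) powr (p x / 2) \<le> f x z" "f x z \<le> L * (\<mu>\<^sup>2 + (norm z)\<^sup>2) powr (p x / 2)" for z
    using s x by (auto simp: structure_conditions_def)
  have "norm z powr p x = ((norm z)\<^sup>2) powr (p x / 2)" by (simp add: square_powr_half)
  also have "\<dots> \<le> (\<mu>\<^sup>2 + (norm z)\<^sup>2) powr (p x / 2)" using p by (intro powr_mono2) auto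
  also have "\<dots> = L * (inverse L * (\<mu>\<^sup>2 + (norm z)\<^sup>2) powr (p x / 2))" using L by simp
  also have "\<dots> \<le> L * f x z" using s1(1) L by (intro mult_left_mono) auto
  finally show "norm z powr p x \<le> L * f x z" .
  have "\<mu>\<^sup>2 \<le> 1" using \<mu> by (simp add: power_le_one)
  then have "(\<mu>\<^sup>2 + (norm z)\<^sup>2) powr (p x / 2) \<le> ((1 + norm z)\<^sup>2) powr (p x / 2)"
  proof (intro powr_mono2)
    show "\<mu>\<^sup>2 + (norm z)\<^sup>2 \<le> (1 + norm z)\<^sup>2" using \<open>\<mu>\<^sup>2 \<le> 1\<close> norm_ge_zero[of z] unfolding power2_sum power_one by linarith
  qed (use p in auto)
  also have "\<dots> = (1 + norm z) powr p x" by (simp add: square_powr_half)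
  also have "\<dots> \<le> 2 powr pp * (1 powr p x + norm z powr p x)" using p by (intro powr_add_le) auto
  finally show "f x z \<le> L * (2 powr pp * (1 + norm z powr p x))"
    using order_trans[OF s1(2)[of z] mult_left_mono[of _ _ L]] L by simp
  have "(\<mu>\<^sup>2) powr (p x / 2) \<le> 1" using \<mu> p by (simp add: square_powr_half powr_le1)
  then show "f x 0 \<le> L" using order_trans[OF s1(2)[of 0] mult_left_mono[of _ 1 L]] L by simp
qed

lemma Ck_on_2_continuous: "Ck_on 2 S f \<Longrightarrow> continuous_on S f"
  by (auto simp: numeral_2_eq_2 intro!: continuous_at_imp_continuous_on differentiable_imp_continuous_within)

text \<open>Monotonicity moves the modulus from t to e before the logarithmic bound is used; this
  covers t = 0, where that bound says nothing.\<close>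

lemma log_modulus_bound:
  assumes "log_modulus L \<omega>" "0 < e" "e \<le> 1/2" "0 \<le> t" "t \<le> e" "d \<le> \<omega> t"
  shows "d * ln (1 / e) \<le> L"
proof -
  have l: "ln (1 / e) > 0" "\<bar>ln e\<bar> = ln (1 / e)" using assms(2,3) by (auto simp: ln_div abs_of_neg)
  have "\<omega> t \<le> \<omega> e" using assms unfolding log_modulus_def by (auto intro: mono_onD)
  also have "\<omega> e \<le> L * inverse \<bar>ln e\<bar>" using assms unfolding log_modulus_def by auto
  finally have "d * ln (1 / e) \<le> (L * inverse (ln (1 / e))) * ln (1 / e)" using assms(6) l by (intro mult_right_mono) auto
  also have "\<dots> = L" using l(1) by (simp only: mult.assoc left_inverse[OF less_imp_neq[OF l(1), symmetric]] mult_1_right)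
  finally show ?thesis .
qed

text \<open>Above the norm there is an admissible l < N = norm + 1. Where |g / N| \<le> 1 its r-th
  power is at most 1, elsewhere r may be raised to q x and N lowered to l; the integral is thus at
  most the measure plus 1. That sum is enlarged to its r-th power so that the bound has the form
  B^r.\<close>

lemma luxemburg_norm_Lp_bound:
  assumes \<Omega>: "open \<Omega>" "bounded \<Omega>" and qm: "q \<in> borel_measurable (lebesgue_on \<Omega>)" and q: "\<And>x. x \<in> \<Omega> \<Longrightarrow> 1 \<le> q x \<and> r \<le> q x"
    and r: "1 \<le> r" and g: "g \<in> var_Lp \<Omega> q"
  shows "0 \<le> luxemburg_norm \<Omega> q g"
    and "(\<integral>\<^sup>+x. ennreal (\<bar>g x\<bar> powr r) \<partial>lebesgue_on \<Omega>) \<le> ennreal (((luxemburg_norm \<Omega> q g + 1) * (measure lebesgue \<Omega> + 1)) powr r)"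
proof -
  note [measurable] = qm
  have [measurable]: "g \<in> borel_measurable (lebesgue_on \<Omega>)" using g by (simp add: var_Lp_def)
  define S where "S = {l. 0 < l \<and> var_modular \<Omega> q (\<lambda>x. g x / l) \<le> 1}"
  have ne: "S \<noteq> {}" using luxemburg_nonempty[OF qm _ g] q by (auto simp: S_def)
  have norm: "luxemburg_norm \<Omega> q g = Inf S" by (simp add: luxemburg_norm_def S_def)
  show n0: "0 \<le> luxemburg_norm \<Omega> q g" unfolding norm by (rule cInf_greatest[OF ne]) (auto simp: S_def)
  define N where "N = luxemburg_norm \<Omega> q g + 1"
  obtain l where l: "l > 0" "var_modular \<Omega> q (\<lambda>x. g x / l) \<le> 1" "l < N"
    using cInf_lessD[OF ne, of N] by (auto simp: N_def norm S_def)
  have N: "N > 0" using l by simp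
  define m where "m = measure lebesgue \<Omega>"
  have em: "emeasure (lebesgue_on \<Omega>) \<Omega> = ennreal m"
  proof -
    have "emeasure (lebesgue_on \<Omega>) \<Omega> = emeasure lebesgue \<Omega>" using \<Omega>(1) by (simp add: emeasure_restrict_space)
    also have "\<dots> = ennreal m"
      unfolding m_def by (rule emeasure_eq_ennreal_measure) (use emeasure_bounded_finite[OF \<Omega>(2)] \<Omega>(1) in \<open>simp add: less_top\<close>)
    finally show ?thesis .
  qed
  have "(\<integral>\<^sup>+x. ennreal (\<bar>g x / N\<bar> powr r) \<partial>lebesgue_on \<Omega>) \<le> (\<integral>\<^sup>+x. 1 + ennreal (\<bar>g x / l\<bar> powr q x) \<partial>lebesgue_on \<Omega>)"
  proof (rule nn_integral_mono)
    fix x assume "x \<in> space (lebesgue_on \<Omega>)"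
    then have x: "x \<in> \<Omega>" by simp
    have le: "\<bar>g x / N\<bar> \<le> \<bar>g x / l\<bar>" using l N by (auto simp: abs_divide intro: divide_left_mono)
    have "\<bar>g x / N\<bar> powr r \<le> 1 + \<bar>g x / l\<bar> powr q x"
    proof (cases "\<bar>g x / N\<bar> \<le> 1")
      case True
      then have "\<bar>g x / N\<bar> powr r \<le> 1" using r by (intro powr_le1) auto
      then show ?thesis using powr_ge_zero[of "\<bar>g x / l\<bar>" "q x"] by linarith
    next
      case False
      have "\<bar>g x / N\<bar> powr r \<le> \<bar>g x / N\<bar> powr q x" using False q[OF x] by (intro powr_mono) auto
      also have "\<dots> \<le> \<bar>g x / l\<bar> powr q x" using le q[OF x] by (intro powr_mono2) auto
      finally show ?thesis by simp
    qed
    then have "ennreal (\<bar>g x / N\<bar> powr r) \<le> ennreal (1 + \<bar>g x / l\<bar> powr q x)" by (rule ennreal_leI)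
    then show "ennreal (\<bar>g x / N\<bar> powr r) \<le> 1 + ennreal (\<bar>g x / l\<bar> powr q x)" by (simp add: ennreal_plus)
  qed
  also have "\<dots> = emeasure (lebesgue_on \<Omega>) \<Omega> + var_modular \<Omega> q (\<lambda>x. g x / l)"
    unfolding var_modular_def by (subst nn_integral_add) auto
  also have "\<dots> \<le> ennreal m + 1" unfolding em by (intro add_left_mono l(2))
  also have "\<dots> = ennreal (m + 1)" by (simp add: ennreal_plus m_def)
  finally have *: "(\<integral>\<^sup>+x. ennreal (\<bar>g x / N\<bar> powr r) \<partial>lebesgue_on \<Omega>) \<le> ennreal (m + 1)" .
  have "(\<integral>\<^sup>+x. ennreal (\<bar>g x\<bar> powr r) \<partial>lebesgue_on \<Omega>) = (\<integral>\<^sup>+x. ennreal (N powr r) * ennreal (\<bar>g x / N\<bar> powr r) \<partial>lebesgue_on \<Omega>)"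
    by (rule nn_integral_cong) (use N in \<open>simp add: ennreal_mult[symmetric] powr_mult[symmetric] abs_divide\<close>)
  also have "\<dots> = ennreal (N powr r) * (\<integral>\<^sup>+x. ennreal (\<bar>g x / N\<bar> powr r) \<partial>lebesgue_on \<Omega>)" by (rule nn_integral_cmult) measurable
  also have "\<dots> \<le> ennreal (N powr r) * ennreal (m + 1)" by (rule mult_left_mono[OF *]) simp
  also have "\<dots> \<le> ennreal (N powr r) * ennreal ((m + 1) powr r)"
  proof (intro mult_left_mono ennreal_leI)
    have "(m + 1) powr 1 \<le> (m + 1) powr r" using r by (intro powr_mono) (auto simp: m_def)
    then show "m + 1 \<le> (m + 1) powr r" by (simp add: m_def)
  qed simp
  also have "\<dots> = ennreal ((N * (m + 1)) powr r)" using N by (simp add: ennreal_mult powr_mult m_def)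
  finally show "(\<integral>\<^sup>+x. ennreal (\<bar>g x\<bar> powr r) \<partial>lebesgue_on \<Omega>) \<le> ennreal (((luxemburg_norm \<Omega> q g + 1) * (measure lebesgue \<Omega> + 1)) powr r)"
    by (simp add: N_def m_def)
qed

text \<open>As 1 / pm \<ge> 1 / pp, the quantity 1 / n - 1 / pm + 1 / pp is at most 1 / n and its
  reciprocal at least n; for pm < 2 the extra factor 1 / (pm - 1) exceeds 1.\<close>

lemma exponent_gt_dim:
  fixes n pm pp r :: real
  assumes n: "0 < n" and p: "1 < pm" "pm \<le> pp" and \<kappa>: "1 / pm - 1 / pp < 1 / n"
    and r: "r > (if pm < 2 then 1 / (pm - 1) * (1 / (1 / n - 1 / pm + 1 / pp)) else 1 / (1 / n - 1 / pm + 1 / pp))"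
  shows "n < r"
proof -
  define k where "k = 1 / n - 1 / pm + 1 / pp"
  have k: "0 < k" using \<kappa> by (simp add: k_def)
  have "1 / pp \<le> 1 / pm" using p by (intro divide_left_mono) auto
  then have "k \<le> 1 / n" by (simp add: k_def)
  then have "n \<le> 1 / k" using k n by (simp add: field_simps)
  moreover have "1 / k < r"
  proof (cases "pm < 2")
    case True
    have "1 * (1 / k) \<le> 1 / (pm - 1) * (1 / k)" using True p k by (intro mult_right_mono) auto
    then show ?thesis using r True by (simp add: k_def)
  next
    case False
    then show ?thesis using r by (simp add: k_def)
  qed
  ultimately show ?thesis by simp
qed

theorem theorem2p1:
  assumes "CARD('n::finite) \<ge> 2"
  shows "\<exists>C :: real \<Rightarrow> real \<Rightarrow> real \<Rightarrow> real \<Rightarrow> real \<Rightarrow> real \<Rightarrow> (real^'n) set \<Rightarrow> real \<Rightarrow> real \<Rightarrow> real.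
    \<forall>(\<Omega> :: (real^'n) set) (L :: real) (\<mu> :: real) (lam_m :: real) (lam_p :: real)
      (\<omega> :: real \<Rightarrow> real) (p :: real^'n \<Rightarrow> real) (q :: real^'n \<Rightarrow> real) (q_m :: real)
      (f :: real^'n \<Rightarrow> real^'n \<Rightarrow> real) (\<psi> :: real^'n \<Rightarrow> real) (g :: real^'n \<Rightarrow> real) (\<gamma> :: real).
      open \<Omega> \<and> connected \<Omega> \<and> bounded \<Omega> \<and> \<Omega> \<noteq> {} \<longrightarrow>
      1 \<le> L \<and> 0 \<le> \<mu> \<and> \<mu> \<le> 1 \<and> 0 < lam_m \<and> lam_m < lam_p \<longrightarrow>
      log_modulus L \<omega> \<longrightarrow>
      continuous_on (closure \<Omega>) p \<and> (\<forall>x\<in>closure \<Omega>. 1 < p x) \<and>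
      (\<forall>x\<in>closure \<Omega>. \<forall>y\<in>closure \<Omega>. \<bar>p x - p y\<bar> \<le> \<omega> (norm (x - y))) \<and>
      1 < exp_minus \<Omega> p \<and> bdd_above (p ` \<Omega>) \<longrightarrow>
      continuous_on \<Omega> q \<and> (\<forall>x\<in>\<Omega>. 1 < q x) \<and>
      (\<exists>\<omega>q. log_modulus L \<omega>q \<and> (\<forall>x\<in>\<Omega>. \<forall>y\<in>\<Omega>. \<bar>q x - q y\<bar> \<le> \<omega>q (norm (x - y)))) \<and>
      (\<forall>x\<in>\<Omega>. q_m \<le> q x) \<longrightarrow>
      1 / exp_minus \<Omega> p - 1 / exp_plus \<Omega> p < 1 / real CARD('n) \<longrightarrow>
      q_m > (if exp_minus \<Omega> p < 2
             then 1 / (exp_minus \<Omega> p - 1) *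
                  (1 / (1 / real CARD('n) - 1 / exp_minus \<Omega> p + 1 / exp_plus \<Omega> p))
             else 1 / (1 / real CARD('n) - 1 / exp_minus \<Omega> p + 1 / exp_plus \<Omega> p)) \<longrightarrow>
      structure_conditions \<Omega> L \<mu> \<omega> p f \<longrightarrow>
      \<psi> \<in> var_W1p \<Omega> p \<inter> Linf \<Omega> \<longrightarrow>
      g \<in> var_Lp \<Omega> q \<longrightarrow>
      0 \<le> \<gamma> \<and> \<gamma> \<le> 1 \<longrightarrow>
      (\<exists>u. is_minimizer (energy \<Omega> f lam_p lam_m g \<gamma>) (admissible \<Omega> p \<psi>) u \<and>
           Linf_norm \<Omega> u \<le> ereal (C L q_m (exp_minus \<Omega> p) (exp_plus \<Omega> p) lam_p lam_m \<Omega>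
                                       (bdry_Linf_norm \<Omega> p \<psi>) (luxemburg_norm \<Omega> q g)))"
proof -
  \<comment> \<open>The 1 after B is the price for a level k1 within distance 1 of the boundary
    supremum, taken instead of the infimum itself. Selecting K by \<open>SOME\<close> makes it a
    function of \<Omega> and q_m, and the third argument of \<open>degiorgi_bound\<close> is the
    norm bound from \<open>luxemburg_norm_Lp_bound\<close>.\<close>
  define C where "C L q_m pm pp lam_p lam_m \<Omega> B G = B + 1 +
      degiorgi_bound L (SOME K. poincare_const \<Omega> q_m K) ((G + 1) * (measure lebesgue \<Omega> + 1)) pm q_m (measure (lebesgue_on \<Omega>) (space (lebesgue_on \<Omega>)))"
    for L q_m pm pp lam_p lam_m :: real and \<Omega> :: "(real^'n) set" and B G :: real
  show ?thesis
  proof (intro exI[of _ C] allI impI)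
    fix \<Omega> :: "(real^'n) set" and L \<mu> lam_m lam_p :: real and \<omega> :: "real \<Rightarrow> real" and p q :: "real^'n \<Rightarrow> real" and q_m :: real
      and f :: "real^'n \<Rightarrow> real^'n \<Rightarrow> real" and \<psi> g :: "real^'n \<Rightarrow> real" and \<gamma> :: real
    assume \<Omega>: "open \<Omega> \<and> connected \<Omega> \<and> bounded \<Omega> \<and> \<Omega> \<noteq> {}"
      and par: "1 \<le> L \<and> 0 \<le> \<mu> \<and> \<mu> \<le> 1 \<and> 0 < lam_m \<and> lam_m < lam_p"
      and \<omega>: "log_modulus L \<omega>"
      and p: "continuous_on (closure \<Omega>) p \<and> (\<forall>x\<in>closure \<Omega>. 1 < p x) \<and>
        (\<forall>x\<in>closure \<Omega>. \<forall>y\<in>closure \<Omega>. \<bar>p x - p y\<bar> \<le> \<omega> (norm (x - y))) \<and> 1 < exp_minus \<Omega> p \<and> bdd_above (p ` \<Omega>)"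
      and q: "continuous_on \<Omega> q \<and> (\<forall>x\<in>\<Omega>. 1 < q x) \<and>
        (\<exists>\<omega>q. log_modulus L \<omega>q \<and> (\<forall>x\<in>\<Omega>. \<forall>y\<in>\<Omega>. \<bar>q x - q y\<bar> \<le> \<omega>q (norm (x - y)))) \<and> (\<forall>x\<in>\<Omega>. q_m \<le> q x)"
      and \<kappa>: "1 / exp_minus \<Omega> p - 1 / exp_plus \<Omega> p < 1 / real CARD('n)"
      and q_m: "q_m > (if exp_minus \<Omega> p < 2
             then 1 / (exp_minus \<Omega> p - 1) *
                  (1 / (1 / real CARD('n) - 1 / exp_minus \<Omega> p + 1 / exp_plus \<Omega> p))
             else 1 / (1 / real CARD('n) - 1 / exp_minus \<Omega> p + 1 / exp_plus \<Omega> p))"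
      and f: "structure_conditions \<Omega> L \<mu> \<omega> p f" and \<psi>: "\<psi> \<in> var_W1p \<Omega> p \<inter> Linf \<Omega>" and g: "g \<in> var_Lp \<Omega> q" and \<gamma>: "0 \<le> \<gamma> \<and> \<gamma> \<le> 1"
    define pm where "pm = exp_minus \<Omega> p"
    define pp where "pp = exp_plus \<Omega> p"
    have cl: "x \<in> closure \<Omega>" if "x \<in> \<Omega>" for x using that closure_subset by auto
    have pb: "pm \<le> p x \<and> p x \<le> pp" if x: "x \<in> \<Omega>" for x
    proof
      show "pm \<le> p x" unfolding pm_def exp_minus_def by (rule cINF_lower[OF _ x], rule bdd_belowI2[of _ 1]) (use p cl in \<open>simp add: less_imp_le\<close>)
      show "p x \<le> pp" unfolding pp_def exp_plus_def by (rule cSUP_upper[OF x]) (use p in simp)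
    qed
    have pm1: "1 < pm" using p by (simp add: pm_def)
    obtain x0 where "x0 \<in> \<Omega>" using \<Omega> by blast
    then have pmpp: "pm \<le> pp" using pb[of x0] by linarith
    have qn: "real CARD('n) < q_m" by (rule exponent_gt_dim[OF _ pm1 pmpp \<kappa>[folded pm_def pp_def] q_m[folded pm_def pp_def]]) simp
    have q1: "1 < q_m" using qn assms by linarith
    interpret vd: var_domain \<Omega> p pm pp L
    proof
      show "continuous_on \<Omega> p" by (rule continuous_on_subset[OF conjunct1[OF p] closure_subset])
      fix e :: real and x y assume e: "0 < e" "e \<le> 1/2" and xy: "x \<in> \<Omega>" "y \<in> \<Omega>" "norm (x - y) \<le> e"
      show "\<bar>p x - p y\<bar> * ln (1 / e) \<le> L"
        by (rule log_modulus_bound[OF \<omega> e norm_ge_zero xy(3)]) (use p cl[OF xy(1)] cl[OF xy(2)] in simp)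
    qed (use \<Omega> pm1 pmpp pb in auto)
    obtain G\<psi> where G\<psi>: "vd.sob (\<lambda>x. (\<psi> x, G\<psi> x))" using \<psi> unfolding vd.var_W1p_iff Int_iff by blast
    obtain M\<psi> where M\<psi>: "0 \<le> M\<psi>" "AE x in lebesgue_on \<Omega>. \<bar>\<psi> x\<bar> \<le> M\<psi>"
    proof -
      have "Linf_norm \<Omega> \<psi> < \<infinity>" using \<psi> by (simp add: Linf_def)
      then obtain r where r: "Linf_norm \<Omega> \<psi> \<le> ereal r" by (cases "Linf_norm \<Omega> \<psi>") auto
      have "AE x in lebesgue_on \<Omega>. ereal \<bar>\<psi> x\<bar> \<le> Linf_norm \<Omega> \<psi>" unfolding Linf_norm_def by (rule esssup_AE)
      then have "AE x in lebesgue_on \<Omega>. \<bar>\<psi> x\<bar> \<le> max 0 r"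
        by eventually_elim (use r order_trans in \<open>fastforce\<close>)
      then show ?thesis by (rule that[rotated]) simp
    qed
    define S where "S = {k. 0 \<le> k \<and> (\<lambda>x. max (\<bar>\<psi> x\<bar> - k) 0) \<in> var_W1p_0 \<Omega> p}"
    have "M\<psi> \<in> S" using M\<psi>(1) vd.bdry_set_nonempty[OF G\<psi> M\<psi>(2)] by (simp add: S_def)
    then obtain k1 where k1: "k1 \<in> S" "k1 < bdry_Linf_norm \<Omega> p \<psi> + 1"
      using cInf_lessD[of S "bdry_Linf_norm \<Omega> p \<psi> + 1"] by (auto simp: bdry_Linf_norm_def S_def)
    obtain G' where G': "vd.sob0 (\<lambda>x. (max (\<bar>\<psi> x\<bar> - k1) 0, G' x))" using k1(1) unfolding S_def vd.var_W1p_0_iff by blast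
    have K: "poincare_const \<Omega> q_m (SOME K. poincare_const \<Omega> q_m K)"
      by (rule someI_ex, rule poincare_const_exists) (use \<Omega> qn in auto)
    have qmeas: "q \<in> borel_measurable (lebesgue_on \<Omega>)"
      using q \<Omega> by (intro continuous_imp_measurable_on_sets_lebesgue) auto
    note lux = luxemburg_norm_Lp_bound[OF _ _ qmeas _ _ g, of q_m]
    define N where "N = (luxemburg_norm \<Omega> q g + 1) * (measure lebesgue \<Omega> + 1)"
    have n0: "0 \<le> luxemburg_norm \<Omega> q g" by (rule lux(1)) (use \<Omega> q q1 less_imp_le in auto)
    have gN: "(\<integral>\<^sup>+x. ennreal (\<bar>g x\<bar> powr q_m) \<partial>lebesgue_on \<Omega>) \<le> ennreal (N powr q_m)"
      unfolding N_def by (rule lux(2)) (use \<Omega> q q1 less_imp_le in auto)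
    have gr: "norm z powr p x \<le> L * f x z" "f x z \<le> L * (2 powr pp * (1 + norm z powr p x))" "f x 0 \<le> L" if "x \<in> \<Omega>" for x z
    proof -
      have h: "1 \<le> L" "0 \<le> \<mu>" "\<mu> \<le> 1" "1 \<le> p x" "p x \<le> pp" using par pb[OF that] pm1 by auto
      note gr = structure_conditions_growth[OF f h(1-3) that h(4,5)]
      show "norm z powr p x \<le> L * f x z" "f x z \<le> L * (2 powr pp * (1 + norm z powr p x))" "f x 0 \<le> L" by (rule gr)+
    qed
    interpret v: variational \<Omega> p pm pp L f L lam_p lam_m \<gamma> g q_m "SOME K. poincare_const \<Omega> q_m K" N
      "\<lambda>x. (\<psi> x, G\<psi> x)" "\<lambda>x. (max (\<bar>\<psi> x\<bar> - k1) 0, G' x)" M\<psi> k1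
    proof
      show "continuous_on (\<Omega> \<times> UNIV) (\<lambda>(x, z). f x z)" using f by (auto simp: structure_conditions_def intro: Ck_on_2_continuous)
      show "convex_on UNIV (f x)" if "x \<in> \<Omega>" for x using f that by (auto simp: structure_conditions_def)
      show "N > 0" unfolding N_def using n0 by (intro mult_pos_pos add_nonneg_pos) auto
      show "g \<in> borel_measurable (lebesgue_on \<Omega>)" using g by (simp add: var_Lp_def)
    qed (use gr par \<gamma> gN K q1 G\<psi> G' M\<psi>(2) k1(1) in \<open>auto simp: S_def\<close>)
    obtain u where u: "is_minimizer (energy \<Omega> f lam_p lam_m g \<gamma>) (admissible \<Omega> p \<psi>) u" "Linf_norm \<Omega> u \<le> ereal (k1 + v.excess)"
      using v.exists_bounded_energy_minimizer by auto
    have "k1 + v.excess \<le> C L q_m pm pp lam_p lam_m \<Omega> (bdry_Linf_norm \<Omega> p \<psi>) (luxemburg_norm \<Omega> q g)"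
      using k1(2) by (simp add: C_def N_def)
    then show "\<exists>u. is_minimizer (energy \<Omega> f lam_p lam_m g \<gamma>) (admissible \<Omega> p \<psi>) u \<and>
           Linf_norm \<Omega> u \<le> ereal (C L q_m (exp_minus \<Omega> p) (exp_plus \<Omega> p) lam_p lam_m \<Omega>
                                       (bdry_Linf_norm \<Omega> p \<psi>) (luxemburg_norm \<Omega> q g))"
      using u order_trans[OF u(2)] unfolding pm_def pp_def by (auto intro: exI[of _ u])
  qed
qed

end
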